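(* There exist $0<\lambda^*,\mu^*<+\infty$ and a non-increasing continuous curve $\mu=\Gamma(\lambda)$ connecting $(0,\mu^* )$ and $(\lambda^*,0)$ such that the positive quadrant $\mathbb{R}^+\times\mathbb{R}^+$ of the $(\lambda,\mu)$-plane is separated by this curve into two connected components $\mathcal{O}_1$ and $\mathcal{O}_2$ with the following properties. For $(\lambda,\mu)\in\mathcal{O}_1$, problem (E) has a positive classical minimal solution $(w_{\lambda,\mu},z_{\lambda,\mu})$. For $(\lambda,\mu)\in\mathcal{O}_2$, problem (E) admits no weak solution.
   Context: $\Omega\subset\mathbb{R}^N$ is a smooth bounded domain; $\alpha,\beta$ are nonnegative, nontrivial (not identically zero), Hölder continuous functions on $\bar\Omega$; $f,g\in C^2[0,1)$ are positive, increasing and strictly convex with $\lim_{v\to1^-}f(v)=\lim_{u\to1^-}g(u)=+\infty$. For parameters $\lambda,\mu>0$, problem (E) is $$-\Delta w=\lambda\alpha(x)f(z)\ \text{ in }\Omega,\qquad -\Delta z=\mu\beta(x)g(w)\ \text{ in }\Omega,\qquad w=z=0\ \text{ on }\partial\Omega.$$ A classical solution is a pair $(w,z)$ of functions with $0\le w,z<1$ satisfying (E) pointwise. A classical solution is minimal if it is $\le$ (componentwise) every other classical solution. A weak solution is a pair $(w,z)$ of functions in $L^1(\Omega)$ with $0\le w,z<1$ a.e., $\alpha f(z),\beta g(w)\in L^1(\Omega)$, and $\int_\Omega w(-\Delta\varphi)\,dx=\int_\Omega\lambda\alpha\varphi f(z)\,dx$, $\int_\Omega z(-\Delta\varphi)\,dx=\int_\Omega\mu\beta\varphi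 g(w)\,dx$ for all $\varphi\in C^2(\bar\Omega)$ with $\varphi|_{\partial\Omega}=0$. *)

theory Defs
  imports "HOL-Analysis.Analysis"
begin

definition partial :: "'a::euclidean_space \<Rightarrow> ('a \<Rightarrow> real) \<Rightarrow> 'a \<Rightarrow> real" where
  "partial i f x = frechet_derivative f (at x) i"

definition laplacian :: "('a::euclidean_space \<Rightarrow> real) \<Rightarrow> 'a \<Rightarrow> real" where
  "laplacian f x = (\<Sum>i\<in>Basis. partial i (partial i f) x)"

text \<open>The class \<open>C\<^sup>k(S)\<close>; only meaningful for open \<open>S\<close>.\<close>

fun Ck_on :: "nat \<Rightarrow> ('a::euclidean_space \<Rightarrow> real) \<Rightarrow> 'a set \<Rightarrow> bool" where
  "Ck_on 0 f S \<longleftrightarrow> continuous_on S f"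
| "Ck_on (Suc k) f S \<longleftrightarrow>
     (\<forall>x\<in>S. f differentiable (at x)) \<and> (\<forall>i\<in>Basis. Ck_on k (partial i f) S)"

definition smooth_bounded_domain :: "'a::euclidean_space set \<Rightarrow> bool" where
  "smooth_bounded_domain \<Omega> \<longleftrightarrow>
     open \<Omega> \<and> connected \<Omega> \<and> \<Omega> \<noteq> {} \<and> bounded \<Omega> \<and>
     (\<forall>p\<in>frontier \<Omega>. \<exists>U \<rho>. open U \<and> p \<in> U \<and> (\<forall>k. Ck_on k \<rho> U) \<and>
        (\<forall>x\<in>U. \<exists>i\<in>Basis. partial i \<rho> x \<noteq> 0) \<and>
        \<Omega> \<inter> U = {x \<in> U. \<rho> x < 0} \<and>
        frontier \<Omega> \<inter> U = {x \<in> U. \<rho> x = 0})"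

definition hoelder_on :: "'a::metric_space set \<Rightarrow> ('a \<Rightarrow> real) \<Rightarrow> bool" where
  "hoelder_on S h \<longleftrightarrow>
     (\<exists>\<gamma> C. 0 < \<gamma> \<and> \<gamma> \<le> 1 \<and> (\<forall>x\<in>S. \<forall>y\<in>S. \<bar>h x - h y\<bar> \<le> C * dist x y powr \<gamma>))"

text \<open>The class \<open>C\<^sup>2[0,1)\<close>, with one-sided derivatives at \<open>0\<close>.\<close>

definition C2_Ico01 :: "(real \<Rightarrow> real) \<Rightarrow> bool" where
  "C2_Ico01 h \<longleftrightarrow>
     (\<exists>h' h''. (\<forall>t\<in>{0..<1}. (h has_real_derivative h' t) (at t within {0..<1})) \<and>
        (\<forall>t\<in>{0..<1}. (h' has_real_derivative h'' t) (at t within {0..<1})) \<and>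
        continuous_on {0..<1} h'')"

definition strictly_convex_on :: "real set \<Rightarrow> (real \<Rightarrow> real) \<Rightarrow> bool" where
  "strictly_convex_on S h \<longleftrightarrow> convex S \<and>
     (\<forall>x\<in>S. \<forall>y\<in>S. \<forall>t\<in>{0<..<1}. x \<noteq> y \<longrightarrow>
        h ((1 - t) * x + t * y) < (1 - t) * h x + t * h y)"

text \<open>A function is in \<open>C\<^sup>2\<close> up to the boundary if it is \<open>C\<^sup>2\<close> inside and it and its derivatives
  of order at most two extend continuously to the closure.\<close>

definition extends_continuously :: "'a::euclidean_space set \<Rightarrow> ('a \<Rightarrow> real) \<Rightarrow> bool" where
  "extends_continuously S h \<longleftrightarrow>
     (\<exists>H. continuous_on (closure S) H \<and> (\<forall>x\<in>S. H x = h x))"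

definition C2_closure :: "'a::euclidean_space set \<Rightarrow> ('a \<Rightarrow> real) \<Rightarrow> bool" where
  "C2_closure \<Omega> \<phi> \<longleftrightarrow> Ck_on 2 \<phi> \<Omega> \<and> continuous_on (closure \<Omega>) \<phi> \<and>
     (\<forall>i\<in>Basis. extends_continuously \<Omega> (partial i \<phi>)) \<and>
     (\<forall>i\<in>Basis. \<forall>j\<in>Basis. extends_continuously \<Omega> (partial j (partial i \<phi>)))"

definition classical_solution ::
  "'a::euclidean_space set \<Rightarrow> ('a \<Rightarrow> real) \<Rightarrow> ('a \<Rightarrow> real) \<Rightarrow> (real \<Rightarrow> real) \<Rightarrow> (real \<Rightarrow> real) \<Rightarrow>
   real \<Rightarrow> real \<Rightarrow> ('a \<Rightarrow> real) \<Rightarrow> ('a \<Rightarrow> real) \<Rightarrow> bool" where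
  "classical_solution \<Omega> \<alpha> \<beta> f g lam mu w z \<longleftrightarrow>
     Ck_on 2 w \<Omega> \<and> continuous_on (closure \<Omega>) w \<and>
     Ck_on 2 z \<Omega> \<and> continuous_on (closure \<Omega>) z \<and>
     (\<forall>x\<in>closure \<Omega>. 0 \<le> w x \<and> w x < 1 \<and> 0 \<le> z x \<and> z x < 1) \<and>
     (\<forall>x\<in>\<Omega>. - laplacian w x = lam * \<alpha> x * f (z x)) \<and>
     (\<forall>x\<in>\<Omega>. - laplacian z x = mu * \<beta> x * g (w x)) \<and>
     (\<forall>x\<in>frontier \<Omega>. w x = 0 \<and> z x = 0)"

definition minimal_classical_solution ::
  "'a::euclidean_space set \<Rightarrow> ('a \<Rightarrow> real) \<Rightarrow> ('a \<Rightarrow> real) \<Rightarrow> (real \<Rightarrow> real) \<Rightarrow> (real \<Rightarrow> real) \<Rightarrow>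
   real \<Rightarrow> real \<Rightarrow> ('a \<Rightarrow> real) \<Rightarrow> ('a \<Rightarrow> real) \<Rightarrow> bool" where
  "minimal_classical_solution \<Omega> \<alpha> \<beta> f g lam mu w z \<longleftrightarrow>
     classical_solution \<Omega> \<alpha> \<beta> f g lam mu w z \<and>
     (\<forall>w' z'. classical_solution \<Omega> \<alpha> \<beta> f g lam mu w' z' \<longrightarrow>
        (\<forall>x\<in>\<Omega>. w x \<le> w' x \<and> z x \<le> z' x))"

definition weak_solution ::
  "'a::euclidean_space set \<Rightarrow> ('a \<Rightarrow> real) \<Rightarrow> ('a \<Rightarrow> real) \<Rightarrow> (real \<Rightarrow> real) \<Rightarrow> (real \<Rightarrow> real) \<Rightarrow>
   real \<Rightarrow> real \<Rightarrow> ('a \<Rightarrow> real) \<Rightarrow> ('a \<Rightarrow> real) \<Rightarrow> bool" where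
  "weak_solution \<Omega> \<alpha> \<beta> f g lam mu w z \<longleftrightarrow>
     set_integrable lebesgue \<Omega> w \<and> set_integrable lebesgue \<Omega> z \<and>
     (AE x\<in>\<Omega> in lebesgue. 0 \<le> w x \<and> w x < 1 \<and> 0 \<le> z x \<and> z x < 1) \<and>
     set_integrable lebesgue \<Omega> (\<lambda>x. \<alpha> x * f (z x)) \<and>
     set_integrable lebesgue \<Omega> (\<lambda>x. \<beta> x * g (w x)) \<and>
     (\<forall>\<phi>. C2_closure \<Omega> \<phi> \<and> (\<forall>x\<in>frontier \<Omega>. \<phi> x = 0) \<longrightarrow>
        (LINT x:\<Omega>|lebesgue. w x * (- laplacian \<phi> x)) =
          (LINT x:\<Omega>|lebesgue. lam * \<alpha> x * \<phi> x * f (z x)) \<and>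
        (LINT x:\<Omega>|lebesgue. z x * (- laplacian \<phi> x)) =
          (LINT x:\<Omega>|lebesgue. mu * \<beta> x * \<phi> x * g (w x)))"

end

(* Poisson's equation is solved from scratch. A radial function Phi supported in the unit ball, whose
   Laplacian links two dyadic scales of a cutoff eta, gives a Newton potential as a sum of mollifications,
   together with representation formulas and interior estimates. Harmonic functions with prescribed
   boundary values come from polynomials on balls and from Poincare's sweeping method, with exterior
   balls providing barriers.

   Iterating the Green operator from 0 increases to the minimal solution below any supersolution, so the
   set Lam of parameters with a classical solution is closed under decreasing either parameter. It contains
   a small box, since a small multiple of the solution of -Laplace u = 1 is a supersolution for small
   parameters, and it is bounded, since w and z are below 1. If (w, z) is a weak solution then, for
   0 < theta < 1, the pair (theta w, theta z) is a weak supersolution at (theta l, theta m) bounded by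
   theta < 1; hence (theta l, theta m) lies in Lam.

   The critical curve bounds Lam. The only nontrivial point in its continuity is that a vertical jump is
   impossible: convexity of f lets one trade a decrease of m for a small increase of l. *)

theory Submission
  imports Defs "HOL-Library.Function_Algebras"
begin

section \<open>Second derivatives and the maximum principle\<close>

text \<open>The fundamental solution of the Laplacian is never written down: its formula depends on
  the dimension and it is singular. A series of rescaled compactly supported kernels takes its
  place, with one formula for all dimensions, and the estimates reduce to geometric series. The
  nonlinear part is governed by a bound \<theta> < 1. On [0, \<theta>] the functions f and g are
  Lipschitz, so iterates below \<theta> again yield Hoelder sources with uniform bounds. A classical
  supersolution has such a bound by compactness. A weak solution may come arbitrarily close to 1;
  scaling by \<theta> creates the bound, and \<theta> f(z) >= \<theta> f(\<theta> z) keeps the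
  supersolution property. The price is a contraction of the parameters towards the origin. A point
  above a continuous graph stays above it under a slight contraction, so continuity of the curve is
  also what excludes weak solutions above it. In the jump argument the obstacle is uniformity:
  solutions are available only for l strictly below the critical value, and the increase of l must
  not depend on them. Its size is therefore derived from a lower bound for z that depends on m
  alone.\<close>

definition has_grad_on :: "('a::euclidean_space \<Rightarrow> real) \<Rightarrow> ('a \<Rightarrow> 'a \<Rightarrow> real) \<Rightarrow> 'a set \<Rightarrow> bool" where
  "has_grad_on u d S \<longleftrightarrow>
     (\<forall>x\<in>S. (u has_derivative (\<lambda>v. \<Sum>i\<in>Basis. (v \<bullet> i) * d i x)) (at x))"

text \<open>The derivatives are explicit witnesses instead of \<open>partial\<close>, so that radial
  functions, mollifications and series carry their derivatives as formulas;
  \<open>has_hess_on_Ck\<close> and \<open>Ck_has_hess_on\<close> translate to and from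
  \<open>Ck_on 2\<close>.\<close>

definition has_hess_on ::
  "('a::euclidean_space \<Rightarrow> real) \<Rightarrow> ('a \<Rightarrow> 'a \<Rightarrow> real) \<Rightarrow> ('a \<Rightarrow> 'a \<Rightarrow> 'a \<Rightarrow> real) \<Rightarrow> 'a set \<Rightarrow> bool" where
  "has_hess_on u d D S \<longleftrightarrow> has_grad_on u d S \<and> (\<forall>i\<in>Basis. has_grad_on (d i) (D i) S) \<and>
     (\<forall>i\<in>Basis. \<forall>j\<in>Basis. continuous_on S (D i j))"

section \<open>Calculus of explicit gradients and Hessians\<close>

lemma has_grad_onD:
  "has_grad_on u d S \<Longrightarrow> x \<in> S \<Longrightarrow> (u has_derivative (\<lambda>v. \<Sum>i\<in>Basis. (v \<bullet> i) * d i x)) (at x)"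
  by (simp add: has_grad_on_def)

lemma has_grad_on_differentiable: "has_grad_on u d S \<Longrightarrow> x \<in> S \<Longrightarrow> u differentiable (at x)"
  by (meson differentiableI has_grad_onD)

lemma has_grad_on_subset: "has_grad_on u d S \<Longrightarrow> T \<subseteq> S \<Longrightarrow> has_grad_on u d T"
  by (auto simp: has_grad_on_def)

lemma has_hess_on_subset: "has_hess_on u d D S \<Longrightarrow> T \<subseteq> S \<Longrightarrow> has_hess_on u d D T"
  unfolding has_hess_on_def by (meson continuous_on_subset has_grad_on_subset)

lemma has_grad_on_continuous: "has_grad_on u d S \<Longrightarrow> continuous_on S u"
  by (meson continuous_at_imp_continuous_on has_derivative_continuous has_grad_onD)

lemma sum_Basis_single: "i \<in> Basis \<Longrightarrow> (\<Sum>j\<in>Basis. (i \<bullet> j) * c j) = (c (i::'a::euclidean_space) :: real)"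
  by (simp add: inner_Basis if_distrib if_distribR cong: if_cong)

lemma partial_eq_grad:
  assumes "has_grad_on u d S" "x \<in> S" "i \<in> Basis" shows "partial i u x = d i x"
  using frechet_derivative_at[OF has_grad_onD[OF assms(1,2)]] sum_Basis_single[OF assms(3)]
  unfolding partial_def by metis

lemma differentiable_has_grad_on:
  assumes "\<And>x. x \<in> S \<Longrightarrow> u differentiable (at x)"
  shows "has_grad_on u (\<lambda>i. partial i u) S"
  unfolding has_grad_on_def
proof
  fix x assume "x \<in> S"
  then have d: "(u has_derivative frechet_derivative u (at x)) (at x)"
    using assms frechet_derivative_works by blast
  then have l: "linear (frechet_derivative u (at x))"
    by (simp add: has_derivative_bounded_linear bounded_linear.linear)
  have "frechet_derivative u (at x) v = (\<Sum>i\<in>Basis. (v \<bullet> i) * partial i u x)" for v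
  proof -
    have "frechet_derivative u (at x) (\<Sum>i\<in>Basis. (v \<bullet> i) *\<^sub>R i) = (\<Sum>i\<in>Basis. (v \<bullet> i) * partial i u x)"
      unfolding partial_def using l by (simp add: linear_sum linear_scale)
    then show ?thesis by (simp add: euclidean_representation)
  qed
  then show "(u has_derivative (\<lambda>v. \<Sum>i\<in>Basis. (v \<bullet> i) * partial i u x)) (at x)" using d by presburger
qed

lemma has_grad_on_cong:
  assumes "open S" "has_grad_on u d S" "\<And>x. x \<in> S \<Longrightarrow> u x = v x"
    "\<And>x i. x \<in> S \<Longrightarrow> i \<in> Basis \<Longrightarrow> d i x = e i x"
  shows "has_grad_on v e S"
  unfolding has_grad_on_def
proof
  fix x assume x: "x \<in> S"
  have "(v has_derivative (\<lambda>v. \<Sum>i\<in>Basis. (v \<bullet> i) * d i x)) (at x)"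
    using has_derivative_transform_within_open[OF has_grad_onD[OF assms(2) x] assms(1) x] assms(3) by blast
  then show "(v has_derivative (\<lambda>v. \<Sum>i\<in>Basis. (v \<bullet> i) * e i x)) (at x)"
    using assms(4)[OF x] by simp
qed

lemma has_hess_on_cong:
  assumes "open S" "has_hess_on u d D S" "\<And>x. x \<in> S \<Longrightarrow> u x = v x"
  shows "has_hess_on v d D S"
  using assms has_grad_on_cong unfolding has_hess_on_def by blast

text \<open>Openness matters: \<open>partial i u\<close> is known to equal \<open>d i\<close> only
  on S, and differentiating it once more requires the equality on a neighbourhood.\<close>

lemma has_hess_on_Ck:
  assumes "open S" "has_hess_on u d D S"
  shows "Ck_on 2 u S" "\<And>x. x \<in> S \<Longrightarrow> laplacian u x = (\<Sum>i\<in>Basis. D i i x)"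
proof -
  have g: "has_grad_on u d S" "\<And>i. i \<in> Basis \<Longrightarrow> has_grad_on (d i) (D i) S"
    and c: "\<And>i j. i \<in> Basis \<Longrightarrow> j \<in> Basis \<Longrightarrow> continuous_on S (D i j)"
    using assms(2) by (auto simp: has_hess_on_def)
  have p: "partial i u x = d i x" if "x \<in> S" "i \<in> Basis" for i x
    using partial_eq_grad g(1) that by blast
  have g2: "has_grad_on (partial i u) (D i) S" if "i \<in> Basis" for i
    using has_grad_on_cong[OF assms(1) g(2)[OF that]] p that by simp
  have p2: "partial j (partial i u) x = D i j x" if "x \<in> S" "i \<in> Basis" "j \<in> Basis" for i j x
    using partial_eq_grad g2 that by blast
  show "laplacian u x = (\<Sum>i\<in>Basis. D i i x)" if "x \<in> S" for x
    unfolding laplacian_def using p2 that by simp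
  have "continuous_on S (partial j (partial i u))" if "i \<in> Basis" "j \<in> Basis" for i j
    using c[OF that] p2 that by (simp cong: continuous_on_cong)
  then show "Ck_on 2 u S"
    unfolding numeral_2_eq_2 using g(1) g2 by (auto intro: has_grad_on_differentiable)
qed

lemma Ck_has_hess_on:
  assumes "Ck_on 2 u S"
  shows "has_hess_on u (\<lambda>i. partial i u) (\<lambda>i j. partial j (partial i u)) S"
  using assms unfolding numeral_2_eq_2 has_hess_on_def
  by (auto intro!: differentiable_has_grad_on)

lemma Ck2_cong:
  assumes "open S" "Ck_on 2 u S" "\<And>x. x \<in> S \<Longrightarrow> u x = v x"
  shows "Ck_on 2 v S" "\<And>x. x \<in> S \<Longrightarrow> laplacian v x = laplacian u x"
  using has_hess_on_Ck[OF assms(1) has_hess_on_cong[OF assms(1) Ck_has_hess_on[OF assms(2)] assms(3)]]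
    has_hess_on_Ck[OF assms(1) Ck_has_hess_on[OF assms(2)]] by auto

lemma Ck2_subset: "Ck_on 2 u S \<Longrightarrow> T \<subseteq> S \<Longrightarrow> Ck_on 2 u T"
  unfolding numeral_2_eq_2 by simp (meson continuous_on_subset subsetD)

lemma Ck2_local:
  assumes "\<And>x. x \<in> S \<Longrightarrow> \<exists>U. open U \<and> x \<in> U \<and> Ck_on 2 u U"
  shows "Ck_on 2 u S"
  unfolding numeral_2_eq_2
proof (clarsimp, intro conjI ballI)
  fix x assume "x \<in> S"
  then show "u differentiable at x" using assms unfolding numeral_2_eq_2 by force
next
  fix i x :: 'a assume "i \<in> Basis" "x \<in> S"
  then show "partial i u differentiable at x" using assms unfolding numeral_2_eq_2 by force
next
  fix i j :: 'a assume ij: "i \<in> Basis" "j \<in> Basis"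
  have "isCont (partial j (partial i u)) x" if x: "x \<in> S" for x
  proof -
    obtain U where "open U" "x \<in> U" "continuous_on U (partial j (partial i u))"
      using assms[OF x] ij unfolding numeral_2_eq_2 by auto
    then show ?thesis using continuous_on_eq_continuous_at by blast
  qed
  then show "continuous_on S (partial j (partial i u))" by (simp add: continuous_at_imp_continuous_on)
qed

lemma Ck2_continuous: "Ck_on 2 u S \<Longrightarrow> continuous_on S u"
  using Ck_has_hess_on has_grad_on_continuous has_hess_on_def by blast

lemma has_grad_on_lincomb:
  assumes "has_grad_on u d S" "has_grad_on v e S"
  shows "has_grad_on (\<lambda>x. a * u x + b * v x) (\<lambda>i x. a * d i x + b * e i x) S"
  unfolding has_grad_on_def
proof
  fix x assume x: "x \<in> S"
  show "((\<lambda>x. a * u x + b * v x) has_derivative (\<lambda>v. \<Sum>i\<in>Basis. (v \<bullet> i) * (a * d i x + b * e i x))) (at x)"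
    by (rule has_derivative_eq_rhs, rule derivative_intros, (rule derivative_intros has_grad_onD[OF assms(1) x] has_grad_onD[OF assms(2) x])+)
      (simp add: fun_eq_iff algebra_simps sum.distrib sum_distrib_left)
qed

lemma has_hess_on_lincomb:
  assumes "has_hess_on u d D S" "has_hess_on v e E S"
  shows "has_hess_on (\<lambda>x. a * u x + b * v x) (\<lambda>i x. a * d i x + b * e i x) (\<lambda>i j x. a * D i j x + b * E i j x) S"
  using assms unfolding has_hess_on_def
  by (auto intro!: has_grad_on_lincomb continuous_intros)

lemma Ck2_lincomb:
  assumes "open S" "Ck_on 2 u S" "Ck_on 2 v S"
  shows "Ck_on 2 (\<lambda>x. a * u x + b * v x) S"
    "\<And>x. x \<in> S \<Longrightarrow> laplacian (\<lambda>x. a * u x + b * v x) x = a * laplacian u x + b * laplacian v x"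
  using has_hess_on_Ck[OF assms(1) has_hess_on_lincomb[OF Ck_has_hess_on[OF assms(2)] Ck_has_hess_on[OF assms(3)]]]
  by (auto simp: laplacian_def sum.distrib sum_distrib_left)

lemma has_hess_on_const: "has_hess_on (\<lambda>x. c) (\<lambda>i x. 0) (\<lambda>i j x. 0) S"
  by (auto simp: has_hess_on_def has_grad_on_def)

lemma Ck2_const: "open S \<Longrightarrow> Ck_on 2 (\<lambda>x. c) S" "open S \<Longrightarrow> x \<in> S \<Longrightarrow> laplacian (\<lambda>x. c) x = 0"
  using has_hess_on_Ck[OF _ has_hess_on_const] by auto

lemma Ck2_scale:
  assumes "open S" "Ck_on 2 u S"
  shows "Ck_on 2 (\<lambda>x. a * u x) S" "\<And>x. x \<in> S \<Longrightarrow> laplacian (\<lambda>x. a * u x) x = a * laplacian u x"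
  using Ck2_lincomb[OF assms assms(2), where a=a and b=0] by auto

lemma Ck2_add:
  assumes "open S" "Ck_on 2 u S" "Ck_on 2 v S"
  shows "Ck_on 2 (\<lambda>x. u x + v x) S"
    "\<And>x. x \<in> S \<Longrightarrow> laplacian (\<lambda>x. u x + v x) x = laplacian u x + laplacian v x"
  using Ck2_lincomb[OF assms, where a=1 and b=1] by auto

lemma Ck2_diff:
  assumes "open S" "Ck_on 2 u S" "Ck_on 2 v S"
  shows "Ck_on 2 (\<lambda>x. u x - v x) S"
    "\<And>x. x \<in> S \<Longrightarrow> laplacian (\<lambda>x. u x - v x) x = laplacian u x - laplacian v x"
  using Ck2_lincomb[OF assms, where a=1 and b="-1"] by auto

text \<open>The profile acts on the squared distance, which is a polynomial, so nothing special
  happens at the centre y, where the distance itself is not differentiable.\<close>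

lemma has_hess_on_radial:
  fixes y :: "'a::euclidean_space" and F F' F'' :: "real \<Rightarrow> real"
  assumes F: "\<And>s. s \<in> T \<Longrightarrow> (F has_real_derivative F' s) (at s)"
    and F': "\<And>s. s \<in> T \<Longrightarrow> (F' has_real_derivative F'' s) (at s)"
    and c: "continuous_on T F''" and S: "\<And>x. x \<in> S \<Longrightarrow> (x - y) \<bullet> (x - y) \<in> T"
  shows "has_hess_on (\<lambda>x. F ((x - y) \<bullet> (x - y))) (\<lambda>i x. 2 * ((x - y) \<bullet> i) * F' ((x - y) \<bullet> (x - y)))
    (\<lambda>i j x. 2 * (i \<bullet> j) * F' ((x - y) \<bullet> (x - y)) + 4 * ((x - y) \<bullet> i) * ((x - y) \<bullet> j) * F'' ((x - y) \<bullet> (x - y))) S"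
proof -
  have s: "((\<lambda>x. (x - y) \<bullet> (x - y)) has_derivative (\<lambda>v. 2 * (v \<bullet> (x - y)))) (at x)" for x
    by (auto intro!: derivative_eq_intros simp: inner_commute)
  have ex: "v \<bullet> w = (\<Sum>i\<in>Basis. (v \<bullet> i) * (w \<bullet> i))" for v w :: 'a
    by (rule euclidean_inner)
  have g1: "((\<lambda>x. F ((x - y) \<bullet> (x - y))) has_derivative (\<lambda>v. 2 * (v \<bullet> (x - y)) * F' ((x - y) \<bullet> (x - y)))) (at x)"
    if "x \<in> S" for x
    using has_derivative_compose[OF s F[OF S[OF that], unfolded has_field_derivative_def]]
    by (simp add: mult.commute)
  have g2: "((\<lambda>x. F' ((x - y) \<bullet> (x - y))) has_derivative (\<lambda>v. 2 * (v \<bullet> (x - y)) * F'' ((x - y) \<bullet> (x - y)))) (at x)"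
    if "x \<in> S" for x
    using has_derivative_compose[OF s F'[OF S[OF that], unfolded has_field_derivative_def]]
    by (simp add: mult.commute)
  have cF': "continuous_on T F'" using F' by (meson DERIV_continuous_on DERIV_subset subset_UNIV has_field_derivative_at_within)
  have cs: "continuous_on S (\<lambda>x. h ((x - y) \<bullet> (x - y)))" if "continuous_on T h" for h :: "real \<Rightarrow> real"
    by (rule continuous_on_compose2[OF that]) (auto intro!: continuous_intros S)
  show ?thesis
    unfolding has_hess_on_def has_grad_on_def
  proof (intro conjI ballI)
    fix x assume x: "x \<in> S"
    show "((\<lambda>x. F ((x - y) \<bullet> (x - y))) has_derivative
            (\<lambda>v. \<Sum>i\<in>Basis. v \<bullet> i * (2 * ((x - y) \<bullet> i) * F' ((x - y) \<bullet> (x - y))))) (at x)"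
      by (rule has_derivative_eq_rhs[OF g1[OF x]], rule ext, subst ex[of _ "x - y"])
        (simp add: sum_distrib_left sum_distrib_right mult_ac)
  next
    fix i x :: 'a assume i: "i \<in> Basis" and x: "x \<in> S"
    have "((\<lambda>x. 2 * ((x - y) \<bullet> i) * F' ((x - y) \<bullet> (x - y))) has_derivative
      (\<lambda>v. 2 * ((x - y) \<bullet> i) * (2 * (v \<bullet> (x - y)) * F'' ((x - y) \<bullet> (x - y))) + 2 * (v \<bullet> i) * F' ((x - y) \<bullet> (x - y)))) (at x)"
      by (rule derivative_eq_intros refl g2[OF x])+ (auto simp: algebra_simps)
    moreover have "2 * ((x - y) \<bullet> i) * (2 * (v \<bullet> (x - y)) * F'' ((x - y) \<bullet> (x - y))) + 2 * (v \<bullet> i) * F' ((x - y) \<bullet> (x - y))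
      = (\<Sum>j\<in>Basis. (v \<bullet> j) * (2 * (i \<bullet> j) * F' ((x - y) \<bullet> (x - y)) + 4 * ((x - y) \<bullet> i) * ((x - y) \<bullet> j) * F'' ((x - y) \<bullet> (x - y))))" for v
      apply (subst ex[of v "x - y"], subst ex[of v i])
      apply (simp add: sum_distrib_left sum_distrib_right distrib_left sum.distrib)
      apply (simp add: mult_ac)
      done
    ultimately show "((\<lambda>x. 2 * ((x - y) \<bullet> i) * F' ((x - y) \<bullet> (x - y))) has_derivative
            (\<lambda>v. \<Sum>j\<in>Basis. (v \<bullet> j) * (2 * (i \<bullet> j) * F' ((x - y) \<bullet> (x - y)) + 4 * ((x - y) \<bullet> i) * ((x - y) \<bullet> j) * F'' ((x - y) \<bullet> (x - y))))) (at x)"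
      by (rule has_derivative_eq_rhs[OF _ ext])
  next
    fix i j :: 'a
    show "continuous_on S (\<lambda>x. 2 * (i \<bullet> j) * F' ((x - y) \<bullet> (x - y)) + 4 * ((x - y) \<bullet> i) * ((x - y) \<bullet> j) * F'' ((x - y) \<bullet> (x - y)))"
      by (intro continuous_intros cs cF' c)
  qed
qed

lemma Ck2_radial:
  fixes y :: "'a::euclidean_space" and F F' F'' :: "real \<Rightarrow> real"
  assumes "open S" and F: "\<And>s. s \<in> T \<Longrightarrow> (F has_real_derivative F' s) (at s)"
    and F': "\<And>s. s \<in> T \<Longrightarrow> (F' has_real_derivative F'' s) (at s)"
    and c: "continuous_on T F''" and S: "\<And>x. x \<in> S \<Longrightarrow> (x - y) \<bullet> (x - y) \<in> T"
  shows "Ck_on 2 (\<lambda>x. F ((x - y) \<bullet> (x - y))) S"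
    "\<And>x. x \<in> S \<Longrightarrow> laplacian (\<lambda>x. F ((x - y) \<bullet> (x - y))) x =
      2 * DIM('a) * F' ((x - y) \<bullet> (x - y)) + 4 * ((x - y) \<bullet> (x - y)) * F'' ((x - y) \<bullet> (x - y))"
proof -
  note H = has_hess_on_Ck[OF assms(1) has_hess_on_radial[OF F F' c S]]
  show "Ck_on 2 (\<lambda>x. F ((x - y) \<bullet> (x - y))) S" by (rule H(1)) auto
  fix x assume "x \<in> S"
  then have "laplacian (\<lambda>x. F ((x - y) \<bullet> (x - y))) x = (\<Sum>i\<in>Basis. 2 * (i \<bullet> i) * F' ((x - y) \<bullet> (x - y)) + 4 * ((x - y) \<bullet> i) * ((x - y) \<bullet> i) * F'' ((x - y) \<bullet> (x - y)))"
    by (intro H(2)) auto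
  also have "\<dots> = (\<Sum>i\<in>(Basis::'a set). 2 * F' ((x - y) \<bullet> (x - y))) + (\<Sum>i\<in>Basis. 4 * (((x - y) \<bullet> i) * ((x - y) \<bullet> i)) * F'' ((x - y) \<bullet> (x - y)))"
    unfolding sum.distrib[symmetric] by (rule sum.cong) (auto simp: mult_ac)
  also have "\<dots> = 2 * DIM('a) * F' ((x - y) \<bullet> (x - y)) + 4 * ((x - y) \<bullet> (x - y)) * F'' ((x - y) \<bullet> (x - y))"
    by (simp add: sum_distrib_left[symmetric] sum_distrib_right[symmetric] euclidean_inner[of "x - y" "x - y", symmetric])
  finally show "laplacian (\<lambda>x. F ((x - y) \<bullet> (x - y))) x =
      2 * DIM('a) * F' ((x - y) \<bullet> (x - y)) + 4 * ((x - y) \<bullet> (x - y)) * F'' ((x - y) \<bullet> (x - y))" .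
qed

lemma Ck2_quadratic:
  fixes y :: "'a::euclidean_space"
  assumes "open S"
  shows "Ck_on 2 (\<lambda>x. (x - y) \<bullet> (x - y)) S"
    "\<And>x. x \<in> S \<Longrightarrow> laplacian (\<lambda>x. (x - y) \<bullet> (x - y)) x = 2 * DIM('a)"
  using Ck2_radial[OF assms, where F="\<lambda>s. s" and F'="\<lambda>s. 1" and F''="\<lambda>s. 0" and T=UNIV and y=y] by auto

section \<open>Local maxima and the maximum principle\<close>

text \<open>Each pure second derivative is nonpositive: if one were positive, the first derivative
  along that coordinate, which vanishes at x, would be positive just to the right of x, and the mean
  value theorem would produce a value above u x.\<close>

lemma laplacian_at_local_max:
  assumes "Ck_on 2 u S" "open S" "x \<in> S" "0 < r" "\<And>y. y \<in> ball x r \<Longrightarrow> u y \<le> u x"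
  shows "laplacian u x \<le> 0"
  unfolding laplacian_def
proof (rule sum_nonpos)
  fix i :: 'a assume i: "i \<in> Basis"
  obtain r' where r': "0 < r'" "ball x r' \<subseteq> S" "r' \<le> r"
  proof -
    obtain q where "0 < q" "ball x q \<subseteq> S" using assms(2,3) open_contains_ball by blast
    moreover have "ball x (min q r) \<subseteq> ball x q" by (rule subset_ball) simp
    ultimately show ?thesis using that[of "min q r"] assms(4) by auto
  qed
  have H: "has_grad_on u (\<lambda>i. partial i u) S" "has_grad_on (partial i u) (\<lambda>j. partial j (partial i u)) S"
    using Ck_has_hess_on[OF assms(1)] i by (auto simp: has_hess_on_def)
  have line: "((\<lambda>t. x + t *\<^sub>R i) has_derivative (\<lambda>t. t *\<^sub>R i)) (at t)" for t :: real
    by (auto intro!: derivative_eq_intros)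
  have inb: "x + t *\<^sub>R i \<in> ball x r'" if "\<bar>t\<bar> < r'" for t using that i by (simp add: dist_norm)
  have D: "((\<lambda>t. h (x + t *\<^sub>R i)) has_real_derivative d i (x + t *\<^sub>R i)) (at t)"
    if "has_grad_on h d S" "\<bar>t\<bar> < r'" for h d t
  proof -
    have "x + t *\<^sub>R i \<in> S" using inb r' that(2) by blast
    from has_derivative_compose[OF line has_grad_onD[OF that(1) this]]
    show ?thesis unfolding has_field_derivative_def
      by (simp add: sum_Basis_single[OF i] mult.assoc sum_distrib_left[symmetric] mult_commute_abs)
  qed
  show "partial i (partial i u) x \<le> 0"
  proof (rule ccontr)
    assume "\<not> ?thesis"
    then have pos: "partial i (partial i u) x > 0" by simp
    have u0: "partial i u x = 0"
    proof -
      have "((\<lambda>t. u (x + t *\<^sub>R i)) has_real_derivative partial i u (x + 0 *\<^sub>R i)) (at 0)"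
        using D[OF H(1), of 0] r' by simp
      then show ?thesis
        using DERIV_local_max[of "\<lambda>t. u (x + t *\<^sub>R i)" _ 0 r'] inb assms(5) r' by (force simp: dist_norm)
    qed
    have "((\<lambda>t. partial i u (x + t *\<^sub>R i)) has_real_derivative partial i (partial i u) x) (at 0)"
      using D[OF H(2), of 0] r' by simp
    from DERIV_pos_inc_right[OF this pos] obtain d where d: "d > 0" "\<And>h. 0 < h \<Longrightarrow> h < d \<Longrightarrow> 0 < partial i u (x + h *\<^sub>R i)"
      by (auto simp: u0)
    define h where "h = min d r' / 2"
    have h: "0 < h" "h < d" "h < r'" using d r' by (auto simp: h_def)
    obtain z where z: "0 < z" "z < h" "u (x + h *\<^sub>R i) - u (x + 0 *\<^sub>R i) = (h - 0) * partial i u (x + z *\<^sub>R i)"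
    proof -
      have "((\<lambda>t. u (x + t *\<^sub>R i)) has_real_derivative partial i u (x + t *\<^sub>R i)) (at t)" if "0 \<le> t" "t \<le> h" for t
        using D[OF H(1), of t] h that by simp
      from MVT2[OF h(1) this] that show ?thesis by blast
    qed
    have "u (x + h *\<^sub>R i) > u x" using z d(2)[of z] h by (simp add: algebra_simps)
    moreover have "u (x + h *\<^sub>R i) \<le> u x" using assms(5) inb[of h] h r' by (auto simp: dist_norm)
    ultimately show False by simp
  qed
qed

text \<open>Subharmonicity in the viscosity sense. It survives the replacement of a function by a larger
  harmonic one on a ball, which is all that the sweeping process below needs.\<close>

definition visc_sub :: "'a::euclidean_space set \<Rightarrow> ('a \<Rightarrow> real) \<Rightarrow> bool" where
  "visc_sub S u \<longleftrightarrow> (\<forall>x\<in>S. \<forall>\<phi> r. 0 < r \<and> ball x r \<subseteq> S \<and> Ck_on 2 \<phi> (ball x r) \<and>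
     (\<forall>y\<in>ball x r. u y - \<phi> y \<le> u x - \<phi> x) \<longrightarrow> 0 \<le> laplacian \<phi> x)"

lemma visc_subD:
  assumes "visc_sub S u" "x \<in> S" "0 < r" "ball x r \<subseteq> S" "Ck_on 2 \<phi> (ball x r)"
    "\<And>y. y \<in> ball x r \<Longrightarrow> u y - \<phi> y \<le> u x - \<phi> x"
  shows "0 \<le> laplacian \<phi> x"
proof -
  have "0 < r \<and> ball x r \<subseteq> S \<and> Ck_on 2 \<phi> (ball x r) \<and> (\<forall>y\<in>ball x r. u y - \<phi> y \<le> u x - \<phi> x)"
    using assms by simp
  then show ?thesis
    by (rule assms(1)[unfolded visc_sub_def, THEN bspec, OF assms(2), THEN spec, THEN spec, THEN mp])
qed

lemma Ck2_visc_sub: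
  assumes "open S" "Ck_on 2 u S" "\<And>x. x \<in> S \<Longrightarrow> 0 \<le> laplacian u x"
  shows "visc_sub S u"
  unfolding visc_sub_def
proof (intro ballI allI impI, elim conjE)
  fix x \<phi> r assume x: "x \<in> S" and r: "0 < r" "ball x r \<subseteq> S" and \<phi>: "Ck_on 2 \<phi> (ball x r)"
    and m: "\<forall>y\<in>ball x r. u y - \<phi> y \<le> u x - \<phi> x"
  have u: "Ck_on 2 u (ball x r)" using Ck2_subset assms(2) r by blast
  note d = Ck2_diff[OF open_ball u \<phi>]
  have "laplacian (\<lambda>x. u x - \<phi> x) x \<le> 0"
    by (rule laplacian_at_local_max[OF d(1) open_ball _ r(1)]) (use r m in auto)
  then show "0 \<le> laplacian \<phi> x" using d(2)[of x] r assms(3)[OF x] by simp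
qed

text \<open>A small multiple of |x|^2 is added to u - \<phi>. The sum still attains its maximum
  inside S, and at that point \<phi> - e |x|^2 is an admissible test function with strictly negative
  Laplacian, against the viscosity inequality.\<close>

lemma visc_max_principle:
  fixes S :: "'a::euclidean_space set"
  assumes S: "open S" "bounded S" and u: "continuous_on (closure S) u" "visc_sub S u"
    and \<phi>: "Ck_on 2 \<phi> S" "continuous_on (closure S) \<phi>" "\<And>x. x \<in> S \<Longrightarrow> laplacian \<phi> x \<le> 0"
    and bd: "\<And>x. x \<in> frontier S \<Longrightarrow> u x \<le> \<phi> x" and x0: "x0 \<in> closure S"
  shows "u x0 \<le> \<phi> x0"
proof (rule ccontr)
  assume "\<not> ?thesis"
  define m where "m = u x0 - \<phi> x0"
  have m: "0 < m" using \<open>\<not> _\<close> by (simp add: m_def)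
  have cl: "closure S = S \<union> frontier S" using closure_Un_frontier by blast
  obtain B where B: "\<And>x. x \<in> closure S \<Longrightarrow> norm x \<le> B"
    using bounded_closure[OF S(2)] by (auto simp: bounded_iff)
  have B2: "x \<bullet> x \<le> B^2" if "x \<in> closure S" for x
    using B[OF that] by (metis norm_ge_zero power_mono power2_norm_eq_inner)
  \<comment> \<open>With |x|^2 <= B^2 on the closure, this e keeps the perturbation below m, so that
    F on the frontier stays below its value at x0.\<close>
  define e where "e = m / (2 * (B^2 + 1))"
  have e: "0 < e" "e * B^2 < m" using m 
    by (auto simp: e_def divide_simps add_pos_nonneg algebra_simps intro: add_strict_increasing2)
  define F where "F = (\<lambda>x. u x - \<phi> x + e * (x \<bullet> x))"
  have "continuous_on (closure S) F" unfolding F_def by (intro continuous_intros u \<phi>)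
  then obtain z where z: "z \<in> closure S" "\<And>y. y \<in> closure S \<Longrightarrow> F y \<le> F z"
    using continuous_attains_sup[of "closure S" F] bounded_closure[OF S(2)] x0
    by (metis closed_closure compact_eq_bounded_closed empty_iff)
  have "0 \<le> e * (x0 \<bullet> x0)" using e by simp
  then have Fz: "m \<le> F z" using z(2)[OF x0] by (simp add: F_def m_def)
  have "z \<in> S"
  proof (rule ccontr)
    assume "z \<notin> S"
    then have "z \<in> frontier S" using z cl by auto
    then have "F z \<le> e * (z \<bullet> z)" using bd by (simp add: F_def)
    also have "\<dots> \<le> e * B^2" using B2[OF z(1)] e by simp
    finally show False using e Fz by simp
  qed
  then obtain r where r: "0 < r" "ball z r \<subseteq> S" using S(1) open_contains_ball by blast
  have \<phi>b: "Ck_on 2 \<phi> (ball z r)" using Ck2_subset \<phi>(1) r by blast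
  have q: "Ck_on 2 (\<lambda>x::'a. x \<bullet> x) (ball z r)" "laplacian (\<lambda>x::'a. x \<bullet> x) z = 2 * DIM('a)"
    using Ck2_quadratic[OF open_ball[of z r], where y="0::'a"] r by auto
  note L = Ck2_lincomb[OF open_ball \<phi>b q(1), where a=1 and b="-e"]
  have "0 \<le> laplacian (\<lambda>x. 1 * \<phi> x + (-e) * (x \<bullet> x)) z"
  proof (rule visc_subD[OF u(2) \<open>z \<in> S\<close> r L(1)])
    fix y assume "y \<in> ball z r"
    then have "y \<in> closure S" using r(2) closure_subset by blast
    then show "u y - (1 * \<phi> y + - e * (y \<bullet> y)) \<le> u z - (1 * \<phi> z + - e * (z \<bullet> z))"
      using z(2) by (force simp: F_def)
  qed
  also have "\<dots> = laplacian \<phi> z - e * (2 * DIM('a))" using L(2)[of z] r q(2) by simp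
  also have "\<dots> < 0" using \<phi>(3)[OF \<open>z \<in> S\<close>] mult_pos_pos[OF e(1), of "2 * real DIM('a)"] by simp
  finally show False by simp
qed

lemma laplacian_comparison:
  fixes S :: "'a::euclidean_space set"
  assumes S: "open S" "bounded S" and u: "Ck_on 2 u S" "continuous_on (closure S) u"
    and v: "Ck_on 2 v S" "continuous_on (closure S) v"
    and le: "\<And>x. x \<in> S \<Longrightarrow> laplacian v x \<le> laplacian u x"
    and bd: "\<And>x. x \<in> frontier S \<Longrightarrow> u x \<le> v x" and x: "x \<in> closure S"
  shows "u x \<le> v x"
proof -
  note d = Ck2_diff[OF S(1) u(1) v(1)]
  have "visc_sub S (\<lambda>x. u x - v x)" by (rule Ck2_visc_sub[OF S(1) d(1)]) (use d(2) le in auto)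
  moreover have "continuous_on (closure S) (\<lambda>x. u x - v x)" by (intro continuous_intros u v)
  ultimately have "u x - v x \<le> 0"
    using visc_max_principle[OF S, of "\<lambda>x. u x - v x" "\<lambda>_. 0", OF _ _ Ck2_const(1)[OF S(1)] _ _ _ x]
      bd Ck2_const(2)[OF S(1)] by simp
  then show ?thesis by simp
qed

text \<open>Outside B the new function equals u and it dominates u everywhere, so a test function
  touching the new one from above also touches u. Inside B the new function is harmonic.\<close>

lemma visc_sub_lift:
  assumes u: "visc_sub S u" and B: "open B" "B \<subseteq> S" and H: "Ck_on 2 H B" "\<And>x. x \<in> B \<Longrightarrow> laplacian H x = 0"
    and le: "\<And>x. x \<in> B \<Longrightarrow> u x \<le> H x"
  shows "visc_sub S (\<lambda>x. if x \<in> B then H x else u x)"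
  unfolding visc_sub_def
proof (intro ballI allI impI, elim conjE)
  let ?u = "\<lambda>x. if x \<in> B then H x else u x"
  fix x \<phi> r assume x: "x \<in> S" and r: "0 < r" "ball x r \<subseteq> S" and \<phi>: "Ck_on 2 \<phi> (ball x r)"
    and m: "\<forall>y\<in>ball x r. ?u y - \<phi> y \<le> ?u x - \<phi> x"
  show "0 \<le> laplacian \<phi> x"
  proof (cases "x \<in> B")
    case False
    have "u y - \<phi> y \<le> u x - \<phi> x" if "y \<in> ball x r" for y
      using m[rule_format, OF that] le[of y] False by (auto split: if_splits)
    then show ?thesis by (rule visc_subD[OF u x r \<phi>])
  next
    case True
    then obtain q where q: "0 < q" "ball x q \<subseteq> B" using B(1) open_contains_ball by blast
    let ?q = "min q r"
    have sub: "ball x ?q \<subseteq> B" "ball x ?q \<subseteq> ball x r" using q by auto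
    have "visc_sub B H" by (rule Ck2_visc_sub[OF B(1) H(1)]) (simp add: H(2))
    moreover have "Ck_on 2 \<phi> (ball x ?q)" using Ck2_subset \<phi> sub by blast
    moreover have "H y - \<phi> y \<le> H x - \<phi> x" if "y \<in> ball x ?q" for y
    proof -
      have "y \<in> B" "y \<in> ball x r" using that sub by blast+
      then show ?thesis using m[rule_format, of y] True by simp
    qed
    moreover have "0 < ?q" using q(1) r(1) by simp
    ultimately show ?thesis using visc_subD[of B H x ?q \<phi>] True sub(1) by simp
  qed
qed

section \<open>Exterior balls and barriers at the boundary\<close>

text \<open>Let G be the gradient of the defining function at p and \<nu> its direction. The ball of
  radius R tangent at p on the side of \<nu> consists of points with |x - p|^2 <= 2 R (x - p).\<nu>.
  The linear part of the defining function is |G| (x - p).\<nu> and its Taylor error is at most C |x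
  - p|^2, so 2 R C < |G| makes the function positive on the ball except at p.\<close>

lemma exterior_ball:
  fixes \<Omega> :: "'a::euclidean_space set"
  assumes "smooth_bounded_domain \<Omega>" "p \<in> frontier \<Omega>"
  obtains y R where "0 < R" "dist p y = R" "\<And>x. x \<in> closure \<Omega> \<Longrightarrow> x \<noteq> p \<Longrightarrow> R < dist x y"
proof -
  obtain U \<rho> where U: "open U" "p \<in> U" and \<rho>: "\<And>k. Ck_on k \<rho> U" "\<And>x. x \<in> U \<Longrightarrow> \<exists>i\<in>Basis. partial i \<rho> x \<noteq> 0"
    and \<Omega>U: "\<Omega> \<inter> U = {x \<in> U. \<rho> x < 0}" "frontier \<Omega> \<inter> U = {x \<in> U. \<rho> x = 0}"
    using assms unfolding smooth_bounded_domain_def by meson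
  have p0: "\<rho> p = 0" using \<Omega>U(2) assms(2) U(2) by auto
  have g: "has_grad_on \<rho> (\<lambda>i. partial i \<rho>) U"
    and g2: "\<And>i. i \<in> Basis \<Longrightarrow> has_grad_on (partial i \<rho>) (\<lambda>j. partial j (partial i \<rho>)) U"
    using Ck_has_hess_on[OF \<rho>(1)] by (auto simp: has_hess_on_def)
  have "\<exists>L s. 0 < s \<and> 0 \<le> L \<and> (\<forall>x. dist x p < s \<longrightarrow> \<bar>partial i \<rho> x - partial i \<rho> p\<bar> \<le> L * dist x p)"
    if i: "i \<in> Basis" for i
  proof -
    obtain f' where f': "bounded_linear f'" "(partial i \<rho> has_derivative f') (at p)"
      using g2[OF i] U(2) by (meson has_derivative_bounded_linear has_grad_onD)
    obtain K where K: "0 < K" "\<And>v. norm (f' v) \<le> norm v * K" using bounded_linear.pos_bounded[OF f'(1)] by blast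
    obtain d where d: "d > 0" "\<And>y. norm (y - p) < d \<Longrightarrow> norm (partial i \<rho> y - partial i \<rho> p - f' (y - p)) \<le> 1 * norm (y - p)"
      using f'(2) unfolding has_derivative_at_alt by (meson zero_less_one)
    have "\<bar>partial i \<rho> x - partial i \<rho> p\<bar> \<le> (K + 1) * dist x p" if "dist x p < d" for x
      using d(2)[of x] K(2)[of "x - p"] that by (simp add: dist_norm algebra_simps)
    then show ?thesis using d(1) K(1) by (metis add_nonneg_nonneg less_imp_le zero_le_one)
  qed
  then obtain L s where Ls: "\<And>i. i \<in> Basis \<Longrightarrow> 0 < s i \<and> 0 \<le> L i \<and> (\<forall>x. dist x p < s i \<longrightarrow> \<bar>partial i \<rho> x - partial i \<rho> p\<bar> \<le> L i * dist x p)"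
    by metis
  define C where "C = (\<Sum>i\<in>(Basis::'a set). L i)"
  have C: "0 \<le> C" unfolding C_def using Ls by (simp add: sum_nonneg)
  obtain s0 where s0: "0 < s0" "ball p s0 \<subseteq> U" using U open_contains_ball by blast
  define t where "t = Min (insert s0 (s ` Basis))"
  have t: "0 < t" "t \<le> s0" "\<And>i. i \<in> Basis \<Longrightarrow> t \<le> s i"
    unfolding t_def using s0 Ls by (auto simp: Min_gr_iff intro!: min.coboundedI2 Min.coboundedI)
  define G where "G = (\<Sum>i\<in>Basis. partial i \<rho> p *\<^sub>R i)"
  have G: "v \<bullet> G = (\<Sum>i\<in>Basis. (v \<bullet> i) * partial i \<rho> p)" for v
    by (simp add: G_def inner_sum_right mult.commute)
  have "G \<noteq> 0"
  proof
    assume "G = 0"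
    then have "i \<bullet> G = 0" for i by simp
    then show False using \<rho>(2)[OF U(2)] sum_Basis_single[of _ "\<lambda>i. partial i \<rho> p"] G by metis
  qed
  have tay: "(x - p) \<bullet> G - C * (norm (x - p))^2 \<le> \<rho> x" if x: "dist x p < t" for x
  proof -
    define S where "S = cball p (dist x p)"
    have "S \<subseteq> ball p t" using x by (auto simp: S_def dist_commute)
    then have SU: "S \<subseteq> U" using s0 t by force
    have der: "((\<lambda>z. \<rho> z - z \<bullet> G) has_derivative (\<lambda>v. \<Sum>i\<in>Basis. (v \<bullet> i) * (partial i \<rho> z - partial i \<rho> p))) (at z within S)"
      if z: "z \<in> S" for z
    proof -
      have "((\<lambda>z. \<rho> z - z \<bullet> G) has_derivative (\<lambda>v. (\<Sum>i\<in>Basis. (v \<bullet> i) * partial i \<rho> z) - v \<bullet> G)) (at z within S)"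
        using SU z by (auto intro!: derivative_eq_intros has_derivative_at_withinI[OF has_grad_onD[OF g]])
      then show ?thesis by (simp add: G sum_subtractf algebra_simps)
    qed
    have on: "onorm (\<lambda>v. \<Sum>i\<in>Basis. (v \<bullet> i) * (partial i \<rho> z - partial i \<rho> p)) \<le> C * dist x p" if z: "z \<in> S" for z
    proof (rule onorm_bound)
      fix v :: 'a
      have "norm (\<Sum>i\<in>Basis. (v \<bullet> i) * (partial i \<rho> z - partial i \<rho> p)) \<le> (\<Sum>i\<in>Basis. norm v * (L i * dist x p))"
      proof (rule sum_norm_le)
        fix i :: 'a assume i: "i \<in> Basis"
        have zp: "dist z p \<le> dist x p" using z by (simp add: S_def dist_commute)
        have "\<bar>partial i \<rho> z - partial i \<rho> p\<bar> \<le> L i * dist z p" using Ls[OF i] t(3)[OF i] zp x by auto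
        also have "\<dots> \<le> L i * dist x p" using Ls[OF i] zp by (simp add: mult_left_mono)
        finally show "norm (v \<bullet> i * (partial i \<rho> z - partial i \<rho> p)) \<le> norm v * (L i * dist x p)"
          using Basis_le_norm[OF i, of v] by (simp add: abs_mult mult_mono)
      qed
      then show "norm (\<Sum>i\<in>Basis. (v \<bullet> i) * (partial i \<rho> z - partial i \<rho> p)) \<le> C * dist x p * norm v"
        by (simp add: C_def sum_distrib_left sum_distrib_right mult_ac)
    qed (use C in simp)
    have "norm ((\<rho> x - x \<bullet> G) - (\<rho> p - p \<bullet> G)) \<le> C * dist x p * norm (x - p)"
      by (rule differentiable_bound[where S=S and f'="\<lambda>z v. \<Sum>i\<in>Basis. (v \<bullet> i) * (partial i \<rho> z - partial i \<rho> p)"])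
        (use der on in \<open>auto simp: S_def dist_commute\<close>)
    then show ?thesis by (simp add: p0 inner_diff_left dist_norm power2_eq_square abs_le_iff algebra_simps)
  qed
  define \<nu> where "\<nu> = G /\<^sub>R norm G"
  have \<nu>: "norm \<nu> = 1" "v \<bullet> G = norm G * (v \<bullet> \<nu>)" for v using \<open>G \<noteq> 0\<close> by (auto simp: \<nu>_def)
  \<comment> \<open>The first bound keeps the ball, of diameter 2 R, inside the neighbourhood where
    the Taylor estimate holds; the second gives 2 R C < |G|, with a denominator that is positive
    even for C = 0.\<close>
  define R where "R = min (t / 4) (norm G / (4 * C + 2))"
  have pos: "0 < 4 * C + 2" "0 < norm G" using C \<open>G \<noteq> 0\<close> by auto
  then have R: "0 < R" "2 * R < t" using t(1) by (auto simp: R_def)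
  have "R * (4 * C + 2) \<le> norm G" using pos(1) by (simp add: R_def pos_le_divide_eq[symmetric])
  moreover have "0 \<le> R * C" using R(1) C by simp
  ultimately have RC: "2 * R * C < norm G" using R(1) by (simp add: algebra_simps)
  show thesis
  proof (rule that[of R "p + R *\<^sub>R \<nu>"])
    show "0 < R" by fact
    show "dist p (p + R *\<^sub>R \<nu>) = R" using R(1) \<nu>(1) by (simp add: dist_norm)
    fix x assume x: "x \<in> closure \<Omega>" "x \<noteq> p"
    show "R < dist x (p + R *\<^sub>R \<nu>)"
    proof (rule ccontr)
      assume "\<not> ?thesis"
      then have le: "norm ((x - p) - R *\<^sub>R \<nu>) \<le> R" by (simp add: dist_norm algebra_simps)
      then have "norm (x - p) \<le> 2 * R" using norm_triangle_ineq4[of "(x - p) - R *\<^sub>R \<nu>" "- (R *\<^sub>R \<nu>)"] R(1) \<nu>(1) by simp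
      then have xt: "dist x p < t" using R by (simp add: dist_norm)
      have "(norm ((x - p) - R *\<^sub>R \<nu>))^2 \<le> R^2" using le by (simp add: power_mono)
      moreover have "\<nu> \<bullet> \<nu> = 1" using \<nu>(1) by (simp add: norm_eq_1)
      ultimately have sq: "(norm (x - p))^2 \<le> 2 * R * ((x - p) \<bullet> \<nu>)"
        unfolding power2_norm_eq_inner by (simp add: inner_diff_left inner_diff_right inner_commute power2_eq_square algebra_simps)
      moreover have "0 < (norm (x - p))^2" using x(2) by simp
      ultimately have pos: "0 < (x - p) \<bullet> \<nu>" using R(1)
        by (smt (verit) mult_nonneg_nonpos)
      have "C * (norm (x - p))^2 \<le> C * (2 * R * ((x - p) \<bullet> \<nu>))" using sq C by (simp add: mult_left_mono)
      also have "\<dots> < norm G * ((x - p) \<bullet> \<nu>)" using mult_strict_right_mono[OF RC pos] by (simp add: mult_ac)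
      finally have "0 < \<rho> x" using tay[OF xt] \<nu>(2)[of "x - p"] by simp
      moreover have "x \<in> U" using xt t(2) s0 by (auto simp: dist_commute)
      ultimately have "x \<notin> \<Omega> \<inter> U" "x \<notin> frontier \<Omega> \<inter> U" "x \<in> U" unfolding \<Omega>U by auto
      then have "x \<notin> \<Omega>" "x \<notin> frontier \<Omega>" by auto
      then show False using x(1) closure_Un_frontier by blast
    qed
  qed
qed

text \<open>With y and R from the exterior ball and N the dimension, the barrier is R^(-2N) - |x -
  y|^(-2N). The function |x|^(-k) is subharmonic as soon as k >= N - 2, and k = 2N satisfies this in
  every dimension without a logarithmic case.\<close>

lemma barrier:
  fixes \<Omega> :: "'a::euclidean_space set"
  assumes "smooth_bounded_domain \<Omega>" "p \<in> frontier \<Omega>"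
  obtains b where "Ck_on 2 b \<Omega>" "continuous_on (closure \<Omega>) b" "\<And>x. x \<in> \<Omega> \<Longrightarrow> laplacian b x \<le> 0"
    "b p = 0" "\<And>x. x \<in> closure \<Omega> \<Longrightarrow> x \<noteq> p \<Longrightarrow> 0 < b x"
proof -
  obtain y R where R: "0 < R" "dist p y = R" "\<And>x. x \<in> closure \<Omega> \<Longrightarrow> x \<noteq> p \<Longrightarrow> R < dist x y"
    by (rule exterior_ball[OF assms]) blast
  have op: "open \<Omega>" using assms(1) by (simp add: smooth_bounded_domain_def)
  define m where "m = DIM('a)"
  define F where "F = (\<lambda>s::real. inverse ((R^2)^m) - inverse (s^m))"
  define b where "b = (\<lambda>x. F ((x - y) \<bullet> (x - y)))"
  have sq: "(x - y) \<bullet> (x - y) = (dist x y)^2" for x by (simp add: dist_norm power2_norm_eq_inner)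
  have pos: "0 < (x - y) \<bullet> (x - y)" if "x \<in> closure \<Omega>" for x
  proof -
    have "0 < dist x y" using R that by (cases "x = p") force+
    then show ?thesis by (simp add: sq)
  qed
  have F1: "(F has_real_derivative m * inverse (s^(m+1))) (at s)" if "s \<in> {0<..}" for s
    unfolding F_def using that
    by (auto intro!: derivative_eq_intros simp: field_simps m_def power_Suc[symmetric] simp del: power_Suc)
      (auto simp: field_simps power_add[symmetric] simp flip: power_Suc)
  have F2: "((\<lambda>s. m * inverse (s^(m+1))) has_real_derivative - m * (m + 1) * inverse (s^(m+2))) (at s)" if "s \<in> {0<..}" for s :: real
    using that
    by (auto intro!: derivative_eq_intros simp: field_simps simp del: power_Suc)
      (auto simp: field_simps power_add[symmetric] power2_eq_square)
  have c: "continuous_on {0<..} (\<lambda>s::real. - m * (m + 1) * inverse (s^(m+2)))"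
    by (auto intro!: continuous_intros)
  have T: "(x - y) \<bullet> (x - y) \<in> {0<..}" if "x \<in> \<Omega>" for x using pos closure_subset that by auto
  note K = Ck2_radial[where F=F and y=y, OF op F1 F2 c T]
  show thesis
  proof (rule that[of b])
    show "Ck_on 2 b \<Omega>" unfolding b_def by (rule K(1)) auto
    show "continuous_on (closure \<Omega>) b"
      unfolding b_def F_def using pos by (intro continuous_intros) force+
    show "b p = 0" by (simp add: b_def F_def sq R)
    show "0 < b x" if "x \<in> closure \<Omega>" "x \<noteq> p" for x
      using R(1) R(3)[OF that] by (simp add: b_def F_def sq less_imp_inverse_less power_strict_mono m_def)
    fix x assume x: "x \<in> \<Omega>"
    let ?s = "(x - y) \<bullet> (x - y)"
    have s: "0 < ?s" using T[OF x] by simp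
    have "laplacian b x = 2 * DIM('a) * (m * inverse (?s^(m+1))) + 4 * ?s * (- m * (m + 1) * inverse (?s^(m+2)))"
      unfolding b_def by (rule K(2)) (use x in auto)
    also have "4 * ?s * (- m * (m + 1) * inverse (?s^(m+2))) = - (4 * m * (m+1) * inverse (?s^(m+1)))"
      using s by (simp add: field_simps)
    also have "2 * DIM('a) * (m * inverse (?s^(m+1))) + - (4 * m * (m+1) * inverse (?s^(m+1))) = - (2 * m * (m + 2)) * inverse (?s^(m+1))"
      by (simp add: m_def algebra_simps)
    also have "\<dots> \<le> 0"
    proof (rule mult_nonpos_nonneg)
      show "0 \<le> inverse (?s^(m+1))" using s by simp
      have "- (2 * real m) \<le> real m * real m" by (rule order_trans[of _ 0]) auto
      then show "- (2 * m * (m + 2)) \<le> (0::real)" by (simp add: algebra_simps)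
    qed
    finally show "laplacian b x \<le> 0" .
  qed
qed

section \<open>Mollification and the dyadic Newton potential\<close>

definition kern :: "real \<Rightarrow> ('a::euclidean_space \<Rightarrow> real) \<Rightarrow> bool" where
  "kern \<rho> K \<longleftrightarrow> continuous_on UNIV K \<and> (\<forall>z. \<rho> \<le> norm z \<longrightarrow> K z = 0)"

text \<open>Convolution with the rescaled kernel r^(-N) K(x / r). The kernel is neither normalised
  nor assumed nonnegative, because first and second derivatives of kernels are used in the same
  role.\<close>

definition mollify :: "('a::euclidean_space \<Rightarrow> real) \<Rightarrow> real \<Rightarrow> ('a \<Rightarrow> real) \<Rightarrow> 'a \<Rightarrow> real" where
  "mollify K r h x = (LINT y|lebesgue. K (inverse r *\<^sub>R (x - y)) * h y) / r ^ DIM('a)"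

lemma kern_continuous: "kern \<rho> K \<Longrightarrow> continuous_on A K"
  by (auto simp: kern_def intro: continuous_on_subset)

lemma kern_zero: "kern \<rho> K \<Longrightarrow> \<rho> \<le> norm z \<Longrightarrow> K z = 0"
  by (simp add: kern_def)

lemma kern_mono: "kern \<rho> K \<Longrightarrow> \<rho> \<le> \<rho>' \<Longrightarrow> kern \<rho>' K"
  by (auto simp: kern_def)

lemma kern_bounded:
  assumes "kern \<rho> K" obtains M where "0 < M" "\<And>z. \<bar>K z\<bar> \<le> M"
proof -
  have "bounded (K ` cball 0 \<rho>)"
    by (intro compact_imp_bounded compact_continuous_image kern_continuous[OF assms] compact_cball)
  then obtain M where M: "0 < M" "\<And>z. norm z \<le> \<rho> \<Longrightarrow> \<bar>K z\<bar> \<le> M"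
    by (auto simp: bounded_pos)
  have "\<bar>K z\<bar> \<le> M" for z
    using M kern_zero[OF assms, of z] by (cases "norm z \<le> \<rho>") auto
  then show thesis using that M(1) by blast
qed

lemma kern_uniformly_continuous:
  fixes K :: "'a::euclidean_space \<Rightarrow> real"
  assumes "kern \<rho> K" shows "uniformly_continuous_on UNIV K"
  unfolding uniformly_continuous_on_def
proof (intro allI impI)
  fix e :: real assume e: "0 < e"
  have "uniformly_continuous_on (cball 0 (\<rho> + 1)) K"
    by (intro compact_uniformly_continuous kern_continuous[OF assms] compact_cball)
  then obtain d where d: "d > 0" "\<And>x y. x \<in> cball 0 (\<rho> + 1) \<Longrightarrow> y \<in> cball 0 (\<rho> + 1) \<Longrightarrow> dist y x < d \<Longrightarrow> dist (K y) (K x) < e"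
    by (rule uniformly_continuous_onE[OF _ e]) blast
  have "dist (K y) (K x) < e" if "dist y x < min d 1" for x y :: 'a
  proof (cases "norm x < \<rho> \<or> norm y < \<rho>")
    case True
    have "\<bar>norm y - norm x\<bar> < 1" using that norm_triangle_ineq3[of y x] by (simp add: dist_norm)
    then have "norm x \<le> \<rho> + 1" "norm y \<le> \<rho> + 1" using True by linarith+
    then show ?thesis using d(2)[of x y] that by simp
  next
    case False
    then show ?thesis using kern_zero[OF assms] e by simp
  qed
  then show "\<exists>d>0. \<forall>x\<in>UNIV. \<forall>x'\<in>UNIV. dist x' x < d \<longrightarrow> dist (K x') (K x) < e"
    using d(1) by (intro exI[of _ "min d 1"]) auto
qed

lemma kern_integrable:
  fixes K :: "'a::euclidean_space \<Rightarrow> real"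
  assumes "kern \<rho> K" shows "integrable lebesgue K"
proof -
  have "integrable lborel (\<lambda>x. indicator (cball 0 \<rho>) x *\<^sub>R K x)"
    by (intro borel_integrable_compact kern_continuous[OF assms] compact_cball)
  also have "(\<lambda>x. indicator (cball 0 \<rho>) x *\<^sub>R K x) = K"
    using kern_zero[OF assms] by (auto simp: fun_eq_iff indicator_def)
  finally show ?thesis
    by (subst integrable_completion) (auto intro: borel_measurable_integrable)
qed

lemma norm_inverse_scaleR:
  fixes v :: "'a::real_normed_vector"
  shows "0 < r \<Longrightarrow> norm (inverse r *\<^sub>R v) = norm v / r"
  by (simp add: divide_inverse mult.commute)

lemma kern_scaled:
  fixes K :: "'a::euclidean_space \<Rightarrow> real"
  assumes "kern \<rho> K" "0 < r"
  shows "kern (norm x + r * \<rho>) (\<lambda>y. K (inverse r *\<^sub>R (x - y)))"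
  unfolding kern_def
proof (intro conjI allI impI)
  show "continuous_on UNIV (\<lambda>y. K (inverse r *\<^sub>R (x - y)))"
    by (rule continuous_on_compose2[OF kern_continuous[OF assms(1), of UNIV]]) (auto intro!: continuous_intros)
  fix z :: 'a assume "norm x + r * \<rho> \<le> norm z"
  then have "r * \<rho> \<le> norm (x - z)" using norm_triangle_ineq2[of z x] by (simp add: norm_minus_commute)
  then have "\<rho> \<le> norm (inverse r *\<^sub>R (x - z))"
    using assms(2) unfolding norm_inverse_scaleR[OF assms(2)] by (simp add: pos_le_divide_eq mult.commute)
  then show "K (inverse r *\<^sub>R (x - z)) = 0" by (rule kern_zero[OF assms(1)])
qed

lemma lebesgue_measurable_continuous:
  fixes f :: "'a::euclidean_space \<Rightarrow> real"
  shows "continuous_on UNIV f \<Longrightarrow> f \<in> borel_measurable lebesgue"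
  by (simp add: borel_measurable_continuous_onI measurable_completion)

lemma kern_times_integrable:
  fixes K :: "'a::euclidean_space \<Rightarrow> real"
  assumes "kern \<rho> K" "integrable lebesgue h"
  shows "integrable lebesgue (\<lambda>y. K y * h y)"
proof -
  obtain M where M: "0 < M" "\<And>z. \<bar>K z\<bar> \<le> M" using kern_bounded[OF assms(1)] by metis
  show ?thesis
  proof (rule Bochner_Integration.integrable_bound[of _ "\<lambda>y. M * h y"])
    show "(\<lambda>y. K y * h y) \<in> borel_measurable lebesgue"
      by (rule borel_measurable_times[OF lebesgue_measurable_continuous[OF kern_continuous[OF assms(1)]]
            borel_measurable_integrable[OF assms(2)]])
    show "AE x in lebesgue. norm (K x * h x) \<le> norm (M * h x)"
      using M by (auto simp: abs_mult intro!: mult_right_mono)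
  qed (use assms in simp)
qed

lemma mollify_integrable:
  fixes K :: "'a::euclidean_space \<Rightarrow> real"
  assumes "kern \<rho> K" "0 < r" "integrable lebesgue h"
  shows "integrable lebesgue (\<lambda>y. K (inverse r *\<^sub>R (x - y)) * h y)"
  by (rule kern_times_integrable[OF kern_scaled[OF assms(1,2)] assms(3)])

abbreviation ball_vol :: "'a::euclidean_space itself \<Rightarrow> real" where
  "ball_vol _ \<equiv> measure lebesgue (ball (0::'a) 1)"

lemma measure_ball_scaled:
  fixes x :: "'a::euclidean_space"
  assumes "0 < r" shows "measure lebesgue (ball x r) = r ^ DIM('a) * ball_vol TYPE('a)"
  using content_ball_conv_unit_ball[of r x] assms by (simp add: measure_completion)

lemma ball_vol_pos: "0 < ball_vol TYPE('a::euclidean_space)"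
  using content_ball_pos[of 1 "0::'a"] by (simp add: measure_completion)

text \<open>The integral of a non-integrable function is 0 by convention, so the bound is true in
  that case too.\<close>

lemma integral_ball_bound:
  fixes f :: "'a::euclidean_space \<Rightarrow> real"
  assumes "0 < r" "\<And>y. y \<notin> ball x r \<Longrightarrow> f y = 0" "AE y in lebesgue. y \<in> ball x r \<longrightarrow> \<bar>f y\<bar> \<le> B" "0 \<le> B"
  shows "\<bar>LINT y|lebesgue. f y\<bar> \<le> B * (r ^ DIM('a) * ball_vol TYPE('a))"
proof (cases "integrable lebesgue f")
  case True
  have i: "integrable lebesgue (\<lambda>y. B * indicator (ball x r) y :: real)"
    by (intro integrable_mult_right integrable_real_indicator) (auto simp: emeasure_bounded_finite[unfolded infinity_ennreal_def])
  have "\<bar>LINT y|lebesgue. f y\<bar> \<le> (LINT y|lebesgue. \<bar>f y\<bar>)" by (rule integral_abs_bound)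
  also have "\<dots> \<le> (LINT y|lebesgue. B * indicator (ball x r) y)"
  proof (rule integral_mono_AE)
    show "AE y in lebesgue. \<bar>f y\<bar> \<le> B * indicator (ball x r) y"
      using assms(3) by eventually_elim (use assms(2) in \<open>auto simp: indicator_def\<close>)
  qed (use True i in auto)
  also have "\<dots> = B * measure lebesgue (ball x r)" by simp
  finally show ?thesis using measure_ball_scaled[OF assms(1), of x] by simp
next
  case False
  then show ?thesis using assms ball_vol_pos[where 'a='a] by (simp add: not_integrable_integral_eq)
qed

text \<open>The volume of the ball is proportional to r^N and cancels the normalisation, so the
  bound is the same at all scales.\<close>

lemma mollify_bound:
  fixes K :: "'a::euclidean_space \<Rightarrow> real"
  assumes "kern 1 K" "0 < r" "\<And>z. \<bar>K z\<bar> \<le> M" "AE y in lebesgue. y \<in> ball x r \<longrightarrow> \<bar>h y\<bar> \<le> B" "0 \<le> B"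
  shows "\<bar>mollify K r h x\<bar> \<le> M * ball_vol TYPE('a) * B"
proof -
  have M: "0 \<le> M" using assms(3)[of 0] by linarith
  have "\<bar>LINT y|lebesgue. K (inverse r *\<^sub>R (x - y)) * h y\<bar> \<le> (M * B) * (r ^ DIM('a) * ball_vol TYPE('a))"
  proof (rule integral_ball_bound[OF assms(2)])
    fix y assume "y \<notin> ball x r"
    then have "1 \<le> norm (inverse r *\<^sub>R (x - y))" using assms(2) unfolding norm_inverse_scaleR[OF assms(2)] by (simp add: dist_norm)
    then show "K (inverse r *\<^sub>R (x - y)) * h y = 0" using kern_zero[OF assms(1)] by simp
  next
    show "AE y in lebesgue. y \<in> ball x r \<longrightarrow> \<bar>K (inverse r *\<^sub>R (x - y)) * h y\<bar> \<le> M * B"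
      using assms(4) by eventually_elim (use assms(3,5) M in \<open>auto simp: abs_mult intro!: mult_mono\<close>)
  qed (use M assms(5) in simp)
  then show ?thesis using assms(2) by (simp add: mollify_def field_simps)
qed

text \<open>The mean value inequality applied to u minus its linear part at z, a function whose
  gradient has entries of size at most e.\<close>

lemma gradient_taylor_bound:
  fixes u :: "'a::euclidean_space \<Rightarrow> real" and e :: real
  assumes g: "has_grad_on u d S" and S: "convex S" "z \<in> S" "w \<in> S"
    and e: "\<And>i x. i \<in> Basis \<Longrightarrow> x \<in> S \<Longrightarrow> \<bar>d i x - d i z\<bar> \<le> e"
  shows "\<bar>u w - u z - (\<Sum>i\<in>Basis. ((w - z) \<bullet> i) * d i z)\<bar> \<le> DIM('a) * e * norm (w - z)"
proof -
  define L where "L = (\<lambda>v::'a. \<Sum>i\<in>Basis. (v \<bullet> i) * d i z)"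
  have Llin: "L w - L z = L (w - z)"
    by (simp add: L_def inner_diff_left left_diff_distrib sum_subtractf)
  have e0: "0 \<le> e" using e[OF SOME_Basis S(2)] by simp
  have "norm ((u w - L w) - (u z - L z)) \<le> DIM('a) * e * norm (w - z)"
  proof (rule differentiable_bound[OF S(1) _ _ S(3) S(2), where f'="\<lambda>x v. \<Sum>i\<in>Basis. (v \<bullet> i) * (d i x - d i z)"])
    fix x assume x: "x \<in> S"
    have "((\<lambda>x. u x - L x) has_derivative (\<lambda>v. (\<Sum>i\<in>Basis. (v \<bullet> i) * d i x) - L v)) (at x within S)"
      unfolding L_def using x
      by (auto intro!: derivative_eq_intros has_derivative_at_withinI[OF has_grad_onD[OF g]])
    then show "((\<lambda>x. u x - L x) has_derivative (\<lambda>v. \<Sum>i\<in>Basis. (v \<bullet> i) * (d i x - d i z))) (at x within S)"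
      by (simp add: L_def sum_subtractf algebra_simps)
    show "onorm (\<lambda>v. \<Sum>i\<in>Basis. (v \<bullet> i) * (d i x - d i z)) \<le> DIM('a) * e"
    proof (rule onorm_bound)
      fix v :: 'a
      have "norm (\<Sum>i\<in>Basis. (v \<bullet> i) * (d i x - d i z)) \<le> (\<Sum>i\<in>(Basis::'a set). norm v * e)"
        by (rule sum_norm_le) (use e[OF _ x] Basis_le_norm[of _ v] in \<open>auto simp: abs_mult intro!: mult_mono\<close>)
      then show "norm (\<Sum>i\<in>Basis. (v \<bullet> i) * (d i x - d i z)) \<le> DIM('a) * e * norm v"
        by (simp add: mult_ac)
    qed (use e0 in simp)
  qed
  then show ?thesis using Llin by (simp add: L_def algebra_simps)
qed

text \<open>Compact support makes the gradient uniformly continuous, hence the first-order expansion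
  uniform in the base point. This is what allows differentiation under the integral against a merely
  integrable function.\<close>

lemma kern_uniform_derivative:
  fixes K :: "'a::euclidean_space \<Rightarrow> real"
  assumes g: "has_grad_on K d UNIV" and d: "\<And>i. i \<in> Basis \<Longrightarrow> kern \<rho> (d i)" and e: "0 < e"
  obtains \<delta> where "0 < \<delta>" "\<And>z v. norm v < \<delta> \<Longrightarrow> \<bar>K (z + v) - K z - (\<Sum>i\<in>Basis. (v \<bullet> i) * d i z)\<bar> \<le> e * norm v"
proof -
  define e' where "e' = e / DIM('a)"
  have e': "0 < e'" using e by (simp add: e'_def)
  have "\<exists>t>0. \<forall>x y. dist y x < t \<longrightarrow> dist (d i y) (d i x) < e'" if "i \<in> Basis" for i
    using kern_uniformly_continuous[OF d[OF that]] e' unfolding uniformly_continuous_on_def by (meson UNIV_I)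
  then obtain t where t: "\<And>i. i \<in> Basis \<Longrightarrow> 0 < t i"
    "\<And>i x y. i \<in> Basis \<Longrightarrow> dist y x < t i \<Longrightarrow> dist (d i y) (d i x) < e'" by metis
  define \<delta> where "\<delta> = Min (t ` Basis)"
  have \<delta>: "0 < \<delta>" "\<And>i. i \<in> Basis \<Longrightarrow> \<delta> \<le> t i" unfolding \<delta>_def using t(1) by auto
  show thesis
  proof (rule that[OF \<delta>(1)])
    fix z v :: 'a assume v: "norm v < \<delta>"
    have "\<bar>K (z + v) - K z - (\<Sum>i\<in>Basis. ((z + v - z) \<bullet> i) * d i z)\<bar> \<le> DIM('a) * e' * norm (z + v - z)"
    proof (rule gradient_taylor_bound[where S="ball z \<delta>" and e=e'])
      show "has_grad_on K d (ball z \<delta>)" using g has_grad_on_subset by blast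
      fix i x :: 'a assume "i \<in> Basis" "x \<in> ball z \<delta>"
      then show "\<bar>d i x - d i z\<bar> \<le> e'" using t(2)[of i x z] \<delta>(2)[of i] by (auto simp: dist_real_def dist_commute)
    qed (use \<delta> v in \<open>auto simp: dist_norm\<close>)
    then show "\<bar>K (z + v) - K z - (\<Sum>i\<in>Basis. (v \<bullet> i) * d i z)\<bar> \<le> e * norm v" by (simp add: e'_def)
  qed
qed

lemma mollify_has_grad:
  fixes K :: "'a::euclidean_space \<Rightarrow> real"
  assumes K: "kern \<rho> K" and g: "has_grad_on K d UNIV" and d: "\<And>i. i \<in> Basis \<Longrightarrow> kern \<rho> (d i)"
    and r: "0 < r" and h: "integrable lebesgue h"
  shows "has_grad_on (mollify K r h) (\<lambda>i x. mollify (d i) r h x / r) UNIV"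
  unfolding has_grad_on_def
proof
  fix x :: 'a
  let ?N = "r ^ DIM('a)"
  define A where "A = (LINT y|lebesgue. \<bar>h y\<bar>)"
  have A: "0 \<le> A" by (simp add: A_def)
  have bl: "bounded_linear (\<lambda>v. \<Sum>i\<in>Basis. (v \<bullet> i) * (mollify (d i) r h x / r))"
    by (intro bounded_linear_sum bounded_linear_mult_const bounded_linear_inner_left)
  have "\<exists>t>0. \<forall>y. norm (y - x) < t \<longrightarrow> norm (mollify K r h y - mollify K r h x - (\<Sum>i\<in>Basis. ((y - x) \<bullet> i) * (mollify (d i) r h x / r))) \<le> e * norm (y - x)"
    if e: "0 < e" for e
  proof -
    \<comment> \<open>Integrating the expansion against |h| multiplies the error by at most A, and
      the rescaled increment has length |w - x| / r; this choice leaves exactly e |w - x|. The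
      summand 1 guards against A = 0.\<close>
    define e' where "e' = e * r * ?N / (A + 1)"
    have e': "0 < e'" using e r A by (simp add: e'_def)
    obtain \<delta> where \<delta>: "0 < \<delta>" "\<And>z v. norm v < \<delta> \<Longrightarrow> \<bar>K (z + v) - K z - (\<Sum>i\<in>Basis. (v \<bullet> i) * d i z)\<bar> \<le> e' * norm v"
      using kern_uniform_derivative[OF g d e'] by blast
    have "norm (mollify K r h w - mollify K r h x - (\<Sum>i\<in>Basis. ((w - x) \<bullet> i) * (mollify (d i) r h x / r))) \<le> e * norm (w - x)"
      if w: "norm (w - x) < r * \<delta>" for w
    proof -
      define v where "v = inverse r *\<^sub>R (w - x)"
      have v2: "norm v = norm (w - x) / r" unfolding v_def by (rule norm_inverse_scaleR[OF r])
      then have v: "norm v < \<delta>" "norm v = norm (w - x) / r" using w r by (auto simp: pos_divide_less_eq mult.commute)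
      define G where "G = (\<lambda>y. (K (inverse r *\<^sub>R (w - y)) - K (inverse r *\<^sub>R (x - y)) - (\<Sum>i\<in>Basis. (v \<bullet> i) * d i (inverse r *\<^sub>R (x - y)))) * h y)"
      have G: "G = (\<lambda>y. K (inverse r *\<^sub>R (w - y)) * h y - K (inverse r *\<^sub>R (x - y)) * h y - (\<Sum>i\<in>Basis. (v \<bullet> i) * (d i (inverse r *\<^sub>R (x - y)) * h y)))"
        by (auto simp: G_def fun_eq_iff algebra_simps sum_distrib_left sum_distrib_right)
      have iG: "integrable lebesgue G"
        unfolding G using mollify_integrable[OF K r h] mollify_integrable[OF d r h]
        by (intro Bochner_Integration.integrable_diff Bochner_Integration.integrable_sum integrable_mult_right) auto
      have "(LINT y|lebesgue. G y) = ?N * (mollify K r h w - mollify K r h x - (\<Sum>i\<in>Basis. ((w - x) \<bullet> i) * (mollify (d i) r h x / r)))"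
      proof -
        have "(LINT y|lebesgue. G y) = (LINT y|lebesgue. K (inverse r *\<^sub>R (w - y)) * h y) - (LINT y|lebesgue. K (inverse r *\<^sub>R (x - y)) * h y)
            - (\<Sum>i\<in>Basis. (v \<bullet> i) * (LINT y|lebesgue. d i (inverse r *\<^sub>R (x - y)) * h y))"
          unfolding G using mollify_integrable[OF K r h] mollify_integrable[OF d r h]
          by (simp del: scaleR_diff_right)
        also have "\<dots> = ?N * mollify K r h w - ?N * mollify K r h x - (\<Sum>i\<in>Basis. ?N * (((w - x) \<bullet> i) * (mollify (d i) r h x / r)))"
        proof -
          have c: "(LINT y|lebesgue. Q (inverse r *\<^sub>R (z - y)) * h y) = ?N * mollify Q r h z" for Q z
            using r by (simp add: mollify_def)
          show ?thesis unfolding c v_def by (simp add: divide_inverse mult_ac)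
        qed
        finally show ?thesis by (simp add: sum_distrib_left right_diff_distrib)
      qed
      moreover have "\<bar>LINT y|lebesgue. G y\<bar> \<le> (LINT y|lebesgue. e' * norm v * \<bar>h y\<bar>)"
      proof (rule order_trans[OF integral_abs_bound integral_mono])
        fix y
        have "inverse r *\<^sub>R (w - y) = inverse r *\<^sub>R (x - y) + v" by (simp add: v_def algebra_simps)
        then show "\<bar>G y\<bar> \<le> e' * norm v * \<bar>h y\<bar>"
          unfolding G_def abs_mult using \<delta>(2)[OF v(1)] by (intro mult_right_mono) auto
      qed (use iG h in auto)
      ultimately have "?N * \<bar>mollify K r h w - mollify K r h x - (\<Sum>i\<in>Basis. ((w - x) \<bullet> i) * (mollify (d i) r h x / r))\<bar> \<le> e' * norm v * A"
        using r by (simp add: A_def abs_mult)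
      also have "\<dots> \<le> e' * norm v * (A + 1)" using e' by (intro mult_left_mono) auto
      also have "\<dots> = ?N * (e * norm (w - x))" using v(2) r A by (simp add: e'_def)
      finally show ?thesis using r by simp
    qed
    then show ?thesis using r \<delta>(1) by (intro exI[of _ "r * \<delta>"]) auto
  qed
  then show "(mollify K r h has_derivative (\<lambda>v. \<Sum>i\<in>Basis. (v \<bullet> i) * (mollify (d i) r h x / r))) (at x)"
    unfolding has_derivative_at_alt using bl by blast
qed

lemma mollify_continuous:
  fixes K :: "'a::euclidean_space \<Rightarrow> real"
  assumes K: "kern \<rho> K" and r: "0 < r" and h: "integrable lebesgue h"
  shows "continuous_on S (mollify K r h)"
proof -
  let ?N = "r ^ DIM('a)"
  define A where "A = (LINT y|lebesgue. \<bar>h y\<bar>)"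
  have A: "0 \<le> A" by (simp add: A_def)
  have "continuous_on UNIV (mollify K r h)"
    unfolding continuous_on_iff
  proof (intro ballI allI impI)
    fix x :: 'a and e :: real assume e: "0 < e"
    define e' where "e' = e * ?N / (A + 1) / 2"
    have e': "0 < e'" using e r A by (simp add: e'_def)
    obtain \<delta> where \<delta>: "0 < \<delta>" "\<And>z w. dist w z < \<delta> \<Longrightarrow> dist (K w) (K z) < e'"
      using kern_uniformly_continuous[OF K] e' unfolding uniformly_continuous_on_def by (meson UNIV_I)
    have "dist (mollify K r h w) (mollify K r h x) < e" if w: "dist w x < r * \<delta>" for w
    proof -
      have "?N * (mollify K r h w - mollify K r h x) = (LINT y|lebesgue. K (inverse r *\<^sub>R (w - y)) * h y - K (inverse r *\<^sub>R (x - y)) * h y)"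
        using mollify_integrable[OF K r h] r by (simp add: mollify_def algebra_simps)
      also have "\<bar>\<dots>\<bar> \<le> (LINT y|lebesgue. e' * \<bar>h y\<bar>)"
      proof (rule order_trans[OF integral_abs_bound integral_mono])
        fix y
        have "dist (inverse r *\<^sub>R (w - y)) (inverse r *\<^sub>R (x - y)) = dist w x / r"
          using r by (simp add: dist_norm scaleR_diff_right[symmetric] divide_inverse)
        also have "\<dots> < \<delta>" using w r by (simp add: field_simps)
        finally have "\<bar>K (inverse r *\<^sub>R (w - y)) - K (inverse r *\<^sub>R (x - y))\<bar> \<le> e'" using \<delta>(2) by (force simp: dist_real_def)
        then show "\<bar>K (inverse r *\<^sub>R (w - y)) * h y - K (inverse r *\<^sub>R (x - y)) * h y\<bar> \<le> e' * \<bar>h y\<bar>"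
          unfolding left_diff_distrib[symmetric] abs_mult by (intro mult_right_mono) auto
      qed (use mollify_integrable[OF K r h] h in auto)
      also have "\<dots> = e' * A" by (simp add: A_def)
      finally have "?N * \<bar>mollify K r h w - mollify K r h x\<bar> \<le> e' * A" using r by (simp add: abs_mult)
      also have "\<dots> \<le> e' * (A + 1)" using e' by simp
      also have "\<dots> = ?N * (e / 2)"
      proof -
        have "A + 1 \<noteq> 0" using A by simp
        then show ?thesis by (simp add: e'_def field_simps)
      qed
      finally show ?thesis using r e by (simp add: dist_real_def)
    qed
    then show "\<exists>d>0. \<forall>x'\<in>UNIV. dist x' x < d \<longrightarrow> dist (mollify K r h x') (mollify K r h x) < e"
      using r \<delta>(1) by (intro exI[of _ "r * \<delta>"]) auto
  qed
  then show ?thesis by (rule continuous_on_subset) simp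
qed

definition kern2 :: "('a::euclidean_space \<Rightarrow> real) \<Rightarrow> ('a \<Rightarrow> 'a \<Rightarrow> real) \<Rightarrow> ('a \<Rightarrow> 'a \<Rightarrow> 'a \<Rightarrow> real) \<Rightarrow> bool" where
  "kern2 K d D \<longleftrightarrow> has_hess_on K d D UNIV \<and> kern 1 K \<and> (\<forall>i\<in>Basis. kern 1 (d i)) \<and>
     (\<forall>i\<in>Basis. \<forall>j\<in>Basis. kern 1 (D i j))"

lemma mollify_has_hess:
  fixes K :: "'a::euclidean_space \<Rightarrow> real"
  assumes K: "kern2 K d D" and r: "0 < r" and h: "integrable lebesgue h"
  shows "has_hess_on (mollify K r h) (\<lambda>i x. mollify (d i) r h x / r) (\<lambda>i j x. mollify (D i j) r h x / r\<^sup>2) UNIV"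
  unfolding has_hess_on_def
proof (intro conjI ballI)
  have k: "has_hess_on K d D UNIV" "kern 1 K" "\<And>i. i \<in> Basis \<Longrightarrow> kern 1 (d i)"
    "\<And>i j. i \<in> Basis \<Longrightarrow> j \<in> Basis \<Longrightarrow> kern 1 (D i j)" using K by (auto simp: kern2_def)
  show "has_grad_on (mollify K r h) (\<lambda>i x. mollify (d i) r h x / r) UNIV"
    by (rule mollify_has_grad[OF k(2) _ k(3) r h]) (use k(1) in \<open>auto simp: has_hess_on_def\<close>)
  show "continuous_on UNIV (\<lambda>x. mollify (D i j) r h x / r\<^sup>2)" if "i \<in> Basis" "j \<in> Basis" for i j
    using r by (intro continuous_intros mollify_continuous[OF k(4)[OF that] r h]) auto
  fix i :: 'a assume i: "i \<in> Basis"
  have "has_grad_on (mollify (d i) r h) (\<lambda>j x. mollify (D i j) r h x / r) UNIV"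
    by (rule mollify_has_grad[OF k(3)[OF i] _ k(4)[OF i] r h]) (use k(1) i in \<open>auto simp: has_hess_on_def\<close>)
  from has_grad_on_lincomb[OF this this, of "inverse r" 0]
  show "has_grad_on (\<lambda>x. mollify (d i) r h x / r) (\<lambda>j x. mollify (D i j) r h x / r\<^sup>2) UNIV"
    by (simp add: divide_inverse power2_eq_square mult_ac)
qed

lemma integral_affine:
  fixes F :: "'a::euclidean_space \<Rightarrow> real"
  assumes "continuous_on UNIV F" "c \<noteq> 0"
  shows "(LINT y|lebesgue. F y) = \<bar>c\<bar> ^ DIM('a) * (LINT y|lebesgue. F (t + c *\<^sub>R y))"
proof -
  have m: "F \<in> borel_measurable borel" "(\<lambda>y. F (t + c *\<^sub>R y)) \<in> borel_measurable borel"
    using assms(1) by (auto intro!: borel_measurable_continuous_onI continuous_intros intro: continuous_on_compose2)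
  have "(LINT y|lborel. F y) = (LINT y|density (distr lborel borel (\<lambda>x. t + c *\<^sub>R x)) (\<lambda>_. ennreal (\<bar>c\<bar>^DIM('a))). F y)"
    by (subst lborel_affine[OF assms(2), of t]) simp
  also have "\<dots> = \<bar>c\<bar> ^ DIM('a) * (LINT y|lborel. F (t + c *\<^sub>R y))"
    using m by (simp add: integral_density integral_distr)
  finally show ?thesis using m by (simp add: integral_completion)
qed

lemma mollify_const:
  fixes K :: "'a::euclidean_space \<Rightarrow> real"
  assumes "kern \<rho> K" "0 < r"
  shows "mollify K r (\<lambda>_. a) x = a * (LINT y|lebesgue. K y)"
proof -
  have "(LINT y|lebesgue. K y) = \<bar>- inverse r\<bar> ^ DIM('a) * (LINT y|lebesgue. K (inverse r *\<^sub>R x + (- inverse r) *\<^sub>R y))"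
    using assms(2) by (intro integral_affine kern_continuous[OF assms(1)]) simp
  moreover have "inverse r *\<^sub>R x + (- inverse r) *\<^sub>R y = inverse r *\<^sub>R (x - y)" for y
    by (simp add: scaleR_diff_right)
  ultimately show ?thesis using assms(2) by (simp add: mollify_def divide_inverse power_inverse mult_ac)
qed

lemma mollify_diff:
  assumes "kern \<rho> K" "0 < r" "integrable lebesgue h" "integrable lebesgue h'"
  shows "mollify K r (\<lambda>y. h y - h' y) x = mollify K r h x - mollify K r h' x"
  using mollify_integrable[OF assms(1,2,3)] mollify_integrable[OF assms(1,2,4)]
  by (simp add: mollify_def right_diff_distrib diff_divide_distrib)

text \<open>Subtracting the constant a reduces the claim to \<open>mollify_bound\<close>. For a
  kernel of integral 0, such as a second derivative, it bounds the mollification by the oscillation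
  of h alone.\<close>

lemma mollify_approx:
  fixes K :: "'a::euclidean_space \<Rightarrow> real"
  assumes K: "kern 1 K" "\<And>z. \<bar>K z\<bar> \<le> M" and r: "0 < r" and h: "integrable lebesgue h"
    and e: "AE y in lebesgue. y \<in> ball x r \<longrightarrow> \<bar>h y - a\<bar> \<le> e" "0 \<le> e"
  shows "\<bar>mollify K r h x - a * (LINT y|lebesgue. K y)\<bar> \<le> M * ball_vol TYPE('a) * e"
proof -
  have i: "integrable lebesgue (\<lambda>y. K (inverse r *\<^sub>R (x - y)) * a)"
    using kern_integrable[OF kern_scaled[OF K(1) r, of x]] by simp
  have "mollify K r (\<lambda>y. h y - a) x = mollify K r h x - mollify K r (\<lambda>_. a) x"
    using mollify_integrable[OF K(1) r h, of x] i by (simp add: mollify_def right_diff_distrib diff_divide_distrib)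
  then show ?thesis using mollify_bound[OF K(1) r K(2) e] mollify_const[OF K(1) r, of a x] by simp
qed

section \<open>Integration by parts against compactly supported kernels\<close>

text \<open>Translation invariance replaces integration by parts: the integral of a difference
  quotient of F vanishes, and the quotients converge uniformly to the derivative inside one fixed
  ball.\<close>

lemma integral_grad_zero:
  fixes F :: "'a::euclidean_space \<Rightarrow> real"
  assumes F: "kern \<rho> F" "has_grad_on F d UNIV" and d: "\<And>i. i \<in> Basis \<Longrightarrow> kern \<rho> (d i)" and i: "i \<in> Basis"
  shows "(LINT y|lebesgue. d i y) = 0"
proof -
  \<comment> \<open>The margin 1 leaves room for translations by t < 1, so that all difference
    quotients vanish outside the same ball.\<close>
  define R where "R = \<bar>\<rho>\<bar> + 1"
  define C where "C = R ^ DIM('a) * ball_vol TYPE('a)"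
  have R: "0 < R" by (simp add: R_def)
  have C: "0 < C" using R ball_vol_pos[where 'a='a] by (simp add: C_def)
  have "\<bar>LINT y|lebesgue. d i y\<bar> \<le> e" if e: "0 < e" for e
  proof -
    have eC: "0 < e / C" using e C by simp
    obtain \<delta> where \<delta>: "0 < \<delta>" "\<And>z v. norm v < \<delta> \<Longrightarrow> \<bar>F (z + v) - F z - (\<Sum>i\<in>Basis. (v \<bullet> i) * d i z)\<bar> \<le> e / C * norm v"
      using kern_uniform_derivative[OF F(2) d eC] by blast
    define t where "t = min (\<delta> / 2) (1 / 2)"
    have t: "0 < t" "t < \<delta>" "t < 1" using \<delta>(1) by (auto simp: t_def)
    have Ft: "integrable lebesgue (\<lambda>y. F (y + t *\<^sub>R i))"
      using kern_integrable[OF kern_scaled[OF kern_mono[OF F(1)], of "\<bar>\<rho>\<bar>" 1 0]] kern_integrable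
    proof -
      have "kern (\<bar>\<rho>\<bar> + 1) (\<lambda>y. F (y + t *\<^sub>R i))"
        unfolding kern_def
      proof (intro conjI allI impI)
        show "continuous_on UNIV (\<lambda>y. F (y + t *\<^sub>R i))"
          by (rule continuous_on_compose2[OF kern_continuous[OF F(1), of UNIV]]) (auto intro!: continuous_intros)
        fix z :: 'a assume z: "\<bar>\<rho>\<bar> + 1 \<le> norm z"
        have "norm z - norm (t *\<^sub>R i) \<le> norm (z + t *\<^sub>R i)" using norm_triangle_ineq4[of "z + t *\<^sub>R i" "t *\<^sub>R i"] by simp
        then show "F (z + t *\<^sub>R i) = 0" using z t i by (intro kern_zero[OF F(1)]) auto
      qed
      then show ?thesis by (rule kern_integrable)
    qed
    define G where "G = (\<lambda>y. F (y + t *\<^sub>R i) - F y - t * d i y)"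
    have "(LINT y|lebesgue. F (y + t *\<^sub>R i)) = (LINT y|lebesgue. F y)"
      using integral_affine[OF kern_continuous[OF F(1)], of 1 "t *\<^sub>R i"] by (simp add: add.commute)
    then have "(LINT y|lebesgue. G y) = - t * (LINT y|lebesgue. d i y)"
      unfolding G_def using Ft kern_integrable[OF F(1)] kern_integrable[OF d[OF i]] by simp
    moreover have "\<bar>LINT y|lebesgue. G y\<bar> \<le> (e / C * t) * C"
      unfolding C_def
    proof (rule integral_ball_bound[OF R, where x=0])
      fix y :: 'a assume y: "y \<notin> ball 0 R"
      have "norm y - norm (t *\<^sub>R i) \<le> norm (y + t *\<^sub>R i)" using norm_triangle_ineq4[of "y + t *\<^sub>R i" "t *\<^sub>R i"] by simp
      then have "\<rho> \<le> norm (y + t *\<^sub>R i)" "\<rho> \<le> norm y" using y t i by (auto simp: R_def)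
      then show "G y = 0" using kern_zero[OF F(1)] kern_zero[OF d[OF i]] by (simp add: G_def)
    next
      have "\<bar>G y\<bar> \<le> e / C * t" for y
        using \<delta>(2)[of "t *\<^sub>R i" y] t i sum_Basis_single[OF i, of "\<lambda>j. d j y"]
        by (simp add: G_def mult.assoc sum_distrib_left[symmetric])
      then show "AE y in lebesgue. y \<in> ball 0 R \<longrightarrow> \<bar>G y\<bar> \<le> e / (R ^ DIM('a) * ball_vol TYPE('a)) * t"
        by (simp add: C_def)
    qed (use e C t in \<open>simp add: C_def\<close>)
    ultimately have "t * \<bar>LINT y|lebesgue. d i y\<bar> \<le> t * e" using t(1) C by (simp add: abs_mult mult.commute)
    then show ?thesis using t(1) by simp
  qed
  then have "\<bar>LINT y|lebesgue. d i y\<bar> \<le> 0" by (rule field_le_epsilon) simp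
  then show ?thesis by simp
qed

lemma has_grad_on_mult:
  assumes "has_grad_on u d S" "has_grad_on v e S"
  shows "has_grad_on (\<lambda>x. u x * v x) (\<lambda>i x. u x * e i x + d i x * v x) S"
  unfolding has_grad_on_def
proof
  fix x assume x: "x \<in> S"
  show "((\<lambda>x. u x * v x) has_derivative (\<lambda>w. \<Sum>i\<in>Basis. (w \<bullet> i) * (u x * e i x + d i x * v x))) (at x)"
    by (rule has_derivative_eq_rhs[OF has_derivative_mult[OF has_grad_onD[OF assms(1) x] has_grad_onD[OF assms(2) x]]])
      (simp add: fun_eq_iff algebra_simps sum.distrib sum_distrib_left)
qed

lemma has_grad_on_const: "has_grad_on (\<lambda>x. c) (\<lambda>i x. 0) S"
  by (simp add: has_grad_on_def)

lemma has_grad_on_Un: "has_grad_on u d S \<Longrightarrow> has_grad_on u d T \<Longrightarrow> has_grad_on u d (S \<union> T)"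
  by (auto simp: has_grad_on_def)

text \<open>In the gradient of \<phi> \<open>p i\<close> - v \<open>d i\<close> the mixed terms of
  the i-th component cancel and \<phi> \<open>P i i\<close> - v \<open>D i i\<close> remains, so its
  integral vanishes. Since \<phi> is zero off C, values of v outside S do not matter, and regularity
  on the whole space is patched together from the open sets S and - C.\<close>

lemma green_identity:
  fixes v :: "'a::euclidean_space \<Rightarrow> real"
  assumes S: "open S" and v: "Ck_on 2 v S" and \<phi>: "has_hess_on \<phi> d D UNIV" and C: "compact C" "C \<subseteq> S"
    and zero: "\<And>y. y \<notin> C \<Longrightarrow> \<phi> y = 0" "\<And>y i. y \<notin> C \<Longrightarrow> i \<in> Basis \<Longrightarrow> d i y = 0"
      "\<And>y i j. y \<notin> C \<Longrightarrow> i \<in> Basis \<Longrightarrow> j \<in> Basis \<Longrightarrow> D i j y = 0"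
  shows "(LINT y|lebesgue. \<phi> y * laplacian v y) = (LINT y|lebesgue. (\<Sum>i\<in>Basis. D i i y) * v y)"
proof -
  define p where "p = (\<lambda>i. partial i v)"
  define P where "P = (\<lambda>i j. partial j (partial i v))"
  have vh: "has_grad_on v p S" "\<And>i. i \<in> Basis \<Longrightarrow> has_grad_on (p i) (P i) S"
    "\<And>i j. i \<in> Basis \<Longrightarrow> j \<in> Basis \<Longrightarrow> continuous_on S (P i j)"
    using Ck_has_hess_on[OF v] by (auto simp: has_hess_on_def p_def P_def)
  have \<phi>h: "has_grad_on \<phi> d S" "\<And>i. i \<in> Basis \<Longrightarrow> has_grad_on (d i) (D i) S"
    "\<And>i j. i \<in> Basis \<Longrightarrow> j \<in> Basis \<Longrightarrow> continuous_on S (D i j)"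
    using \<phi> has_grad_on_subset[OF _ subset_UNIV] continuous_on_subset[OF _ subset_UNIV]
    unfolding has_hess_on_def by blast+
  note co = has_grad_on_continuous[OF vh(1)] has_grad_on_continuous[OF vh(2)] vh(3)
    has_grad_on_continuous[OF \<phi>h(1)] has_grad_on_continuous[OF \<phi>h(2)] \<phi>h(3)
  obtain \<rho> where \<rho>: "\<And>y. y \<in> C \<Longrightarrow> norm y < \<rho>"
    using compact_imp_bounded[OF C(1)] by (metis bounded_pos_less)
  have un: "S \<union> - C = UNIV" using C(2) by auto
  have opC: "open (- C)" using C(1) by (simp add: compact_imp_closed open_Compl)
  have ker: "kern \<rho> f" if "continuous_on S f" "\<And>y. y \<notin> C \<Longrightarrow> f y = 0" for f :: "'a \<Rightarrow> real"
    unfolding kern_def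
  proof
    have "continuous_on (- C) f"
      by (rule continuous_on_eq[OF continuous_on_const[of _ 0]]) (use that(2) in auto)
    then have "continuous_on (S \<union> - C) f" using that(1) S opC by (intro continuous_on_open_Un)
    then show "continuous_on UNIV f" by (simp add: un)
    show "\<forall>z. \<rho> \<le> norm z \<longrightarrow> f z = 0" using \<rho> that(2) by (meson not_less)
  qed
  have E0: "(LINT y|lebesgue. \<phi> y * P i i y - v y * D i i y) = 0" if i: "i \<in> Basis" for i
  proof -
    define F where "F = (\<lambda>y. \<phi> y * p i y + (-1) * (v y * d i y))"
    define E where "E = (\<lambda>j y. (\<phi> y * P i j y + d j y * p i y) + (-1) * (v y * D i j y + p j y * d i y))"
    have gS: "has_grad_on F E S"
      unfolding F_def E_def
      using has_grad_on_lincomb[OF has_grad_on_mult[OF \<phi>h(1) vh(2)[OF i]] has_grad_on_mult[OF vh(1) \<phi>h(2)[OF i]], of 1 "-1"] by simp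
    have gC: "has_grad_on F E (- C)"
      by (rule has_grad_on_cong[OF opC has_grad_on_const[of 0]]) (auto simp: F_def E_def zero i)
    have "has_grad_on F E UNIV" using has_grad_on_Un[OF gS gC] un by simp
    moreover have "kern \<rho> F" by (rule ker[OF has_grad_on_continuous[OF gS]]) (auto simp: F_def zero i)
    moreover have "kern \<rho> (E j)" if "j \<in> Basis" for j
    proof (rule ker)
      show "continuous_on S (E j)" unfolding E_def by (intro continuous_intros co i that)
    qed (auto simp: E_def zero i that)
    ultimately have "(LINT y|lebesgue. E i y) = 0" using integral_grad_zero i by blast
    moreover have "E i = (\<lambda>y. \<phi> y * P i i y - v y * D i i y)" by (auto simp: E_def)
    ultimately show ?thesis by simp
  qed
  have k1: "kern \<rho> (\<lambda>y. \<phi> y * P i i y)" if "i \<in> Basis" for i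
    using that by (intro ker continuous_intros co) (auto simp: zero)
  have k2: "kern \<rho> (\<lambda>y. v y * D i i y)" if "i \<in> Basis" for i
    using that by (intro ker continuous_intros co) (auto simp: zero)
  have eq: "(LINT y|lebesgue. \<phi> y * P i i y) = (LINT y|lebesgue. v y * D i i y)" if "i \<in> Basis" for i
    using E0[OF that] kern_integrable[OF k1[OF that]] kern_integrable[OF k2[OF that]] by simp
  have "(LINT y|lebesgue. \<phi> y * laplacian v y) = (LINT y|lebesgue. (\<Sum>i\<in>Basis. \<phi> y * P i i y))"
    by (simp add: laplacian_def P_def sum_distrib_left)
  also have "\<dots> = (\<Sum>i\<in>Basis. LINT y|lebesgue. \<phi> y * P i i y)"
    by (intro Bochner_Integration.integral_sum kern_integrable[OF k1])
  also have "\<dots> = (\<Sum>i\<in>Basis. LINT y|lebesgue. v y * D i i y)" using eq by simp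
  also have "\<dots> = (LINT y|lebesgue. (\<Sum>i\<in>Basis. v y * D i i y))"
    by (intro Bochner_Integration.integral_sum[symmetric] kern_integrable[OF k2])
  finally show ?thesis by (simp add: sum_distrib_left sum_distrib_right mult.commute)
qed

lemma has_hess_on_scaled:
  assumes K: "has_hess_on K d D UNIV"
  shows "has_hess_on (\<lambda>y. K (inverse r *\<^sub>R (x - y))) (\<lambda>i y. - d i (inverse r *\<^sub>R (x - y)) / r)
    (\<lambda>i j y. D i j (inverse r *\<^sub>R (x - y)) / r\<^sup>2) UNIV"
proof -
  have g: "has_grad_on (\<lambda>y. u (inverse r *\<^sub>R (x - y))) (\<lambda>i y. - e i (inverse r *\<^sub>R (x - y)) / r) UNIV"
    if "has_grad_on u e UNIV" for u :: "'a \<Rightarrow> real" and e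
    unfolding has_grad_on_def
  proof
    fix y
    have l: "((\<lambda>y. inverse r *\<^sub>R (x - y)) has_derivative (\<lambda>v. - inverse r *\<^sub>R v)) (at y)"
      by (auto intro!: derivative_eq_intros)
    show "((\<lambda>y. u (inverse r *\<^sub>R (x - y))) has_derivative (\<lambda>v. \<Sum>i\<in>Basis. (v \<bullet> i) * (- e i (inverse r *\<^sub>R (x - y)) / r))) (at y)"
      by (rule has_derivative_eq_rhs[OF has_derivative_compose[OF l has_grad_onD[OF that UNIV_I]]])
        (simp add: fun_eq_iff sum_negf divide_inverse mult_ac)
  qed
  have "has_grad_on (\<lambda>y. - d i (inverse r *\<^sub>R (x - y)) / r) (\<lambda>j y. D i j (inverse r *\<^sub>R (x - y)) / r\<^sup>2) UNIV"
    if "i \<in> Basis" for i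
  proof -
    have "has_grad_on (d i) (D i) UNIV" using K that by (auto simp: has_hess_on_def)
    from has_grad_on_lincomb[OF g[OF this] g[OF this], of "- inverse r" 0]
    show ?thesis by (simp add: divide_inverse power2_eq_square mult_ac)
  qed
  moreover have "continuous_on UNIV (\<lambda>y. D i j (inverse r *\<^sub>R (x - y)) / r\<^sup>2)" if "i \<in> Basis" "j \<in> Basis" for i j
  proof -
    have c: "continuous_on UNIV (D i j)" using K that by (auto simp: has_hess_on_def)
    show ?thesis unfolding divide_inverse
      by (intro continuous_intros continuous_on_compose2[OF c]) auto
  qed
  ultimately show ?thesis using g K unfolding has_hess_on_def by blast
qed

lemma kern2_scaled_zero:
  fixes x :: "'a::euclidean_space"
  assumes K: "kern2 K d D" and r: "0 < r" and y: "y \<notin> cball x r" and i: "i \<in> Basis" "j \<in> Basis"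
  shows "K (inverse r *\<^sub>R (x - y)) = 0" "d i (inverse r *\<^sub>R (x - y)) = 0" "D i j (inverse r *\<^sub>R (x - y)) = 0"
proof -
  have "1 \<le> norm (inverse r *\<^sub>R (x - y))"
    unfolding norm_inverse_scaleR[OF r] using y r by (simp add: dist_norm)
  then show "K (inverse r *\<^sub>R (x - y)) = 0" "d i (inverse r *\<^sub>R (x - y)) = 0" "D i j (inverse r *\<^sub>R (x - y)) = 0"
    using K i kern_zero unfolding kern2_def by blast+
qed

lemma mollify_green:
  fixes v :: "'a::euclidean_space \<Rightarrow> real"
  assumes K: "kern2 K d D" and r: "0 < r" and S: "open S" "cball x r \<subseteq> S" and v: "Ck_on 2 v S"
  shows "mollify (\<lambda>z. \<Sum>i\<in>Basis. D i i z) r v x = r\<^sup>2 * mollify K r (laplacian v) x"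
proof -
  have "(LINT y|lebesgue. K (inverse r *\<^sub>R (x - y)) * laplacian v y) =
    (LINT y|lebesgue. (\<Sum>i\<in>Basis. D i i (inverse r *\<^sub>R (x - y)) / r\<^sup>2) * v y)"
    using K kern2_scaled_zero[OF K r] SOME_Basis
    by (intro green_identity[OF S(1) v has_hess_on_scaled compact_cball S(2)]) (auto simp: kern2_def)
  also have "\<dots> = (LINT y|lebesgue. (\<Sum>i\<in>Basis. D i i (inverse r *\<^sub>R (x - y))) * v y) / r\<^sup>2"
    by (simp add: sum_divide_distrib[symmetric])
  finally show ?thesis using r by (simp add: mollify_def)
qed

lemma has_grad_on_suminf:
  fixes f :: "nat \<Rightarrow> 'a::euclidean_space \<Rightarrow> real"
  assumes S: "open S" and g: "\<And>k. has_grad_on (f k) (d k) S" and A: "summable A"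
    and f: "\<And>k x. x \<in> S \<Longrightarrow> \<bar>f k x\<bar> \<le> A k" and d: "\<And>k i x. i \<in> Basis \<Longrightarrow> x \<in> S \<Longrightarrow> \<bar>d k i x\<bar> \<le> A k"
  shows "has_grad_on (\<lambda>x. \<Sum>k. f k x) (\<lambda>i x. \<Sum>k. d k i x) S"
  unfolding has_grad_on_def
proof
  fix x assume x: "x \<in> S"
  obtain r where r: "0 < r" "ball x r \<subseteq> S" using S x open_contains_ball by blast
  define g' where "g' = (\<lambda>y v. \<Sum>i\<in>Basis. (v \<bullet> i) * (\<Sum>k. d k i y))"
  have sm: "summable (\<lambda>k. f k y)" if "y \<in> S" for y
    by (rule summable_comparison_test'[OF A, of 0]) (use f[OF that] in auto)
  have "\<exists>G. \<forall>y\<in>ball x r. (\<lambda>k. f k y) sums G y \<and> (G has_derivative g' y) (at y within ball x r)"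
  proof (rule has_derivative_series[where f'="\<lambda>k y v. \<Sum>i\<in>Basis. (v \<bullet> i) * d k i y" and x=x and l="\<Sum>k. f k x"])
    show "(f n has_derivative (\<lambda>v. \<Sum>i\<in>Basis. v \<bullet> i * d n i y)) (at y within ball x r)" if "y \<in> ball x r" for n y
      using has_derivative_at_withinI[OF has_grad_onD[OF g]] r that by blast
    show "(\<lambda>n. f n x) sums (\<Sum>k. f k x)" using sm[OF x] by (rule summable_sums)
  next
    fix e :: real assume e: "0 < e"
    define e' where "e' = e / DIM('a)"
    have e': "0 < e'" using e by (simp add: e'_def)
    have "\<forall>\<^sub>F n in sequentially. \<forall>y\<in>S. dist (\<Sum>k<n. d k i y) (\<Sum>k. d k i y) < e'" if i: "i \<in> Basis" for i
      by (rule uniform_limitD[OF Weierstrass_m_test[OF _ A] e']) (use d i in auto)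
    then have "\<forall>\<^sub>F n in sequentially. \<forall>i\<in>Basis. \<forall>y\<in>S. dist (\<Sum>k<n. d k i y) (\<Sum>k. d k i y) < e'"
      by (simp add: eventually_ball_finite)
    then show "\<forall>\<^sub>F n in sequentially. \<forall>y\<in>ball x r. \<forall>v. norm ((\<Sum>k<n. \<Sum>i\<in>Basis. v \<bullet> i * d k i y) - g' y v) \<le> e * norm v"
    proof eventually_elim
      case (elim n)
      show ?case
      proof (intro ballI allI)
        fix y v assume y: "y \<in> ball x r"
        have "(\<Sum>k<n. \<Sum>i\<in>Basis. v \<bullet> i * d k i y) - g' y v = (\<Sum>i\<in>Basis. (v \<bullet> i) * ((\<Sum>k<n. d k i y) - (\<Sum>k. d k i y)))"
          unfolding g'_def by (subst sum.swap) (simp add: right_diff_distrib sum_subtractf sum_distrib_left)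
        also have "norm \<dots> \<le> (\<Sum>i\<in>(Basis::'a set). norm v * e')"
        proof (rule sum_norm_le)
          fix i :: 'a assume i: "i \<in> Basis"
          have "\<bar>(\<Sum>k<n. d k i y) - (\<Sum>k. d k i y)\<bar> \<le> e'"
            using elim i y r by (force simp: dist_real_def)
          then show "norm (v \<bullet> i * ((\<Sum>k<n. d k i y) - (\<Sum>k. d k i y))) \<le> norm v * e'"
            using Basis_le_norm[OF i, of v] by (simp add: abs_mult mult_mono)
        qed
        also have "\<dots> = e * norm v" by (simp add: e'_def)
        finally show "norm ((\<Sum>k<n. \<Sum>i\<in>Basis. v \<bullet> i * d k i y) - g' y v) \<le> e * norm v" .
      qed
    qed
  qed (use r in auto)
  then obtain G where G: "\<And>y. y \<in> ball x r \<Longrightarrow> (\<lambda>k. f k y) sums G y" "(G has_derivative g' x) (at x within ball x r)"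
    using r(1) by (meson centre_in_ball)
  have "(G has_derivative g' x) (at x)" using G(2) r(1) by (simp add: at_within_open[of x "ball x r"])
  then have "((\<lambda>y. \<Sum>k. f k y) has_derivative g' x) (at x)"
    by (rule has_derivative_transform_within_open[OF _ open_ball[of x r]]) (use r G(1) in \<open>auto simp: sums_unique\<close>)
  then show "((\<lambda>x. \<Sum>k. f k x) has_derivative (\<lambda>v. \<Sum>i\<in>Basis. v \<bullet> i * (\<Sum>k. d k i x))) (at x)"
    by (simp add: g'_def)
qed

lemma continuous_on_suminf_bounded:
  fixes f :: "nat \<Rightarrow> 'a::topological_space \<Rightarrow> real"
  assumes "summable A" "\<And>k x. x \<in> S \<Longrightarrow> \<bar>f k x\<bar> \<le> A k" "\<And>k. continuous_on S (f k)"
  shows "continuous_on S (\<lambda>x. \<Sum>k. f k x)"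
  by (rule uniform_limit_theorem[OF _ Weierstrass_m_test[OF _ assms(1)]])
    (use assms(2,3) in \<open>auto intro!: always_eventually continuous_intros\<close>)

lemma has_hess_on_suminf:
  fixes f :: "nat \<Rightarrow> 'a::euclidean_space \<Rightarrow> real"
  assumes S: "open S" and h: "\<And>k. has_hess_on (f k) (d k) (D k) S" and A: "summable A"
    and f: "\<And>k x. x \<in> S \<Longrightarrow> \<bar>f k x\<bar> \<le> A k" and d: "\<And>k i x. i \<in> Basis \<Longrightarrow> x \<in> S \<Longrightarrow> \<bar>d k i x\<bar> \<le> A k"
    and D: "\<And>k i j x. i \<in> Basis \<Longrightarrow> j \<in> Basis \<Longrightarrow> x \<in> S \<Longrightarrow> \<bar>D k i j x\<bar> \<le> A k"
  shows "has_hess_on (\<lambda>x. \<Sum>k. f k x) (\<lambda>i x. \<Sum>k. d k i x) (\<lambda>i j x. \<Sum>k. D k i j x) S"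
  using h unfolding has_hess_on_def
  by (auto intro!: has_grad_on_suminf[OF S _ A] continuous_on_suminf_bounded[OF A] f d D)

section \<open>The radial cutoff and the dyadic kernel\<close>

text \<open>An exponent of at least two makes the power differentiable also where the positive part
  starts to vanish, because the difference quotient of \<open>max 0 h ^ Suc (Suc n)\<close> at 0 is
  at most |h|^(n+1).\<close>

lemma DERIV_pos_part_power:
  assumes "(g has_real_derivative g') (at x)"
  shows "((\<lambda>x. max 0 (g x) ^ Suc (Suc n)) has_real_derivative real (n + 2) * max 0 (g x) ^ Suc n * g') (at x)"
proof -
  have "((\<lambda>x. max 0 x ^ Suc (Suc n)) has_real_derivative real (n + 2) * max 0 y ^ Suc n) (at y)" for y :: real
  proof (cases "y = 0")
    case True
    have "((\<lambda>h. max 0 h ^ Suc (Suc n) / h) \<longlongrightarrow> 0) (at (0::real))"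
    proof (rule Lim_null_comparison)
      show "\<forall>\<^sub>F h in at (0::real). norm (max 0 h ^ Suc (Suc n) / h) \<le> \<bar>h\<bar> ^ Suc n"
      proof (intro always_eventually allI)
        fix h :: real
        show "norm (max 0 h ^ Suc (Suc n) / h) \<le> \<bar>h\<bar> ^ Suc n"
        proof (cases "h > 0")
          case False
          then have "norm (max 0 h ^ Suc (Suc n) / h) = 0" by (simp add: max_def)
          then show ?thesis by (metis abs_ge_zero zero_le_power)
        qed simp
      qed
      show "((\<lambda>h. \<bar>h\<bar> ^ Suc n) \<longlongrightarrow> 0) (at (0::real))" by (auto intro!: tendsto_eq_intros)
    qed
    then show ?thesis using True by (simp add: DERIV_def)
  next
    case False
    show ?thesis
    proof (cases "y > 0")
      case True
      have "((\<lambda>x. x ^ Suc (Suc n)) has_real_derivative real (n + 2) * max 0 y ^ Suc n) (at y)"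
        by (rule DERIV_cong[OF DERIV_pow]) (use True in simp)
      then show ?thesis
        by (rule has_field_derivative_transform_within_open[where S="{0<..}"]) (use True in \<open>auto simp: max_def\<close>)
    next
      case F: False
      have "((\<lambda>x. 0) has_real_derivative real (n + 2) * max 0 y ^ Suc n) (at y)"
        using F False by (auto simp: max_def)
      then show ?thesis
        by (rule has_field_derivative_transform_within_open[where S="{..<0}"]) (use F False in \<open>auto simp: max_def\<close>)
    qed
  qed
  from DERIV_chain2[OF this assms] show ?thesis .
qed

text \<open>The cubes of positive parts make this cutoff profile twice continuously differentiable.\<close>

definition e0 :: "real \<Rightarrow> real" where
  "e0 s = max 0 (1 - max 0 (2 * s - 1) ^ 3) ^ 3"

definition e1 :: "real \<Rightarrow> real" where
  "e1 s = - 18 * (max 0 (1 - max 0 (2 * s - 1) ^ 3) ^ 2 * max 0 (2 * s - 1) ^ 2)"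

definition e2 :: "real \<Rightarrow> real" where
  "e2 s = - 18 * (max 0 (1 - max 0 (2 * s - 1) ^ 3) ^ 2 * (4 * max 0 (2 * s - 1))
     - 12 * max 0 (1 - max 0 (2 * s - 1) ^ 3) * max 0 (2 * s - 1) ^ 2 * max 0 (2 * s - 1) ^ 2)"

lemma DERIV_e0: "(e0 has_real_derivative e1 s) (at s)"
proof -
  have l: "((\<lambda>s. 2 * s - 1) has_real_derivative 2) (at s)" by (auto intro!: derivative_eq_intros)
  have q: "((\<lambda>s. 1 - max 0 (2 * s - 1) ^ 3) has_real_derivative - (6 * max 0 (2 * s - 1) ^ 2)) (at s)"
    using DERIV_diff[OF DERIV_const[of 1] DERIV_pos_part_power[OF l, of 1]] by (simp add: numeral_eq_Suc)
  show ?thesis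
    using DERIV_pos_part_power[OF q, of 1] unfolding e0_def[abs_def] e1_def
    by (simp add: numeral_3_eq_3 numeral_2_eq_2 mult.assoc)
qed

lemma DERIV_e1: "(e1 has_real_derivative e2 s) (at s)"
proof -
  have l: "((\<lambda>s. 2 * s - 1) has_real_derivative 2) (at s)" by (auto intro!: derivative_eq_intros)
  have q: "((\<lambda>s. 1 - max 0 (2 * s - 1) ^ 3) has_real_derivative - (6 * max 0 (2 * s - 1) ^ 2)) (at s)"
    using DERIV_diff[OF DERIV_const[of 1] DERIV_pos_part_power[OF l, of 1]] by (simp add: numeral_eq_Suc)
  have a: "((\<lambda>s. max 0 (2 * s - 1) ^ 2) has_real_derivative 4 * max 0 (2 * s - 1)) (at s)"
    using DERIV_pos_part_power[OF l, of 0] by (simp add: numeral_2_eq_2)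
  have b: "((\<lambda>s. max 0 (1 - max 0 (2 * s - 1) ^ 3) ^ 2) has_real_derivative
      2 * max 0 (1 - max 0 (2 * s - 1) ^ 3) * - (6 * max 0 (2 * s - 1) ^ 2)) (at s)"
    using DERIV_pos_part_power[OF q, of 0] by (simp add: numeral_2_eq_2)
  show ?thesis
    unfolding e1_def[abs_def] e2_def
    by (rule DERIV_cong[OF DERIV_cmult[OF DERIV_mult[OF b a]]]) (simp add: algebra_simps)
qed

lemma continuous_e2: "continuous_on A e2"
  unfolding e2_def[abs_def] by (intro continuous_intros)

lemma continuous_e0: "continuous_on A e0"
  unfolding e0_def[abs_def] by (intro continuous_intros)

lemma continuous_e1: "continuous_on A e1"
  unfolding e1_def[abs_def] by (intro continuous_intros)

lemma e0_nonneg: "0 \<le> e0 s" by (simp add: e0_def)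

lemma e0_one: assumes "s \<le> 1/2" shows "e0 s = 1"
proof -
  have "max 0 (2 * s - 1) = 0" using assms by simp
  then show ?thesis by (simp add: e0_def)
qed

lemma e_zero: "1 \<le> s \<Longrightarrow> e0 s = 0" "1 \<le> s \<Longrightarrow> e1 s = 0" "1 \<le> s \<Longrightarrow> e2 s = 0"
proof -
  assume "1 \<le> s"
  then have "1 \<le> max 0 (2 * s - 1) ^ 3" by (simp add: max_def one_le_power)
  then have "max 0 (1 - max 0 (2 * s - 1) ^ 3) = 0" by simp
  then show "e0 s = 0" "e1 s = 0" "e2 s = 0" by (simp_all add: e0_def e1_def e2_def)
qed

lemma e0_pos: "s < 1 \<Longrightarrow> 0 < e0 s"
proof -
  assume "s < 1"
  then have "max 0 (2 * s - 1) < 1" by simp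
  then have "max 0 (2 * s - 1) ^ 3 < 1" by (simp add: power_less_one_iff)
  then show ?thesis by (simp add: e0_def)
qed

text \<open>Derivatives of the profile at s = 0 are two-sided, so a profile has to live on some
  interval reaching below 0 although |x|^2 never does; T is that domain.\<close>

lemma radial_kern2:
  fixes F F' F'' :: "real \<Rightarrow> real"
  assumes F: "\<And>s. s \<in> T \<Longrightarrow> (F has_real_derivative F' s) (at s)"
    and F': "\<And>s. s \<in> T \<Longrightarrow> (F' has_real_derivative F'' s) (at s)"
    and c: "continuous_on T F''" and T: "{0..} \<subseteq> T"
    and z: "\<And>s. 1 \<le> s \<Longrightarrow> F s = 0" "\<And>s. 1 \<le> s \<Longrightarrow> F' s = 0" "\<And>s. 1 \<le> s \<Longrightarrow> F'' s = 0"
  shows "kern2 (\<lambda>x::'a::euclidean_space. F (x \<bullet> x)) (\<lambda>i x. 2 * (x \<bullet> i) * F' (x \<bullet> x))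
    (\<lambda>i j x. 2 * (i \<bullet> j) * F' (x \<bullet> x) + 4 * (x \<bullet> i) * (x \<bullet> j) * F'' (x \<bullet> x))"
    "(\<Sum>i\<in>Basis. 2 * (i \<bullet> i) * F' (x \<bullet> x) + 4 * ((x::'a) \<bullet> i) * (x \<bullet> i) * F'' (x \<bullet> x)) =
      2 * DIM('a) * F' (x \<bullet> x) + 4 * (x \<bullet> x) * F'' (x \<bullet> x)"
proof -
  have H: "has_hess_on (\<lambda>x::'a. F (x \<bullet> x)) (\<lambda>i x. 2 * (x \<bullet> i) * F' (x \<bullet> x))
    (\<lambda>i j x. 2 * (i \<bullet> j) * F' (x \<bullet> x) + 4 * (x \<bullet> i) * (x \<bullet> j) * F'' (x \<bullet> x)) UNIV"
  proof -
    have "x \<bullet> x \<in> T" for x :: 'a using T by auto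
    then show ?thesis using has_hess_on_radial[OF F F' c, where S=UNIV and y="0::'a"] by simp
  qed
  have n: "1 \<le> z \<bullet> z" if "1 \<le> norm z" for z :: 'a
    using that by (simp add: dot_square_norm one_le_power)
  show "kern2 (\<lambda>x::'a. F (x \<bullet> x)) (\<lambda>i x. 2 * (x \<bullet> i) * F' (x \<bullet> x))
    (\<lambda>i j x. 2 * (i \<bullet> j) * F' (x \<bullet> x) + 4 * (x \<bullet> i) * (x \<bullet> j) * F'' (x \<bullet> x))"
  proof -
    have "continuous_on UNIV (\<lambda>x::'a. F (x \<bullet> x))" "\<And>i. i \<in> Basis \<Longrightarrow> continuous_on UNIV (\<lambda>x::'a. 2 * (x \<bullet> i) * F' (x \<bullet> x))"
      using H unfolding has_hess_on_def by (blast intro: has_grad_on_continuous)+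
    moreover have "continuous_on UNIV (\<lambda>x::'a. 2 * (i \<bullet> j) * F' (x \<bullet> x) + 4 * (x \<bullet> i) * (x \<bullet> j) * F'' (x \<bullet> x))"
      if "i \<in> Basis" "j \<in> Basis" for i j
      using H that unfolding has_hess_on_def by blast
    ultimately show ?thesis using H n z unfolding kern2_def kern_def by simp
  qed
  show "(\<Sum>i\<in>Basis. 2 * (i \<bullet> i) * F' (x \<bullet> x) + 4 * ((x::'a) \<bullet> i) * (x \<bullet> i) * F'' (x \<bullet> x)) =
      2 * DIM('a) * F' (x \<bullet> x) + 4 * (x \<bullet> x) * F'' (x \<bullet> x)"
  proof -
    have "(\<Sum>i\<in>Basis. 2 * (i \<bullet> i) * F' (x \<bullet> x) + 4 * (x \<bullet> i) * (x \<bullet> i) * F'' (x \<bullet> x)) =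
      (\<Sum>i\<in>(Basis::'a set). 2 * F' (x \<bullet> x)) + (\<Sum>i\<in>Basis. 4 * ((x \<bullet> i) * (x \<bullet> i)) * F'' (x \<bullet> x))"
      unfolding sum.distrib[symmetric] by (rule sum.cong) (auto simp: mult_ac)
    then show ?thesis
      by (simp add: sum_distrib_left[symmetric] sum_distrib_right[symmetric] euclidean_inner[of x x, symmetric])
  qed
qed

lemma kern2D:
  assumes "kern2 K d D"
  shows "has_hess_on K d D UNIV" "kern 1 K" "i \<in> Basis \<Longrightarrow> kern 1 (d i)"
    "i \<in> Basis \<Longrightarrow> j \<in> Basis \<Longrightarrow> kern 1 (D i j)"
  using assms by (auto simp: kern2_def)

definition eta :: "'a::euclidean_space \<Rightarrow> real" where "eta x = e0 (x \<bullet> x)"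

definition eta_grad :: "'a::euclidean_space \<Rightarrow> 'a \<Rightarrow> real" where
  "eta_grad i x = 2 * (x \<bullet> i) * e1 (x \<bullet> x)"

definition eta_hess :: "'a::euclidean_space \<Rightarrow> 'a \<Rightarrow> 'a \<Rightarrow> real" where
  "eta_hess i j x = 2 * (i \<bullet> j) * e1 (x \<bullet> x) + 4 * (x \<bullet> i) * (x \<bullet> j) * e2 (x \<bullet> x)"

lemma eta_kern2: "kern2 eta eta_grad (eta_hess :: 'a::euclidean_space \<Rightarrow> 'a \<Rightarrow> 'a \<Rightarrow> real)"
  unfolding eta_def[abs_def] eta_grad_def[abs_def] eta_hess_def[abs_def]
  by (rule radial_kern2[where T=UNIV]) (auto intro: DERIV_e0 DERIV_e1 continuous_e2 e_zero)

lemma eta_kern: "kern 1 eta" by (rule kern2D(2)[OF eta_kern2])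

lemma eta_nonneg: "0 \<le> eta x" by (simp add: eta_def e0_nonneg)

text \<open>The profile \<open>kk\<close> is chosen so that the radial vector field \<open>x kk(|x|\<^sup>2)\<close> has divergence
  \<open>2\<^sup>N eta(2x) - eta(x)\<close>; its potential \<open>Phi\<close> then links two consecutive dyadic scales of \<open>eta\<close>.\<close>

definition kk :: "nat \<Rightarrow> real \<Rightarrow> real" where
  "kk N s = integral (cbox 1 2) (\<lambda>t. e0 (s * t\<^sup>2) * t ^ (N - 1))"

definition kk1 :: "nat \<Rightarrow> real \<Rightarrow> real" where
  "kk1 N s = integral (cbox 1 2) (\<lambda>t. e1 (s * t\<^sup>2) * t\<^sup>2 * t ^ (N - 1))"

lemma DERIV_kk: "(kk N has_real_derivative kk1 N s) (at s)"
proof -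
  have "((\<lambda>s. integral (cbox 1 2) (\<lambda>t. e0 (s * t\<^sup>2) * t ^ (N - 1))) has_field_derivative
      integral (cbox 1 2) (\<lambda>t. e1 (s * t\<^sup>2) * t\<^sup>2 * t ^ (N - 1))) (at s within UNIV)"
  proof (rule leibniz_rule_field_derivative)
    fix x t :: real
    have "((\<lambda>x. e0 (x * t\<^sup>2)) has_real_derivative e1 (x * t\<^sup>2) * t\<^sup>2) (at x)"
      by (rule DERIV_chain2[OF DERIV_e0]) (auto intro!: derivative_eq_intros)
    from DERIV_cmult_right[OF this, of "t ^ (N - 1)"]
    show "((\<lambda>x. e0 (x * t\<^sup>2) * t ^ (N - 1)) has_real_derivative e1 (x * t\<^sup>2) * t\<^sup>2 * t ^ (N - 1)) (at x within UNIV)"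
      by simp
  next
    fix x :: real
    show "(\<lambda>t. e0 (x * t\<^sup>2) * t ^ (N - 1)) integrable_on cbox 1 2"
      by (intro integrable_continuous continuous_intros continuous_on_compose2[OF continuous_e0[of UNIV]]) auto
  next
    show "continuous_on (UNIV \<times> cbox 1 2) (\<lambda>(x, t). e1 (x * t\<^sup>2) * t\<^sup>2 * t ^ (N - 1))"
      unfolding split_def
      by (intro continuous_intros continuous_on_compose2[OF continuous_e1[of UNIV]]) auto
  qed auto
  then show ?thesis by (simp add: kk_def[abs_def] kk1_def)
qed

lemma continuous_kk1: "continuous_on A (kk1 N)"
proof -
  have "continuous_on UNIV (\<lambda>s. integral (cbox 1 2) (\<lambda>t. e1 (s * t\<^sup>2) * t\<^sup>2 * t ^ (N - 1)))"
    by (rule integral_continuous_on_param, unfold split_def)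
      (intro continuous_intros continuous_on_compose2[OF continuous_e1[of UNIV]], auto)
  then have "continuous_on UNIV (kk1 N)" by (simp add: kk1_def[abs_def])
  then show ?thesis by (rule continuous_on_subset) simp
qed

lemma continuous_kk: "continuous_on A (kk N)"
  by (meson DERIV_kk DERIV_continuous continuous_at_imp_continuous_on)

lemma kk_zero: assumes "1 \<le> s" shows "kk N s = 0" "kk1 N s = 0"
proof -
  have z: "e0 (s * t\<^sup>2) = 0" "e1 (s * t\<^sup>2) = 0" if "t \<in> cbox 1 2" for t :: real
  proof -
    have "1 \<le> t\<^sup>2" using that by (simp add: one_le_power)
    then have "1 * 1 \<le> s * t\<^sup>2" using assms by (intro mult_mono) auto
    then show "e0 (s * t\<^sup>2) = 0" "e1 (s * t\<^sup>2) = 0" using e_zero by auto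
  qed
  have "kk N s = integral (cbox 1 2) (\<lambda>t::real. 0)" unfolding kk_def by (rule integral_cong) (simp add: z)
  then show "kk N s = 0" by simp
  have "kk1 N s = integral (cbox 1 2) (\<lambda>t::real. 0)" unfolding kk1_def by (rule integral_cong) (simp add: z)
  then show "kk1 N s = 0" by simp
qed

lemma kk_nonneg: "0 \<le> kk N s"
  unfolding kk_def by (rule Henstock_Kurzweil_Integration.integral_nonneg)
    (auto intro!: integrable_continuous_real continuous_intros continuous_on_compose2[OF continuous_e0[of UNIV]] mult_nonneg_nonneg e0_nonneg)

text \<open>The left side is an integral over [1, 2] whose integrand is the derivative in t of t^N
  e0(s t^2), so the end values give the right side. The interval [1, 2] is one dyadic step.\<close>

lemma kk_identity:
  assumes "0 < N" shows "N * kk N s + 2 * s * kk1 N s = 2 ^ N * e0 (4 * s) - e0 s"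
proof -
  define h where "h = (\<lambda>t. N * (e0 (s * t\<^sup>2) * t ^ (N - 1)) + 2 * s * (e1 (s * t\<^sup>2) * t\<^sup>2 * t ^ (N - 1)))"
  have tN: "t ^ N = t * t ^ (N - 1)" for t :: real using assms by (cases N) auto
  have "(h has_integral (\<lambda>t. t ^ N * e0 (s * t\<^sup>2)) 2 - (\<lambda>t. t ^ N * e0 (s * t\<^sup>2)) 1) {1..2}"
  proof (rule fundamental_theorem_of_calculus)
    fix t :: real
    have "((\<lambda>t. e0 (s * t\<^sup>2)) has_real_derivative e1 (s * t\<^sup>2) * (2 * s * t)) (at t)"
      by (rule DERIV_chain2[OF DERIV_e0]) (auto intro!: derivative_eq_intros)
    from DERIV_mult[OF DERIV_pow[of N t] this]
    have "((\<lambda>t. t ^ N * e0 (s * t\<^sup>2)) has_real_derivative h t) (at t)"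
      by (rule DERIV_cong) (simp add: h_def tN power2_eq_square mult_ac)
    then show "((\<lambda>t. t ^ N * e0 (s * t\<^sup>2)) has_vector_derivative h t) (at t within {1..2})"
      by (meson has_real_derivative_iff_has_vector_derivative has_vector_derivative_at_within)
  qed simp
  then have "integral (cbox 1 2) h = 2 ^ N * e0 (4 * s) - e0 s"
    by (simp add: integral_unique mult.commute)
  moreover have "integral (cbox 1 2) h = N * kk N s + 2 * s * kk1 N s"
    unfolding h_def kk_def kk1_def
    by (subst Henstock_Kurzweil_Integration.integral_add)
      (auto intro!: integrable_continuous_real continuous_intros continuous_on_compose2[OF continuous_e0[of UNIV]] continuous_on_compose2[OF continuous_e1[of UNIV]])
  ultimately show ?thesis by simp
qed

text \<open>The primitive of -kk/2 that vanishes for s >= 1, so that PP(|x|^2) has the gradient -x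
  kk(|x|^2). The lower limit -1, in place of 0, makes it differentiable from both sides at s =
  0.\<close>

definition PP :: "nat \<Rightarrow> real \<Rightarrow> real" where
  "PP N s = (integral {-1..1} (kk N) - integral {-1..s} (kk N)) / 2"

lemma DERIV_PP: assumes "-1 < s" shows "(PP N has_real_derivative - kk N s / 2) (at s)"
proof -
  have "((\<lambda>s. integral {-1..s} (kk N)) has_real_derivative kk N s) (at s within {-1..s+1})"
    by (rule integral_has_real_derivative[OF continuous_kk]) (use assms in auto)
  moreover have "at s within {-1..s+1} = at s" using assms by (intro at_within_interior) auto
  ultimately have "((\<lambda>s. integral {-1..s} (kk N)) has_real_derivative kk N s) (at s)" by simp
  then show ?thesis unfolding PP_def[abs_def] by (auto intro!: derivative_eq_intros)
qed

lemma PP_zero: assumes "1 \<le> s" shows "PP N s = 0"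
proof -
  have "integral {-1..1} (kk N) + integral {1..s} (kk N) = integral {-1..s} (kk N)"
    using assms by (intro Henstock_Kurzweil_Integration.integral_combine integrable_continuous_real continuous_kk) auto
  moreover have "integral {1..s} (kk N) = integral {1..s} (\<lambda>t::real. 0)"
    by (rule integral_cong) (auto simp: kk_zero)
  ultimately show ?thesis by (simp add: PP_def)
qed

lemma PP_nonneg: assumes "0 \<le> s" shows "0 \<le> PP N s"
proof (cases "s \<le> 1")
  case True
  have "integral {-1..s} (kk N) + integral {s..1} (kk N) = integral {-1..1} (kk N)"
    using assms True by (intro Henstock_Kurzweil_Integration.integral_combine integrable_continuous_real continuous_kk) auto
  moreover have "0 \<le> integral {s..1} (kk N)"
    by (intro Henstock_Kurzweil_Integration.integral_nonneg integrable_continuous_real continuous_kk) (auto simp: kk_nonneg)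
  ultimately show ?thesis by (simp add: PP_def)
qed (simp add: PP_zero)

definition Phi :: "'a::euclidean_space \<Rightarrow> real" where "Phi x = PP DIM('a) (x \<bullet> x)"

definition Phi_grad :: "'a::euclidean_space \<Rightarrow> 'a \<Rightarrow> real" where
  "Phi_grad i x = 2 * (x \<bullet> i) * (- kk DIM('a) (x \<bullet> x) / 2)"

definition Phi_hess :: "'a::euclidean_space \<Rightarrow> 'a \<Rightarrow> 'a \<Rightarrow> real" where
  "Phi_hess i j x = 2 * (i \<bullet> j) * (- kk DIM('a) (x \<bullet> x) / 2) + 4 * (x \<bullet> i) * (x \<bullet> j) * (- kk1 DIM('a) (x \<bullet> x) / 2)"

lemma Phi_kern2: "kern2 Phi Phi_grad (Phi_hess :: 'a::euclidean_space \<Rightarrow> 'a \<Rightarrow> 'a \<Rightarrow> real)"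
  and Phi_laplacian: "(\<Sum>i\<in>Basis. Phi_hess i i (x::'a)) = eta x - 2 ^ DIM('a) * eta (2 *\<^sub>R x)"
proof -
  note R = radial_kern2[where T="{-1<..}" and F="PP DIM('a)" and F'="\<lambda>s. - kk DIM('a) s / 2" and F''="\<lambda>s. - kk1 DIM('a) s / 2"]
  have p: "(PP DIM('a) has_real_derivative - kk DIM('a) s / 2) (at s)" if "s \<in> {-1<..}" for s
    using DERIV_PP that by simp
  have d: "((\<lambda>s. - kk DIM('a) s / 2) has_real_derivative - kk1 DIM('a) s / 2) (at s)" for s
    by (auto intro!: derivative_eq_intros DERIV_kk)
  have c: "continuous_on {-1<..} (\<lambda>s. - kk1 DIM('a) s / 2)" by (intro continuous_intros continuous_kk1) auto
  show "kern2 Phi Phi_grad (Phi_hess :: 'a \<Rightarrow> 'a \<Rightarrow> 'a \<Rightarrow> real)"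
    unfolding Phi_def[abs_def] Phi_grad_def[abs_def] Phi_hess_def[abs_def]
    by (rule R(1)[OF p d c]) (auto simp: PP_zero kk_zero)
  have "(\<Sum>i\<in>Basis. Phi_hess i i x) = 2 * DIM('a) * (- kk DIM('a) (x \<bullet> x) / 2) + 4 * (x \<bullet> x) * (- kk1 DIM('a) (x \<bullet> x) / 2)"
    unfolding Phi_hess_def by (rule R(2)[OF p d c]) (auto simp: PP_zero kk_zero)
  also have "\<dots> = eta x - 2 ^ DIM('a) * eta (2 *\<^sub>R x)"
    using kk_identity[OF DIM_positive[where 'a='a], of "x \<bullet> x"] by (simp add: eta_def algebra_simps)
  finally show "(\<Sum>i\<in>Basis. Phi_hess i i x) = eta x - 2 ^ DIM('a) * eta (2 *\<^sub>R x)" .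
qed

lemma Phi_nonneg: "0 \<le> Phi x" by (simp add: Phi_def PP_nonneg)

abbreviation eta_mass :: "'a::euclidean_space itself \<Rightarrow> real" where
  "eta_mass _ \<equiv> (LINT y|lebesgue. eta (y::'a))"

text \<open>\<open>eta\<close> is not normalised, so its mass enters the representation formulas as
  a factor and has to be divided out.\<close>

lemma eta_mass_pos: "0 < eta_mass TYPE('a::euclidean_space)"
proof -
  have b: "integrable lebesgue (\<lambda>y. indicator (ball (0::'a) (1/2)) y :: real)"
    by (intro integrable_real_indicator) (auto simp: emeasure_bounded_finite[unfolded infinity_ennreal_def])
  have "measure lebesgue (ball (0::'a) (1/2)) = (LINT y|lebesgue. indicator (ball (0::'a) (1/2)) y)" by simp
  also have "\<dots> \<le> eta_mass TYPE('a)"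
  proof (rule integral_mono[OF b kern_integrable[OF eta_kern]])
    fix y :: 'a
    show "indicator (ball 0 (1/2)) y \<le> eta y"
    proof (cases "y \<in> ball 0 (1/2)")
      case True
      then have "norm y * norm y \<le> 1/2 * (1/2)" by (intro mult_mono) auto
      then have "y \<bullet> y \<le> 1/2" by (simp add: power2_norm_eq_inner[symmetric] power2_eq_square)
      then show ?thesis by (simp add: eta_def e0_one indicator_def)
    qed (simp add: eta_nonneg)
  qed
  finally show ?thesis using measure_ball_scaled[of "1/2" "0::'a"] ball_vol_pos[where 'a='a]
    by (smt (verit) mult_pos_pos zero_less_power divide_pos_pos)
qed

lemma mollify_cong:
  assumes "kern 1 K" "0 < r" "\<And>y. y \<in> ball x r \<Longrightarrow> h y = h' y"
  shows "mollify K r h x = mollify K r h' x"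
proof -
  have "K (inverse r *\<^sub>R (x - y)) * h y = K (inverse r *\<^sub>R (x - y)) * h' y" for y
  proof (cases "y \<in> ball x r")
    case False
    then have "1 \<le> norm (inverse r *\<^sub>R (x - y))"
      unfolding norm_inverse_scaleR[OF assms(2)] using assms(2) by (simp add: dist_norm)
    then show ?thesis using kern_zero[OF assms(1)] by simp
  qed (simp add: assms(3))
  then show ?thesis unfolding mollify_def by (simp only:)
qed

lemma mollify_nonneg:
  assumes "kern 1 K" "0 < r" "\<And>z. 0 \<le> K z" "\<And>y. y \<in> ball x r \<Longrightarrow> 0 \<le> h y"
  shows "0 \<le> mollify K r h x"
proof -
  have "mollify K r h x = mollify K r (\<lambda>y. if y \<in> ball x r then h y else 0) x"
    by (rule mollify_cong[OF assms(1,2)]) simp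
  also have "0 \<le> \<dots>" unfolding mollify_def
    using assms(2-4) by (intro divide_nonneg_nonneg Bochner_Integration.integral_nonneg) auto
  finally show ?thesis .
qed

lemma mollify_minus: "mollify K r (\<lambda>y. - h y) x = - mollify K r h x"
  by (simp add: mollify_def)

lemma kern_sum:
  assumes "\<And>i. i \<in> I \<Longrightarrow> kern \<rho> (K i)"
  shows "kern \<rho> (\<lambda>z. \<Sum>i\<in>I. K i z)"
  using assms unfolding kern_def by (intro conjI continuous_on_sum allI impI sum.neutral) blast+

lemma mollify_sum:
  assumes "\<And>i. i \<in> I \<Longrightarrow> kern \<rho> (K i)" "0 < r" "integrable lebesgue h"
  shows "mollify (\<lambda>z. \<Sum>i\<in>I. K i z) r h x = (\<Sum>i\<in>I. mollify (K i) r h x)"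
  using mollify_integrable[OF assms(1) assms(2,3), of _ x]
  by (simp add: mollify_def sum_distrib_right sum_divide_distrib)

text \<open>At scale r the kernel 2^N eta(2x) is the mollifier of scale r/2. Consecutive scales
  therefore share a term, and sums over R / 2^k telescope.\<close>

lemma mollify_Phi_laplacian:
  fixes h :: "'a::euclidean_space \<Rightarrow> real"
  assumes r: "0 < r" and h: "integrable lebesgue h"
  shows "mollify (\<lambda>z. \<Sum>i\<in>Basis. Phi_hess i i z) r h x = mollify eta r h x - mollify eta (r / 2) h x"
proof -
  have a: "2 *\<^sub>R inverse r *\<^sub>R (x - y) = inverse (r / 2) *\<^sub>R (x - y)" for y
    by (simp only: scaleR_scaleR inverse_divide) (simp only: divide_inverse)
  have "(LINT y|lebesgue. (\<Sum>i\<in>Basis. Phi_hess i i (inverse r *\<^sub>R (x - y))) * h y)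
    = (LINT y|lebesgue. eta (inverse r *\<^sub>R (x - y)) * h y - 2 ^ DIM('a) * (eta (inverse (r / 2) *\<^sub>R (x - y)) * h y))"
    unfolding Phi_laplacian a by (simp only: left_diff_distrib mult.assoc)
  also have "\<dots> = (LINT y|lebesgue. eta (inverse r *\<^sub>R (x - y)) * h y) - 2 ^ DIM('a) * (LINT y|lebesgue. eta (inverse (r / 2) *\<^sub>R (x - y)) * h y)"
    using mollify_integrable[OF eta_kern r h, of x] mollify_integrable[OF eta_kern _ h, of "r/2" x] r by simp
  finally show ?thesis using r by (simp add: mollify_def diff_divide_distrib power_divide)
qed

lemma integrable_restrict_compact:
  fixes v :: "'a::euclidean_space \<Rightarrow> real"
  assumes "compact C" "continuous_on C v"
  shows "integrable lebesgue (\<lambda>y. if y \<in> C then v y else 0)"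
proof -
  have "integrable lborel (\<lambda>x. indicator C x *\<^sub>R v x)" by (rule borel_integrable_compact[OF assms])
  also have "(\<lambda>x. indicator C x *\<^sub>R v x) = (\<lambda>y. if y \<in> C then v y else 0)" by (auto simp: indicator_def)
  finally show ?thesis by (subst integrable_completion) (auto intro: borel_measurable_integrable)
qed

section \<open>Representation formula, mean values and interior estimates\<close>

lemma mollify_eta_tendsto:
  fixes h :: "'a::euclidean_space \<Rightarrow> real"
  assumes R: "0 < R" and h: "integrable lebesgue h" and c: "isCont h x"
  shows "(\<lambda>k. mollify eta (R / 2 ^ k) h x) \<longlonglongrightarrow> eta_mass TYPE('a) * h x"
proof (rule LIMSEQ_I)
  fix e :: real assume e: "0 < e"
  obtain M where M: "0 < M" "\<And>z::'a. \<bar>eta z\<bar> \<le> M" using kern_bounded[OF eta_kern] by metis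
  define e' where "e' = e / (M * ball_vol TYPE('a)) / 2"
  have e': "0 < e'" using e M ball_vol_pos[where 'a='a] by (simp add: e'_def)
  obtain d where d: "d > 0" "\<And>y. dist y x < d \<Longrightarrow> \<bar>h y - h x\<bar> \<le> e'"
    using c e' unfolding continuous_at_eps_delta dist_real_def by (meson less_imp_le)
  have "(\<lambda>k. R * (1/2) ^ k) \<longlonglongrightarrow> R * 0" by (intro tendsto_intros) auto
  then have "\<forall>\<^sub>F k in sequentially. R * (1/2) ^ k < d" using d(1) by (simp add: order_tendsto_iff)
  then obtain k0 where k0: "\<And>k. k \<ge> k0 \<Longrightarrow> R / 2 ^ k < d" by (auto simp: eventually_sequentially power_divide)
  show "\<exists>no. \<forall>n\<ge>no. norm (mollify eta (R / 2 ^ n) h x - eta_mass TYPE('a) * h x) < e"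
  proof (intro exI[of _ k0] allI impI)
    fix n assume "k0 \<le> n"
    then have "\<bar>mollify eta (R / 2 ^ n) h x - h x * eta_mass TYPE('a)\<bar> \<le> M * ball_vol TYPE('a) * e'"
      using k0[of n] d(2) e' R by (intro mollify_approx[OF eta_kern M(2) _ h]) (auto simp: dist_commute)
    also have "\<dots> < e" using e M ball_vol_pos[where 'a='a] by (simp add: e'_def)
    finally show "norm (mollify eta (R / 2 ^ n) h x - eta_mass TYPE('a) * h x) < e" by (simp add: mult.commute)
  qed
qed

text \<open>Green's identity turns the k-th term into the difference of the mollifications of v at
  scales R / 2^k and R / 2^(k+1). The sum runs from the mollification at scale R down to the point
  value, so the series is the correction by which a general function fails the mean value
  property.\<close>

lemma representation:
  fixes v :: "'a::euclidean_space \<Rightarrow> real"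
  assumes R: "0 < R" and S: "open S" "cball x R \<subseteq> S" and v: "Ck_on 2 v S"
  shows "(\<lambda>k. (R / 2 ^ k)\<^sup>2 * mollify Phi (R / 2 ^ k) (laplacian v) x) sums (mollify eta R v x - eta_mass TYPE('a) * v x)"
proof -
  \<comment> \<open>The cut-off makes v integrable on the whole space; mollifications at x of radius
    at most R do not notice it.\<close>
  define v0 where "v0 = (\<lambda>y. if y \<in> cball x R then v y else 0)"
  have i: "integrable lebesgue v0"
    unfolding v0_def using Ck2_continuous[OF v] S(2)
    by (intro integrable_restrict_compact compact_cball) (blast intro: continuous_on_subset)
  have rk: "0 < R / 2 ^ k" "R / 2 ^ k \<le> R" for k using R by (auto simp: field_simps)
  have c: "isCont v0 x"
  proof -
    have "continuous_on (ball x R) v"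
      using Ck2_continuous[OF v] S(2) ball_subset_cball by (blast intro: continuous_on_subset)
    then have "continuous_on (ball x R) v0" by (rule continuous_on_eq) (simp add: v0_def)
    then show ?thesis using R by (simp add: continuous_on_eq_continuous_at)
  qed
  have eq: "mollify K (R / 2 ^ k) v x = mollify K (R / 2 ^ k) v0 x" if "kern 1 K" for K k
    using rk[of k] by (intro mollify_cong[OF that]) (auto simp: v0_def)
  have pk: "kern 1 (\<lambda>z::'a. \<Sum>i\<in>Basis. Phi_hess i i z)"
  proof (rule kern_sum)
    fix i :: 'a assume i: "i \<in> Basis"
    show "kern 1 (Phi_hess i i)" by (rule kern2D(4)[OF Phi_kern2 i i])
  qed
  have "(R / 2 ^ k)\<^sup>2 * mollify Phi (R / 2 ^ k) (laplacian v) x = mollify eta (R / 2 ^ k) v0 x - mollify eta (R / 2 ^ Suc k) v0 x" for k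
  proof -
    have "cball x (R / 2 ^ k) \<subseteq> S" using rk(2)[of k] S(2) by (meson order_trans subset_cball)
    from mollify_green[OF Phi_kern2 rk(1) S(1) this v]
    have "(R / 2 ^ k)\<^sup>2 * mollify Phi (R / 2 ^ k) (laplacian v) x = mollify (\<lambda>z. \<Sum>i\<in>Basis. Phi_hess i i z) (R / 2 ^ k) v x" by simp
    also have "\<dots> = mollify eta (R / 2 ^ k) v0 x - mollify eta (R / 2 ^ k / 2) v0 x"
      unfolding eq[OF pk] by (rule mollify_Phi_laplacian[OF rk(1) i])
    finally show ?thesis by (simp add: mult.commute)
  qed
  moreover have "(\<lambda>k. mollify eta (R / 2 ^ k) v0 x - mollify eta (R / 2 ^ Suc k) v0 x) sums (mollify eta (R / 2 ^ 0) v0 x - eta_mass TYPE('a) * v0 x)"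
    by (rule telescope_sums'[OF mollify_eta_tendsto[OF R i c]])
  ultimately show ?thesis using eq[OF eta_kern, of 0] R by (simp add: v0_def)
qed

lemma laplacian_continuous:
  assumes "Ck_on 2 v S" shows "continuous_on S (laplacian v)"
proof -
  have "continuous_on S (\<lambda>x. \<Sum>i\<in>Basis. partial i (partial i v) x)"
    using Ck_has_hess_on[OF assms] by (intro continuous_intros) (auto simp: has_hess_on_def)
  then show ?thesis by (simp add: laplacian_def[abs_def])
qed

lemma mean_value_harmonic:
  fixes v :: "'a::euclidean_space \<Rightarrow> real"
  assumes R: "0 < R" and S: "open S" "cball x R \<subseteq> S" and v: "Ck_on 2 v S" "\<And>y. y \<in> S \<Longrightarrow> laplacian v y = 0"
  shows "mollify eta R v x = eta_mass TYPE('a) * v x"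
proof -
  have "mollify Phi (R / 2 ^ k) (laplacian v) x = mollify Phi (R / 2 ^ k) (\<lambda>_. 0) x" for k
  proof (rule mollify_cong[OF kern2D(2)[OF Phi_kern2]])
    fix y assume y: "y \<in> ball x (R / 2 ^ k)"
    have "R / 2 ^ k \<le> R" using R by (simp add: field_simps)
    then have "y \<in> S" using y S(2) by (auto simp: subset_iff)
    then show "laplacian v y = 0" by (rule v(2))
  qed (use R in simp)
  then have "mollify Phi (R / 2 ^ k) (laplacian v) x = 0" for k by (simp add: mollify_def)
  then show ?thesis using representation[OF R S v(1)] sums_unique2[OF sums_zero] by fastforce
qed

text \<open>\<open>Phi\<close> is nonnegative, so every term of the series in
  \<open>representation\<close> has the sign of the Laplacian.\<close>

lemma mean_value_superharmonic:
  fixes v :: "'a::euclidean_space \<Rightarrow> real"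
  assumes R: "0 < R" and S: "open S" "cball x R \<subseteq> S" and v: "Ck_on 2 v S" "\<And>y. y \<in> S \<Longrightarrow> laplacian v y \<le> 0"
  shows "mollify eta R v x \<le> eta_mass TYPE('a) * v x"
proof -
  have "0 \<le> - mollify Phi (R / 2 ^ k) (laplacian v) x" for k
    unfolding mollify_minus[symmetric]
  proof (rule mollify_nonneg[OF kern2D(2)[OF Phi_kern2]])
    fix y assume y: "y \<in> ball x (R / 2 ^ k)"
    have "R / 2 ^ k \<le> R" using R by (simp add: field_simps)
    then have "y \<in> S" using y S(2) by (auto simp: subset_iff)
    then show "0 \<le> - laplacian v y" using v(2) by simp
  qed (use R Phi_nonneg in auto)
  then have "(R / 2 ^ k)\<^sup>2 * mollify Phi (R / 2 ^ k) (laplacian v) x \<le> 0" for k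
    by (simp add: mult_nonneg_nonpos)
  then show ?thesis using sums_le[OF _ representation[OF R S v(1)] sums_zero] by simp
qed

lemma kern2_bounded:
  fixes K :: "'a::euclidean_space \<Rightarrow> real"
  assumes "kern2 K d D"
  obtains M where "0 < M" "\<And>z. \<bar>K z\<bar> \<le> M" "\<And>i z. i \<in> Basis \<Longrightarrow> \<bar>d i z\<bar> \<le> M"
    "\<And>i j z. i \<in> Basis \<Longrightarrow> j \<in> Basis \<Longrightarrow> \<bar>D i j z\<bar> \<le> M"
proof -
  obtain M0 where M0: "0 < M0" "\<And>z. \<bar>K z\<bar> \<le> M0" using kern_bounded[OF kern2D(2)[OF assms]] by metis
  have "\<exists>M. \<forall>z. \<bar>d i z\<bar> \<le> M" if "i \<in> Basis" for i
    using kern_bounded[OF kern2D(3)[OF assms that]] by metis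
  then obtain M1 where M1: "\<And>i z. i \<in> Basis \<Longrightarrow> \<bar>d i z\<bar> \<le> M1 i" by metis
  have "\<exists>M. \<forall>z. \<bar>D i j z\<bar> \<le> M" if "i \<in> Basis" "j \<in> Basis" for i j
    using kern_bounded[OF kern2D(4)[OF assms that]] by metis
  then obtain M2 where M2: "\<And>i j z. i \<in> Basis \<Longrightarrow> j \<in> Basis \<Longrightarrow> \<bar>D i j z\<bar> \<le> M2 i j" by metis
  define M where "M = Max (insert M0 (M1 ` Basis \<union> (\<lambda>(i, j). M2 i j) ` (Basis \<times> Basis)))"
  have le: "M0 \<le> M" "\<And>i. i \<in> Basis \<Longrightarrow> M1 i \<le> M" "\<And>i j. i \<in> Basis \<Longrightarrow> j \<in> Basis \<Longrightarrow> M2 i j \<le> M"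
    unfolding M_def by (rule Max_ge; force)+
  show thesis
  proof (rule that[of M])
    show "0 < M" "\<bar>K z\<bar> \<le> M" for z using M0 le(1) by (auto intro: order_trans)
    show "\<bar>d i z\<bar> \<le> M" if "i \<in> Basis" for i z using M1[OF that] le(2)[OF that] by (rule order_trans)
    show "\<bar>D i j z\<bar> \<le> M" if "i \<in> Basis" "j \<in> Basis" for i j z
      using M2[OF that] le(3)[OF that] by (rule order_trans)
  qed
qed

text \<open>A harmonic function is locally a constant multiple of its own mollification. Dominated
  convergence carries this identity to the limit, which is thereby a mollification of an integrable
  function and twice differentiable; its Laplacian is a limit of mollifications in the same
  way.\<close>

lemma harmonic_limit:
  fixes u :: "'a::euclidean_space \<Rightarrow> real"
  assumes S: "open S" and v: "\<And>n. Ck_on 2 (v n) S" "\<And>n y. y \<in> S \<Longrightarrow> laplacian (v n) y = 0"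
    and M: "\<And>n y. y \<in> S \<Longrightarrow> \<bar>v n y\<bar> \<le> M" and lim: "\<And>y. y \<in> S \<Longrightarrow> (\<lambda>n. v n y) \<longlonglongrightarrow> u y"
  shows "Ck_on 2 u S" "\<And>y. y \<in> S \<Longrightarrow> laplacian u y = 0"
proof -
  have "\<exists>U. open U \<and> x0 \<in> U \<and> Ck_on 2 u U \<and> (\<forall>x\<in>U. laplacian u x = 0)" if x0: "x0 \<in> S" for x0
  proof -
    obtain e where e: "0 < e" "cball x0 e \<subseteq> S" using S x0 open_contains_cball by blast
    define R where "R = e / 2"
    have R: "0 < R" "2 * R = e" using e by (auto simp: R_def)
    let ?C = "cball x0 e"
    define w where "w = (\<lambda>n y. if y \<in> ?C then v n y else 0)"
    define u0 where "u0 = (\<lambda>y. if y \<in> ?C then u y else 0)"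
    have M0: "0 \<le> M" using M[OF x0, of 0] by linarith
    have iw: "integrable lebesgue (w n)" for n
      unfolding w_def using Ck2_continuous[OF v(1)] e(2)
      by (intro integrable_restrict_compact compact_cball) (blast intro: continuous_on_subset)
    have wl: "(\<lambda>n. w n y) \<longlonglongrightarrow> u0 y" for y
      using lim[of y] e(2) by (cases "y \<in> ?C") (auto simp: w_def u0_def)
    define B where "B = (\<lambda>y. M * indicator ?C y :: real)"
    have iB: "integrable lebesgue B"
      unfolding B_def by (intro integrable_mult_right integrable_real_indicator)
        (auto simp: emeasure_bounded_finite[unfolded infinity_ennreal_def])
    have wB: "norm (w n y) \<le> B y" for n y
      using M[of y n] e(2) by (auto simp: w_def B_def indicator_def)
    have u0m: "u0 \<in> borel_measurable lebesgue"
      by (rule borel_measurable_LIMSEQ_real[OF wl]) (use iw in auto)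
    have iu: "integrable lebesgue u0"
      by (rule integrable_dominated_convergence[where s=w and w=B, OF u0m _ iB]) (use iw wl wB in auto)
    have cvl: "(\<lambda>n. mollify K R (w n) x) \<longlonglongrightarrow> mollify K R u0 x" if K: "kern 1 K" for K x
    proof -
      obtain L where L: "0 < L" "\<And>z. \<bar>K z\<bar> \<le> L" using kern_bounded[OF K] by metis
      have "(\<lambda>n. LINT y|lebesgue. K (inverse R *\<^sub>R (x - y)) * w n y) \<longlonglongrightarrow> (LINT y|lebesgue. K (inverse R *\<^sub>R (x - y)) * u0 y)"
      proof (rule integral_dominated_convergence[where w="\<lambda>y. L * B y"])
        show "AE y in lebesgue. norm (K (inverse R *\<^sub>R (x - y)) * w n y) \<le> L * B y" for n
          using L wB M0 unfolding norm_mult by (auto intro!: mult_mono)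
        show "AE y in lebesgue. (\<lambda>n. K (inverse R *\<^sub>R (x - y)) * w n y) \<longlonglongrightarrow> K (inverse R *\<^sub>R (x - y)) * u0 y"
          by (auto intro!: tendsto_intros wl)
      qed (use mollify_integrable[OF K R(1) iu, of x] mollify_integrable[OF K R(1) iw, of x] iB in auto)
      then show ?thesis unfolding mollify_def using R by (intro tendsto_intros) auto
    qed
    let ?c = "eta_mass TYPE('a)"
    have sub: "cball x R \<subseteq> ?C" "cball x R \<subseteq> S" if "x \<in> ball x0 R" for x
    proof -
      show *: "cball x R \<subseteq> ?C"
      proof
        fix y assume "y \<in> cball x R"
        then show "y \<in> ?C" using that R dist_triangle[of x0 y x] by simp
      qed
      show "cball x R \<subseteq> S" using * e(2) by blast
    qed
    have mv: "mollify eta R (w n) x = ?c * v n x" if x: "x \<in> ball x0 R" for n x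
    proof -
      have "mollify eta R (w n) x = mollify eta R (v n) x"
        using sub(1)[OF x] by (intro mollify_cong[OF eta_kern R(1)]) (auto simp: w_def subset_iff)
      then show ?thesis using mean_value_harmonic[OF R(1) S sub(2)[OF x] v] by simp
    qed
    have mu: "mollify eta R u0 x = ?c * u x" if x: "x \<in> ball x0 R" for x
    proof -
      have "x \<in> S" using x R e by auto
      then have "(\<lambda>n. ?c * v n x) \<longlonglongrightarrow> ?c * u x" by (intro tendsto_intros lim)
      then show ?thesis using cvl[OF eta_kern, of x] LIMSEQ_unique unfolding mv[OF x] by blast
    qed
    have lapl: "laplacian (mollify eta R h) x = (\<Sum>i\<in>Basis. mollify (eta_hess i i) R h x / R\<^sup>2)" "Ck_on 2 (mollify eta R h) UNIV"
      if "integrable lebesgue h" for h x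
      using has_hess_on_Ck[OF open_UNIV mollify_has_hess[OF eta_kern2 R(1) that]] by auto
    have l0: "laplacian (mollify eta R (w n)) x = 0" if x: "x \<in> ball x0 R" for n x
    proof -
      have "ball x0 R \<subseteq> cball x0 e" using R by auto
      then have "Ck_on 2 (v n) (ball x0 R)" using Ck2_subset[OF v(1)] e(2) by blast
      note sc = Ck2_scale[OF open_ball this, where a="?c"]
      have "laplacian (mollify eta R (w n)) x = laplacian (\<lambda>x. ?c * v n x) x"
        by (rule Ck2_cong(2)[OF open_ball sc(1) _ x]) (simp add: mv)
      also have "\<dots> = ?c * laplacian (v n) x" by (rule sc(2)[OF x])
      also have "x \<in> S" using x R e by auto
      then have "?c * laplacian (v n) x = 0" by (simp add: v(2))
      finally show ?thesis .
    qed
    have u_l0: "laplacian (mollify eta R u0) x = 0" if x: "x \<in> ball x0 R" for x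
    proof -
      have "(\<lambda>n. \<Sum>i\<in>Basis. mollify (eta_hess i i) R (w n) x / R\<^sup>2) \<longlonglongrightarrow> (\<Sum>i\<in>Basis. mollify (eta_hess i i) R u0 x / R\<^sup>2)"
        using R by (intro tendsto_intros cvl kern2D(4)[OF eta_kern2]) auto
      then have "(\<lambda>n. laplacian (mollify eta R (w n)) x) \<longlonglongrightarrow> laplacian (mollify eta R u0) x"
        unfolding lapl(1)[OF iw] lapl(1)[OF iu] .
      then show ?thesis unfolding l0[OF x] by (simp add: LIMSEQ_const_iff)
    qed
    have "Ck_on 2 (mollify eta R u0) (ball x0 R)" using Ck2_subset[OF lapl(2)[OF iu]] by simp
    note sc = Ck2_scale[OF open_ball this, where a="inverse ?c"]
    have eq: "inverse ?c * mollify eta R u0 x = u x" if "x \<in> ball x0 R" for x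
      using mu[OF that] eta_mass_pos[where 'a='a] by simp
    note C = Ck2_cong[OF open_ball sc(1) eq]
    have "laplacian u x = 0" if "x \<in> ball x0 R" for x
      using C(2)[OF _ that] sc(2)[OF that] u_l0[OF that] by simp
    then show ?thesis using C(1) R(1) by (intro exI[of _ "ball x0 R"]) auto
  qed
  then show "Ck_on 2 u S" "\<And>y. y \<in> S \<Longrightarrow> laplacian u y = 0" by (meson Ck2_local)+
qed

lemma gradient_bound_lipschitz:
  fixes u :: "'a::euclidean_space \<Rightarrow> real" and e :: real
  assumes "has_grad_on u d UNIV" "\<And>i x. i \<in> Basis \<Longrightarrow> \<bar>d i x\<bar> \<le> e"
  shows "\<bar>u w - u z\<bar> \<le> DIM('a) * e * norm (w - z)"
proof -
  have e0: "0 \<le> e" using assms(2)[OF SOME_Basis, of 0] by linarith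
  have "norm (u w - u z) \<le> DIM('a) * e * norm (w - z)"
  proof (rule differentiable_bound[OF convex_UNIV, where f'="\<lambda>x v. \<Sum>i\<in>Basis. (v \<bullet> i) * d i x"])
    fix x :: 'a
    show "(u has_derivative (\<lambda>v. \<Sum>i\<in>Basis. (v \<bullet> i) * d i x)) (at x within UNIV)"
      using has_grad_onD[OF assms(1)] by simp
    show "onorm (\<lambda>v. \<Sum>i\<in>Basis. (v \<bullet> i) * d i x) \<le> DIM('a) * e"
    proof (rule onorm_bound)
      fix v :: 'a
      have "norm (\<Sum>i\<in>Basis. (v \<bullet> i) * d i x) \<le> (\<Sum>i\<in>(Basis::'a set). norm v * e)"
        by (rule sum_norm_le) (use assms(2) Basis_le_norm[of _ v] in \<open>auto simp: abs_mult intro!: mult_mono\<close>)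
      then show "norm (\<Sum>i\<in>Basis. (v \<bullet> i) * d i x) \<le> DIM('a) * e * norm v" by (simp add: mult_ac)
    qed (use e0 in simp)
  qed auto
  then show ?thesis by simp
qed

lemma mollify_lipschitz:
  fixes K :: "'a::euclidean_space \<Rightarrow> real"
  assumes K: "kern2 K d D" and M: "\<And>i z. i \<in> Basis \<Longrightarrow> \<bar>d i z\<bar> \<le> M" and r: "0 < r"
    and h: "integrable lebesgue h" and B: "\<And>y. \<bar>h y\<bar> \<le> B"
  shows "\<bar>mollify K r h w - mollify K r h z\<bar> \<le> DIM('a) * (M * ball_vol TYPE('a) * B / r) * norm (w - z)"
proof (rule gradient_bound_lipschitz)
  show "has_grad_on (mollify K r h) (\<lambda>i x. mollify (d i) r h x / r) UNIV"
    using mollify_has_hess[OF K r h] by (simp add: has_hess_on_def)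
  fix i x :: 'a assume i: "i \<in> Basis"
  have "0 \<le> B" using B[of 0] by linarith
  then have "\<bar>mollify (d i) r h x\<bar> \<le> M * ball_vol TYPE('a) * B"
    using B M[OF i] by (intro mollify_bound[OF kern2D(3)[OF K i] r]) auto
  then show "\<bar>mollify (d i) r h x / r\<bar> \<le> M * ball_vol TYPE('a) * B / r" using r by (simp add: divide_right_mono)
qed

text \<open>In the representation at scale R the mollified part has a Lipschitz constant of order A
  / R. The k-th correction has weight (R / 2^k)^2 against a Lipschitz constant of order B / (R /
  2^k), which leaves a geometric series. The quantifiers stay inside the statement so that L depends
  on R alone and serves whole sequences of functions.\<close>

lemma interior_lipschitz:
  assumes "0 < R"
  shows "\<exists>L>0. \<forall>(v::'a::euclidean_space \<Rightarrow> real) S x0 A B. open S \<longrightarrow> cball x0 (2 * R) \<subseteq> S \<longrightarrow> Ck_on 2 v S \<longrightarrow>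
     (\<forall>y\<in>S. \<bar>v y\<bar> \<le> A) \<longrightarrow> (\<forall>y\<in>S. \<bar>laplacian v y\<bar> \<le> B) \<longrightarrow>
     (\<forall>x\<in>ball x0 R. \<forall>y\<in>ball x0 R. \<bar>v x - v y\<bar> \<le> L * (A + B) * norm (x - y))"
proof -
  obtain M1 where M1: "0 < M1" "\<And>i z. i \<in> Basis \<Longrightarrow> \<bar>eta_grad (i::'a) z\<bar> \<le> M1"
    using kern2_bounded[OF eta_kern2] by metis
  obtain M2 where M2: "0 < M2" "\<And>i z. i \<in> Basis \<Longrightarrow> \<bar>Phi_grad (i::'a) z\<bar> \<le> M2"
    using kern2_bounded[OF Phi_kern2] by metis
  let ?c = "eta_mass TYPE('a)" and ?V = "ball_vol TYPE('a)" and ?N = "real DIM('a)"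
  have c: "0 < ?c" and V: "0 < ?V" by (rule eta_mass_pos ball_vol_pos)+
  define L1 where "L1 = ?N * M1 * ?V / R"
  define L2 where "L2 = ?N * M2 * ?V * R"
  define L where "L = (L1 + 2 * L2) / ?c"
  have L12: "0 < L1" "0 < L2" using assms M1 M2 V by (auto simp: L1_def L2_def)
  show ?thesis
  proof (intro exI[of _ L] conjI allI impI ballI)
    show "0 < L" using L12 c by (simp add: L_def)
    fix v :: "'a \<Rightarrow> real" and S x0 A B x y
    assume S: "open S" "cball x0 (2 * R) \<subseteq> S" and v: "Ck_on 2 v S"
      and A': "\<forall>y\<in>S. \<bar>v y\<bar> \<le> A" and B': "\<forall>y\<in>S. \<bar>laplacian v y\<bar> \<le> B"
      and x: "x \<in> ball x0 R" and y: "y \<in> ball x0 R"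
    have A: "\<And>y. y \<in> S \<Longrightarrow> \<bar>v y\<bar> \<le> A" and B: "\<And>y. y \<in> S \<Longrightarrow> \<bar>laplacian v y\<bar> \<le> B"
      using A' B' by blast+
    let ?C = "cball x0 (2 * R)"
    have "x0 \<in> S" using S(2) assms by auto
    then have AB: "0 \<le> A" "0 \<le> B" using A[of x0] B[of x0] by linarith+
    define v0 where "v0 = (\<lambda>y. if y \<in> ?C then v y else 0)"
    define h0 where "h0 = (\<lambda>y. if y \<in> ?C then laplacian v y else 0)"
    have iv: "integrable lebesgue v0" "integrable lebesgue h0"
      unfolding v0_def h0_def using Ck2_continuous[OF v] laplacian_continuous[OF v] S(2)
      by (intro integrable_restrict_compact compact_cball; blast intro: continuous_on_subset)+
    have b: "\<bar>v0 z\<bar> \<le> A" "\<bar>h0 z\<bar> \<le> B" for z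
      using A B AB S(2) by (auto simp: v0_def h0_def)
    have sub: "cball z R \<subseteq> ?C" if "z \<in> ball x0 R" for z
    proof
      fix q assume "q \<in> cball z R"
      then show "q \<in> ?C" using that dist_triangle[of x0 q z] by simp
    qed
    have rk: "0 < R / 2 ^ k" "R / 2 ^ k \<le> R" for k using assms by (auto simp: field_simps)
    have rep: "(\<lambda>k. (R / 2 ^ k)\<^sup>2 * mollify Phi (R / 2 ^ k) h0 z) sums (mollify eta R v0 z - ?c * v z)" if z: "z \<in> ball x0 R" for z
    proof -
      have "mollify eta R v z = mollify eta R v0 z"
        using sub[OF z] assms by (intro mollify_cong[OF eta_kern]) (auto simp: v0_def subset_iff)
      moreover have "mollify Phi (R / 2 ^ k) (laplacian v) z = mollify Phi (R / 2 ^ k) h0 z" for k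
        using sub[OF z] rk[of k] by (intro mollify_cong[OF kern2D(2)[OF Phi_kern2]]) (auto simp: h0_def subset_iff)
      ultimately show ?thesis using representation[OF assms S(1) _ v, of z] sub[OF z] S(2) by auto
    qed
    have "(\<lambda>k. (R / 2 ^ k)\<^sup>2 * mollify Phi (R / 2 ^ k) h0 x - (R / 2 ^ k)\<^sup>2 * mollify Phi (R / 2 ^ k) h0 y) sums
        ((mollify eta R v0 x - ?c * v x) - (mollify eta R v0 y - ?c * v y))"
      by (rule sums_diff[OF rep[OF x] rep[OF y]])
    moreover have "(\<lambda>k. L2 * B * norm (x - y) * (1 / 2) ^ k) sums (L2 * B * norm (x - y) * (1 / (1 - 1 / 2)))"
      by (intro sums_mult geometric_sums) simp
    moreover have "\<bar>(R / 2 ^ k)\<^sup>2 * mollify Phi (R / 2 ^ k) h0 x - (R / 2 ^ k)\<^sup>2 * mollify Phi (R / 2 ^ k) h0 y\<bar> \<le> L2 * B * norm (x - y) * (1 / 2) ^ k" for k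
    proof -
      have "\<bar>mollify Phi (R / 2 ^ k) h0 x - mollify Phi (R / 2 ^ k) h0 y\<bar> \<le> ?N * (M2 * ?V * B / (R / 2 ^ k)) * norm (x - y)"
        by (rule mollify_lipschitz[OF Phi_kern2 M2(2) rk(1) iv(2) b(2)])
      then have "(R / 2 ^ k)\<^sup>2 * \<bar>mollify Phi (R / 2 ^ k) h0 x - mollify Phi (R / 2 ^ k) h0 y\<bar> \<le> (R / 2 ^ k)\<^sup>2 * (?N * (M2 * ?V * B / (R / 2 ^ k)) * norm (x - y))"
        by (rule mult_left_mono) simp
      also have "\<dots> = L2 * B * norm (x - y) * (1 / 2) ^ k"
        using assms by (simp add: L2_def power2_eq_square power_divide)
      finally show ?thesis by (simp add: abs_mult right_diff_distrib[symmetric])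
    qed
    ultimately have D: "\<bar>(mollify eta R v0 x - ?c * v x) - (mollify eta R v0 y - ?c * v y)\<bar> \<le> L2 * B * norm (x - y) * (1 / (1 - 1 / 2))"
      using norm_sums_le by fastforce
    have "\<bar>mollify eta R v0 x - mollify eta R v0 y\<bar> \<le> ?N * (M1 * ?V * A / R) * norm (x - y)"
      by (rule mollify_lipschitz[OF eta_kern2 M1(2) assms iv(1) b(1)])
    then have "\<bar>mollify eta R v0 x - mollify eta R v0 y\<bar> \<le> L1 * A * norm (x - y)" by (simp add: L1_def)
    with D have "\<bar>?c * v x - ?c * v y\<bar> \<le> L1 * A * norm (x - y) + 2 * L2 * B * norm (x - y)" by (simp add: abs_le_iff algebra_simps)
    also have "\<dots> \<le> (L1 + 2 * L2) * A * norm (x - y) + (L1 + 2 * L2) * B * norm (x - y)"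
      using L12 AB by (intro add_mono mult_right_mono) auto
    also have "\<dots> = (L1 + 2 * L2) * (A + B) * norm (x - y)" by (simp add: algebra_simps)
    also have "\<bar>?c * v x - ?c * v y\<bar> = ?c * \<bar>v x - v y\<bar>"
      using c by (simp add: abs_mult right_diff_distrib[symmetric])
    finally have "?c * \<bar>v x - v y\<bar> \<le> (L1 + 2 * L2) * (A + B) * norm (x - y)" .
    then show "\<bar>v x - v y\<bar> \<le> L * (A + B) * norm (x - y)"
      using c by (simp add: L_def pos_le_divide_eq mult.commute)
  qed
qed

text \<open>By continuity the exceptional set is open, and an open null set is empty.\<close>

lemma AE_open_mem_closed:
  fixes f :: "'a::euclidean_space \<Rightarrow> real"
  assumes S: "open S" and f: "continuous_on S f" and C: "closed C"
    and ae: "AE y in lebesgue. y \<in> S \<longrightarrow> f y \<in> C" and x: "x \<in> S"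
  shows "f x \<in> C"
proof -
  have "open {y \<in> S. f y \<in> - C}"
    using continuous_open_preimage[OF f S, of "- C"] C by (simp add: open_Compl vimage_def Int_def)
  then have "closed (- {y \<in> S. f y \<in> - C})" by (rule closed_Compl)
  moreover have "AE y\<in>S in lebesgue. y \<in> - {y \<in> S. f y \<in> - C}"
    using ae by eventually_elim simp
  ultimately have "x \<in> - {y \<in> S. f y \<in> - C}" using mem_closed_if_AE_lebesgue_open[OF S _ _ x] by blast
  then show ?thesis using x by simp
qed

text \<open>Strong minimum principle. At a zero of v the mean of v weighted by \<open>eta\<close> is
  nonpositive; as v is nonnegative and \<open>eta\<close> is positive on the open unit ball, v
  vanishes on a whole ball. The zero set is thus open as well as relatively closed, and
  connectedness would force v = 0 throughout, against the nonzero Laplacian at p.\<close>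

lemma superharmonic_positive:
  fixes v :: "'a::euclidean_space \<Rightarrow> real"
  assumes S: "open S" "connected S" and v: "Ck_on 2 v S" "\<And>x. x \<in> S \<Longrightarrow> laplacian v x \<le> 0" "\<And>x. x \<in> S \<Longrightarrow> 0 \<le> v x"
    and ne: "p \<in> S" "laplacian v p \<noteq> 0" and x: "x \<in> S"
  shows "0 < v x"
proof (rule ccontr)
  assume "\<not> ?thesis"
  then have x0: "v x = 0" using v(3)[OF x] by simp
  define Z where "Z = {y \<in> S. v y = 0}"
  have "open Z"
    unfolding open_contains_ball
  proof
    fix y assume y: "y \<in> Z"
    then have "y \<in> S" by (simp add: Z_def)
    then obtain e where e: "0 < e" "cball y e \<subseteq> S" using S(1) open_contains_cball by blast
    define w where "w = (\<lambda>z. if z \<in> cball y e then v z else 0)"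
    have w0: "0 \<le> w z" for z using v(3) e(2) by (auto simp: w_def)
    have iw: "integrable lebesgue w"
      unfolding w_def using Ck2_continuous[OF v(1)] e(2)
      by (intro integrable_restrict_compact compact_cball) (blast intro: continuous_on_subset)
    have "mollify eta e v y \<le> 0" using mean_value_superharmonic[OF e(1) S(1) e(2) v(1,2)] y by (simp add: Z_def)
    moreover have "mollify eta e v y = mollify eta e w y" by (rule mollify_cong[OF eta_kern e(1)]) (simp add: w_def)
    moreover have "0 \<le> (LINT z|lebesgue. eta (inverse e *\<^sub>R (y - z)) * w z)"
      using w0 eta_nonneg by (intro Bochner_Integration.integral_nonneg mult_nonneg_nonneg) auto
    moreover have "(LINT z|lebesgue. eta (inverse e *\<^sub>R (y - z)) * w z) = e ^ DIM('a) * mollify eta e w y"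
      using e(1) by (simp add: mollify_def)
    ultimately have "(LINT z|lebesgue. eta (inverse e *\<^sub>R (y - z)) * w z) = 0"
      using zero_less_power[OF e(1), of "DIM('a)"] by (metis mult_nonneg_nonpos order_antisym order_less_imp_le)
    moreover have "AE z in lebesgue. 0 \<le> eta (inverse e *\<^sub>R (y - z)) * w z"
      by (intro AE_I2 mult_nonneg_nonneg eta_nonneg w0)
    ultimately
    have ae: "AE z in lebesgue. eta (inverse e *\<^sub>R (y - z)) * w z = 0"
      using integral_nonneg_eq_0_iff_AE[OF mollify_integrable[OF eta_kern e(1) iw, of y]] by blast
    have "v z = 0" if z: "z \<in> ball y e" for z
    proof -
      have "v z \<in> {0}"
      proof (rule AE_open_mem_closed[OF open_ball, where f=v])
        show "AE z in lebesgue. z \<in> ball y e \<longrightarrow> v z \<in> {0}"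
          using ae
        proof eventually_elim
          case (elim z)
          show ?case
          proof
            assume z: "z \<in> ball y e"
            have "norm (inverse e *\<^sub>R (y - z)) < 1"
              using z e(1) unfolding norm_inverse_scaleR[OF e(1)] by (simp add: dist_norm)
            then have "inverse e *\<^sub>R (y - z) \<bullet> inverse e *\<^sub>R (y - z) < 1"
              unfolding dot_square_norm by (simp add: power_less_one_iff abs_square_less_1)
            then have "0 < eta (inverse e *\<^sub>R (y - z))" unfolding eta_def by (rule e0_pos)
            then show "v z \<in> {0}" using elim z by (simp add: w_def)
          qed
        qed
        show "continuous_on (ball y e) v" using Ck2_continuous[OF v(1)] e(2) ball_subset_cball by (blast intro: continuous_on_subset)
      qed (use z in auto)
      then show ?thesis by simp
    qed
    then show "\<exists>e>0. ball y e \<subseteq> Z" using e ball_subset_cball unfolding Z_def by (intro exI[of _ e]) blast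
  qed
  moreover have "open {y \<in> S. v y \<noteq> 0}"
    using continuous_open_preimage[OF Ck2_continuous[OF v(1)] S(1), of "- {0}"] by (auto simp: vimage_def Int_def)
  ultimately have "{y \<in> S. v y \<noteq> 0} = {}"
    using connectedD[OF S(2), of Z "{y \<in> S. v y \<noteq> 0}"] x x0 by (auto simp: Z_def)
  then have "v y = 0" if "y \<in> S" for y using that by blast
  then have "laplacian v p = laplacian (\<lambda>_. 0) p"
    using Ck2_cong(2)[OF S(1) Ck2_const(1)[OF S(1), of 0] _ ne(1), of v] by simp
  then show False using ne Ck2_const(2)[OF S(1)] by simp
qed

section \<open>The Newton potential of a locally Hoelder function\<close>

text \<open>Radius, exponent and constant may depend on the point: the interior estimates give no
  Hoelder control up to the boundary.\<close>

definition loc_hoelder :: "'a::euclidean_space set \<Rightarrow> ('a \<Rightarrow> real) \<Rightarrow> bool" where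
  "loc_hoelder S h \<longleftrightarrow> (\<forall>x\<in>S. \<exists>r>0. \<exists>\<gamma>>0. \<exists>C\<ge>0. ball x r \<subseteq> S \<and>
     (\<forall>y\<in>ball x r. \<forall>z\<in>ball x r. \<bar>h y - h z\<bar> \<le> C * dist y z powr \<gamma>))"

lemma loc_hoelder_isCont:
  assumes "loc_hoelder S h" "x \<in> S"
  shows "isCont h x"
proof -
  obtain r \<gamma> C where r: "0 < r" "0 < \<gamma>" "0 \<le> C" and h: "\<And>y z. y \<in> ball x r \<Longrightarrow> z \<in> ball x r \<Longrightarrow> \<bar>h y - h z\<bar> \<le> C * dist y z powr \<gamma>"
    using assms unfolding loc_hoelder_def by metis
  have "((\<lambda>y. h y - h x) \<longlongrightarrow> 0) (at x)"
  proof (rule Lim_null_comparison)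
    show "\<forall>\<^sub>F y in at x. norm (h y - h x) \<le> C * dist y x powr \<gamma>"
      unfolding eventually_at using r(1) h[of _ x] by (intro exI[of _ r]) (auto simp: dist_commute)
    show "((\<lambda>y. C * dist y x powr \<gamma>) \<longlongrightarrow> 0) (at x)"
      using r(2) by (auto intro!: tendsto_eq_intros tendsto_powr'[where a=0 and b=\<gamma>])
  qed
  then show ?thesis by (simp add: isCont_def LIM_zero_iff)
qed

lemma integral_hess_zero:
  assumes "kern2 K d D" "i \<in> Basis" "j \<in> Basis"
  shows "(LINT y|lebesgue. D i j y) = 0"
proof (rule integral_grad_zero[OF kern2D(3)[OF assms(1,2)] _ kern2D(4)[OF assms(1,2)] assms(3)])
  show "has_grad_on (d i) (D i) UNIV" using assms by (simp add: kern2_def has_hess_on_def)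
qed

text \<open>Summed over the dyadic scales \<open>R / 2\<^sup>k\<close>, the identity for the Laplacian of \<open>Phi\<close> telescopes to
  \<open>mollify eta R h - eta_mass * h\<close>. The Hoelder bound makes the sum of the second derivatives converge,
  because the second derivatives of \<open>Phi\<close> have mean zero.\<close>

lemma newton_potential:
  fixes h :: "'a::euclidean_space \<Rightarrow> real"
  defines "N R \<equiv> (\<lambda>x. \<Sum>k. (R / 2 ^ k)\<^sup>2 * mollify Phi (R / 2 ^ k) h x)"
  assumes R: "0 < R" and h: "integrable lebesgue h" and B: "\<And>y. \<bar>h y\<bar> \<le> B"
    and S: "open S" and hoel: "loc_hoelder S h"
  shows "continuous_on T (N R)" "Ck_on 2 (N R) S"
    "\<And>x. x \<in> S \<Longrightarrow> laplacian (N R) x = mollify eta R h x - eta_mass TYPE('a) * h x"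
proof -
  have B0: "0 \<le> B" using B[of 0] by linarith
  obtain M where M: "0 < M" "\<And>z::'a. \<bar>Phi z\<bar> \<le> M" "\<And>i z::'a. i \<in> Basis \<Longrightarrow> \<bar>Phi_grad i z\<bar> \<le> M"
    "\<And>i j z::'a. i \<in> Basis \<Longrightarrow> j \<in> Basis \<Longrightarrow> \<bar>Phi_hess i j z\<bar> \<le> M"
    using kern2_bounded[OF Phi_kern2] by metis
  define V where "V = ball_vol TYPE('a)"
  have V: "0 < V" unfolding V_def by (rule ball_vol_pos)
  define r where "r = (\<lambda>k::nat. R / 2 ^ k)"
  have r: "0 < r k" "r k \<le> R" for k using R by (auto simp: r_def field_simps)
  define f where "f = (\<lambda>k x. (r k)\<^sup>2 * mollify Phi (r k) h x)"
  define d where "d = (\<lambda>k i x. r k * mollify (Phi_grad i) (r k) h x)"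
  define D where "D = (\<lambda>k i j x. mollify (Phi_hess i j) (r k) h x)"
  have NR: "N R = (\<lambda>x. \<Sum>k. f k x)" by (simp add: N_def f_def r_def)
  have fb: "\<bar>f k x\<bar> \<le> (r k)\<^sup>2 * (M * V * B)" for k x
    unfolding f_def abs_mult V_def using mollify_bound[OF kern2D(2)[OF Phi_kern2] r(1) M(2), of x k h B] B B0
    by (auto intro!: mult_left_mono)
  have db: "\<bar>d k i x\<bar> \<le> r k * (M * V * B)" if "i \<in> Basis" for k i x
    unfolding d_def abs_mult V_def using mollify_bound[OF kern2D(3)[OF Phi_kern2 that] r(1) M(3)[OF that], of x k h B] B B0 r(1)[of k]
    by (auto intro!: mult_left_mono)
  have Db: "\<bar>D k i j x\<bar> \<le> M * V * B" if "i \<in> Basis" "j \<in> Basis" for k i j x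
    unfolding D_def V_def using mollify_bound[OF kern2D(4)[OF Phi_kern2 that] r(1) M(4)[OF that], of x k h B] B B0 by auto
  have hess: "has_hess_on (f k) (d k) (D k) U" for k U
  proof -
    note H = mollify_has_hess[OF Phi_kern2 r(1)[of k] h]
    have "has_hess_on (\<lambda>x. (r k)\<^sup>2 * mollify Phi (r k) h x + 0 * mollify Phi (r k) h x)
      (\<lambda>i x. (r k)\<^sup>2 * (mollify (Phi_grad i) (r k) h x / r k) + 0 * (mollify (Phi_grad i) (r k) h x / r k))
      (\<lambda>i j x. (r k)\<^sup>2 * (mollify (Phi_hess i j) (r k) h x / (r k)\<^sup>2) + 0 * (mollify (Phi_hess i j) (r k) h x / (r k)\<^sup>2)) UNIV"
      by (rule has_hess_on_lincomb[OF H H])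
    moreover have "(r k)\<^sup>2 * (a / r k) = r k * a" "(r k)\<^sup>2 * (a / (r k)\<^sup>2) = a" for a
      using r(1)[of k] by (auto simp: power2_eq_square)
    ultimately have "has_hess_on (f k) (d k) (D k) UNIV" unfolding f_def d_def D_def by simp
    then show ?thesis using has_hess_on_subset by blast
  qed
  have q2: "(r k)\<^sup>2 = R\<^sup>2 * (1/4) ^ k" and q1: "r k = R * (1/2) ^ k" for k
  proof -
    show "r k = R * (1/2) ^ k" by (simp add: r_def power_divide)
    then show "(r k)\<^sup>2 = R\<^sup>2 * (1/4) ^ k" by (simp add: power_mult_distrib power2_eq_square power_mult_distrib[symmetric])
  qed
  have s2: "summable (\<lambda>k. (r k)\<^sup>2)" unfolding q2 by (intro summable_mult summable_geometric) simp
  have s1: "summable r" unfolding q1[abs_def] by (intro summable_mult summable_geometric) simp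
  show "continuous_on T (N R)"
    unfolding NR
  proof (rule continuous_on_suminf_bounded)
    show "summable (\<lambda>k. (r k)\<^sup>2 * (M * V * B))" using s2 by (rule summable_mult2)
    show "continuous_on T (f k)" for k
      using hess[of k T] has_grad_on_continuous unfolding has_hess_on_def by blast
  qed (rule fb)
  have main: "\<exists>U. open U \<and> x0 \<in> U \<and> Ck_on 2 (N R) U \<and> (\<forall>x\<in>U. laplacian (N R) x = mollify eta R h x - eta_mass TYPE('a) * h x)"
    if x0: "x0 \<in> S" for x0
  proof -
    obtain p \<gamma> C where p: "0 < p" "0 < \<gamma>" "0 \<le> C" "ball x0 p \<subseteq> S"
      and hC: "\<And>y z. y \<in> ball x0 p \<Longrightarrow> z \<in> ball x0 p \<Longrightarrow> \<bar>h y - h z\<bar> \<le> C * dist y z powr \<gamma>"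
      using hoel x0 unfolding loc_hoelder_def by metis
    define q where "q = p / 2"
    have q: "0 < q" "q + q = p" using p by (auto simp: q_def)
    \<comment> \<open>One majorant for values, gradients and Hessians at once. The last summand
      covers the finitely many coarse scales r k > q, at which the mollification ball may leave the
      neighbourhood with the Hoelder bound.\<close>
    define A where "A = (\<lambda>k. (r k)\<^sup>2 * (M * V * B) + r k * (M * V * B) + M * V * (C * r k powr \<gamma>) + (if r k \<le> q then 0 else M * V * B))"
    have "(\<lambda>k. r k powr \<gamma>) = (\<lambda>k. R powr \<gamma> * ((1/2) powr \<gamma>) ^ k)"
      using R by (simp add: q1 powr_mult powr_power[symmetric] powr_realpow[symmetric] powr_powr mult.commute)
    moreover have "(1/2::real) powr \<gamma> < 1" using powr_less_mono2[of \<gamma> "1/2" 1] p(2) by simp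
    ultimately have sg: "summable (\<lambda>k. r k powr \<gamma>)" by (simp add: summable_mult summable_geometric)
    have "r \<longlonglongrightarrow> 0" using s1 by (rule summable_LIMSEQ_zero)
    then have "\<forall>\<^sub>F k in sequentially. r k < q" using q(1) by (simp add: order_tendsto_iff)
    then obtain k0 where k0: "\<And>k. k \<ge> k0 \<Longrightarrow> r k < q" by (auto simp: eventually_sequentially)
    have sf: "summable (\<lambda>k. if r k \<le> q then 0 else M * V * B)"
      by (rule summable_finite[of "{..<k0}"]) (use k0 in \<open>force simp: not_less[symmetric]\<close>)+
    have sA: "summable A"
      unfolding A_def by (intro summable_add summable_mult2 summable_mult s1 s2 sg sf)
    have pos: "0 \<le> (r k)\<^sup>2 * (M * V * B)" "0 \<le> r k * (M * V * B)" "0 \<le> M * V * (C * r k powr \<gamma>)" "0 \<le> M * V * B" for k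
      using M(1) V B0 p(3) r(1)[of k] by auto
    have "a \<le> a + b + c + (if P then 0 else e) \<and> b \<le> a + b + c + (if P then 0 else e) \<and> c \<le> a + b + c + (if P then 0 else e) \<and>
        (\<not> P \<longrightarrow> e \<le> a + b + c + (if P then 0 else e))"
      if "0 \<le> a" "0 \<le> b" "0 \<le> c" "0 \<le> e" for a b c e :: real and P
      using that by auto
    from this[OF pos] have Ak: "(r k)\<^sup>2 * (M * V * B) \<le> A k" "r k * (M * V * B) \<le> A k" "M * V * (C * r k powr \<gamma>) \<le> A k"
      "\<not> r k \<le> q \<Longrightarrow> M * V * B \<le> A k" for k
      unfolding A_def by blast+
    have b1: "\<bar>f k x\<bar> \<le> A k" for k x using order_trans[OF fb Ak(1)] .
    have b2: "\<bar>d k i x\<bar> \<le> A k" if "i \<in> Basis" for k i x using order_trans[OF db[OF that] Ak(2)] .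
    have b3: "\<bar>D k i j x\<bar> \<le> A k" if ij: "i \<in> Basis" "j \<in> Basis" and x: "x \<in> ball x0 q" for k i j x
    proof (cases "r k \<le> q")
      case True
      have "\<bar>h y - h x\<bar> \<le> C * r k powr \<gamma>" if y: "y \<in> ball x (r k)" for y
      proof -
        have "dist x0 y < p" using y x True q(2) dist_triangle[of x0 y x] by simp
        then have "\<bar>h y - h x\<bar> \<le> C * dist y x powr \<gamma>" using x q by (intro hC) auto
        also have "\<dots> \<le> C * r k powr \<gamma>" using y p by (intro mult_left_mono powr_mono2) (auto simp: dist_commute)
        finally show ?thesis .
      qed
      then have "\<bar>mollify (Phi_hess i j) (r k) h x - h x * (LINT y|lebesgue. Phi_hess i j y)\<bar> \<le> M * ball_vol TYPE('a) * (C * r k powr \<gamma>)"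
        using p(3) by (intro mollify_approx[OF kern2D(4)[OF Phi_kern2 ij] M(4)[OF ij] r(1) h]) auto
      then show ?thesis using Ak(3)[of k] by (simp add: integral_hess_zero[OF Phi_kern2 ij] D_def V_def)
    next
      case False
      then show ?thesis using order_trans[OF Db[OF ij] Ak(4)] by blast
    qed
    have H: "has_hess_on (N R) (\<lambda>i x. \<Sum>k. d k i x) (\<lambda>i j x. \<Sum>k. D k i j x) (ball x0 q)"
      unfolding NR by (rule has_hess_on_suminf[OF open_ball hess sA b1 b2 b3])
    have "laplacian (N R) x = mollify eta R h x - eta_mass TYPE('a) * h x" if x: "x \<in> ball x0 q" for x
    proof -
      have "laplacian (N R) x = (\<Sum>i\<in>Basis. \<Sum>k. D k i i x)"
        by (rule has_hess_on_Ck(2)[OF open_ball H x])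
      also have "\<dots> = (\<Sum>k. \<Sum>i\<in>Basis. D k i i x)"
        by (rule suminf_sum[symmetric]) (rule summable_comparison_test'[OF sA, of 0], use b3 x in auto)
      also have "(\<lambda>k. \<Sum>i\<in>Basis. D k i i x) = (\<lambda>k. mollify eta (R / 2 ^ k) h x - mollify eta (R / 2 ^ Suc k) h x)"
      proof
        fix k
        have "(\<Sum>i\<in>Basis. D k i i x) = mollify (\<lambda>z. \<Sum>i\<in>Basis. Phi_hess i i z) (r k) h x"
          unfolding D_def by (rule mollify_sum[symmetric, OF _ r(1) h]) (rule kern2D(4)[OF Phi_kern2])
        also have "\<dots> = mollify eta (r k) h x - mollify eta (r k / 2) h x" by (rule mollify_Phi_laplacian[OF r(1) h])
        finally show "(\<Sum>i\<in>Basis. D k i i x) = mollify eta (R / 2 ^ k) h x - mollify eta (R / 2 ^ Suc k) h x"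
          by (simp add: r_def mult.commute)
      qed
      also have "(\<Sum>k. mollify eta (R / 2 ^ k) h x - mollify eta (R / 2 ^ Suc k) h x) = mollify eta (R / 2 ^ 0) h x - eta_mass TYPE('a) * h x"
      proof (rule sums_unique[symmetric, OF telescope_sums'[OF mollify_eta_tendsto[OF R h]]])
        have "x \<in> S" using x p q by auto
        then show "isCont h x" by (rule loc_hoelder_isCont[OF hoel])
      qed
      finally show ?thesis by simp
    qed
    then show ?thesis using has_hess_on_Ck(1)[OF open_ball H] q(1) by (intro exI[of _ "ball x0 q"]) auto
  qed
  then show "Ck_on 2 (N R) S" "\<And>x. x \<in> S \<Longrightarrow> laplacian (N R) x = mollify eta R h x - eta_mass TYPE('a) * h x"
    by (meson Ck2_local)+
qed

section \<open>The Dirichlet and Poisson problems\<close>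

text \<open>An injective linear map of a finite-dimensional space sends a basis to an independent
  set of the same size, hence to a spanning set. The map is asked to be linear only on the span,
  because the Laplacian is not additive on arbitrary functions; L' is the linear map with the same
  values on a basis.\<close>

lemma (in vector_space) injective_endomorphism_surjective:
  assumes fin: "finite M" and add: "\<And>x y. x \<in> span M \<Longrightarrow> y \<in> span M \<Longrightarrow> L (x + y) = L x + L y"
    and sc: "\<And>c x. x \<in> span M \<Longrightarrow> L (scale c x) = scale c (L x)"
    and into: "\<And>x. x \<in> span M \<Longrightarrow> L x \<in> span M" and inj: "\<And>x. x \<in> span M \<Longrightarrow> L x = 0 \<Longrightarrow> x = 0"
    and y: "y \<in> span M"
  shows "\<exists>x\<in>span M. L x = y"
proof -
  obtain B where B: "B \<subseteq> M" "independent B" "M \<subseteq> span B" using maximal_independent_subset[of M] by blast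
  have finB: "finite B" using B(1) fin finite_subset by blast
  have sp: "span B = span M" using B(1,3) by (simp add: span_eq) (meson span_base subset_iff)
  interpret p: vector_space_pair scale scale by unfold_locales
  define L' where "L' = p.construct B L"
  have lin: "Vector_Spaces.linear scale scale L'" unfolding L'_def by (rule p.linear_construct[OF B(2)])
  have "x \<in> span M \<and> L' x = L x" if "x \<in> span B" for x
    using that
  proof (induction rule: span_induct_alt)
    case base
    have "L 0 = 0" using sc[of 0 0] span_zero by simp
    then show ?case using p.linear_0[OF lin] span_zero by simp
  next
    case (step c x y)
    have m: "x \<in> span M" "y \<in> span M" using step.hyps step.IH B(1) span_base by auto
    then have s: "scale c x + y \<in> span M" by (intro span_add span_scale)
    have "L (scale c x + y) = scale c (L x) + L y" using add[OF span_scale[OF m(1)] m(2)] sc[OF m(1)] by simp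
    moreover have "L' x = L x" unfolding L'_def by (rule p.construct_basis[OF B(2) step.hyps(1)])
    ultimately show ?case using step.IH s p.linear_add[OF lin] p.linear_scale[OF lin] by simp
  qed
  then have eq: "\<And>x. x \<in> span B \<Longrightarrow> L' x = L x" by blast
  have injon: "inj_on L' (span B)"
  proof (rule inj_onI)
    fix a b assume ab: "a \<in> span B" "b \<in> span B" "L' a = L' b"
    then have "L' (a - b) = 0" using p.linear_diff[OF lin] by simp
    moreover have "a - b \<in> span B" using ab span_diff by blast
    ultimately have "a - b = 0" using eq[of "a - b"] inj[of "a - b"] sp by simp
    then show "a = b" by simp
  qed
  have ind: "independent (L' ` B)" by (rule p.linear_independent_injective_image[OF lin B(2) injon])
  have card: "card (L' ` B) = card B"
    using injon span_superset by (intro card_image) (blast intro: inj_on_subset)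
  have sub: "L' ` B \<subseteq> span B"
  proof
    fix z assume "z \<in> L' ` B"
    then obtain b where b: "b \<in> B" "z = L' b" by blast
    then have bs: "b \<in> span B" by (simp add: span_base)
    then show "z \<in> span B" using b(2) eq[OF bs] into[of b] sp by simp
  qed
  have "y \<in> span (L' ` B)"
  proof (rule ccontr)
    assume n: "y \<notin> span (L' ` B)"
    then have "y \<notin> L' ` B" using span_base[of y "L' ` B"] by blast
    moreover have "independent (insert y (L' ` B))" using n ind by (rule independent_insertI)
    moreover have "insert y (L' ` B) \<subseteq> span B" using sub y sp by simp
    ultimately have "card B + 1 \<le> card B"
      using independent_span_bound[OF finB, of "insert y (L' ` B)"] card finB by simp
    then show False by simp
  qed
  then have "y \<in> L' ` span B" using p.linear_span_image[OF lin] by simp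
  then show ?thesis using eq sp by auto
qed

interpretation fs: vector_space "\<lambda>(c::real) (f :: 'a::euclidean_space \<Rightarrow> real) x. c * f x"
  by unfold_locales (auto simp: fun_eq_iff algebra_simps)

text \<open>The monomials of degree at most n, built one coordinate factor at a time. Their span is
  the space of polynomials of degree at most n, and finiteness of the set gives it finite
  dimension.\<close>

fun mon :: "nat \<Rightarrow> ('a::euclidean_space \<Rightarrow> real) set" where
  "mon 0 = {\<lambda>_. 1}"
| "mon (Suc n) = mon n \<union> (\<Union>i\<in>Basis. (\<lambda>q x. (x \<bullet> i) * q x) ` mon n)"

lemma finite_mon: "finite (mon n)"
  by (induction n) auto

declare mon.simps [simp del]

lemma span_mon_Suc: "q \<in> fs.span (mon n) \<Longrightarrow> q \<in> fs.span (mon (Suc n))"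
  using fs.span_mono[of "mon n" "mon (Suc n)"] by (auto simp: mon.simps)

lemma span_mon_mono: "m \<le> n \<Longrightarrow> q \<in> fs.span (mon m) \<Longrightarrow> q \<in> fs.span (mon n)"
  by (induction rule: dec_induct) (auto intro: span_mon_Suc)

lemma span_mon_add: "p \<in> fs.span (mon n) \<Longrightarrow> q \<in> fs.span (mon n) \<Longrightarrow> (\<lambda>x. p x + q x) \<in> fs.span (mon n)"
  using fs.span_add[of p "mon n" q] by (simp add: plus_fun_def)

lemma span_mon_scale: "p \<in> fs.span (mon n) \<Longrightarrow> (\<lambda>x. c * p x) \<in> fs.span (mon n)"
  by (rule fs.span_scale)

lemma span_mon_sum: "(\<And>i. i \<in> I \<Longrightarrow> p i \<in> fs.span (mon n)) \<Longrightarrow> (\<lambda>x. \<Sum>i\<in>I. p i x) \<in> fs.span (mon n)"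
proof (induction I rule: infinite_finite_induct)
  case (insert i I)
  then show ?case using span_mon_add[of "p i" n "\<lambda>x. \<Sum>i\<in>I. p i x"] by simp
qed (use fs.span_zero[of "mon n"] in \<open>simp_all add: zero_fun_def\<close>)

lemma span_mon_zero: "(\<lambda>x. 0) \<in> fs.span (mon n)"
  using fs.span_zero[of "mon n"] by (simp add: zero_fun_def)

lemma span_mon_one: "(\<lambda>x. 1) \<in> fs.span (mon n)"
  by (rule span_mon_mono[of 0]) (auto intro: fs.span_base simp: mon.simps)

lemma span_mon_induct [consumes 1, case_names base zero add scale]:
  assumes "q \<in> fs.span (mon n)" "\<And>q. q \<in> mon n \<Longrightarrow> P q" "P (\<lambda>x. 0)"
    "\<And>p q. P p \<Longrightarrow> P q \<Longrightarrow> P (\<lambda>x. p x + q x)" "\<And>c p. P p \<Longrightarrow> P (\<lambda>x. c * p x)"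
  shows "P q"
proof (rule fs.span_induct[OF assms(1)])
  show "fs.subspace (Collect P)"
    using assms(3-5) by (auto simp: fs.subspace_def zero_fun_def plus_fun_def)
qed (rule assms(2))

lemma span_mon_times_coord:
  assumes "q \<in> fs.span (mon n)" "i \<in> Basis"
  shows "(\<lambda>x. (x \<bullet> i) * q x) \<in> fs.span (mon (Suc n))"
  using assms(1)
proof (induction rule: span_mon_induct)
  case (base q)
  then show ?case using assms(2) by (intro fs.span_base) (auto simp: mon.simps)
next
  case zero
  then show ?case using span_mon_zero by simp
next
  case (add p q)
  then show ?case using span_mon_add by (simp add: distrib_left)
next
  case (scale c p)
  then show ?case using span_mon_scale[of _ _ c] by (simp add: mult.left_commute)
qed

lemma span_mon_mult:
  assumes "p \<in> fs.span (mon m)" "q \<in> fs.span (mon n)"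
  shows "(\<lambda>x. p x * q x) \<in> fs.span (mon (m + n))"
proof -
  have M: "(\<lambda>x. p x * q x) \<in> fs.span (mon (m + n))" if "p \<in> mon m" for p
    using that
  proof (induction m arbitrary: p)
    case 0
    then show ?case using assms(2) by (simp add: mon.simps)
  next
    case (Suc m)
    then consider "p \<in> mon m" | i p' where "i \<in> Basis" "p' \<in> mon m" "p = (\<lambda>x. (x \<bullet> i) * p' x)"
      by (auto simp: mon.simps)
    then show ?case
    proof cases
      case 1
      then show ?thesis using span_mon_Suc[OF Suc.IH[OF 1]] by simp
    next
      case 2
      then show ?thesis using span_mon_times_coord[OF Suc.IH[OF 2(2)] 2(1)] by (simp add: mult.assoc)
    qed
  qed
  show ?thesis
    using assms(1)
  proof (induction rule: span_mon_induct)
    case (base p)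
    then show ?case by (rule M)
  next
    case zero
    then show ?case using span_mon_zero by simp
  next
    case (add p p')
    then show ?case using span_mon_add by (simp add: distrib_right)
  next
    case (scale c p)
    then show ?case using span_mon_scale[of _ _ c] by (simp add: mult.assoc)
  qed
qed

lemma linear_in_span_mon:
  fixes f :: "'a::euclidean_space \<Rightarrow> real"
  assumes "linear f" shows "f \<in> fs.span (mon 1)"
proof -
  define c where "c = f"
  have "f x = (\<Sum>i\<in>Basis. c i * ((x \<bullet> i) * 1))" for x
  proof -
    have "f (\<Sum>i\<in>Basis. (x \<bullet> i) *\<^sub>R i) = (\<Sum>i\<in>Basis. f i * ((x \<bullet> i) * 1))"
      using assms by (simp add: linear_sum linear_scale mult.commute)
    then show ?thesis by (simp add: euclidean_representation c_def)
  qed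
  then have "f = (\<lambda>x. \<Sum>i\<in>Basis. c i * ((x \<bullet> i) * 1))" by (rule ext)
  moreover have "(\<lambda>x. \<Sum>i\<in>Basis. c i * ((x \<bullet> i) * 1)) \<in> fs.span (mon 1)"
    using span_mon_times_coord[OF span_mon_one[of 0]] by (intro span_mon_sum span_mon_scale) simp
  ultimately show ?thesis by simp
qed

lemma polynomial_in_span_mon:
  fixes p :: "'a::euclidean_space \<Rightarrow> real"
  assumes "real_polynomial_function p" shows "\<exists>n. p \<in> fs.span (mon n)"
  using assms
proof induction
  case (linear f)
  then show ?case using linear_in_span_mon bounded_linear.linear by blast
next
  case (const c)
  then show ?case using span_mon_scale[OF span_mon_one, of c] by auto
next
  case (add f g)
  then obtain m n where "f \<in> fs.span (mon m)" "g \<in> fs.span (mon n)" by blast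
  then have "f \<in> fs.span (mon (max m n))" "g \<in> fs.span (mon (max m n))"
    using span_mon_mono[of m "max m n" f] span_mon_mono[of n "max m n" g] by auto
  then show ?case using span_mon_add by blast
next
  case (mult f g)
  then show ?case using span_mon_mult by blast
qed

lemma span_mon_polynomial: "p \<in> fs.span (mon n) \<Longrightarrow> real_polynomial_function p"
proof (induction rule: span_mon_induct)
  case (base q)
  then show ?case
  proof (induction n arbitrary: q)
    case 0
    then show ?case using real_polynomial_function.intros(2) by (simp add: mon.simps)
  next
    case (Suc n)
    then consider "q \<in> mon n" | i p where "p \<in> mon n" "q = (\<lambda>x. (x \<bullet> i) * p x)" by (auto simp: mon.simps)
    then show ?case
    proof cases
      case 1
      then show ?thesis by (rule Suc.IH)
    next
      case 2
      show ?thesis unfolding 2(2)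
        by (rule real_polynomial_function.intros(4)[OF real_polynomial_function.intros(1)[OF bounded_linear_inner_left] Suc.IH[OF 2(1)]])
    qed
  qed
next
  case zero
  show ?case by (rule real_polynomial_function.intros(2))
next
  case (add p q)
  then show ?case by (rule real_polynomial_function.intros(3))
next
  case (scale c p)
  show ?case by (rule real_polynomial_function.intros(4)[OF real_polynomial_function.intros(2) scale])
qed

lemma has_grad_on_coord: "has_grad_on (\<lambda>x. x \<bullet> i) (\<lambda>j x. j \<bullet> i) S"
  unfolding has_grad_on_def
proof
  fix x
  have d: "((\<lambda>x. x \<bullet> i) has_derivative (\<lambda>v. v \<bullet> i)) (at x)"
    by (rule bounded_linear_imp_has_derivative[OF bounded_linear_inner_left])
  have "v \<bullet> i = (\<Sum>j\<in>Basis. v \<bullet> j * (j \<bullet> i))" for v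
    by (subst euclidean_inner) (simp add: inner_commute[of i])
  then show "((\<lambda>x. x \<bullet> i) has_derivative (\<lambda>v. \<Sum>j\<in>Basis. v \<bullet> j * (j \<bullet> i))) (at x)"
    by (rule has_derivative_eq_rhs[OF d ext])
qed

lemma span_mon_gradient:
  fixes q :: "'a::euclidean_space \<Rightarrow> real"
  assumes "q \<in> fs.span (mon n)"
  shows "\<exists>d. has_grad_on q d UNIV \<and> (\<forall>i\<in>Basis. d i \<in> fs.span (mon (n - 1)))"
proof -
  \<comment> \<open>For n = 0 the truncated difference n - 1 does not decrease, so the induction
    also records that the gradient is then zero; the product rule in the step from degree 0 to
    degree 1 relies on it.\<close>
  have M: "\<exists>d. has_grad_on q d UNIV \<and> (\<forall>i\<in>Basis. d i \<in> fs.span (mon (n - 1))) \<and> (n = 0 \<longrightarrow> (\<forall>i. d i = (\<lambda>x. 0)))" if "q \<in> mon n"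
    for q :: "'a \<Rightarrow> real"
    using that
  proof (induction n arbitrary: q)
    case 0
    then have "q = (\<lambda>_. 1)" by (simp add: mon.simps)
    then show ?case using has_grad_on_const span_mon_zero by (intro exI[of _ "\<lambda>i x. 0"]) auto
  next
    case (Suc n)
    then consider "q \<in> mon n" | j p where "j \<in> Basis" "p \<in> mon n" "q = (\<lambda>x. (x \<bullet> j) * p x)"
      by (auto simp: mon.simps)
    then show ?case
    proof cases
      case 1
      then show ?thesis using Suc.IH span_mon_mono[of "n - 1" "n"] by fastforce
    next
      case 2
      obtain d where d: "has_grad_on p d UNIV" "\<And>i. i \<in> Basis \<Longrightarrow> d i \<in> fs.span (mon (n - 1))" "n = 0 \<Longrightarrow> d = (\<lambda>i x. 0)"
        using Suc.IH[OF 2(2)] by blast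
      have "has_grad_on q (\<lambda>i x. (x \<bullet> j) * d i x + (i \<bullet> j) * p x) UNIV"
        unfolding 2(3) by (rule has_grad_on_mult[OF has_grad_on_coord d(1)])
      moreover have "(\<lambda>x. (x \<bullet> j) * d i x + (i \<bullet> j) * p x) \<in> fs.span (mon n)" if i: "i \<in> Basis" for i
      proof (rule span_mon_add)
        show "(\<lambda>x. (i \<bullet> j) * p x) \<in> fs.span (mon n)" using 2(2) by (intro span_mon_scale fs.span_base)
        show "(\<lambda>x. (x \<bullet> j) * d i x) \<in> fs.span (mon n)"
        proof (cases n)
          case 0
          then show ?thesis using d(3) span_mon_zero by simp
        next
          case (Suc m)
          then show ?thesis using span_mon_times_coord[OF d(2)[OF i] 2(1)] by simp
        qed
      qed
      ultimately show ?thesis by (intro exI[of _ "\<lambda>i x. (x \<bullet> j) * d i x + (i \<bullet> j) * p x"]) simp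
    qed
  qed
  show ?thesis
    using assms
  proof (induction rule: span_mon_induct)
    case (base q)
    then show ?case using M by blast
  next
    case zero
    then show ?case using has_grad_on_const span_mon_zero by (intro exI[of _ "\<lambda>i x. 0"]) auto
  next
    case (add p q)
    then obtain d e where d: "has_grad_on p d UNIV" "\<And>i. i \<in> Basis \<Longrightarrow> d i \<in> fs.span (mon (n - 1))"
      and e: "has_grad_on q e UNIV" "\<And>i. i \<in> Basis \<Longrightarrow> e i \<in> fs.span (mon (n - 1))" by blast
    have "(\<lambda>x. d i x + e i x) \<in> fs.span (mon (n - 1))" if "i \<in> Basis" for i
      by (rule span_mon_add[OF d(2)[OF that] e(2)[OF that]])
    then show ?case using has_grad_on_lincomb[OF d(1) e(1), of 1 1]
      by (intro exI[of _ "\<lambda>i x. d i x + e i x"]) auto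
  next
    case (scale c p)
    then obtain d where d: "has_grad_on p d UNIV" "\<And>i. i \<in> Basis \<Longrightarrow> d i \<in> fs.span (mon (n - 1))" by blast
    have "(\<lambda>x. c * d i x) \<in> fs.span (mon (n - 1))" if "i \<in> Basis" for i
      by (rule span_mon_scale[OF d(2)[OF that]])
    then show ?case using has_grad_on_lincomb[OF d(1) d(1), of c 0]
      by (intro exI[of _ "\<lambda>i x. c * d i x"]) auto
  qed
qed

lemma span_mon_laplacian:
  fixes q :: "'a::euclidean_space \<Rightarrow> real"
  assumes "q \<in> fs.span (mon n)"
  shows "Ck_on 2 q S" "laplacian q \<in> fs.span (mon (n - 2))"
proof -
  obtain d where d: "has_grad_on q d UNIV" "\<And>i. i \<in> Basis \<Longrightarrow> d i \<in> fs.span (mon (n - 1))"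
    using span_mon_gradient[OF assms] by blast
  have "\<exists>e. has_grad_on (d i) e UNIV \<and> (\<forall>j\<in>Basis. e j \<in> fs.span (mon (n - 2)))" if "i \<in> Basis" for i
    using span_mon_gradient[OF d(2)[OF that]] by (simp add: numeral_2_eq_2)
  then obtain D where D: "\<And>i. i \<in> Basis \<Longrightarrow> has_grad_on (d i) (D i) UNIV"
    "\<And>i j. i \<in> Basis \<Longrightarrow> j \<in> Basis \<Longrightarrow> D i j \<in> fs.span (mon (n - 2))" by metis
  have "continuous_on UNIV (D i j)" if "i \<in> Basis" "j \<in> Basis" for i j
    using span_mon_gradient[OF D(2)[OF that]] has_grad_on_continuous by blast
  then have H: "has_hess_on q d D UNIV" using d D by (simp add: has_hess_on_def)
  note C = has_hess_on_Ck[OF open_UNIV H]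
  show "Ck_on 2 q S" using Ck2_subset[OF C(1)] by simp
  have "laplacian q = (\<lambda>x. \<Sum>i\<in>Basis. D i i x)" using C(2) by auto
  then show "laplacian q \<in> fs.span (mon (n - 2))" using span_mon_sum[of Basis "\<lambda>i. D i i"] D(2) by simp
qed

text \<open>Along the line through a and x the polynomial has one variable and infinitely many
  zeros, so all its coefficients vanish.\<close>

lemma polynomial_zero_on_ball:
  fixes q :: "'a::euclidean_space \<Rightarrow> real"
  assumes q: "real_polynomial_function q" and r: "0 < r" and z: "\<And>x. x \<in> ball a r \<Longrightarrow> q x = 0"
  shows "q x = 0"
proof (cases "x = a")
  case False
  have "polynomial_function (\<lambda>t::real. a + t *\<^sub>R (x - a))"
    by (intro polynomial_function_add polynomial_function_const polynomial_function_bounded_linear bounded_linear_scaleR_left)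
  then have "real_polynomial_function (q \<circ> (\<lambda>t::real. a + t *\<^sub>R (x - a)))"
    using q by (rule real_polynomial_function_compose)
  then obtain c n where c: "(q \<circ> (\<lambda>t::real. a + t *\<^sub>R (x - a))) = (\<lambda>t. \<Sum>i\<le>n. c i * t ^ i)"
    using real_polynomial_function_imp_sum by blast
  have ct: "q (a + t *\<^sub>R (x - a)) = (\<Sum>i\<le>n. c i * t ^ i)" for t
    using fun_cong[OF c, of t] by simp
  let ?s = "r / norm (x - a)"
  have "{0<..<?s} \<subseteq> {t. (\<Sum>i\<le>n. c i * t ^ i) = 0}"
  proof
    fix t assume "t \<in> {0<..<?s}"
    then have "a + t *\<^sub>R (x - a) \<in> ball a r" using False by (simp add: dist_norm pos_less_divide_eq)
    then have "q (a + t *\<^sub>R (x - a)) = 0" by (rule z)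
    then show "t \<in> {t. (\<Sum>i\<le>n. c i * t ^ i) = 0}" by (simp add: ct)
  qed
  moreover have "infinite {0<..<?s}" using r False by (simp add: infinite_Ioo)
  ultimately have "infinite {t. (\<Sum>i\<le>n. c i * t ^ i) = 0}" using finite_subset by blast
  then have "\<forall>i\<le>n. c i = 0" using polyfun_finite_roots[of c n] by blast
  then show ?thesis using ct[of 1] by simp
qed (use z r in simp)

text \<open>On polynomials of bounded degree the map \<open>q \<mapsto> \<Delta>((\<rho>\<^sup>2 - |x - a|\<^sup>2) q)\<close> is injective by the maximum
  principle, hence surjective; solving for \<open>\<Delta> p\<close> corrects \<open>p\<close> to a harmonic polynomial.\<close>

lemma ball_dirichlet_polynomial:
  fixes p :: "'a::euclidean_space \<Rightarrow> real"
  assumes p: "real_polynomial_function p" and \<rho>: "0 < \<rho>"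
  obtains H where "real_polynomial_function H" "Ck_on 2 H UNIV" "\<And>x. laplacian H x = 0" "\<And>x. x \<in> sphere a \<rho> \<Longrightarrow> H x = p x"
proof -
  obtain n where n: "p \<in> fs.span (mon n)" using polynomial_in_span_mon[OF p] by blast
  \<comment> \<open>Being zero on the sphere, w times q does not change boundary values; being of
    degree two, it makes the Laplacian of w times q fall back into degree at most n.\<close>
  define w where "w = (\<lambda>x. \<rho>\<^sup>2 - (x - a) \<bullet> (x - a))"
  have w: "w \<in> fs.span (mon 2)"
  proof -
    have l: "(\<lambda>x. (x - a) \<bullet> i) \<in> fs.span (mon 1)" for i
      using span_mon_add[OF linear_in_span_mon[OF bounded_linear.linear[OF bounded_linear_inner_left[of i]]] span_mon_scale[OF span_mon_one[of 1], of "- (a \<bullet> i)"]]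
      by (simp add: inner_diff_left)
    have "(\<lambda>x. \<Sum>i\<in>Basis. ((x - a) \<bullet> i) * ((x - a) \<bullet> i)) \<in> fs.span (mon 2)"
      using span_mon_mult[OF l l] by (intro span_mon_sum) (simp add: numeral_2_eq_2)
    from span_mon_add[OF span_mon_scale[OF span_mon_one, of "\<rho>\<^sup>2"] span_mon_scale[OF this, of "-1"]]
    show ?thesis by (simp add: w_def euclidean_inner[of "_ - a" "_ - a"])
  qed
  define L where "L = (\<lambda>q. laplacian (\<lambda>x. w x * q x))"
  have wq: "(\<lambda>x. w x * q x) \<in> fs.span (mon (2 + n))" if "q \<in> fs.span (mon n)" for q
    by (rule span_mon_mult[OF w that])
  note wC = span_mon_laplacian[OF wq]
  have inj: "q = 0" if q: "q \<in> fs.span (mon n)" "L q = 0" for q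
  proof -
    have l0: "laplacian (\<lambda>x. w x * q x) x = 0" for x using fun_cong[OF q(2), of x] by (simp add: L_def)
    have c: "continuous_on (closure (ball a \<rho>)) (\<lambda>x. w x * q x)"
      using Ck2_continuous[OF wC(1)[OF q(1)]] by blast
    have fr: "w x * q x = 0" if "x \<in> frontier (ball a \<rho>)" for x
      using that \<rho> by (simp add: w_def sphere_def dist_norm dot_square_norm norm_minus_commute)
    have "w x * q x = 0" if "x \<in> ball a \<rho>" for x
    proof (rule order_antisym)
      have x: "x \<in> closure (ball a \<rho>)" using that closure_subset by blast
      have z: "Ck_on 2 (\<lambda>_. 0) (ball a \<rho>)" "\<And>x. x \<in> ball a \<rho> \<Longrightarrow> laplacian (\<lambda>_. 0) x = 0"
        by (rule Ck2_const[OF open_ball]; assumption)+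
      show "w x * q x \<le> 0"
        by (rule laplacian_comparison[OF open_ball bounded_ball wC(1)[OF q(1)] c z(1) _ _ _ x]) (simp_all only: l0 z(2) fr continuous_on_const order_refl)
      show "0 \<le> w x * q x"
        by (rule laplacian_comparison[OF open_ball bounded_ball z(1) _ wC(1)[OF q(1)] c _ _ x]) (simp_all only: l0 z(2) fr continuous_on_const order_refl)
    qed
    moreover have "w x \<noteq> 0" if "x \<in> ball a \<rho>" for x
    proof -
      have "(norm (x - a))\<^sup>2 < \<rho>\<^sup>2" using that by (intro power_strict_mono) (auto simp: dist_norm norm_minus_commute)
      then show ?thesis by (simp add: w_def dot_square_norm)
    qed
    ultimately have "q x = 0" if "x \<in> ball a \<rho>" for x using that by simp
    then show "q = 0" using polynomial_zero_on_ball[OF span_mon_polynomial[OF q(1)] \<rho>] by (auto simp: fun_eq_iff)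
  qed
  have "\<exists>q\<in>fs.span (mon n). L q = - laplacian p"
  proof (rule fs.injective_endomorphism_surjective[OF finite_mon _ _ _ inj])
    fix q q' :: "'a \<Rightarrow> real" assume q: "q \<in> fs.span (mon n)" "q' \<in> fs.span (mon n)"
    have "laplacian (\<lambda>x. w x * q x + w x * q' x) x = laplacian (\<lambda>x. w x * q x) x + laplacian (\<lambda>x. w x * q' x) x" for x
      using Ck2_add(2)[OF open_UNIV wC(1)[OF q(1)] wC(1)[OF q(2)]] by simp
    then show "L (q + q') = L q + L q'" by (simp add: L_def fun_eq_iff distrib_left)
  next
    fix c :: real and q :: "'a \<Rightarrow> real" assume q: "q \<in> fs.span (mon n)"
    have "laplacian (\<lambda>x. c * (w x * q x)) x = c * laplacian (\<lambda>x. w x * q x) x" for x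
      using Ck2_scale(2)[OF open_UNIV wC(1)[OF q]] by simp
    then show "L (\<lambda>x. c * q x) = (\<lambda>x. c * L q x)" by (simp add: L_def fun_eq_iff mult.left_commute)
  next
    fix q :: "'a \<Rightarrow> real" assume "q \<in> fs.span (mon n)"
    then show "L q \<in> fs.span (mon n)" using wC(2) by (simp add: L_def)
  next
    have "laplacian p \<in> fs.span (mon n)" using span_mon_laplacian(2)[OF n] span_mon_mono[of "n - 2" n] by simp
    then show "- laplacian p \<in> fs.span (mon n)" by (rule fs.span_neg)
  qed
  then obtain q where q: "q \<in> fs.span (mon n)" "L q = - laplacian p" by blast
  define H where "H = (\<lambda>x. p x + w x * q x)"
  have pC: "Ck_on 2 p UNIV" by (rule span_mon_laplacian(1)[OF n])
  show thesis
  proof (rule that[of H])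
    show "real_polynomial_function H"
      unfolding H_def by (intro real_polynomial_function.intros(3) p span_mon_polynomial[OF wq[OF q(1)]])
    show "Ck_on 2 H UNIV" unfolding H_def by (rule Ck2_add(1)[OF open_UNIV pC wC(1)[OF q(1)]])
    show "laplacian H x = 0" for x
      unfolding H_def using Ck2_add(2)[OF open_UNIV pC wC(1)[OF q(1)], of x] fun_cong[OF q(2), of x]
      by (simp add: L_def)
    show "H x = p x" if "x \<in> sphere a \<rho>" for x
      using that by (simp add: H_def w_def dist_norm dot_square_norm norm_minus_commute)
  qed
qed

lemma compact_continuous_bound:
  fixes f :: "'a::topological_space \<Rightarrow> real"
  assumes "compact C" "continuous_on C f"
  obtains M where "0 \<le> M" "\<And>x. x \<in> C \<Longrightarrow> \<bar>f x\<bar> \<le> M"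
proof -
  have "bounded (f ` C)" by (rule compact_imp_bounded[OF compact_continuous_image[OF assms(2,1)]])
  then obtain M where "0 < M" "\<forall>y\<in>f ` C. norm y \<le> M" unfolding bounded_pos by blast
  then show thesis by (intro that[of M]) auto
qed

text \<open>Boundary data are approximated uniformly by polynomials. The maximum principle transfers
  the Cauchy property from the frontier to the closure, and \<open>harmonic_limit\<close> shows that
  the uniform limit is harmonic. Both balls and the domain are treated through this
  reduction.\<close>

lemma dirichlet_of_polynomial:
  fixes u :: "'a::euclidean_space \<Rightarrow> real"
  assumes S: "open S" "bounded S"
    and poly: "\<And>p. real_polynomial_function p \<Longrightarrow> \<exists>h. Ck_on 2 h S \<and> continuous_on (closure S) h \<and>
      (\<forall>x\<in>S. laplacian h x = 0) \<and> (\<forall>x\<in>frontier S. h x = p x)"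
    and u: "continuous_on (frontier S) u"
  obtains H where "continuous_on (closure S) H" "Ck_on 2 H S" "\<And>x. x \<in> S \<Longrightarrow> laplacian H x = 0"
    "\<And>x. x \<in> frontier S \<Longrightarrow> H x = u x"
proof -
  have cf: "compact (frontier S)" using S(2) by (simp add: compact_frontier_bounded)
  have cc: "compact (closure S)" using S(2) by (simp add: compact_closure)
  have "\<exists>h. Ck_on 2 h S \<and> continuous_on (closure S) h \<and> (\<forall>x\<in>S. laplacian h x = 0) \<and> (\<forall>x\<in>frontier S. \<bar>u x - h x\<bar> < inverse (real (Suc n)))" for n
  proof -
    obtain p where p: "real_polynomial_function p" "\<And>x. x \<in> frontier S \<Longrightarrow> \<bar>u x - p x\<bar> < inverse (real (Suc n))"
      using Stone_Weierstrass_real_polynomial_function[OF cf u, of "inverse (real (Suc n))"] by auto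
    show ?thesis using poly[OF p(1)] p(2) by metis
  qed
  then obtain h where h: "\<And>n. Ck_on 2 (h n) S" "\<And>n. continuous_on (closure S) (h n)" "\<And>n x. x \<in> S \<Longrightarrow> laplacian (h n) x = 0"
    "\<And>n x. x \<in> frontier S \<Longrightarrow> \<bar>u x - h n x\<bar> < inverse (real (Suc n))" by metis
  have le: "h n x \<le> h m x + (inverse (real (Suc n)) + inverse (real (Suc m)))" if x: "x \<in> closure S" for n m x
  proof -
    let ?c = "inverse (real (Suc n)) + inverse (real (Suc m))"
    note A = Ck2_add[OF S(1) h(1)[of m] Ck2_const(1)[OF S(1), where c="?c"]]
    show ?thesis
    proof (rule laplacian_comparison[OF S h(1,2) A(1) _ _ _ x])
      show "continuous_on (closure S) (\<lambda>x. h m x + ?c)" by (intro continuous_intros h(2))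
      show "laplacian (\<lambda>x. h m x + ?c) x \<le> laplacian (h n) x" if "x \<in> S" for x
        using A(2)[OF that] h(3)[OF that] Ck2_const(2)[OF S(1) that] by simp
      show "h n x \<le> h m x + ?c" if "x \<in> frontier S" for x
        using h(4)[OF that, of n] h(4)[OF that, of m] unfolding abs_less_iff by linarith
    qed
  qed
  have "uniformly_Cauchy_on (closure S) h"
  proof (rule uniformly_Cauchy_onI)
    fix e :: real assume e: "0 < e"
    obtain N where N: "inverse (real (Suc N)) < e / 2" using reals_Archimedean[of "e / 2"] e by auto
    have "dist (h m x) (h n x) < e" if "x \<in> closure S" "N \<le> m" "N \<le> n" for x m n
    proof -
      have "inverse (real (Suc m)) \<le> inverse (real (Suc N))" "inverse (real (Suc n)) \<le> inverse (real (Suc N))"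
        using that by (auto simp: le_imp_inverse_le)
      then show ?thesis using le[OF that(1), of m n] le[OF that(1), of n m] N
        unfolding dist_real_def abs_less_iff by linarith
    qed
    then show "\<exists>M. \<forall>x\<in>closure S. \<forall>m\<ge>M. \<forall>n\<ge>M. dist (h m x) (h n x) < e" by blast
  qed
  then obtain H where H: "uniform_limit (closure S) h H sequentially"
    using Cauchy_uniformly_convergent uniformly_convergent_on_def by blast
  have Hc: "continuous_on (closure S) H"
    by (rule uniform_limit_theorem[OF always_eventually H]) (use h(2) in auto)
  have lim: "(\<lambda>n. h n x) \<longlonglongrightarrow> H x" if "x \<in> closure S" for x
    using tendsto_uniform_limitI[OF H that] .
  obtain M where M: "\<And>x. x \<in> closure S \<Longrightarrow> \<bar>h 0 x\<bar> \<le> M"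
    using compact_continuous_bound[OF cc h(2)] by metis
  have cl: "S \<subseteq> closure S" "frontier S \<subseteq> closure S" using closure_subset by (auto simp: frontier_def)
  have bd: "\<bar>h n x\<bar> \<le> M + 2" if "x \<in> S" for n x
  proof -
    have x: "x \<in> closure S" using that cl by blast
    have "inverse (real (Suc n)) \<le> 1" by (simp add: inverse_le_1_iff)
    then show ?thesis using le[OF x, of n 0] le[OF x, of 0 n] M[OF x] by (auto simp: abs_le_iff)
  qed
  have limS: "(\<lambda>n. h n x) \<longlonglongrightarrow> H x" if "x \<in> S" for x using lim cl that by blast
  show thesis
  proof (rule that[OF Hc])
    show "Ck_on 2 H S" by (rule harmonic_limit(1)[OF S(1) h(1,3) bd limS])
    show "laplacian H x = 0" if "x \<in> S" for x by (rule harmonic_limit(2)[OF S(1) h(1,3) bd limS that])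
    show "H x = u x" if x: "x \<in> frontier S" for x
    proof -
      have "(\<lambda>n. u x - h n x) \<longlonglongrightarrow> 0"
        by (rule Lim_null_comparison[OF _ LIMSEQ_inverse_real_of_nat]) (use h(4)[OF x] in \<open>auto intro!: always_eventually less_imp_le\<close>)
      then have "(\<lambda>n. u x - (u x - h n x)) \<longlonglongrightarrow> u x - 0" by (intro tendsto_intros)
      moreover have "(\<lambda>n. h n x) \<longlonglongrightarrow> H x" using lim x cl by blast
      ultimately show ?thesis using LIMSEQ_unique by simp
    qed
  qed
qed

lemma ball_dirichlet:
  fixes u :: "'a::euclidean_space \<Rightarrow> real"
  assumes u: "continuous_on (sphere a \<rho>) u" and \<rho>: "0 < \<rho>"
  obtains H where "continuous_on (cball a \<rho>) H" "Ck_on 2 H (ball a \<rho>)" "\<And>x. x \<in> ball a \<rho> \<Longrightarrow> laplacian H x = 0"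
    "\<And>x. x \<in> sphere a \<rho> \<Longrightarrow> H x = u x"
proof -
  have cl: "closure (ball a \<rho>) = cball a \<rho>" "frontier (ball a \<rho>) = sphere a \<rho>" using \<rho> by auto
  have "\<exists>h. Ck_on 2 h (ball a \<rho>) \<and> continuous_on (closure (ball a \<rho>)) h \<and>
      (\<forall>x\<in>ball a \<rho>. laplacian h x = 0) \<and> (\<forall>x\<in>frontier (ball a \<rho>). h x = p x)"
    if p: "real_polynomial_function p" for p
  proof -
    obtain H where H: "Ck_on 2 H UNIV" "\<And>x. laplacian H x = 0" "\<And>x. x \<in> sphere a \<rho> \<Longrightarrow> H x = p x"
      using ball_dirichlet_polynomial[OF p \<rho>, of a] by metis
    have "continuous_on (closure (ball a \<rho>)) H" using Ck2_continuous[OF H(1)] continuous_on_subset by blast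
    moreover have "Ck_on 2 H (ball a \<rho>)" using Ck2_subset[OF H(1)] by simp
    ultimately show ?thesis using H cl by auto
  qed
  from dirichlet_of_polynomial[OF open_ball bounded_ball this, of u] u that show thesis unfolding cl by blast
qed

section \<open>Sweeping and continuity at the boundary\<close>

lemma visc_sub_subset: "visc_sub S u \<Longrightarrow> T \<subseteq> S \<Longrightarrow> visc_sub T u"
  unfolding visc_sub_def by (meson order_trans subsetD)

text \<open>A choice operator, so that the sweeping process can be a plain recursion; unspecified
  unless u is continuous on the sphere and the radius is positive.\<close>

definition harmonic_lift :: "('a::euclidean_space \<Rightarrow> real) \<Rightarrow> 'a \<Rightarrow> real \<Rightarrow> 'a \<Rightarrow> real" where
  "harmonic_lift u a \<rho> = (SOME H. continuous_on (cball a \<rho>) H \<and> Ck_on 2 H (ball a \<rho>) \<and>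
     (\<forall>x\<in>ball a \<rho>. laplacian H x = 0) \<and> (\<forall>x\<in>sphere a \<rho>. H x = u x))"

lemma harmonic_lift:
  assumes "continuous_on (sphere a \<rho>) u" "0 < \<rho>"
  shows "continuous_on (cball a \<rho>) (harmonic_lift u a \<rho>)" "Ck_on 2 (harmonic_lift u a \<rho>) (ball a \<rho>)"
    "x \<in> ball a \<rho> \<Longrightarrow> laplacian (harmonic_lift u a \<rho>) x = 0" "x \<in> sphere a \<rho> \<Longrightarrow> harmonic_lift u a \<rho> x = u x"
proof -
  have "\<exists>H. continuous_on (cball a \<rho>) H \<and> Ck_on 2 H (ball a \<rho>) \<and>
     (\<forall>x\<in>ball a \<rho>. laplacian H x = 0) \<and> (\<forall>x\<in>sphere a \<rho>. H x = u x)"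
    using ball_dirichlet[OF assms] by metis
  from someI_ex[OF this, folded harmonic_lift_def]
  show "continuous_on (cball a \<rho>) (harmonic_lift u a \<rho>)" "Ck_on 2 (harmonic_lift u a \<rho>) (ball a \<rho>)"
    "x \<in> ball a \<rho> \<Longrightarrow> laplacian (harmonic_lift u a \<rho>) x = 0" "x \<in> sphere a \<rho> \<Longrightarrow> harmonic_lift u a \<rho> x = u x"
    by auto
qed

definition lift_on :: "('a::euclidean_space \<Rightarrow> real) \<Rightarrow> 'a \<Rightarrow> real \<Rightarrow> 'a \<Rightarrow> real" where
  "lift_on u a \<rho> x = (if x \<in> ball a \<rho> then harmonic_lift u a \<rho> x else u x)"

text \<open>Poincare's sweeping method: \<open>sweep\<close> replaces the current function by its harmonic lift on one
  ball at a time, where \<open>prod_decode\<close> makes sure that every ball is visited infinitely often.\<close>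

fun sweep :: "(nat \<Rightarrow> 'a::euclidean_space) \<Rightarrow> (nat \<Rightarrow> real) \<Rightarrow> ('a \<Rightarrow> real) \<Rightarrow> nat \<Rightarrow> 'a \<Rightarrow> real" where
  "sweep a \<rho> P 0 = P"
| "sweep a \<rho> P (Suc n) = lift_on (sweep a \<rho> P n) (a (fst (prod_decode n))) (\<rho> (fst (prod_decode n)))"

text \<open>On the ball the lift dominates u by the maximum principle, and on the sphere it agrees
  with u, so the glued function is continuous and again subharmonic. The closed ball lies inside the
  domain, which leaves the frontier untouched.\<close>

lemma sweep_step:
  fixes \<Omega> :: "'a::euclidean_space set"
  assumes \<Omega>: "open \<Omega>" and B: "0 < \<rho>" "cball a \<rho> \<subseteq> \<Omega>" and u: "continuous_on (closure \<Omega>) u" "visc_sub \<Omega> u"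
  shows "continuous_on (closure \<Omega>) (lift_on u a \<rho>)" "visc_sub \<Omega> (lift_on u a \<rho>)" "u x \<le> lift_on u a \<rho> x"
    "x \<in> frontier \<Omega> \<Longrightarrow> lift_on u a \<rho> x = u x"
proof -
  define u' where "u' = lift_on u a \<rho>"
  have u'_def: "u' = (\<lambda>x. if x \<in> ball a \<rho> then harmonic_lift u a \<rho> x else u x)"
    by (auto simp: u'_def lift_on_def)
  have cu: "continuous_on (cball a \<rho>) u" using u(1) B(2) closure_subset by (blast intro: continuous_on_subset)
  then have "continuous_on (sphere a \<rho>) u" using sphere_cball by (blast intro: continuous_on_subset)
  note H = harmonic_lift[OF this B(1)]
  have bs: "ball a \<rho> \<subseteq> \<Omega>" using B(2) ball_subset_cball by blast
  have cl: "closure (ball a \<rho>) = cball a \<rho>" "frontier (ball a \<rho>) = sphere a \<rho>" using B(1) by auto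
  have le: "u x \<le> harmonic_lift u a \<rho> x" if "x \<in> ball a \<rho>" for x
    by (rule visc_max_principle[OF open_ball bounded_ball _ visc_sub_subset[OF u(2) bs] H(2)])
      (use H cu cl that in auto)
  show "u x \<le> lift_on u a \<rho> x" using le by (simp add: lift_on_def)
  have "visc_sub \<Omega> u'" unfolding u'_def by (rule visc_sub_lift[OF u(2) open_ball bs H(2,3) le])
  then show "visc_sub \<Omega> (lift_on u a \<rho>)" using u'_def by (simp add: lift_on_def[abs_def])
  show "lift_on u a \<rho> x = u x" if "x \<in> frontier \<Omega>"
  proof -
    have "x \<notin> \<Omega>" using that \<Omega> by (simp add: frontier_def interior_open)
    then show ?thesis using bs by (auto simp: lift_on_def)
  qed
  have un: "closure \<Omega> = cball a \<rho> \<union> (closure \<Omega> - ball a \<rho>)"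
    using B(2) closure_subset by fastforce
  have "continuous_on (cball a \<rho>) u'"
    by (rule continuous_on_eq[OF H(1)]) (use H(4) in \<open>auto simp: u'_def\<close>)
  moreover have "continuous_on (closure \<Omega> - ball a \<rho>) u'"
    by (rule continuous_on_eq[of _ u]) (use u(1) in \<open>auto simp: u'_def intro: continuous_on_subset\<close>)
  ultimately have "continuous_on (cball a \<rho> \<union> (closure \<Omega> - ball a \<rho>)) u'"
    by (intro continuous_on_closed_Un) (auto intro: closed_Diff)
  then show "continuous_on (closure \<Omega>) (lift_on u a \<rho>)" using un u'_def by (simp add: lift_on_def[abs_def])
qed

text \<open>Starting from a subharmonic function makes the sweeps increase. On each ball of a
  countable cover infinitely many of them are harmonic, hence so is the limit. At a boundary point
  the limit is squeezed between P and a multiple of the barrier added to the boundary value.\<close>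

lemma dirichlet_subharmonic:
  fixes \<Omega> :: "'a::euclidean_space set"
  assumes sd: "smooth_bounded_domain \<Omega>" and P: "Ck_on 2 P \<Omega>" "continuous_on (closure \<Omega>) P" "\<And>x. x \<in> \<Omega> \<Longrightarrow> 0 \<le> laplacian P x"
  obtains H where "Ck_on 2 H \<Omega>" "continuous_on (closure \<Omega>) H" "\<And>x. x \<in> \<Omega> \<Longrightarrow> laplacian H x = 0"
    "\<And>x. x \<in> frontier \<Omega> \<Longrightarrow> H x = P x"
proof -
  have \<Omega>: "open \<Omega>" "bounded \<Omega>" "\<Omega> \<noteq> {}" using sd by (auto simp: smooth_bounded_domain_def)
  have cc: "compact (closure \<Omega>)" using \<Omega>(2) by (simp add: compact_closure)
  have cl: "\<Omega> \<subseteq> closure \<Omega>" "frontier \<Omega> \<subseteq> closure \<Omega>" "closure \<Omega> = \<Omega> \<union> frontier \<Omega>"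
    using closure_subset closure_Un_frontier[of \<Omega>] by (auto simp: frontier_def)
  define F where "F = {ball x r | x r. 0 < r \<and> cball x r \<subseteq> \<Omega>}"
  obtain F' where F': "F' \<subseteq> F" "countable F'" "\<Union>F' = \<Union>F" using Lindelof[of F] by (auto simp: F_def)
  have UF: "\<Union>F = \<Omega>"
  proof
    show "\<Union>F \<subseteq> \<Omega>" using ball_subset_cball by (fastforce simp: F_def)
    show "\<Omega> \<subseteq> \<Union>F"
    proof
      fix x assume "x \<in> \<Omega>"
      then obtain r where "0 < r" "cball x r \<subseteq> \<Omega>" using \<Omega>(1) open_contains_cball by blast
      then have "ball x r \<in> F" "x \<in> ball x r" by (auto simp: F_def)
      then show "x \<in> \<Union>F" by blast
    qed
  qed
  have "F' \<noteq> {}" using F'(3) UF \<Omega>(3) by auto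
  have "\<exists>x r. 0 < r \<and> cball x r \<subseteq> \<Omega> \<and> from_nat_into F' i = ball x r" for i
    using from_nat_into[OF \<open>F' \<noteq> {}\<close>, of i] F'(1) unfolding F_def by blast
  then obtain a \<rho> where a\<rho>: "\<And>i. 0 < \<rho> i" "\<And>i. cball (a i) (\<rho> i) \<subseteq> \<Omega>" "\<And>i. from_nat_into F' i = ball (a i) (\<rho> i)" by metis
  have cover: "\<exists>i. x \<in> ball (a i) (\<rho> i)" if "x \<in> \<Omega>" for x
  proof -
    have "x \<in> \<Union>F'" using that F'(3) UF by simp
    then obtain T where "T \<in> F'" "x \<in> T" by (rule UnionE)
    moreover obtain i where "from_nat_into F' i = T" using from_nat_into_surj[OF F'(2) \<open>T \<in> F'\<close>] by blast
    ultimately have "x \<in> ball (a i) (\<rho> i)" using a\<rho>(3)[of i] by simp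
    then show ?thesis by blast
  qed
  define u where "u = sweep a \<rho> P"
  have uS: "u (Suc n) = lift_on (u n) (a (fst (prod_decode n))) (\<rho> (fst (prod_decode n)))" for n
    by (simp add: u_def)
  have inv: "continuous_on (closure \<Omega>) (u n) \<and> visc_sub \<Omega> (u n) \<and> (\<forall>x\<in>frontier \<Omega>. u n x = P x)" for n
  proof (induction n)
    case 0
    then show ?case using P Ck2_visc_sub[OF \<Omega>(1) P(1,3)] by (simp add: u_def)
  next
    case (Suc n)
    let ?i = "fst (prod_decode n)"
    note st = sweep_step[OF \<Omega>(1) a\<rho>(1)[of ?i] a\<rho>(2)[of ?i], of "u n", folded uS]
    show ?case using st(1,2,4) Suc by simp
  qed
  have mono: "u n x \<le> u (Suc n) x" for n x
  proof -
    let ?i = "fst (prod_decode n)"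
    show ?thesis using sweep_step(3)[OF \<Omega>(1) a\<rho>(1)[of ?i] a\<rho>(2)[of ?i], of "u n" x, folded uS] inv[of n] by blast
  qed
  then have inc: "incseq (\<lambda>n. u n x)" for x by (rule incseq_SucI)
  have upper: "u n x \<le> \<phi> x" if "Ck_on 2 \<phi> \<Omega>" "continuous_on (closure \<Omega>) \<phi>" "\<And>x. x \<in> \<Omega> \<Longrightarrow> laplacian \<phi> x \<le> 0"
    "\<And>x. x \<in> frontier \<Omega> \<Longrightarrow> P x \<le> \<phi> x" "x \<in> closure \<Omega>" for n \<phi> x
    by (rule visc_max_principle[OF \<Omega>(1,2) _ _ that(1,2,3) _ that(5)]) (use inv that(4) in auto)
  have lower: "P x \<le> u n x" for n x using incseqD[OF inc, of 0 n x] by (simp add: u_def)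
  obtain M where M: "\<And>x. x \<in> closure \<Omega> \<Longrightarrow> \<bar>P x\<bar> \<le> M"
    using compact_continuous_bound[OF cc P(2)] by metis
  have uM: "\<bar>u n x\<bar> \<le> M" if x: "x \<in> closure \<Omega>" for n x
  proof -
    have "u n x \<le> M"
      by (rule upper[OF Ck2_const(1)[OF \<Omega>(1)] continuous_on_const _ _ x])
        (use M cl Ck2_const(2)[OF \<Omega>(1)] in \<open>auto simp: abs_le_iff\<close>)
    then show ?thesis using lower[of x n] M[OF x] by (auto simp: abs_le_iff)
  qed
  define U where "U = (\<lambda>x. lim (\<lambda>n. u n x))"
  have lim: "(\<lambda>n. u n x) \<longlonglongrightarrow> U x" if x: "x \<in> closure \<Omega>" for x
  proof -
    have "convergent (\<lambda>n. u n x)"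
      by (rule Bseq_mono_convergent) (use uM[OF x] inc[of x] in \<open>auto simp: incseq_def intro!: BseqI'[of _ M]\<close>)
    then show ?thesis by (simp add: U_def convergent_LIMSEQ_iff)
  qed
  have Ub: "P x \<le> U x" if x: "x \<in> closure \<Omega>" for x
    by (rule LIMSEQ_le_const[OF lim[OF x]]) (use lower in auto)
  have Uup: "U x \<le> \<phi> x" if "Ck_on 2 \<phi> \<Omega>" "continuous_on (closure \<Omega>) \<phi>" "\<And>x. x \<in> \<Omega> \<Longrightarrow> laplacian \<phi> x \<le> 0"
    "\<And>x. x \<in> frontier \<Omega> \<Longrightarrow> P x \<le> \<phi> x" "x \<in> closure \<Omega>" for \<phi> x
    by (rule LIMSEQ_le_const2[OF lim[OF that(5)]]) (use upper[OF that] in auto)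
  have Ufr: "U x = P x" if x: "x \<in> frontier \<Omega>" for x
  proof -
    have "(\<lambda>n. u n x) = (\<lambda>n. P x)" using inv x by auto
    moreover have "(\<lambda>n. u n x) \<longlonglongrightarrow> U x" using lim x cl by blast
    ultimately show ?thesis by (simp add: LIMSEQ_const_iff)
  qed
  have loc: "\<exists>V. open V \<and> x \<in> V \<and> Ck_on 2 U V \<and> (\<forall>y\<in>V. laplacian U y = 0)" if x: "x \<in> \<Omega>" for x
  proof -
    obtain i where i: "x \<in> ball (a i) (\<rho> i)" using cover[OF x] by blast
    \<comment> \<open>The steps at which ball i has just been swept: these functions are harmonic on
      it, and their indices form a sequence tending to infinity, so they have the same limit
      U.\<close>
    define v where "v = (\<lambda>j. u (Suc (prod_encode (i, j))))"
    let ?B = "ball (a i) (\<rho> i)"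
    have BO: "?B \<subseteq> closure \<Omega>" using a\<rho>(2)[of i] ball_subset_cball cl by blast
    have cs: "continuous_on (sphere (a i) (\<rho> i)) (u n)" for n
      using inv[of n] a\<rho>(2)[of i] sphere_cball cl by (blast intro: continuous_on_subset)
    have ve: "v j y = harmonic_lift (u (prod_encode (i, j))) (a i) (\<rho> i) y" if "y \<in> ?B" for j y
      using that by (simp add: v_def uS lift_on_def)
    note hl = harmonic_lift[OF cs a\<rho>(1)[of i]]
    have vC: "Ck_on 2 (v j) ?B" "\<And>y. y \<in> ?B \<Longrightarrow> laplacian (v j) y = 0" for j
    proof -
      note C = Ck2_cong[OF open_ball hl(2)[of "prod_encode (i, j)"] ve[symmetric]]
      show "Ck_on 2 (v j) ?B" by (rule C(1))
      show "laplacian (v j) y = 0" if "y \<in> ?B" for y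
        using C(2)[OF _ that] hl(3)[OF that] by simp
    qed
    have "filterlim (\<lambda>j. Suc (prod_encode (i, j))) at_top sequentially"
      by (rule filterlim_at_top_mono[OF filterlim_ident]) (auto intro!: always_eventually le_SucI le_prod_encode_2)
    then have vl: "(\<lambda>j. v j y) \<longlonglongrightarrow> U y" if "y \<in> ?B" for y
      unfolding v_def using filterlim_compose[OF lim] BO that by blast
    have vM: "\<bar>v j y\<bar> \<le> M" if "y \<in> ?B" for j y using uM BO that by (auto simp: v_def)
    note HL = harmonic_limit[OF open_ball vC vM vl]
    show ?thesis using i HL by (intro exI[of _ ?B]) auto
  qed
  have UC: "Ck_on 2 U \<Omega>" by (rule Ck2_local) (use loc in blast)
  have Ul: "laplacian U x = 0" if "x \<in> \<Omega>" for x using loc[OF that] by blast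
  have "continuous (at \<xi> within closure \<Omega>) U" if \<xi>: "\<xi> \<in> closure \<Omega>" for \<xi>
  proof (cases "\<xi> \<in> \<Omega>")
    case True
    then have "isCont U \<xi>" using Ck2_continuous[OF UC] \<Omega>(1) continuous_on_eq_continuous_at by blast
    then show ?thesis by (rule continuous_at_imp_continuous_at_within)
  next
    case False
    then have fr: "\<xi> \<in> frontier \<Omega>" using \<xi> cl by blast
    obtain b where b: "Ck_on 2 b \<Omega>" "continuous_on (closure \<Omega>) b" "\<And>x. x \<in> \<Omega> \<Longrightarrow> laplacian b x \<le> 0"
      "b \<xi> = 0" "\<And>x. x \<in> closure \<Omega> \<Longrightarrow> x \<noteq> \<xi> \<Longrightarrow> 0 < b x"
      using barrier[OF sd fr] by metis
    have b0: "0 \<le> b x" if "x \<in> closure \<Omega>" for x using b(4) b(5)[OF that] by (cases "x = \<xi>") auto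
    show ?thesis
      unfolding continuous_within_eps_delta
    proof (intro allI impI)
      fix e :: real assume e: "0 < e"
      obtain d where d: "d > 0" "\<And>x. x \<in> closure \<Omega> \<Longrightarrow> dist x \<xi> < d \<Longrightarrow> \<bar>P x - P \<xi>\<bar> < e / 2"
        using P(2) \<xi> e unfolding continuous_on_iff dist_real_def by (meson half_gt_zero)
      obtain m where m: "0 < m" "\<And>x. x \<in> closure \<Omega> \<Longrightarrow> d \<le> dist x \<xi> \<Longrightarrow> m \<le> b x"
      proof (cases "closure \<Omega> - ball \<xi> d = {}")
        case True
        then show ?thesis using that[of 1] by (force simp: dist_commute)
      next
        case ne: False
        have "compact (closure \<Omega> - ball \<xi> d)" using cc by (simp add: compact_diff)
        then obtain z where z: "z \<in> closure \<Omega> - ball \<xi> d" "\<And>x. x \<in> closure \<Omega> - ball \<xi> d \<Longrightarrow> b z \<le> b x"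
          using continuous_attains_inf[OF _ ne] b(2) by (meson Diff_subset continuous_on_subset)
        have "0 < b z" using z(1) d(1) by (intro b(5)) auto
        then show ?thesis using that[of "b z"] z(2) by (simp add: dist_commute)
      qed
      \<comment> \<open>At distance at least d from \<xi> the barrier is at least m, so K times it
        exceeds the oscillation of P there.\<close>
      define K where "K = 2 * \<bar>M\<bar> / m"
      have K: "0 \<le> K" "K * m = 2 * \<bar>M\<bar>" using m(1) by (auto simp: K_def)
      define \<phi> where "\<phi> = (\<lambda>x. K * b x + 1 * (P \<xi> + e / 2))"
      note LC = Ck2_lincomb[OF \<Omega>(1) b(1) Ck2_const(1)[OF \<Omega>(1), where c="P \<xi> + e / 2"], where a=K and b=1, folded \<phi>_def]
      have \<phi>: "Ck_on 2 \<phi> \<Omega>" "\<And>x. x \<in> \<Omega> \<Longrightarrow> laplacian \<phi> x = K * laplacian b x"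
        using LC Ck2_const(2)[OF \<Omega>(1)] by simp_all
      have U\<phi>: "U x \<le> \<phi> x" if "x \<in> closure \<Omega>" for x
      proof (rule Uup[OF \<phi>(1)])
        show "continuous_on (closure \<Omega>) \<phi>" unfolding \<phi>_def by (intro continuous_intros b(2))
        show "laplacian \<phi> x \<le> 0" if "x \<in> \<Omega>" for x using \<phi>(2)[OF that] b(3)[OF that] K(1) by (simp add: mult_nonneg_nonpos)
        show "P x \<le> \<phi> x" if "x \<in> frontier \<Omega>" for x
        proof (cases "dist x \<xi> < d")
          case True
          have "\<bar>P x - P \<xi>\<bar> < e / 2" using d(2) True that cl by blast
          moreover have "0 \<le> K * b x" using K(1) b0 that cl by (intro mult_nonneg_nonneg) auto
          ultimately show ?thesis unfolding \<phi>_def abs_less_iff mult_1 by linarith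
        next
          case False
          have "K * m \<le> K * b x" using m(2)[of x] False that cl K(1) by (intro mult_left_mono) auto
          moreover have "\<bar>P x\<bar> \<le> M" "\<bar>P \<xi>\<bar> \<le> M" using M that fr cl by blast+
          ultimately show ?thesis using K(2) e unfolding \<phi>_def mult_1 by linarith
        qed
      qed (rule that)
      obtain d' where d': "d' > 0" "\<And>x. x \<in> closure \<Omega> \<Longrightarrow> dist x \<xi> < d' \<Longrightarrow> \<bar>b x - b \<xi>\<bar> < e / (2 * (K + 1))"
        using b(2) \<xi> e K(1) unfolding continuous_on_iff dist_real_def
        by (metis add_nonneg_pos divide_pos_pos mult_pos_pos zero_less_numeral zero_less_one)
      have "\<bar>U x - U \<xi>\<bar> < e" if x: "x \<in> closure \<Omega>" "dist x \<xi> < min d d'" for x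
      proof -
        have "K * b x \<le> (K + 1) * b x" using b0[OF x(1)] by (intro mult_right_mono) auto
        also have "\<dots> < (K + 1) * (e / (2 * (K + 1)))"
        proof (rule mult_strict_left_mono)
          have "\<bar>b x - b \<xi>\<bar> < e / (2 * (K + 1))" using d'(2)[of x] x by simp
          then show "b x < e / (2 * (K + 1))" unfolding b(4) by linarith
        qed (use K(1) in simp)
        also have "\<dots> = e / 2"
        proof -
          have "q * (e / (2 * q)) = e / 2" if "q \<noteq> 0" for q using that by simp
          from this[of "K + 1"] show ?thesis using K(1) by linarith
        qed
        finally have "U x < P \<xi> + e" using U\<phi>[OF x(1)] unfolding \<phi>_def mult_1 by linarith
        moreover have "\<bar>P x - P \<xi>\<bar> < e / 2" using d(2)[of x] x by simp
        then have "P \<xi> - e < U x" using Ub[OF x(1)] e unfolding abs_less_iff by linarith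
        ultimately show ?thesis unfolding Ufr[OF fr] abs_less_iff by linarith
      qed
      then show "\<exists>d>0. \<forall>x'\<in>closure \<Omega>. dist x' \<xi> < d \<longrightarrow> dist (U x') (U \<xi>) < e"
        using d(1) d'(1) by (intro exI[of _ "min d d'"]) (auto simp: dist_real_def)
    qed
  qed
  then have "continuous_on (closure \<Omega>) U" by (simp add: continuous_on_eq_continuous_within)
  then show thesis using that[OF UC _ Ul Ufr] by blast
qed

text \<open>A polynomial p is the difference of the subharmonic functions p + c |x|^2 and c |x|^2
  once c bounds |\<Delta> p| on the closure; both summands are admissible starting points for
  sweeping.\<close>

lemma dirichlet:
  fixes \<Omega> :: "'a::euclidean_space set"
  assumes sd: "smooth_bounded_domain \<Omega>" and u: "continuous_on (frontier \<Omega>) u"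
  obtains H where "continuous_on (closure \<Omega>) H" "Ck_on 2 H \<Omega>" "\<And>x. x \<in> \<Omega> \<Longrightarrow> laplacian H x = 0"
    "\<And>x. x \<in> frontier \<Omega> \<Longrightarrow> H x = u x"
proof -
  have \<Omega>: "open \<Omega>" "bounded \<Omega>" using sd by (auto simp: smooth_bounded_domain_def)
  have "\<exists>h. Ck_on 2 h \<Omega> \<and> continuous_on (closure \<Omega>) h \<and>
      (\<forall>x\<in>\<Omega>. laplacian h x = 0) \<and> (\<forall>x\<in>frontier \<Omega>. h x = p x)"
    if p: "real_polynomial_function p" for p
  proof -
    obtain n where n: "p \<in> fs.span (mon n)" using polynomial_in_span_mon[OF p] by blast
    have pC: "Ck_on 2 p S" for S by (rule span_mon_laplacian(1)[OF n])
    have "continuous_on (closure \<Omega>) (laplacian p)" by (rule laplacian_continuous[OF pC])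
    moreover have "compact (closure \<Omega>)" using \<Omega>(2) by (simp add: compact_closure)
    ultimately obtain K where K: "\<And>x. x \<in> closure \<Omega> \<Longrightarrow> \<bar>laplacian p x\<bar> \<le> K"
      using compact_continuous_bound by metis
    define q where "q = (\<lambda>x::'a. (x - 0) \<bullet> (x - 0))"
    have q: "Ck_on 2 q \<Omega>" "\<And>x. x \<in> \<Omega> \<Longrightarrow> laplacian q x = 2 * DIM('a)"
      unfolding q_def by (rule Ck2_quadratic[OF \<Omega>(1)]; assumption)+
    have qc: "continuous_on S q" for S unfolding q_def by (intro continuous_intros)
    have pc: "continuous_on S p" for S by (rule Ck2_continuous[OF pC])
    define c where "c = \<bar>K\<bar>"
    have N: "1 \<le> 2 * real DIM('a)" using DIM_positive[where 'a='a] by linarith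
    note pq = Ck2_lincomb[OF \<Omega>(1) pC q(1), where a=1 and b=c]
    have s1: "0 \<le> laplacian (\<lambda>x. 1 * p x + c * q x) x" if x: "x \<in> \<Omega>" for x
    proof -
      have "\<bar>laplacian p x\<bar> \<le> K" using K x closure_subset by blast
      moreover have "c * 1 \<le> c * (2 * DIM('a))" using N by (intro mult_left_mono) (auto simp: c_def)
      ultimately show ?thesis using pq(2)[OF x] q(2)[OF x] by (auto simp: c_def)
    qed
    have cont: "continuous_on (closure \<Omega>) (\<lambda>x. 1 * p x + c * q x)" by (intro continuous_intros pc qc)
    obtain H1 where H1: "Ck_on 2 H1 \<Omega>" "continuous_on (closure \<Omega>) H1" "\<And>x. x \<in> \<Omega> \<Longrightarrow> laplacian H1 x = 0"
      "\<And>x. x \<in> frontier \<Omega> \<Longrightarrow> H1 x = 1 * p x + c * q x"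
      using dirichlet_subharmonic[OF sd pq(1) cont s1] by metis
    have s2: "0 \<le> laplacian q x" if "x \<in> \<Omega>" for x using q(2)[OF that] by simp
    obtain H2 where H2: "Ck_on 2 H2 \<Omega>" "continuous_on (closure \<Omega>) H2" "\<And>x. x \<in> \<Omega> \<Longrightarrow> laplacian H2 x = 0"
      "\<And>x. x \<in> frontier \<Omega> \<Longrightarrow> H2 x = q x"
      using dirichlet_subharmonic[OF sd q(1) qc s2] by metis
    note HH = Ck2_lincomb[OF \<Omega>(1) H1(1) H2(1), where a=1 and b="-c"]
    show ?thesis
    proof (intro exI[of _ "\<lambda>x. 1 * H1 x + - c * H2 x"] conjI ballI)
      show "continuous_on (closure \<Omega>) (\<lambda>x. 1 * H1 x + - c * H2 x)" by (intro continuous_intros H1 H2)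
    qed (use HH H1 H2 in auto)
  qed
  from dirichlet_of_polynomial[OF \<Omega> this u] that show thesis by blast
qed

text \<open>The Newton potential of h extended by zero has Laplacian k minus a multiple of h on the
  domain, where k is the mollification at the coarsest scale. A scale large enough makes k a
  constant, which a quadratic removes; a harmonic function then corrects the boundary
  values.\<close>

lemma poisson:
  fixes \<Omega> :: "'a::euclidean_space set"
  assumes sd: "smooth_bounded_domain \<Omega>" and h: "continuous_on (closure \<Omega>) h" "loc_hoelder \<Omega> h"
  obtains v where "Ck_on 2 v \<Omega>" "continuous_on (closure \<Omega>) v" "\<And>x. x \<in> \<Omega> \<Longrightarrow> - laplacian v x = h x"
    "\<And>x. x \<in> frontier \<Omega> \<Longrightarrow> v x = 0"
proof -
  have \<Omega>: "open \<Omega>" "bounded \<Omega>" using sd by (auto simp: smooth_bounded_domain_def)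
  have cc: "compact (closure \<Omega>)" using \<Omega>(2) by (simp add: compact_closure)
  obtain D where D: "0 < D" "\<And>x. x \<in> closure \<Omega> \<Longrightarrow> norm x \<le> D" using compact_imp_bounded[OF cc] by (auto simp: bounded_pos)
  \<comment> \<open>Two points of the closure are at distance at most 2 D = R / 2, and
    \<open>eta\<close> equals 1 on the ball of radius 1/2; hence the mollification at scale R is the
    same number at every point of the domain.\<close>
  define R where "R = 4 * D"
  have R: "0 < R" using D by (simp add: R_def)
  define h0 where "h0 = (\<lambda>x. if x \<in> closure \<Omega> then h x else 0)"
  have ih: "integrable lebesgue h0" unfolding h0_def by (rule integrable_restrict_compact[OF cc h(1)])
  obtain B where "0 \<le> B" "\<And>x. x \<in> closure \<Omega> \<Longrightarrow> \<bar>h x\<bar> \<le> B"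
    using compact_continuous_bound[OF cc h(1)] by metis
  then have B: "\<bar>h0 x\<bar> \<le> B" for x by (simp add: h0_def)
  have lh: "loc_hoelder \<Omega> h0"
    unfolding loc_hoelder_def
  proof
    fix x assume "x \<in> \<Omega>"
    then obtain r \<gamma> C where r: "0 < r" "0 < \<gamma>" "0 \<le> C" "ball x r \<subseteq> \<Omega>" "\<forall>y\<in>ball x r. \<forall>z\<in>ball x r. \<bar>h y - h z\<bar> \<le> C * dist y z powr \<gamma>"
      using h(2) unfolding loc_hoelder_def by meson
    have "h0 y = h y" if "y \<in> ball x r" for y
    proof -
      have "y \<in> closure \<Omega>" using that r(4) closure_subset by blast
      then show ?thesis by (simp add: h0_def)
    qed
    then show "\<exists>r>0. \<exists>\<gamma>>0. \<exists>C\<ge>0. ball x r \<subseteq> \<Omega> \<and> (\<forall>y\<in>ball x r. \<forall>z\<in>ball x r. \<bar>h0 y - h0 z\<bar> \<le> C * dist y z powr \<gamma>)"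
      using r by (intro exI[of _ r] exI[of _ \<gamma>] exI[of _ C] conjI) auto
  qed
  define N where "N = (\<lambda>x. \<Sum>k. (R / 2 ^ k)\<^sup>2 * mollify Phi (R / 2 ^ k) h0 x)"
  note NP = newton_potential[OF R ih B \<Omega>(1) lh, folded N_def]
  define k where "k = (LINT y|lebesgue. h0 y) / R ^ DIM('a)"
  have k: "mollify eta R h0 x = k" if x: "x \<in> \<Omega>" for x
  proof -
    have "eta (inverse R *\<^sub>R (x - y)) * h0 y = h0 y" for y
    proof (cases "y \<in> closure \<Omega>")
      case True
      have "x \<in> closure \<Omega>" using x closure_subset by blast
      then have "norm (x - y) \<le> 2 * D" using D(2)[of x] D(2)[OF True] norm_triangle_ineq4[of x y] by linarith
      then have "norm (inverse R *\<^sub>R (x - y)) \<le> 1 / 2"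
        unfolding norm_inverse_scaleR[OF R] using D(1) by (simp add: R_def field_simps)
      then have "(norm (inverse R *\<^sub>R (x - y)))\<^sup>2 \<le> (1 / 2)\<^sup>2" by (rule power_mono) simp
      then have "eta (inverse R *\<^sub>R (x - y)) = 1" unfolding eta_def dot_square_norm by (intro e0_one) (simp add: power2_eq_square)
      then show ?thesis by simp
    qed (simp add: h0_def)
    then show ?thesis unfolding mollify_def k_def by (simp only:)
  qed
  let ?c = "eta_mass TYPE('a)"
  have c: "0 < ?c" by (rule eta_mass_pos)
  define q where "q = (\<lambda>x::'a. (x - 0) \<bullet> (x - 0))"
  have q: "Ck_on 2 q \<Omega>" "\<And>x. x \<in> \<Omega> \<Longrightarrow> laplacian q x = 2 * DIM('a)"
    unfolding q_def by (rule Ck2_quadratic[OF \<Omega>(1)]; assumption)+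
  \<comment> \<open>Laplacian of the first summand: k divided by the mass of \<open>eta\<close>,
    minus h. The quadratic cancels the constant.\<close>
  define v1 where "v1 = (\<lambda>x. (1 / ?c) * N x + (- k / (2 * DIM('a) * ?c)) * q x)"
  note V = Ck2_lincomb[OF \<Omega>(1) NP(2) q(1), where a="1 / ?c" and b="- k / (2 * DIM('a) * ?c)", folded v1_def]
  have v1l: "- laplacian v1 x = h x" if x: "x \<in> \<Omega>" for x
  proof -
    have "h0 x = h x" using x closure_subset by (auto simp: h0_def)
    then show ?thesis using V(2)[OF x] NP(3)[OF x] k[OF x] q(2)[OF x] c by (simp add: field_simps)
  qed
  have v1c: "continuous_on S v1" for S
    unfolding v1_def q_def by (intro continuous_intros NP(1))
  obtain H where H: "continuous_on (closure \<Omega>) H" "Ck_on 2 H \<Omega>" "\<And>x. x \<in> \<Omega> \<Longrightarrow> laplacian H x = 0"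
    "\<And>x. x \<in> frontier \<Omega> \<Longrightarrow> H x = v1 x"
    using dirichlet[OF sd v1c] by metis
  note VH = Ck2_diff[OF \<Omega>(1) V(1) H(2)]
  show thesis
  proof (rule that[of "\<lambda>x. v1 x - H x"])
    show "continuous_on (closure \<Omega>) (\<lambda>x. v1 x - H x)" by (intro continuous_intros v1c H(1))
  qed (use VH H v1l in auto)
qed

section \<open>Dini's theorem and the class of locally Hoelder functions\<close>

text \<open>Points violating the bound at ever later indices would accumulate at some l. A fixed
  index k is good at l, by continuity also at nearby points, and monotonicity extends this to all
  later indices.\<close>

lemma dini:
  fixes f :: "nat \<Rightarrow> 'a::metric_space \<Rightarrow> real"
  assumes C: "compact C" and f: "\<And>n. continuous_on C (f n)" "continuous_on C F"
    and inc: "\<And>n x. x \<in> C \<Longrightarrow> f n x \<le> f (Suc n) x" and lim: "\<And>x. x \<in> C \<Longrightarrow> (\<lambda>n. f n x) \<longlonglongrightarrow> F x" and e: "0 < e"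
  shows "\<exists>N. \<forall>n\<ge>N. \<forall>x\<in>C. F x - f n x < e"
proof (rule ccontr)
  assume "\<not> ?thesis"
  then have "\<forall>N. \<exists>n\<ge>N. \<exists>x\<in>C. e \<le> F x - f n x" by (meson not_less)
  then obtain m y where m: "\<And>N. N \<le> m N" "\<And>N. y N \<in> C" "\<And>N. e \<le> F (y N) - f (m N) (y N)" by metis
  obtain l r where l: "l \<in> C" "strict_mono r" "(y \<circ> r) \<longlonglongrightarrow> l"
    using C m(2) unfolding compact_def by blast
  have inc': "f i x \<le> f j x" if "x \<in> C" "i \<le> j" for i j x
    using lift_Suc_mono_le[of "\<lambda>n. f n x" i j] inc that by blast
  obtain k where k: "F l - f k l < e"
  proof -
    have "(\<lambda>n. F l - f n l) \<longlonglongrightarrow> F l - F l" by (intro tendsto_intros lim l)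
    then have "\<forall>\<^sub>F n in sequentially. F l - f n l < e" using e by (intro order_tendstoD(2)) auto
    then show ?thesis using that by (auto simp: eventually_sequentially)
  qed
  have "continuous_on C (\<lambda>x. F x - f k x)" by (intro continuous_intros f)
  then have "(\<lambda>n. F ((y \<circ> r) n) - f k ((y \<circ> r) n)) \<longlonglongrightarrow> F l - f k l"
    using l m(2) by (intro continuous_on_tendsto_compose[of C "\<lambda>x. F x - f k x"]) (auto simp: o_def)
  then have "\<forall>\<^sub>F n in sequentially. F ((y \<circ> r) n) - f k ((y \<circ> r) n) < e" using k by (rule order_tendstoD(2))
  then obtain n where n: "n \<ge> k" "F (y (r n)) - f k (y (r n)) < e"
    unfolding eventually_sequentially by (metis comp_apply nle_le)
  have "k \<le> m (r n)" using n(1) m(1)[of "r n"] seq_suble[OF l(2), of n] by linarith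
  then have "f k (y (r n)) \<le> f (m (r n)) (y (r n))" using inc' m(2) by blast
  then show False using n(2) m(3)[of "r n"] by linarith
qed

lemma loc_hoelder_lipschitz:
  assumes "\<And>x. x \<in> S \<Longrightarrow> \<exists>r>0. \<exists>L\<ge>0. ball x r \<subseteq> S \<and> (\<forall>y\<in>ball x r. \<forall>z\<in>ball x r. \<bar>h y - h z\<bar> \<le> L * norm (y - z))"
  shows "loc_hoelder S h"
  unfolding loc_hoelder_def
proof
  fix x assume "x \<in> S"
  then obtain r L where "r > 0" "L \<ge> 0" "ball x r \<subseteq> S" "\<forall>y\<in>ball x r. \<forall>z\<in>ball x r. \<bar>h y - h z\<bar> \<le> L * norm (y - z)"
    using assms by metis
  then show "\<exists>r>0. \<exists>\<gamma>>0. \<exists>C\<ge>0. ball x r \<subseteq> S \<and> (\<forall>y\<in>ball x r. \<forall>z\<in>ball x r. \<bar>h y - h z\<bar> \<le> C * dist y z powr \<gamma>)"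
    by (intro exI[of _ r] exI[of _ "1::real"] exI[of _ L] conjI) (auto simp: dist_norm)
qed

lemma loc_hoelder_mult:
  assumes h: "loc_hoelder S h" "loc_hoelder S k" and B: "\<And>x. x \<in> S \<Longrightarrow> \<bar>h x\<bar> \<le> B" "\<And>x. x \<in> S \<Longrightarrow> \<bar>k x\<bar> \<le> B"
  shows "loc_hoelder S (\<lambda>x. h x * k x)"
  unfolding loc_hoelder_def
proof
  fix x assume x: "x \<in> S"
  obtain r1 \<gamma>1 C1 where 1: "r1 > 0" "\<gamma>1 > 0" "C1 \<ge> 0" "ball x r1 \<subseteq> S"
    "\<And>y z. y \<in> ball x r1 \<Longrightarrow> z \<in> ball x r1 \<Longrightarrow> \<bar>h y - h z\<bar> \<le> C1 * dist y z powr \<gamma>1"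
    using h(1) x unfolding loc_hoelder_def by meson
  obtain r2 \<gamma>2 C2 where 2: "r2 > 0" "\<gamma>2 > 0" "C2 \<ge> 0" "ball x r2 \<subseteq> S"
    "\<And>y z. y \<in> ball x r2 \<Longrightarrow> z \<in> ball x r2 \<Longrightarrow> \<bar>k y - k z\<bar> \<le> C2 * dist y z powr \<gamma>2"
    using h(2) x unfolding loc_hoelder_def by meson
  \<comment> \<open>Radius at most 1/2 keeps distances at most 1, so that the smaller of the two
    exponents gives the larger power.\<close>
  define r where "r = min (min r1 r2) (1/2)"
  define \<gamma> where "\<gamma> = min \<gamma>1 \<gamma>2"
  define C where "C = B * C1 + B * C2"
  have B0: "0 \<le> B" using B(1)[OF x] by linarith
  have sub: "ball x r \<subseteq> ball x r1" "ball x r \<subseteq> ball x r2" by (auto simp: r_def)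
  have "\<bar>h y * k y - h z * k z\<bar> \<le> C * dist y z powr \<gamma>" if y: "y \<in> ball x r" and z: "z \<in> ball x r" for y z
  proof -
    have d: "dist y z \<le> 1" using y z dist_triangle[of y z x] by (simp add: r_def dist_commute)
    have p: "dist y z powr \<gamma>1 \<le> dist y z powr \<gamma>" "dist y z powr \<gamma>2 \<le> dist y z powr \<gamma>"
      using d by (cases "y = z"; auto intro!: powr_mono' simp: \<gamma>_def)+
    have "h y * k y - h z * k z = (h y - h z) * k y + h z * (k y - k z)" by (simp add: algebra_simps)
    also have "\<bar>\<dots>\<bar> \<le> \<bar>h y - h z\<bar> * \<bar>k y\<bar> + \<bar>h z\<bar> * \<bar>k y - k z\<bar>" unfolding abs_mult[symmetric] by (rule abs_triangle_ineq)
    also have "\<dots> \<le> (C1 * dist y z powr \<gamma>) * B + B * (C2 * dist y z powr \<gamma>)"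
    proof (intro add_mono mult_mono)
      show "\<bar>h y - h z\<bar> \<le> C1 * dist y z powr \<gamma>" using 1(5)[of y z] sub y z mult_left_mono[OF p(1) 1(3)] by force
      show "\<bar>k y - k z\<bar> \<le> C2 * dist y z powr \<gamma>" using 2(5)[of y z] sub y z mult_left_mono[OF p(2) 2(3)] by force
      show "\<bar>k y\<bar> \<le> B" "\<bar>h z\<bar> \<le> B" using B sub y z 1(4) by blast+
    qed (use 1(3) B0 in auto)
    also have "\<dots> = C * dist y z powr \<gamma>" by (simp add: C_def algebra_simps)
    finally show ?thesis .
  qed
  moreover have "0 < r" "0 < \<gamma>" "0 \<le> C" "ball x r \<subseteq> S" using 1 2 B0 sub by (auto simp: r_def \<gamma>_def C_def)
  ultimately show "\<exists>r>0. \<exists>\<gamma>>0. \<exists>C\<ge>0. ball x r \<subseteq> S \<and>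
      (\<forall>y\<in>ball x r. \<forall>z\<in>ball x r. \<bar>h y * k y - h z * k z\<bar> \<le> C * dist y z powr \<gamma>)" by blast
qed

lemma loc_hoelder_compose:
  assumes u: "loc_hoelder S u" and L: "0 \<le> L" "\<And>s t. s \<in> T \<Longrightarrow> t \<in> T \<Longrightarrow> \<bar>f s - f t\<bar> \<le> L * \<bar>s - t\<bar>" and T: "\<And>x. x \<in> S \<Longrightarrow> u x \<in> T"
  shows "loc_hoelder S (\<lambda>x. f (u x))"
  unfolding loc_hoelder_def
proof
  fix x assume x: "x \<in> S"
  obtain r \<gamma> C where 1: "r > 0" "\<gamma> > 0" "C \<ge> 0" "ball x r \<subseteq> S"
    "\<And>y z. y \<in> ball x r \<Longrightarrow> z \<in> ball x r \<Longrightarrow> \<bar>u y - u z\<bar> \<le> C * dist y z powr \<gamma>"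
    using u(1) x unfolding loc_hoelder_def by meson
  have "\<bar>f (u y) - f (u z)\<bar> \<le> (L * C) * dist y z powr \<gamma>" if y: "y \<in> ball x r" and z: "z \<in> ball x r" for y z
  proof -
    have "\<bar>f (u y) - f (u z)\<bar> \<le> L * \<bar>u y - u z\<bar>" using T 1(4) y z by (intro L(2)) blast+
    also have "\<dots> \<le> L * (C * dist y z powr \<gamma>)" using L(1) 1(5)[OF y z] by (rule mult_left_mono[rotated])
    finally show ?thesis by (simp add: mult.assoc)
  qed
  moreover have "0 \<le> L * C" using L(1) 1(3) by simp
  ultimately show "\<exists>r>0. \<exists>\<gamma>>0. \<exists>C\<ge>0. ball x r \<subseteq> S \<and>
      (\<forall>y\<in>ball x r. \<forall>z\<in>ball x r. \<bar>f (u y) - f (u z)\<bar> \<le> C * dist y z powr \<gamma>)" using 1(1,2,4) by blast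
qed

lemma Ck2_loc_hoelder:
  assumes S: "open S" and u: "Ck_on 2 u S"
  shows "loc_hoelder S u"
proof (rule loc_hoelder_lipschitz)
  fix x assume "x \<in> S"
  then obtain e where e: "0 < e" "cball x e \<subseteq> S" using S open_contains_cball by blast
  define R where "R = e / 4"
  have R: "0 < R" "cball x (2 * R) \<subseteq> ball x e" "R \<le> e" using e(1) by (auto simp: R_def)
  have be: "ball x e \<subseteq> cball x e" by auto
  obtain A where A: "0 \<le> A" "\<And>y. y \<in> cball x e \<Longrightarrow> \<bar>u y\<bar> \<le> A"
    using compact_continuous_bound[OF compact_cball continuous_on_subset[OF Ck2_continuous[OF u] e(2)]] by metis
  obtain B where B: "0 \<le> B" "\<And>y. y \<in> cball x e \<Longrightarrow> \<bar>laplacian u y\<bar> \<le> B"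
    using compact_continuous_bound[OF compact_cball continuous_on_subset[OF laplacian_continuous[OF u] e(2)]] by metis
  have ub: "Ck_on 2 u (ball x e)" using Ck2_subset[OF u] e(2) be by blast
  have AB: "\<forall>y\<in>ball x e. \<bar>u y\<bar> \<le> A" "\<forall>y\<in>ball x e. \<bar>laplacian u y\<bar> \<le> B" using A(2) B(2) be by blast+
  obtain L where L0: "0 < L" "\<forall>(v::'a \<Rightarrow> real) S x0 A B. open S \<longrightarrow> cball x0 (2 * R) \<subseteq> S \<longrightarrow> Ck_on 2 v S \<longrightarrow>
       (\<forall>y\<in>S. \<bar>v y\<bar> \<le> A) \<longrightarrow> (\<forall>y\<in>S. \<bar>laplacian v y\<bar> \<le> B) \<longrightarrow>
       (\<forall>x\<in>ball x0 R. \<forall>y\<in>ball x0 R. \<bar>v x - v y\<bar> \<le> L * (A + B) * norm (x - y))"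
    using interior_lipschitz[where 'a='a, OF R(1)] by blast
  have "\<forall>y\<in>ball x R. \<forall>z\<in>ball x R. \<bar>u y - u z\<bar> \<le> L * (A + B) * norm (y - z)"
    by (rule L0(2)[THEN spec, THEN spec, THEN spec, THEN spec, THEN spec, THEN mp, THEN mp, THEN mp, THEN mp, THEN mp,
          OF open_ball R(2) ub AB])
  note L = L0(1) this
  moreover have "ball x R \<subseteq> S" using R(3) e(2) by force
  ultimately show "\<exists>r>0. \<exists>L\<ge>0. ball x r \<subseteq> S \<and> (\<forall>y\<in>ball x r. \<forall>z\<in>ball x r. \<bar>u y - u z\<bar> \<le> L * norm (y - z))"
    using R(1) L A(1) B(1) by (intro exI[of _ R] exI[of _ "L * (A + B)"] conjI) simp_all
qed

section \<open>The Green operator and monotone iteration\<close>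

locale smooth_domain =
  fixes \<Omega> :: "'a::euclidean_space set"
  assumes sd: "smooth_bounded_domain \<Omega>"
begin

lemma open_dom: "open \<Omega>" and bounded_dom: "bounded \<Omega>" and connected_dom: "connected \<Omega>" and nonempty_dom: "\<Omega> \<noteq> {}"
  using sd by (auto simp: smooth_bounded_domain_def)

lemma compact_cl: "compact (closure \<Omega>)"
  using bounded_dom by (simp add: compact_closure)

lemma dom_cl: "x \<in> \<Omega> \<Longrightarrow> x \<in> closure \<Omega>"
  using closure_subset by blast

lemma fr_cl: "x \<in> frontier \<Omega> \<Longrightarrow> x \<in> closure \<Omega>"
  by (simp add: frontier_def)

lemma cl_cases: "x \<in> closure \<Omega> \<Longrightarrow> x \<in> \<Omega> \<or> x \<in> frontier \<Omega>"
  using closure_Un_frontier[of \<Omega>] by blast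

text \<open>The sources for which \<open>poisson\<close> applies. The class is closed under products
  and under composition with f as long as the inner function stays in [0, \<theta>], \<theta> < 1,
  so it is preserved by the iteration.\<close>

definition src :: "('a \<Rightarrow> real) \<Rightarrow> bool" where
  "src h \<longleftrightarrow> continuous_on (closure \<Omega>) h \<and> loc_hoelder \<Omega> h"

definition sol :: "('a \<Rightarrow> real) \<Rightarrow> ('a \<Rightarrow> real) \<Rightarrow> bool" where
  "sol v h \<longleftrightarrow> Ck_on 2 v \<Omega> \<and> continuous_on (closure \<Omega>) v \<and> (\<forall>x\<in>\<Omega>. - laplacian v x = h x) \<and> (\<forall>x\<in>frontier \<Omega>. v x = 0)"

text \<open>The Green operator; unspecified unless \<open>src h\<close> holds.\<close>

definition Gr :: "('a \<Rightarrow> real) \<Rightarrow> 'a \<Rightarrow> real" where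
  "Gr h = (SOME v. sol v h)"

lemma Gr_sol: assumes "src h" shows "sol (Gr h) h"
  unfolding Gr_def
proof (rule someI_ex[where P="\<lambda>v. sol v h"])
  obtain v where "Ck_on 2 v \<Omega>" "continuous_on (closure \<Omega>) v" "\<And>x. x \<in> \<Omega> \<Longrightarrow> - laplacian v x = h x"
    "\<And>x. x \<in> frontier \<Omega> \<Longrightarrow> v x = 0" using assms poisson[OF sd] unfolding src_def by metis
  then show "\<exists>v. sol v h" unfolding sol_def by blast
qed

lemma sol_le_super:
  assumes "sol u h" and v: "Ck_on 2 v \<Omega>" "continuous_on (closure \<Omega>) v" "\<And>x. x \<in> \<Omega> \<Longrightarrow> h x \<le> - laplacian v x"
    "\<And>x. x \<in> frontier \<Omega> \<Longrightarrow> 0 \<le> v x" and x: "x \<in> closure \<Omega>"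
  shows "u x \<le> v x"
proof (rule laplacian_comparison[OF open_dom bounded_dom _ _ v(1,2) _ _ x])
  show "laplacian v x \<le> laplacian u x" if "x \<in> \<Omega>" for x
    using assms(1) v(3)[OF that] that unfolding sol_def by force
qed (use assms in \<open>auto simp: sol_def\<close>)

lemma sol_mono:
  assumes "sol u h" "sol v k" "\<And>x. x \<in> \<Omega> \<Longrightarrow> h x \<le> k x" "x \<in> closure \<Omega>"
  shows "u x \<le> v x"
  by (rule sol_le_super[OF assms(1) _ _ _ _ assms(4)]) (use assms(2,3) in \<open>auto simp: sol_def\<close>)

lemma sol_zero: "sol (\<lambda>_. 0) (\<lambda>_. 0)"
  unfolding sol_def using Ck2_const[OF open_dom] by auto

lemma sol_nonneg: "sol u h \<Longrightarrow> (\<And>x. x \<in> \<Omega> \<Longrightarrow> 0 \<le> h x) \<Longrightarrow> x \<in> closure \<Omega> \<Longrightarrow> 0 \<le> u x"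
  using sol_mono[OF sol_zero] by blast

lemma sol_scale: "sol u h \<Longrightarrow> sol (\<lambda>x. c * u x) (\<lambda>x. c * h x)"
  unfolding sol_def using Ck2_scale[OF open_dom, of u, where a=c]
  by (auto intro!: continuous_intros simp flip: mult_minus_right)

lemma sol_diff:
  assumes "sol u h" "sol v k" shows "sol (\<lambda>x. u x - v x) (\<lambda>x. h x - k x)"
proof -
  have C: "Ck_on 2 u \<Omega>" "Ck_on 2 v \<Omega>" using assms by (auto simp: sol_def)
  have "- laplacian (\<lambda>x. u x - v x) x = h x - k x" if x: "x \<in> \<Omega>" for x
  proof -
    have "- laplacian u x = h x" "- laplacian v x = k x" using assms x by (auto simp: sol_def)
    then show ?thesis using Ck2_diff(2)[OF open_dom C x] by linarith
  qed
  then show ?thesis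
    using assms Ck2_diff(1)[OF open_dom C] unfolding sol_def by (auto intro!: continuous_intros)
qed

lemma sol_cong: "sol u h \<Longrightarrow> (\<And>x. x \<in> closure \<Omega> \<Longrightarrow> u x = v x) \<Longrightarrow> (\<And>x. x \<in> \<Omega> \<Longrightarrow> h x = k x) \<Longrightarrow> sol v k"
  unfolding sol_def using Ck2_cong[OF open_dom, of u v] dom_cl fr_cl
  by (auto intro: continuous_on_eq)

lemma sol_pos:
  assumes "sol u h" "\<And>x. x \<in> \<Omega> \<Longrightarrow> 0 \<le> h x" "p \<in> \<Omega>" "h p \<noteq> 0" "x \<in> \<Omega>"
  shows "0 < u x"
proof (rule superharmonic_positive[OF open_dom connected_dom _ _ _ assms(3) _ assms(5)])
  show "laplacian u y \<le> 0" if "y \<in> \<Omega>" for y using assms(1,2) that unfolding sol_def by fastforce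
  show "0 \<le> u y" if "y \<in> \<Omega>" for y using sol_nonneg[OF assms(1,2)] dom_cl[OF that] by blast
  show "laplacian u p \<noteq> 0" using assms(1,3,4) unfolding sol_def by force
qed (use assms(1) in \<open>auto simp: sol_def\<close>)

lemma sol_src: "sol u h \<Longrightarrow> src u"
  unfolding sol_def src_def using Ck2_loc_hoelder[OF open_dom] by blast

lemma src_const: "src (\<lambda>_. c)"
  unfolding src_def by (auto intro!: Ck2_loc_hoelder[OF open_dom] Ck2_const open_dom)

lemma src_mult:
  assumes "src h" "src k" shows "src (\<lambda>x. h x * k x)"
proof -
  obtain A where A: "\<And>x. x \<in> closure \<Omega> \<Longrightarrow> \<bar>h x\<bar> \<le> A"
    using compact_continuous_bound[OF compact_cl] assms(1) unfolding src_def by metis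
  obtain B where B: "\<And>x. x \<in> closure \<Omega> \<Longrightarrow> \<bar>k x\<bar> \<le> B"
    using compact_continuous_bound[OF compact_cl] assms(2) unfolding src_def by metis
  have "loc_hoelder \<Omega> (\<lambda>x. h x * k x)"
    by (rule loc_hoelder_mult[where B="max A B"])
      (use assms A B dom_cl in \<open>auto simp: src_def intro: max.coboundedI1 max.coboundedI2\<close>)
  then show ?thesis using assms unfolding src_def by (auto intro!: continuous_intros)
qed

lemma src_hoelder: assumes "hoelder_on (closure \<Omega>) h" shows "src h"
proof -
  obtain \<gamma> C where g: "0 < \<gamma>" "\<forall>x\<in>closure \<Omega>. \<forall>y\<in>closure \<Omega>. \<bar>h x - h y\<bar> \<le> C * dist x y powr \<gamma>"
    using assms unfolding hoelder_on_def by blast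
  have g2: "\<bar>h x - h y\<bar> \<le> \<bar>C\<bar> * dist x y powr \<gamma>" if "x \<in> closure \<Omega>" "y \<in> closure \<Omega>" for x y
  proof -
    have "C * dist x y powr \<gamma> \<le> \<bar>C\<bar> * dist x y powr \<gamma>" by (intro mult_right_mono) auto
    then show ?thesis using g(2) that by force
  qed
  have "continuous (at x within closure \<Omega>) h" if x: "x \<in> closure \<Omega>" for x
    unfolding continuous_within
  proof (rule LIM_zero_cancel, rule Lim_null_comparison)
    show "\<forall>\<^sub>F y in at x within closure \<Omega>. norm (h y - h x) \<le> \<bar>C\<bar> * dist y x powr \<gamma>"
      unfolding eventually_at using g2 x by (intro exI[of _ 1]) auto
    show "((\<lambda>y. \<bar>C\<bar> * dist y x powr \<gamma>) \<longlongrightarrow> 0) (at x within closure \<Omega>)"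
      using g(1) by (auto intro!: tendsto_eq_intros tendsto_powr'[where a=0 and b=\<gamma>])
  qed
  moreover have "loc_hoelder \<Omega> h"
    unfolding loc_hoelder_def
  proof
    fix x assume "x \<in> \<Omega>"
    then obtain r where "0 < r" "ball x r \<subseteq> \<Omega>" using open_dom open_contains_ball by blast
    then show "\<exists>r>0. \<exists>\<gamma>>0. \<exists>C\<ge>0. ball x r \<subseteq> \<Omega> \<and> (\<forall>y\<in>ball x r. \<forall>z\<in>ball x r. \<bar>h y - h z\<bar> \<le> C * dist y z powr \<gamma>)"
      using g(1) by (intro exI[of _ r] exI[of _ \<gamma>] exI[of _ "\<bar>C\<bar>"] conjI ballI g2 dom_cl) auto
  qed
  ultimately show ?thesis unfolding src_def by (simp add: continuous_on_eq_continuous_within)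
qed

text \<open>A universal majorant: a source bounded by B produces a solution bounded by B times this
  function, which is continuous and zero on the boundary.\<close>

definition torsion :: "'a \<Rightarrow> real" where "torsion = Gr (\<lambda>_. 1)"

lemma torsion_sol: "sol torsion (\<lambda>_. 1)"
  unfolding torsion_def by (rule Gr_sol[OF src_const])

lemma torsion_nonneg: "x \<in> closure \<Omega> \<Longrightarrow> 0 \<le> torsion x"
  by (rule sol_nonneg[OF torsion_sol]) auto

lemma sol_bound:
  assumes "sol u h" "\<And>x. x \<in> \<Omega> \<Longrightarrow> \<bar>h x\<bar> \<le> B" "x \<in> closure \<Omega>"
  shows "\<bar>u x\<bar> \<le> B * torsion x"
proof -
  have s: "sol (\<lambda>x. c * torsion x) (\<lambda>x. c * 1)" for c by (rule sol_scale[OF torsion_sol])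
  have "u x \<le> B * torsion x" by (rule sol_mono[OF assms(1) s _ assms(3)]) (use assms(2) in \<open>force simp: abs_le_iff\<close>)
  moreover have "- B * torsion x \<le> u x"
    by (rule sol_mono[OF s assms(1) _ assms(3)]) (use assms(2) in \<open>force simp: abs_le_iff\<close>)
  ultimately show ?thesis by (simp add: abs_le_iff)
qed

text \<open>The uniform interior Lipschitz bound passes to the pointwise limit, and at the boundary
  all the functions are squeezed by the same multiple of \<open>torsion\<close>. The limit is thus
  admissible inside a source before it is known to solve anything.\<close>

lemma limit_src:
  assumes s: "\<And>n. sol (u n) (h n)" and B: "\<And>n x. x \<in> \<Omega> \<Longrightarrow> \<bar>h n x\<bar> \<le> B"
    and A: "\<And>n x. x \<in> closure \<Omega> \<Longrightarrow> \<bar>u n x\<bar> \<le> A" and lim: "\<And>x. x \<in> closure \<Omega> \<Longrightarrow> (\<lambda>n. u n x) \<longlonglongrightarrow> w x"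
  shows "src w"
proof -
  have lh: "loc_hoelder \<Omega> w"
  proof (rule loc_hoelder_lipschitz)
    fix x assume x: "x \<in> \<Omega>"
    then obtain e where e: "0 < e" "cball x e \<subseteq> \<Omega>" using open_dom open_contains_cball by blast
    define R where "R = e / 2"
    have R: "0 < R" "cball x (2 * R) \<subseteq> \<Omega>" "ball x R \<subseteq> \<Omega>" using e by (auto simp: R_def)
    obtain L where LL: "0 < L \<and> (\<forall>(v::'a \<Rightarrow> real) S x0 A B. open S \<longrightarrow> cball x0 (2 * R) \<subseteq> S \<longrightarrow> Ck_on 2 v S \<longrightarrow>
       (\<forall>y\<in>S. \<bar>v y\<bar> \<le> A) \<longrightarrow> (\<forall>y\<in>S. \<bar>laplacian v y\<bar> \<le> B) \<longrightarrow>
       (\<forall>x\<in>ball x0 R. \<forall>y\<in>ball x0 R. \<bar>v x - v y\<bar> \<le> L * (A + B) * norm (x - y)))"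
      using interior_lipschitz[where 'a='a, OF R(1)] ..
    note L = conjunct1[OF LL] conjunct2[OF LL]
    have un: "\<bar>u n y - u n z\<bar> \<le> L * (A + B) * norm (y - z)" if "y \<in> ball x R" "z \<in> ball x R" for n y z
    proof -
      have 1: "Ck_on 2 (u n) \<Omega>" using s[of n] by (simp add: sol_def)
      have 2: "\<forall>y\<in>\<Omega>. \<bar>u n y\<bar> \<le> A" using A dom_cl by blast
      have 3: "\<forall>y\<in>\<Omega>. \<bar>laplacian (u n) y\<bar> \<le> B"
      proof
        fix y assume y: "y \<in> \<Omega>"
        have "- laplacian (u n) y = h n y" using s[of n] y by (simp add: sol_def)
        then show "\<bar>laplacian (u n) y\<bar> \<le> B" using B[OF y, of n] by linarith
      qed
      have "\<forall>y\<in>ball x R. \<forall>z\<in>ball x R. \<bar>u n y - u n z\<bar> \<le> L * (A + B) * norm (y - z)"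
        by (rule L(2)[THEN spec, THEN spec, THEN spec, THEN spec, THEN spec, THEN mp, THEN mp, THEN mp, THEN mp, THEN mp,
              OF open_dom R(2) 1 2 3])
      then show ?thesis using that by blast
    qed
    have "\<bar>w y - w z\<bar> \<le> L * (A + B) * norm (y - z)" if yz: "y \<in> ball x R" "z \<in> ball x R" for y z
    proof (rule LIMSEQ_le_const2)
      have "y \<in> closure \<Omega>" "z \<in> closure \<Omega>" using yz R(3) dom_cl by blast+
      then show "(\<lambda>n. \<bar>u n y - u n z\<bar>) \<longlonglongrightarrow> \<bar>w y - w z\<bar>" by (intro tendsto_intros lim)
    qed (use un[OF yz] in auto)
    moreover have "0 \<le> A" "0 \<le> B" using A[OF dom_cl[OF x], of 0] B[OF x, of 0] by linarith+
    ultimately show "\<exists>r>0. \<exists>L\<ge>0. ball x r \<subseteq> \<Omega> \<and> (\<forall>y\<in>ball x r. \<forall>z\<in>ball x r. \<bar>w y - w z\<bar> \<le> L * norm (y - z))"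
      using R L(1) by (intro exI[of _ R] exI[of _ "L * (A + B)"] conjI) simp_all
  qed
  have wt: "\<bar>w x\<bar> \<le> B * torsion x" if "x \<in> closure \<Omega>" for x
    by (rule LIMSEQ_le_const2[OF tendsto_rabs[OF lim[OF that]]]) (use sol_bound[OF s B that] in auto)
  have "continuous (at x within closure \<Omega>) w" if x: "x \<in> closure \<Omega>" for x
    using cl_cases[OF x]
  proof
    assume "x \<in> \<Omega>"
    then show ?thesis using loc_hoelder_isCont[OF lh] continuous_at_imp_continuous_at_within by blast
  next
    assume fr: "x \<in> frontier \<Omega>"
    have t: "continuous_on (closure \<Omega>) torsion" "torsion x = 0" using torsion_sol fr by (auto simp: sol_def)
    then have w0: "w x = 0" using wt[OF x] by simp
    show ?thesis
      unfolding continuous_within w0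
    proof (rule Lim_null_comparison)
      show "\<forall>\<^sub>F y in at x within closure \<Omega>. norm (w y) \<le> B * torsion y"
        unfolding eventually_at using wt by (intro exI[of _ 1]) auto
      have "(torsion \<longlongrightarrow> 0) (at x within closure \<Omega>)" using t x unfolding continuous_on_def by force
      then show "((\<lambda>y. B * torsion y) \<longlongrightarrow> 0) (at x within closure \<Omega>)" by (auto intro!: tendsto_eq_intros)
    qed
  qed
  then show ?thesis using lh unfolding src_def by (simp add: continuous_on_eq_continuous_within)
qed

text \<open>No derivative is passed to the limit. Dini's theorem makes the sources converge
  uniformly, \<open>sol_bound\<close> turns this into convergence of the solutions to
  \<open>Gr h'\<close>, and uniqueness of limits identifies w with it.\<close>

lemma limit_sol:
  assumes s: "\<And>n. sol (u n) (h n)" and lim: "\<And>x. x \<in> closure \<Omega> \<Longrightarrow> (\<lambda>n. u n x) \<longlonglongrightarrow> w x"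
    and hn: "\<And>n. continuous_on (closure \<Omega>) (h n)" and h: "src h'" and inc: "\<And>n x. x \<in> closure \<Omega> \<Longrightarrow> h n x \<le> h (Suc n) x"
    and hl: "\<And>x. x \<in> closure \<Omega> \<Longrightarrow> (\<lambda>n. h n x) \<longlonglongrightarrow> h' x"
  shows "sol w h'"
proof -
  have S: "sol (Gr h') h'" by (rule Gr_sol[OF h])
  have hc: "continuous_on (closure \<Omega>) h'" using h by (simp add: src_def)
  have le: "h n x \<le> h' x" if "x \<in> closure \<Omega>" for n x
    by (rule LIMSEQ_le_const[OF hl[OF that]]) (use lift_Suc_mono_le[of "\<lambda>n. h n x" n] inc[OF that] in blast)
  have "w x = Gr h' x" if x: "x \<in> closure \<Omega>" for x
  proof -
    have "(\<lambda>n. Gr h' x - u n x) \<longlonglongrightarrow> 0"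
    proof (rule LIMSEQ_I)
      fix e :: real assume e: "0 < e"
      define d where "d = e / (torsion x + 1)"
      have t: "0 \<le> torsion x" by (rule torsion_nonneg[OF x])
      then have d: "0 < d" using e by (simp add: d_def)
      obtain N where N: "\<And>n y. n \<ge> N \<Longrightarrow> y \<in> closure \<Omega> \<Longrightarrow> h' y - h n y < d"
        using dini[OF compact_cl hn hc inc hl d] by blast
      have "norm (Gr h' x - u n x - 0) < e" if n: "n \<ge> N" for n
      proof -
        have "\<bar>Gr h' x - u n x\<bar> \<le> d * torsion x"
          by (rule sol_bound[OF sol_diff[OF S s] _ x]) (use N[OF n] le dom_cl in \<open>force simp: abs_le_iff\<close>)
        also have "\<dots> < d * (torsion x + 1)" using d by simp
        also have "\<dots> = e" using t by (simp add: d_def)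
        finally show ?thesis by simp
      qed
      then show "\<exists>no. \<forall>n\<ge>no. norm (Gr h' x - u n x - 0) < e" by blast
    qed
    moreover have "(\<lambda>n. Gr h' x - u n x) \<longlonglongrightarrow> Gr h' x - w x" by (intro tendsto_intros lim[OF x])
    ultimately show ?thesis using LIMSEQ_unique by fastforce
  qed
  then show ?thesis using sol_cong[OF S] by metis
qed

end

text \<open>One equation of the system, instantiated below with \<alpha>, f and with \<beta>, g so
  that each estimate is proved once.\<close>

locale nonlinearity = smooth_domain \<Omega> for \<Omega> :: "'a::euclidean_space set" +
  fixes \<alpha> :: "'a \<Rightarrow> real" and f :: "real \<Rightarrow> real"
  assumes coeff_hoelder: "hoelder_on (closure \<Omega>) \<alpha>"
    and coeff_nonneg: "\<forall>x\<in>closure \<Omega>. 0 \<le> \<alpha> x"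
    and coeff_nontrivial: "\<exists>x\<in>closure \<Omega>. \<alpha> x \<noteq> 0"
    and nonlin_C2: "C2_Ico01 f"
    and nonlin_pos': "\<forall>t\<in>{0..<1}. 0 < f t"
    and nonlin_mono': "mono_on {0..<1} f"
    and nonlin_convex: "strictly_convex_on {0..<1} f"
begin

lemma coeff_src: "src \<alpha>"
  by (rule src_hoelder[OF coeff_hoelder])

lemma coeff_ge0: "x \<in> closure \<Omega> \<Longrightarrow> 0 \<le> \<alpha> x"
  using coeff_nonneg by blast

text \<open>The hypothesis speaks of the closure, whereas the strong minimum principle asks for a
  point of the open domain; continuity bridges the gap.\<close>

lemma coeff_nontrivial_inside: "\<exists>p\<in>\<Omega>. \<alpha> p \<noteq> 0"
proof (rule ccontr)
  assume "\<not> ?thesis"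
  then have "\<alpha> x = 0" if "x \<in> closure \<Omega>" for x
    using continuous_constant_on_closure[of \<Omega> \<alpha> 0 x] coeff_src that unfolding src_def by blast
  then show False using coeff_nontrivial by blast
qed

lemma nonlin_pos: "0 \<le> t \<Longrightarrow> t < 1 \<Longrightarrow> 0 < f t"
  using nonlin_pos' by simp

lemma nonlin_mono: "0 \<le> s \<Longrightarrow> s \<le> t \<Longrightarrow> t < 1 \<Longrightarrow> f s \<le> f t"
  using nonlin_mono' unfolding mono_on_def by simp

lemma nonlin_lipschitz:
  assumes "\<theta> < 1"
  shows "\<exists>L\<ge>0. \<forall>s\<in>{0..\<theta>}. \<forall>t\<in>{0..\<theta>}. \<bar>f s - f t\<bar> \<le> L * \<bar>s - t\<bar>"
proof -
  obtain h' h'' where h: "\<And>t. t \<in> {0..<1} \<Longrightarrow> (f has_real_derivative h' t) (at t within {0..<1})"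
    "\<And>t. t \<in> {0..<1} \<Longrightarrow> (h' has_real_derivative h'' t) (at t within {0..<1})"
    using nonlin_C2 unfolding C2_Ico01_def by blast
  have sub: "{0..\<theta>} \<subseteq> {0..<1}" using assms by auto
  have "continuous_on {0..<1} h'" using h(2) by (rule DERIV_continuous_on)
  then have "continuous_on {0..\<theta>} h'" using sub by (rule continuous_on_subset)
  then obtain L where L: "0 \<le> L" "\<And>t. t \<in> {0..\<theta>} \<Longrightarrow> \<bar>h' t\<bar> \<le> L" using compact_continuous_bound[OF compact_Icc] by metis
  have "\<bar>f s - f t\<bar> \<le> L * \<bar>s - t\<bar>" if "s \<in> {0..\<theta>}" "t \<in> {0..\<theta>}" for s t
  proof -
    have "norm (f s - f t) \<le> L * norm (s - t)"
      by (rule field_differentiable_bound[where S="{0..\<theta>}" and f'=h'])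
        (use L(2) that assms in \<open>auto intro!: DERIV_subset[OF h(1) sub]\<close>)
    then show ?thesis by simp
  qed
  then show ?thesis using L(1) by blast
qed

lemma nonlin_continuous: "continuous_on {0..<1} f"
proof -
  obtain h' where "\<forall>t\<in>{0..<1}. (f has_real_derivative h' t) (at t within {0..<1})"
    using nonlin_C2 unfolding C2_Ico01_def by (elim exE conjE) (rule that)
  then show ?thesis by (intro DERIV_continuous_on[where D=h']) simp
qed

lemma compose_src:
  assumes z: "src z" "\<And>x. x \<in> closure \<Omega> \<Longrightarrow> 0 \<le> z x \<and> z x \<le> \<theta>" and \<theta>: "\<theta> < 1"
  shows "src (\<lambda>x. f (z x))"
  unfolding src_def
proof
  have "z ` closure \<Omega> \<subseteq> {0..<1}"
  proof
    fix t assume "t \<in> z ` closure \<Omega>"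
    then obtain x where x: "x \<in> closure \<Omega>" "t = z x" by blast
    show "t \<in> {0..<1}" using z(2)[OF x(1)] \<theta> x(2) by simp
  qed
  then show "continuous_on (closure \<Omega>) (\<lambda>x. f (z x))"
    using z(1) by (intro continuous_on_compose2[OF nonlin_continuous]) (simp_all add: src_def)
  obtain L where L: "0 \<le> L" "\<forall>s\<in>{0..\<theta>}. \<forall>t\<in>{0..\<theta>}. \<bar>f s - f t\<bar> \<le> L * \<bar>s - t\<bar>" using nonlin_lipschitz[OF \<theta>] by blast
  show "loc_hoelder \<Omega> (\<lambda>x. f (z x))"
  proof (rule loc_hoelder_compose[where u=z and T="{0..\<theta>}" and L=L])
    show "loc_hoelder \<Omega> z" using z(1) by (simp add: src_def)
    show "z x \<in> {0..\<theta>}" if "x \<in> \<Omega>" for x using z(2)[OF dom_cl[OF that]] by simp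
  qed (use L in blast)+
qed

definition rhs :: "real \<Rightarrow> ('a \<Rightarrow> real) \<Rightarrow> 'a \<Rightarrow> real" where
  "rhs l z x = l * \<alpha> x * f (z x)"

lemma rhs_src:
  assumes "src z" "\<And>x. x \<in> closure \<Omega> \<Longrightarrow> 0 \<le> z x \<and> z x \<le> \<theta>" "\<theta> < 1"
  shows "src (rhs l z)"
  using src_mult[OF src_mult[OF src_const[of l] coeff_src] compose_src[OF assms]] by (simp add: rhs_def[abs_def])

lemma rhs_mono:
  assumes "0 \<le> l" "l \<le> m" "0 \<le> z x" "z x \<le> z' x" "z' x < 1" "x \<in> closure \<Omega>"
  shows "rhs l z x \<le> rhs m z' x"
  unfolding rhs_def
  using assms coeff_ge0[OF assms(6)] nonlin_mono[of "z x" "z' x"] nonlin_pos[of "z x"]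
  by (intro mult_mono) auto

lemma rhs_nonneg: "0 \<le> l \<Longrightarrow> 0 \<le> z x \<Longrightarrow> z x < 1 \<Longrightarrow> x \<in> closure \<Omega> \<Longrightarrow> 0 \<le> rhs l z x"
  unfolding rhs_def using coeff_ge0 nonlin_pos[of "z x"] by simp

lemma rhs_sol_pos:
  assumes "sol u (rhs l z)" "0 < l" "\<And>x. x \<in> closure \<Omega> \<Longrightarrow> 0 \<le> z x \<and> z x < 1" "x \<in> \<Omega>"
  shows "0 < u x"
proof -
  obtain p where p: "p \<in> \<Omega>" "\<alpha> p \<noteq> 0" using coeff_nontrivial_inside by blast
  show ?thesis
  proof (rule sol_pos[OF assms(1) _ p(1) _ assms(4)])
    show "rhs l z p \<noteq> 0" using assms(2,3) p nonlin_pos[of "z p"] dom_cl unfolding rhs_def by force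
    show "0 \<le> rhs l z y" if "y \<in> \<Omega>" for y using rhs_nonneg assms(2,3) dom_cl[OF that] by simp
  qed
qed

lemma rhs_limit_sol:
  assumes \<theta>: "0 \<le> \<theta>" "\<theta> < 1" and l: "0 \<le> l"
    and v: "\<And>n. src (v n)" "\<And>n x. x \<in> closure \<Omega> \<Longrightarrow> 0 \<le> v n x \<and> v n x \<le> \<theta>" "\<And>n x. x \<in> closure \<Omega> \<Longrightarrow> v n x \<le> v (Suc n) x"
    and z: "src z" "\<And>x. x \<in> closure \<Omega> \<Longrightarrow> (\<lambda>n. v n x) \<longlonglongrightarrow> z x"
    and u: "\<And>n. sol (u n) (rhs l (v n))" and w: "\<And>x. x \<in> closure \<Omega> \<Longrightarrow> (\<lambda>n. u n x) \<longlonglongrightarrow> w x"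
  shows "sol w (rhs l z)"
proof (rule limit_sol[OF u w])
  have zb: "0 \<le> z x \<and> z x \<le> \<theta>" if x: "x \<in> closure \<Omega>" for x
    using LIMSEQ_le_const[OF z(2)[OF x], of 0] LIMSEQ_le_const2[OF z(2)[OF x], of \<theta>] v(2)[OF x] by blast
  show "continuous_on (closure \<Omega>) (rhs l (v n))" for n
    using rhs_src[OF v(1,2) \<theta>(2)] by (simp add: src_def)
  show "src (rhs l z)" by (rule rhs_src[OF z(1) zb \<theta>(2)])
  show "rhs l (v n) x \<le> rhs l (v (Suc n)) x" if x: "x \<in> closure \<Omega>" for n x
    using l v(2)[OF x, of n] v(2)[OF x, of "Suc n"] v(3)[OF x] \<theta> x by (intro rhs_mono) auto
  show "(\<lambda>n. rhs l (v n) x) \<longlonglongrightarrow> rhs l z x" if x: "x \<in> closure \<Omega>" for x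
  proof -
    have "(\<lambda>n. f (v n x)) \<longlonglongrightarrow> f (z x)"
    proof (rule continuous_on_tendsto_compose[OF nonlin_continuous z(2)[OF x]])
      show "z x \<in> {0..<1}" using zb[OF x] \<theta> by simp
      have "v n x \<in> {0..<1}" for n using v(2)[OF x, of n] \<theta> by simp
      then show "\<forall>\<^sub>F n in sequentially. v n x \<in> {0..<1}" by (rule always_eventually[OF allI])
    qed
    then show ?thesis unfolding rhs_def by (intro tendsto_intros)
  qed
qed auto

end

section \<open>The coupled monotone iteration\<close>

locale coupled = smooth_domain \<Omega> + A: nonlinearity \<Omega> \<alpha> f + B: nonlinearity \<Omega> \<beta> g
  for \<Omega> :: "'a::euclidean_space set" and \<alpha> \<beta> :: "'a \<Rightarrow> real" and f g :: "real \<Rightarrow> real"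
begin

fun iterate :: "real \<Rightarrow> real \<Rightarrow> nat \<Rightarrow> ('a \<Rightarrow> real) \<times> ('a \<Rightarrow> real)" where
  "iterate l m 0 = (\<lambda>_. 0, \<lambda>_. 0)"
| "iterate l m (Suc n) = (Gr (A.rhs l (snd (iterate l m n))), Gr (B.rhs m (fst (iterate l m n))))"

text \<open>The invariant of the iteration: it makes the next sources admissible, and
  \<open>Gr\<close> is unspecified on others.\<close>

definition good :: "real \<Rightarrow> ('a \<Rightarrow> real) \<times> ('a \<Rightarrow> real) \<Rightarrow> bool" where
  "good \<theta> p \<longleftrightarrow> src (fst p) \<and> src (snd p) \<and>
     (\<forall>x\<in>closure \<Omega>. 0 \<le> fst p x \<and> fst p x \<le> \<theta> \<and> 0 \<le> snd p x \<and> snd p x \<le> \<theta>)"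

lemma goodD:
  assumes "good \<theta> p"
  shows "src (fst p)" "src (snd p)" "x \<in> closure \<Omega> \<Longrightarrow> 0 \<le> fst p x \<and> fst p x \<le> \<theta>" "x \<in> closure \<Omega> \<Longrightarrow> 0 \<le> snd p x \<and> snd p x \<le> \<theta>"
  using assms by (auto simp: good_def)

lemma good_0: "0 \<le> \<theta> \<Longrightarrow> good \<theta> (iterate l m 0)"
  by (simp add: good_def src_const)

lemma iterate_step:
  assumes "good \<theta> (iterate l m n)" "\<theta> < 1" "0 \<le> l" "0 \<le> m"
  shows "sol (fst (iterate l m (Suc n))) (A.rhs l (snd (iterate l m n)))" "sol (snd (iterate l m (Suc n))) (B.rhs m (fst (iterate l m n)))"
    "x \<in> closure \<Omega> \<Longrightarrow> 0 \<le> fst (iterate l m (Suc n)) x" "x \<in> closure \<Omega> \<Longrightarrow> 0 \<le> snd (iterate l m (Suc n)) x"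
proof -
  note g = goodD[OF assms(1)]
  show s: "sol (fst (iterate l m (Suc n))) (A.rhs l (snd (iterate l m n)))" "sol (snd (iterate l m (Suc n))) (B.rhs m (fst (iterate l m n)))"
    using Gr_sol[OF A.rhs_src[OF g(2,4) assms(2)]] Gr_sol[OF B.rhs_src[OF g(1,3) assms(2)]] by simp_all
  show "0 \<le> fst (iterate l m (Suc n)) x" if "x \<in> closure \<Omega>"
    by (rule sol_nonneg[OF s(1) _ that]) (use A.rhs_nonneg g(4) assms dom_cl in \<open>meson order_le_less_trans\<close>)
  show "0 \<le> snd (iterate l m (Suc n)) x" if "x \<in> closure \<Omega>"
    by (rule sol_nonneg[OF s(2) _ that]) (use B.rhs_nonneg g(3) assms dom_cl in \<open>meson order_le_less_trans\<close>)
qed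

lemma good_Suc:
  assumes "good \<theta> (iterate l m n)" "\<theta> < 1" "0 \<le> l" "0 \<le> m"
    and "\<And>x. x \<in> closure \<Omega> \<Longrightarrow> fst (iterate l m (Suc n)) x \<le> \<theta>" "\<And>x. x \<in> closure \<Omega> \<Longrightarrow> snd (iterate l m (Suc n)) x \<le> \<theta>"
  shows "good \<theta> (iterate l m (Suc n))"
  unfolding good_def using iterate_step[OF assms(1-4)] sol_src assms(5,6) by blast

lemma iterate_le_super:
  assumes good: "good \<theta> (iterate l m n)" "\<theta> < 1" and l: "0 \<le> l" "0 \<le> m"
    and W: "Ck_on 2 W \<Omega>" "continuous_on (closure \<Omega>) W" and Z: "Ck_on 2 Z \<Omega>" "continuous_on (closure \<Omega>) Z"
    and b: "\<And>x. x \<in> closure \<Omega> \<Longrightarrow> 0 \<le> W x \<and> W x < 1 \<and> 0 \<le> Z x \<and> Z x < 1"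
    and sup: "\<And>x. x \<in> \<Omega> \<Longrightarrow> l * \<alpha> x * f (Z x) \<le> - laplacian W x" "\<And>x. x \<in> \<Omega> \<Longrightarrow> m * \<beta> x * g (W x) \<le> - laplacian Z x"
    and IH: "\<And>x. x \<in> closure \<Omega> \<Longrightarrow> fst (iterate l m n) x \<le> W x \<and> snd (iterate l m n) x \<le> Z x" and x: "x \<in> closure \<Omega>"
  shows "fst (iterate l m (Suc n)) x \<le> W x \<and> snd (iterate l m (Suc n)) x \<le> Z x"
proof
  note g = goodD[OF good(1)] and s = iterate_step[OF good l]
  show "fst (iterate l m (Suc n)) x \<le> W x"
  proof (rule sol_le_super[OF s(1) W _ _ x])
    fix y assume y: "y \<in> \<Omega>"
    have "A.rhs l (snd (iterate l m n)) y \<le> A.rhs l Z y"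
      using l g(4)[OF dom_cl[OF y]] IH[OF dom_cl[OF y]] b[OF dom_cl[OF y]] dom_cl[OF y] by (intro A.rhs_mono) auto
    then show "A.rhs l (snd (iterate l m n)) y \<le> - laplacian W y" using sup(1)[OF y] by (simp add: A.rhs_def)
  qed (use b fr_cl in blast)
  show "snd (iterate l m (Suc n)) x \<le> Z x"
  proof (rule sol_le_super[OF s(2) Z _ _ x])
    fix y assume y: "y \<in> \<Omega>"
    have "B.rhs m (fst (iterate l m n)) y \<le> B.rhs m W y"
      using l g(3)[OF dom_cl[OF y]] IH[OF dom_cl[OF y]] b[OF dom_cl[OF y]] dom_cl[OF y] by (intro B.rhs_mono) auto
    then show "B.rhs m (fst (iterate l m n)) y \<le> - laplacian Z y" using sup(2)[OF y] by (simp add: B.rhs_def)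
  qed (use b fr_cl in blast)
qed

text \<open>The hypothesis is a common bound \<theta> < 1 on the iterates and not a supersolution,
  so that classical and weak supersolutions can both supply it. The monotone limits are first shown
  to be admissible by \<open>limit_src\<close>, after which \<open>rhs_limit_sol\<close> identifies
  them as solutions. Minimality holds because each iterate lies below each classical
  solution.\<close>

lemma minimal_exists:
  assumes good: "\<And>n. good \<theta> (iterate l m n)" and \<theta>: "0 \<le> \<theta>" "\<theta> < 1" and l: "0 < l" "0 < m"
  shows "\<exists>w z. minimal_classical_solution \<Omega> \<alpha> \<beta> f g l m w z \<and> (\<forall>x\<in>\<Omega>. 0 < w x \<and> 0 < z x)"
proof -
  define w where "w = (\<lambda>n. fst (iterate l m n))"
  define z where "z = (\<lambda>n. snd (iterate l m n))"
  have l0: "0 \<le> l" "0 \<le> m" using l by auto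
  note gw = goodD[OF good]
  have src: "src (w n)" "src (z n)" for n using gw by (auto simp: w_def z_def)
  have bd: "0 \<le> w n x \<and> w n x \<le> \<theta>" "0 \<le> z n x \<and> z n x \<le> \<theta>" if "x \<in> closure \<Omega>" for n x
    using gw(3,4)[OF that] by (auto simp: w_def z_def)
  have sw: "sol (w (Suc n)) (A.rhs l (z n))" and sz: "sol (z (Suc n)) (B.rhs m (w n))" for n
    unfolding w_def z_def by (rule iterate_step(1,2)[OF good \<theta>(2) l0])+
  have inc: "w n x \<le> w (Suc n) x \<and> z n x \<le> z (Suc n) x" if "x \<in> closure \<Omega>" for n x
    using that
  proof (induction n arbitrary: x)
    case 0
    then show ?case using bd(1)[OF 0, of 1] bd(2)[OF 0, of 1] by (simp add: w_def z_def)
  next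
    case (Suc n)
    have "w (Suc n) x \<le> w (Suc (Suc n)) x"
    proof (rule sol_mono[OF sw sw _ Suc.prems])
      fix y assume y: "y \<in> \<Omega>"
      show "A.rhs l (z n) y \<le> A.rhs l (z (Suc n)) y"
        using Suc.IH[OF dom_cl[OF y]] bd(2)[OF dom_cl[OF y], of n] bd(2)[OF dom_cl[OF y], of "Suc n"] \<theta> l0 dom_cl[OF y]
        by (intro A.rhs_mono) auto
    qed
    moreover have "z (Suc n) x \<le> z (Suc (Suc n)) x"
    proof (rule sol_mono[OF sz sz _ Suc.prems])
      fix y assume y: "y \<in> \<Omega>"
      show "B.rhs m (w n) y \<le> B.rhs m (w (Suc n)) y"
        using Suc.IH[OF dom_cl[OF y]] bd(1)[OF dom_cl[OF y], of n] bd(1)[OF dom_cl[OF y], of "Suc n"] \<theta> l0 dom_cl[OF y]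
        by (intro B.rhs_mono) auto
    qed
    ultimately show ?case by blast
  qed
  have conv: "\<exists>L. (\<lambda>n. v n x) \<longlonglongrightarrow> L" if "\<And>n. v n x \<le> v (Suc n) x" "\<And>n. 0 \<le> v n x \<and> v n x \<le> \<theta>" for v :: "nat \<Rightarrow> 'a \<Rightarrow> real" and x
    using incseq_convergent[of "\<lambda>n. v n x" \<theta>] that by (metis incseq_SucI)
  define W where "W = (\<lambda>x. lim (\<lambda>n. w n x))"
  define Z where "Z = (\<lambda>x. lim (\<lambda>n. z n x))"
  have lw: "(\<lambda>n. w n x) \<longlonglongrightarrow> W x" if "x \<in> closure \<Omega>" for x
    unfolding W_def using conv[of w x] inc[OF that] bd(1)[OF that] by (metis limI)
  have lz: "(\<lambda>n. z n x) \<longlonglongrightarrow> Z x" if "x \<in> closure \<Omega>" for x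
    unfolding Z_def using conv[of z x] inc[OF that] bd(2)[OF that] by (metis limI)
  have lw1: "(\<lambda>n. w (Suc n) x) \<longlonglongrightarrow> W x" and lz1: "(\<lambda>n. z (Suc n) x) \<longlonglongrightarrow> Z x" if "x \<in> closure \<Omega>" for x
    by (rule LIMSEQ_Suc[OF lw[OF that]], rule LIMSEQ_Suc[OF lz[OF that]])
  have WZb: "0 \<le> W x \<and> W x \<le> \<theta>" "0 \<le> Z x \<and> Z x \<le> \<theta>" if "x \<in> closure \<Omega>" for x
    using LIMSEQ_le_const[OF lw[OF that], of 0] LIMSEQ_le_const2[OF lw[OF that], of \<theta>]
      LIMSEQ_le_const[OF lz[OF that], of 0] LIMSEQ_le_const2[OF lz[OF that], of \<theta>] bd[OF that] by blast+
  have const: "src (\<lambda>_. \<theta>)" by (rule src_const)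
  obtain B1 where B1: "\<And>x. x \<in> closure \<Omega> \<Longrightarrow> \<bar>A.rhs l (\<lambda>_. \<theta>) x\<bar> \<le> B1"
    using compact_continuous_bound[OF compact_cl] A.rhs_src[OF const, of \<theta> l] \<theta> unfolding src_def by (metis order_refl)
  obtain B2 where B2: "\<And>x. x \<in> closure \<Omega> \<Longrightarrow> \<bar>B.rhs m (\<lambda>_. \<theta>) x\<bar> \<le> B2"
    using compact_continuous_bound[OF compact_cl] B.rhs_src[OF const, of \<theta> m] \<theta> unfolding src_def by (metis order_refl)
  have r1: "\<bar>A.rhs l (z n) x\<bar> \<le> B1" if "x \<in> \<Omega>" for n x
  proof -
    have x: "x \<in> closure \<Omega>" by (rule dom_cl[OF that])
    have "0 \<le> A.rhs l (z n) x" using bd(2)[OF x, of n] \<theta> l0 x by (intro A.rhs_nonneg) auto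
    moreover have "A.rhs l (z n) x \<le> A.rhs l (\<lambda>_. \<theta>) x" using bd(2)[OF x, of n] \<theta> l0 x by (intro A.rhs_mono) auto
    ultimately show ?thesis using B1[OF x] by linarith
  qed
  have r2: "\<bar>B.rhs m (w n) x\<bar> \<le> B2" if "x \<in> \<Omega>" for n x
  proof -
    have x: "x \<in> closure \<Omega>" by (rule dom_cl[OF that])
    have "0 \<le> B.rhs m (w n) x" using bd(1)[OF x, of n] \<theta> l0 x by (intro B.rhs_nonneg) auto
    moreover have "B.rhs m (w n) x \<le> B.rhs m (\<lambda>_. \<theta>) x" using bd(1)[OF x, of n] \<theta> l0 x by (intro B.rhs_mono) auto
    ultimately show ?thesis using B2[OF x] by linarith
  qed
  have sW: "src W" by (rule limit_src[OF sw r1 _ lw1, of \<theta>]) (use bd in auto)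
  have sZ: "src Z" by (rule limit_src[OF sz r2 _ lz1, of \<theta>]) (use bd in auto)
  have SW: "sol W (A.rhs l Z)"
    by (rule A.rhs_limit_sol[OF \<theta> l0(1) src(2) bd(2) _ sZ lz sw lw1]) (use inc in auto)
  have SZ: "sol Z (B.rhs m W)"
    by (rule B.rhs_limit_sol[OF \<theta> l0(2) src(1) bd(1) _ sW lw sz lz1]) (use inc in auto)
  have b1: "0 \<le> W x \<and> W x < 1 \<and> 0 \<le> Z x \<and> Z x < 1" if "x \<in> closure \<Omega>" for x using WZb[OF that] \<theta>(2) by auto
  have cs: "classical_solution \<Omega> \<alpha> \<beta> f g l m W Z"
    using SW SZ b1 unfolding classical_solution_def sol_def A.rhs_def B.rhs_def by auto
  have min: "W x \<le> w' x \<and> Z x \<le> z' x" if c: "classical_solution \<Omega> \<alpha> \<beta> f g l m w' z'" and x: "x \<in> \<Omega>" for w' z' x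
  proof -
    have "fst (iterate l m n) x \<le> w' x \<and> snd (iterate l m n) x \<le> z' x" if "x \<in> closure \<Omega>" for n x
      using that
    proof (induction n arbitrary: x)
      case 0
      then show ?case using c by (simp add: classical_solution_def)
    next
      case (Suc n)
      show ?case
        by (rule iterate_le_super[OF good \<theta>(2) l0 _ _ _ _ _ _ _ Suc.IH Suc.prems])
          (use c in \<open>auto simp: classical_solution_def\<close>)
    qed
    then have "\<exists>N. \<forall>n\<ge>N. w n x \<le> w' x" "\<exists>N. \<forall>n\<ge>N. z n x \<le> z' x" using dom_cl[OF x] by (auto simp: w_def z_def)
    then show ?thesis using LIMSEQ_le_const2[OF lw[OF dom_cl[OF x]]] LIMSEQ_le_const2[OF lz[OF dom_cl[OF x]]] by blast
  qed
  have pos: "0 < W x" "0 < Z x" if "x \<in> \<Omega>" for x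
    using A.rhs_sol_pos[OF SW l(1) _ that] B.rhs_sol_pos[OF SZ l(2) _ that] b1 by blast+
  show ?thesis using cs min pos unfolding minimal_classical_solution_def by blast
qed

text \<open>Compactness of the closure turns the strict bounds W, Z < 1 into a common bound \<theta>
  < 1, which the iterates inherit.\<close>

lemma super_minimal_exists:
  assumes l: "0 < l" "0 < m"
    and W: "Ck_on 2 W \<Omega>" "continuous_on (closure \<Omega>) W" and Z: "Ck_on 2 Z \<Omega>" "continuous_on (closure \<Omega>) Z"
    and b: "\<And>x. x \<in> closure \<Omega> \<Longrightarrow> 0 \<le> W x \<and> W x < 1 \<and> 0 \<le> Z x \<and> Z x < 1"
    and sup: "\<And>x. x \<in> \<Omega> \<Longrightarrow> l * \<alpha> x * f (Z x) \<le> - laplacian W x" "\<And>x. x \<in> \<Omega> \<Longrightarrow> m * \<beta> x * g (W x) \<le> - laplacian Z x"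
  shows "\<exists>w z. minimal_classical_solution \<Omega> \<alpha> \<beta> f g l m w z \<and> (\<forall>x\<in>\<Omega>. 0 < w x \<and> 0 < z x)"
proof -
  have ne: "closure \<Omega> \<noteq> {}" using nonempty_dom by simp
  obtain a where a: "a \<in> closure \<Omega>" "\<And>x. x \<in> closure \<Omega> \<Longrightarrow> W x \<le> W a"
    using continuous_attains_sup[OF compact_cl ne W(2)] by blast
  obtain c where c: "c \<in> closure \<Omega>" "\<And>x. x \<in> closure \<Omega> \<Longrightarrow> Z x \<le> Z c"
    using continuous_attains_sup[OF compact_cl ne Z(2)] by blast
  define \<theta> where "\<theta> = max (W a) (Z c)"
  have \<theta>: "0 \<le> \<theta>" "\<theta> < 1" using b[OF a(1)] b[OF c(1)] by (auto simp: \<theta>_def)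
  have le: "W x \<le> \<theta>" "Z x \<le> \<theta>" if "x \<in> closure \<Omega>" for x
    using a(2)[OF that] c(2)[OF that] by (auto simp: \<theta>_def)
  have l0: "0 \<le> l" "0 \<le> m" using l by auto
  have "good \<theta> (iterate l m n) \<and> (\<forall>x\<in>closure \<Omega>. fst (iterate l m n) x \<le> W x \<and> snd (iterate l m n) x \<le> Z x)" for n
  proof (induction n)
    case 0
    then show ?case using good_0[OF \<theta>(1)] b by simp
  next
    case (Suc n)
    have s: "fst (iterate l m (Suc n)) x \<le> W x \<and> snd (iterate l m (Suc n)) x \<le> Z x" if "x \<in> closure \<Omega>" for x
      by (rule iterate_le_super[OF _ \<theta>(2) l0 W Z b sup _ that]) (use Suc in auto)
    have "good \<theta> (iterate l m (Suc n))"
      by (rule good_Suc[OF _ \<theta>(2) l0]) (use Suc s le in \<open>blast intro: order_trans\<close>)+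
    then show ?case using s by blast
  qed
  then show ?thesis using minimal_exists[OF _ \<theta> l] by blast
qed

end

section \<open>Weak solutions\<close>

lemma mollify_mono_AE:
  fixes K :: "'a::euclidean_space \<Rightarrow> real"
  assumes K: "kern \<rho> K" "\<And>z. 0 \<le> K z" and r: "0 < r" and h: "integrable lebesgue h" "integrable lebesgue h'"
    and le: "AE y in lebesgue. h y \<le> h' y"
  shows "mollify K r h x \<le> mollify K r h' x"
proof -
  have "(LINT y|lebesgue. K (inverse r *\<^sub>R (x - y)) * h y) \<le> (LINT y|lebesgue. K (inverse r *\<^sub>R (x - y)) * h' y)"
  proof (rule integral_mono_AE)
    show "AE y in lebesgue. K (inverse r *\<^sub>R (x - y)) * h y \<le> K (inverse r *\<^sub>R (x - y)) * h' y"
      using le by eventually_elim (intro mult_left_mono K(2))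
  qed (use mollify_integrable[OF K(1) r] h in auto)
  then show ?thesis using r by (simp add: mollify_def divide_right_mono)
qed

lemma mollify_ge_const:
  fixes K :: "'a::euclidean_space \<Rightarrow> real"
  assumes K: "kern 1 K" "\<And>z. 0 \<le> K z" and r: "0 < r" and h: "integrable lebesgue h"
    and le: "AE y in lebesgue. y \<in> ball x r \<longrightarrow> a \<le> h y"
  shows "a * (LINT y|lebesgue. K y) \<le> mollify K r h x"
proof -
  have i: "integrable lebesgue (\<lambda>y. a * indicator (ball x r) y :: real)"
    by (intro integrable_mult_right integrable_real_indicator) (auto simp: emeasure_bounded_finite[unfolded infinity_ennreal_def])
  have j: "integrable lebesgue (\<lambda>y. indicator (ball x r) y * h y)"
    using integrable_mult_indicator[OF _ h, of "ball x r"] by (simp add: mult.commute)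
  have "a * (LINT y|lebesgue. K y) = mollify K r (\<lambda>_. a) x" using mollify_const[OF K(1) r] by simp
  also have "\<dots> = mollify K r (\<lambda>y. a * indicator (ball x r) y) x" by (rule mollify_cong[OF K(1) r]) simp
  also have "\<dots> \<le> mollify K r (\<lambda>y. indicator (ball x r) y * h y) x"
    by (rule mollify_mono_AE[OF K r i j]) (use le in \<open>eventually_elim, auto simp: indicator_def\<close>)
  also have "\<dots> = mollify K r h x" by (rule mollify_cong[OF K(1) r]) simp
  finally show ?thesis .
qed

text \<open>The counterpart of \<open>mollify_approx\<close> with an integral in place of a
  supremum: near a Lebesgue point the deviation from a is small only on average.\<close>

lemma mollify_diff_const_bound:
  fixes K :: "'a::euclidean_space \<Rightarrow> real"
  assumes K: "kern 1 K" "\<And>z. \<bar>K z\<bar> \<le> M" and r: "0 < r" and h: "integrable lebesgue h"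
    and g: "integrable lebesgue g" "\<And>y. y \<in> ball x r \<Longrightarrow> \<bar>h y - a\<bar> \<le> g y" "\<And>y. 0 \<le> g y"
  shows "\<bar>mollify K r h x - a * (LINT y|lebesgue. K y)\<bar> \<le> M * (LINT y|lebesgue. g y) / r ^ DIM('a)"
proof -
  have M: "0 \<le> M" using K(2)[of 0] by linarith
  have i: "integrable lebesgue (\<lambda>y. K (inverse r *\<^sub>R (x - y)) * a)"
    using kern_integrable[OF kern_scaled[OF K(1) r, of x]] by simp
  have ki: "integrable lebesgue (\<lambda>y. K (inverse r *\<^sub>R (x - y)) * (h y - a))"
    using Bochner_Integration.integrable_diff[OF mollify_integrable[OF K(1) r h, of x] i] by (simp add: right_diff_distrib)
  have "\<bar>LINT y|lebesgue. K (inverse r *\<^sub>R (x - y)) * (h y - a)\<bar> \<le> (LINT y|lebesgue. \<bar>K (inverse r *\<^sub>R (x - y)) * (h y - a)\<bar>)"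
    by (rule integral_abs_bound)
  also have "\<dots> \<le> (LINT y|lebesgue. M * g y)"
  proof (rule integral_mono)
    fix y
    show "\<bar>K (inverse r *\<^sub>R (x - y)) * (h y - a)\<bar> \<le> M * g y"
    proof (cases "y \<in> ball x r")
      case True
      then show ?thesis unfolding abs_mult by (intro mult_mono K(2) g(2)) (use M in auto)
    next
      case False
      then have "1 \<le> norm (inverse r *\<^sub>R (x - y))" using r unfolding norm_inverse_scaleR[OF r] by (simp add: dist_norm)
      then show ?thesis using kern_zero[OF K(1)] M g(3) by simp
    qed
  qed (use ki g(1) in auto)
  finally have b: "\<bar>LINT y|lebesgue. K (inverse r *\<^sub>R (x - y)) * (h y - a)\<bar> \<le> M * (LINT y|lebesgue. g y)" by simp
  have "mollify K r h x - mollify K r (\<lambda>_. a) x = (LINT y|lebesgue. K (inverse r *\<^sub>R (x - y)) * (h y - a)) / r ^ DIM('a)"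
    using mollify_integrable[OF K(1) r h, of x] i by (simp add: mollify_def right_diff_distrib diff_divide_distrib)
  then have "mollify K r h x - a * (LINT y|lebesgue. K y) = (LINT y|lebesgue. K (inverse r *\<^sub>R (x - y)) * (h y - a)) / r ^ DIM('a)"
    using mollify_const[OF K(1) r, of a x] by simp
  then show ?thesis using divide_right_mono[OF b, of "r ^ DIM('a)"] r by simp
qed

text \<open>The available Lebesgue differentiation theorem speaks of cubes with corner \<open>x\<close> and of signed means.
  Applying it to \<open>|u - q|\<close> for all rational \<open>q\<close> gives Lebesgue points, and the mollification is then taken
  around the centre of the cube; this is why the hypothesis is uniform in \<open>x\<close>.\<close>

lemma mollified_nonneg_AE:
  fixes u :: "'a::euclidean_space \<Rightarrow> real"
  assumes u: "integrable lebesgue u"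
    and H: "\<And>e. 0 < e \<Longrightarrow> \<exists>r0>0. \<forall>r x. 0 < r \<longrightarrow> r < r0 \<longrightarrow> - e \<le> mollify eta r u x"
  shows "AE x in lebesgue. 0 \<le> u x"
proof -
  have io: "(\<lambda>y. \<bar>u y - q\<bar>) integrable_on cbox a b" and li: "integrable lebesgue (\<lambda>y. indicator (cbox a b) y * \<bar>u y - q\<bar>)"
    and eq: "(LINT y|lebesgue. indicator (cbox a b) y * \<bar>u y - q\<bar>) = integral (cbox a b) (\<lambda>y. \<bar>u y - q\<bar>)" for q a b
  proof -
    have "integrable lebesgue (\<lambda>y. indicator (cbox a b) y *\<^sub>R u y)"
      using integrable_mult_indicator[OF _ u, of "cbox a b"] by simp
    moreover have "integrable lebesgue (\<lambda>y. indicator (cbox a b) y *\<^sub>R q)"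
      by (intro integrable_scaleR_left integrable_real_indicator) (auto simp: emeasure_lborel_cbox_finite[unfolded infinity_ennreal_def])
    ultimately have "integrable lebesgue (\<lambda>y. \<bar>indicator (cbox a b) y *\<^sub>R u y - indicator (cbox a b) y *\<^sub>R q\<bar>)" by auto
    also have "(\<lambda>y. \<bar>indicator (cbox a b) y *\<^sub>R u y - indicator (cbox a b) y *\<^sub>R q\<bar>) = (\<lambda>y. indicator (cbox a b) y * \<bar>u y - q\<bar>)"
      by (auto simp: indicator_def)
    finally show li: "integrable lebesgue (\<lambda>y. indicator (cbox a b) y * \<bar>u y - q\<bar>)" .
    then have s: "set_integrable lebesgue (cbox a b) (\<lambda>y. \<bar>u y - q\<bar>)" by (simp add: set_integrable_def)
    show "(\<lambda>y. \<bar>u y - q\<bar>) integrable_on cbox a b" by (rule set_lebesgue_integral_eq_integral(1)[OF s])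
    show "(LINT y|lebesgue. indicator (cbox a b) y * \<bar>u y - q\<bar>) = integral (cbox a b) (\<lambda>y. \<bar>u y - q\<bar>)"
      using set_lebesgue_integral_eq_integral(2)[OF s] by (simp add: set_lebesgue_integral_def)
  qed
  have "\<exists>N. negligible N \<and> (\<forall>x e. x \<notin> N \<longrightarrow> 0 < e \<longrightarrow> (\<exists>d>0. \<forall>h. 0 < h \<and> h < d \<longrightarrow>
     norm (integral (cbox x (x + h *\<^sub>R One)) (\<lambda>y. \<bar>u y - q\<bar>) /\<^sub>R h ^ DIM('a) - \<bar>u x - q\<bar>) < e))" for q
    using integrable_ccontinuous_explicit[OF io, of q] by metis
  then obtain N where N: "\<And>q. negligible (N q)" "\<And>q x e. x \<notin> N q \<Longrightarrow> 0 < e \<Longrightarrow> \<exists>d>0. \<forall>h. 0 < h \<and> h < d \<longrightarrow>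
     norm (integral (cbox x (x + h *\<^sub>R One)) (\<lambda>y. \<bar>u y - q\<bar>) /\<^sub>R h ^ DIM('a) - \<bar>u x - q\<bar>) < e"
    by metis
  define NN where "NN = (\<Union>q\<in>\<rat>. N q)"
  have "negligible NN" unfolding NN_def
    by (rule negligible_countable_Union) (use N(1) countable_rat in auto)
  then have ae: "AE x in lebesgue. x \<notin> NN" by (simp add: AE_not_in negligible_iff_null_sets)
  obtain M where M: "0 < M" "\<And>z::'a. \<bar>eta z\<bar> \<le> M" using kern_bounded[OF eta_kern] by metis
  have "0 \<le> u x" if x: "x \<notin> NN" for x
  proof (rule ccontr)
    assume neg: "\<not> 0 \<le> u x"
    let ?c = "eta_mass TYPE('a)"
    define e0 where "e0 = - u x * ?c / 4"
    have e0: "0 < e0" using neg eta_mass_pos[where 'a='a] by (auto simp: e0_def mult_neg_pos)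
    \<comment> \<open>The mean of G over the cube will be at most 3 e, and passing from the volume
      h^N to the normalisation (h/2)^N costs 2^N; with the bound M on \<open>eta\<close> the product
      is exactly e0.\<close>
    define e where "e = e0 / (M * 2 ^ DIM('a)) / 3"
    have e: "0 < e" using e0 M(1) by (simp add: e_def)
    \<comment> \<open>A rational just below u x: passing from u x to q costs at most e, and only
      countably many exceptional sets have been discarded.\<close>
    obtain q where q: "q \<in> \<rat>" "u x - e < q" "q < u x" using Rats_dense_in_real[of "u x - e" "u x"] e by auto
    have "x \<notin> N q" using x q(1) by (auto simp: NN_def)
    then obtain d where d: "0 < d" "\<And>h. 0 < h \<Longrightarrow> h < d \<Longrightarrow>
      norm (integral (cbox x (x + h *\<^sub>R One)) (\<lambda>y. \<bar>u y - q\<bar>) /\<^sub>R h ^ DIM('a) - \<bar>u x - q\<bar>) < e"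
      using N(2)[OF _ e] by metis
    obtain r0 where r0: "0 < r0" "\<And>r p. 0 < r \<Longrightarrow> r < r0 \<Longrightarrow> - e0 \<le> mollify eta r u p" using H[OF e0] by metis
    define h where "h = min d r0 / 2"
    have h: "0 < h" "h < d" "h / 2 < r0" using d(1) r0(1) by (auto simp: h_def)
    define p where "p = x + (h / 2) *\<^sub>R One"
    define Q where "Q = cbox x (x + h *\<^sub>R One)"
    have ball: "y \<in> Q" if "y \<in> ball p (h / 2)" for y
      unfolding Q_def mem_box
    proof
      fix i :: 'a assume i: "i \<in> Basis"
      have "\<bar>(y - p) \<bullet> i\<bar> \<le> norm (y - p)" by (rule Basis_le_norm[OF i])
      also have "\<dots> < h / 2" using that by (simp add: dist_norm norm_minus_commute)
      finally have "\<bar>y \<bullet> i - (x \<bullet> i + h / 2)\<bar> < h / 2" using i by (simp add: p_def inner_diff_left inner_add_left)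
      then have "x \<bullet> i \<le> y \<bullet> i" "y \<bullet> i \<le> x \<bullet> i + h" by linarith+
      then show "x \<bullet> i \<le> y \<bullet> i \<and> y \<bullet> i \<le> (x + h *\<^sub>R One) \<bullet> i" using i by (simp add: inner_add_left)
    qed
    have mQ: "measure lebesgue Q = h ^ DIM('a)"
      using h(1) unfolding Q_def by (subst measure_completion, simp, subst content_cbox) (simp_all add: inner_add_left)
    have iQ: "integrable lebesgue (\<lambda>y. e * indicator Q y :: real)"
      unfolding Q_def by (intro integrable_mult_right integrable_real_indicator) (auto simp: emeasure_lborel_cbox_finite[unfolded infinity_ennreal_def])
    define G where "G = (\<lambda>y. indicator Q y * \<bar>u y - q\<bar> + e * indicator Q y)"
    have Gi: "integrable lebesgue G" unfolding G_def using li[of x "x + h *\<^sub>R One" q] iQ by (auto simp: Q_def)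
    have "(LINT y|lebesgue. G y) = integral Q (\<lambda>y. \<bar>u y - q\<bar>) + e * h ^ DIM('a)"
      unfolding G_def using li[of x "x + h *\<^sub>R One" q] iQ eq[of x "x + h *\<^sub>R One" q] mQ by (auto simp: Q_def)
    moreover have "integral Q (\<lambda>y. \<bar>u y - q\<bar>) \<le> 2 * e * h ^ DIM('a)"
    proof -
      have "integral Q (\<lambda>y. \<bar>u y - q\<bar>) / h ^ DIM('a) \<le> 2 * e"
        using d(2)[OF h(1,2)] q unfolding Q_def by (simp add: divide_inverse mult.commute abs_if split: if_splits)
      then show ?thesis using h(1) by (simp add: pos_divide_le_eq)
    qed
    ultimately have GI: "(LINT y|lebesgue. G y) \<le> 3 * e * h ^ DIM('a)" by simp
    have "\<bar>mollify eta (h / 2) u p - u x * ?c\<bar> \<le> M * (LINT y|lebesgue. G y) / (h / 2) ^ DIM('a)"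
    proof (rule mollify_diff_const_bound[OF eta_kern M(2) _ u Gi])
      show "\<bar>u y - u x\<bar> \<le> G y" if "y \<in> ball p (h / 2)" for y
        using ball[OF that] q unfolding G_def by simp
      show "0 \<le> G y" for y using e by (simp add: G_def)
    qed (use h in auto)
    also have "\<dots> \<le> M * (3 * e * h ^ DIM('a)) / (h / 2) ^ DIM('a)"
      using GI M(1) h(1) by (intro divide_right_mono mult_left_mono) auto
    also have "\<dots> = e0" using h(1) M(1) by (simp add: e_def power_divide)
    finally have "mollify eta (h / 2) u p \<le> u x * ?c + e0" by linarith
    moreover have "- e0 \<le> mollify eta (h / 2) u p" using r0(2) h by simp
    ultimately have "0 \<le> u x * ?c + 2 * e0" by linarith
    then show False using e0 by (simp add: e0_def)
  qed
  then show ?thesis using ae by (auto elim: eventually_mono)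
qed

lemma C2_closure_scaled:
  fixes K :: "'a::euclidean_space \<Rightarrow> real"
  assumes K: "kern2 K d D"
  shows "C2_closure S (\<lambda>y. K (inverse r *\<^sub>R (x - y)))"
proof -
  let ?\<phi> = "\<lambda>y. K (inverse r *\<^sub>R (x - y))"
  note h = has_hess_on_scaled[OF kern2D(1)[OF K], of r x]
  have C: "Ck_on 2 ?\<phi> UNIV" by (rule has_hess_on_Ck(1)[OF open_UNIV h])
  note hh = Ck_has_hess_on[OF C]
  have c1: "continuous_on UNIV (partial i ?\<phi>)" if "i \<in> Basis" for i
    using hh that has_grad_on_continuous unfolding has_hess_on_def by blast
  have c2: "continuous_on UNIV (partial j (partial i ?\<phi>))" if "i \<in> Basis" "j \<in> Basis" for i j
    using hh that unfolding has_hess_on_def by blast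
  have c: "continuous_on (closure S) ?\<phi>" using Ck2_continuous[OF C] by (rule continuous_on_subset) simp
  have e: "extends_continuously S F" if "continuous_on UNIV F" for F
    using continuous_on_subset[OF that, of "closure S"] unfolding extends_continuously_def by blast
  show ?thesis
    unfolding C2_closure_def using Ck2_subset[OF C, of S] c c1 c2 e by simp
qed

section \<open>Comparison of weak supersolutions with Green solutions\<close>

context smooth_domain
begin

text \<open>An equation for W with source H; the inequality that makes W a supersolution enters only
  afterwards, as a pointwise lower bound for H. Both equations of the system fit this form.\<close>

definition weak_super :: "('a \<Rightarrow> real) \<Rightarrow> ('a \<Rightarrow> real) \<Rightarrow> bool" where
  "weak_super W H \<longleftrightarrow> set_integrable lebesgue \<Omega> W \<and> set_integrable lebesgue \<Omega> H \<and> (AE x in lebesgue. x \<in> \<Omega> \<longrightarrow> 0 \<le> W x) \<and>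
     (\<forall>\<phi>. C2_closure \<Omega> \<phi> \<longrightarrow> (\<forall>x\<in>frontier \<Omega>. \<phi> x = 0) \<longrightarrow>
        (LINT x:\<Omega>|lebesgue. W x * (- laplacian \<phi> x)) = (LINT x:\<Omega>|lebesgue. \<phi> x * H x))"

lemma weak_mollify:
  assumes W: "weak_super W H" and r: "0 < r" "cball x r \<subseteq> \<Omega>"
  shows "mollify (\<lambda>z. \<Sum>i\<in>Basis. eta_hess i i z) r (\<lambda>y. indicator \<Omega> y * W y) x = - r\<^sup>2 * mollify eta r (\<lambda>y. indicator \<Omega> y * H y) x"
proof -
  let ?\<phi> = "\<lambda>y. eta (inverse r *\<^sub>R (x - y))"
  let ?D = "\<lambda>y. \<Sum>i\<in>Basis. eta_hess i i (inverse r *\<^sub>R (x - y))"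
  have l: "laplacian ?\<phi> y = ?D y / r\<^sup>2" for y
    using has_hess_on_Ck(2)[OF open_UNIV has_hess_on_scaled[OF kern2D(1)[OF eta_kern2]], of y r x]
    by (simp add: sum_divide_distrib)
  have z: "?\<phi> y = 0" if "y \<in> frontier \<Omega>" for y
  proof -
    have "y \<notin> cball x r" using that r(2) open_dom by (auto simp: frontier_def interior_open)
    then show ?thesis using kern2_scaled_zero(1)[OF eta_kern2 r(1)] SOME_Basis by blast
  qed
  have "(LINT y:\<Omega>|lebesgue. W y * (- laplacian ?\<phi> y)) = (LINT y:\<Omega>|lebesgue. ?\<phi> y * H y)"
    using W C2_closure_scaled[OF eta_kern2, of \<Omega> r x] z unfolding weak_super_def by blast
  also have "(LINT y:\<Omega>|lebesgue. W y * (- laplacian ?\<phi> y)) = (LINT y|lebesgue. - (?D y * (indicator \<Omega> y * W y)) / r\<^sup>2)"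
    unfolding set_lebesgue_integral_def l by (rule Bochner_Integration.integral_cong) auto
  also have "\<dots> = - (LINT y|lebesgue. ?D y * (indicator \<Omega> y * W y)) / r\<^sup>2" by simp
  also have "(LINT y:\<Omega>|lebesgue. ?\<phi> y * H y) = (LINT y|lebesgue. ?\<phi> y * (indicator \<Omega> y * H y))"
    unfolding set_lebesgue_integral_def by (rule Bochner_Integration.integral_cong) auto
  finally have "(LINT y|lebesgue. ?D y * (indicator \<Omega> y * W y)) = - r\<^sup>2 * (LINT y|lebesgue. ?\<phi> y * (indicator \<Omega> y * H y))"
    using r(1) by (simp add: field_simps)
  then show ?thesis by (simp add: mollify_def)
qed

text \<open>Only the compactly supported test functions \<open>eta((x - y) / r)\<close> are needed: they make the mollified
  difference superharmonic at distance more than \<open>r\<close> from the boundary, and closer to the boundary the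
  difference is almost nonnegative because \<open>W\<close> is nonnegative and \<open>v\<close> is small.\<close>

lemma weak_compare:
  assumes W: "weak_super W H" and v: "sol v k" and k: "continuous_on (closure \<Omega>) k"
    and le: "AE x in lebesgue. x \<in> \<Omega> \<longrightarrow> k x \<le> H x"
  shows "AE x in lebesgue. x \<in> \<Omega> \<longrightarrow> v x \<le> W x"
proof -
  define w0 where "w0 = (\<lambda>y. indicator \<Omega> y * W y)"
  define H0 where "H0 = (\<lambda>y. indicator \<Omega> y * H y)"
  define v0 where "v0 = (\<lambda>y. if y \<in> closure \<Omega> then v y else 0)"
  define k0 where "k0 = (\<lambda>y. indicator \<Omega> y * (if y \<in> closure \<Omega> then k y else 0))"
  have vC: "Ck_on 2 v \<Omega>" "continuous_on (closure \<Omega>) v" "\<And>x. x \<in> \<Omega> \<Longrightarrow> - laplacian v x = k x" "\<And>x. x \<in> frontier \<Omega> \<Longrightarrow> v x = 0"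
    using v by (auto simp: sol_def)
  have i: "integrable lebesgue w0" "integrable lebesgue H0" "integrable lebesgue v0" "integrable lebesgue k0"
  proof -
    show "integrable lebesgue w0" "integrable lebesgue H0"
      using W by (auto simp: weak_super_def set_integrable_def w0_def H0_def)
    show "integrable lebesgue v0" unfolding v0_def by (rule integrable_restrict_compact[OF compact_cl vC(2)])
    show "integrable lebesgue k0"
      using integrable_mult_indicator[OF _ integrable_restrict_compact[OF compact_cl k], of \<Omega>] open_dom
      unfolding k0_def by simp
  qed
  define u0 where "u0 = (\<lambda>y. w0 y - v0 y)"
  have u0i: "integrable lebesgue u0" using i by (simp add: u0_def)
  have u0_out: "u0 y = 0" if "y \<notin> \<Omega>" for y
    using that vC(4) cl_cases[of y] by (auto simp: u0_def w0_def v0_def)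
  have u0_in: "u0 y = W y - v y" if "y \<in> \<Omega>" for y
    using that dom_cl by (auto simp: u0_def w0_def v0_def)
  have kH: "AE y in lebesgue. k0 y \<le> H0 y"
    using le by eventually_elim (use dom_cl in \<open>auto simp: k0_def H0_def indicator_def\<close>)
  have lap: "laplacian (mollify eta r u0) x \<le> 0" if r: "0 < r" "cball x r \<subseteq> \<Omega>" for r x
  proof -
    have ker: "\<And>i. i \<in> Basis \<Longrightarrow> kern 1 (eta_hess i (i::'a))" by (rule kern2D(4)[OF eta_kern2])
    let ?L = "\<lambda>z. \<Sum>i\<in>Basis. eta_hess i (i::'a) z"
    have kL: "kern 1 ?L" by (rule kern_sum[OF ker])
    have "laplacian (mollify eta r u0) x = mollify ?L r u0 x / r\<^sup>2"
      using has_hess_on_Ck(2)[OF open_UNIV mollify_has_hess[OF eta_kern2 r(1) u0i], of x] mollify_sum[OF ker r(1) u0i, of Basis "\<lambda>i. i"]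
      by (simp add: sum_divide_distrib)
    moreover have "mollify ?L r u0 x = mollify ?L r w0 x - mollify ?L r v0 x" unfolding u0_def by (rule mollify_diff[OF kL r(1) i(1,3)])
    moreover have "mollify ?L r w0 x = - r\<^sup>2 * mollify eta r H0 x" unfolding w0_def H0_def by (rule weak_mollify[OF W r])
    moreover have "mollify ?L r v0 x = - r\<^sup>2 * mollify eta r k0 x"
    proof -
      have b: "y \<in> \<Omega>" if "y \<in> ball x r" for y using that r(2) ball_subset_cball by blast
      have "mollify ?L r v0 x = mollify ?L r v x" by (rule mollify_cong[OF kL r(1)]) (use b dom_cl in \<open>auto simp: v0_def\<close>)
      also have "\<dots> = r\<^sup>2 * mollify eta r (laplacian v) x" by (rule mollify_green[OF eta_kern2 r(1) open_dom r(2) vC(1)])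
      also have "mollify eta r (laplacian v) x = mollify eta r (\<lambda>y. - k0 y) x"
      proof (rule mollify_cong[OF eta_kern r(1)])
        fix y assume "y \<in> ball x r"
        then have "y \<in> \<Omega>" by (rule b)
        then show "laplacian v y = - k0 y" using vC(3)[of y] dom_cl[of y] by (simp add: k0_def)
      qed
      finally show ?thesis by (simp add: mollify_minus)
    qed
    moreover have "mollify eta r k0 x \<le> mollify eta r H0 x" by (rule mollify_mono_AE[OF eta_kern eta_nonneg r(1) i(4,2) kH])
    ultimately show ?thesis using r(1) by (simp add: divide_le_0_iff)
  qed
  have "AE x in lebesgue. 0 \<le> u0 x"
  proof (rule mollified_nonneg_AE[OF u0i])
    fix e :: real assume e: "0 < e"
    let ?c = "eta_mass TYPE('a)"
    define e' where "e' = e / ?c"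
    have e': "0 < e'" using e eta_mass_pos[where 'a='a] by (simp add: e'_def)
    \<comment> \<open>Off K the solution v is below e'. K is compact and misses the complement of
      the domain because v vanishes on the frontier, so a positive distance d separates
      them.\<close>
    define K where "K = {x \<in> closure \<Omega>. e' \<le> v x}"
    have "closed K" using continuous_closed_preimage[OF vC(2) closed_closure, of "{e'..}"]
      by (simp add: K_def vimage_def Int_def)
    then have K: "compact K" using compact_Int_closed[OF compact_cl, of K] by (simp add: K_def Int_absorb1 subset_iff Int_def)
    have "K \<inter> (- \<Omega>) = {}" using vC(4) e' cl_cases unfolding K_def by force
    then obtain d where d: "0 < d" "\<And>x y. x \<in> K \<Longrightarrow> y \<in> - \<Omega> \<Longrightarrow> d \<le> dist x y"
      using separate_compact_closed[OF K, of "- \<Omega>"] open_dom by (metis closed_Compl)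
    \<comment> \<open>All points of the ball of radius r around x are within 2 r < d of the
      complement, so the ball misses K; inside the domain W - v is therefore above -e' almost
      everywhere there, and outside it u0 is zero.\<close>
    have near: "- e \<le> mollify eta r u0 x" if r: "0 < r" "r < d / 2" and x: "infdist x (- \<Omega>) \<le> r" for r x
    proof -
      have "\<Omega> \<noteq> UNIV" using bounded_dom not_bounded_UNIV by blast
      then have ne: "- \<Omega> \<noteq> {}" by blast
      obtain y0 where y0: "y0 \<in> - \<Omega>" "dist x y0 \<le> r"
        using infdist_attains_inf[OF _ ne, of x] x open_dom by (metis closed_Compl)
      have lb: "- e' \<le> u0 y" if y: "y \<in> ball x r" and Wy: "y \<in> \<Omega> \<longrightarrow> 0 \<le> W y" for y
      proof (cases "y \<in> \<Omega>")
        case True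
        have "dist y y0 < d" using y y0(2) r dist_triangle[of y y0 x] by (simp add: dist_commute)
        then have "y \<notin> K" using d(2)[OF _ y0(1), of y] by force
        then show ?thesis using True Wy u0_in[OF True] dom_cl[OF True] by (simp add: K_def)
      next
        case False
        then show ?thesis using u0_out e' by simp
      qed
      have "AE y in lebesgue. y \<in> \<Omega> \<longrightarrow> 0 \<le> W y" using W by (simp add: weak_super_def)
      then have "AE y in lebesgue. y \<in> ball x r \<longrightarrow> - e' \<le> u0 y" by eventually_elim (use lb in blast)
      then have "- e' * ?c \<le> mollify eta r u0 x" by (rule mollify_ge_const[OF eta_kern eta_nonneg r(1) u0i])
      then show ?thesis using eta_mass_pos[where 'a='a] by (simp add: e'_def)
    qed
    have "- e \<le> mollify eta r u0 x" if r: "0 < r" "r < d / 2" for r x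
    proof (cases "infdist x (- \<Omega>) \<le> r")
      case True
      then show ?thesis by (rule near[OF r])
    next
      case False
      define S where "S = {x. r < infdist x (- \<Omega>)}"
      have S: "open S" unfolding S_def by (intro open_Collect_less continuous_intros)
      have cb: "cball y r \<subseteq> \<Omega>" if y: "y \<in> S" for y
      proof
        fix z assume z: "z \<in> cball y r"
        show "z \<in> \<Omega>"
        proof (rule ccontr)
          assume "z \<notin> \<Omega>"
          then have "infdist y (- \<Omega>) \<le> dist y z" by (intro infdist_le) auto
          then show False using z y by (simp add: S_def)
        qed
      qed
      have "S \<subseteq> \<Omega>"
      proof
        fix y assume "y \<in> S"
        then show "y \<in> \<Omega>" using cb[of y] r(1) by (meson centre_in_cball less_imp_le subsetD)
      qed
      then have bS: "bounded S" using bounded_dom bounded_subset by blast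
      have C: "Ck_on 2 (mollify eta r u0) UNIV" by (rule has_hess_on_Ck(1)[OF open_UNIV mollify_has_hess[OF eta_kern2 r(1) u0i]])
      have c: "continuous_on (closure S) (mollify eta r u0)" using Ck2_continuous[OF C] by (rule continuous_on_subset) simp
      have xS: "x \<in> closure S" using False closure_subset[of S] by (auto simp: S_def)
      show ?thesis
      proof (rule laplacian_comparison[OF S bS Ck2_const(1)[OF S] continuous_on_const Ck2_subset[OF C subset_UNIV] c _ _ xS])
        show "laplacian (mollify eta r u0) y \<le> laplacian (\<lambda>_. - e) y" if "y \<in> S" for y
          using lap[OF r(1) cb[OF that]] Ck2_const(2)[OF S that] by simp
        show "- e \<le> mollify eta r u0 y" if "y \<in> frontier S" for y
        proof (rule near[OF r])
          have "y \<notin> S" using that S by (simp add: frontier_def interior_open)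
          then show "infdist y (- \<Omega>) \<le> r" by (simp add: S_def)
        qed
      qed
    qed
    then show "\<exists>r0>0. \<forall>r x. 0 < r \<longrightarrow> r < r0 \<longrightarrow> - e \<le> mollify eta r u0 x"
      using d(1) by (intro exI[of _ "d / 2"]) simp
  qed
  then show ?thesis by eventually_elim (use u0_in in force)
qed

end

context coupled
begin

text \<open>The order between the iterates and the scaled weak solution is available only almost
  everywhere. That suffices for the next comparison of sources, while continuity of the iterates
  upgrades the resulting bound \<theta> to every point, as \<open>good\<close> demands.\<close>

lemma weak_minimal_exists:
  assumes weak: "weak_solution \<Omega> \<alpha> \<beta> f g l m w z" and l: "0 < l" "0 < m" and \<theta>: "0 < \<theta>" "\<theta> < 1"
  shows "\<exists>w z. minimal_classical_solution \<Omega> \<alpha> \<beta> f g (\<theta> * l) (\<theta> * m) w z \<and> (\<forall>x\<in>\<Omega>. 0 < w x \<and> 0 < z x)"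
proof -
  have bd: "AE x in lebesgue. x \<in> \<Omega> \<longrightarrow> 0 \<le> w x \<and> w x < 1 \<and> 0 \<le> z x \<and> z x < 1"
    and int: "set_integrable lebesgue \<Omega> w" "set_integrable lebesgue \<Omega> z"
      "set_integrable lebesgue \<Omega> (\<lambda>x. \<alpha> x * f (z x))" "set_integrable lebesgue \<Omega> (\<lambda>x. \<beta> x * g (w x))"
    using weak by (auto simp: weak_solution_def)
  have id1: "(LINT x:\<Omega>|lebesgue. w x * (- laplacian \<phi> x)) = (LINT x:\<Omega>|lebesgue. l * \<alpha> x * \<phi> x * f (z x))"
    and id2: "(LINT x:\<Omega>|lebesgue. z x * (- laplacian \<phi> x)) = (LINT x:\<Omega>|lebesgue. m * \<beta> x * \<phi> x * g (w x))"
    if "C2_closure \<Omega> \<phi>" "\<forall>x\<in>frontier \<Omega>. \<phi> x = 0" for \<phi>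
    using weak that unfolding weak_solution_def by blast+
  define H1 where "H1 = A.rhs (\<theta> * l) z"
  define H2 where "H2 = B.rhs (\<theta> * m) w"
  have W: "weak_super (\<lambda>x. \<theta> * w x) H1"
    unfolding weak_super_def
  proof (intro conjI allI impI)
    show "set_integrable lebesgue \<Omega> (\<lambda>x. \<theta> * w x)" using int(1) by simp
    show "set_integrable lebesgue \<Omega> H1"
      using set_integrable_mult_right[OF int(3), of "\<theta> * l"] unfolding H1_def A.rhs_def[abs_def] mult.assoc .
    show "AE x in lebesgue. x \<in> \<Omega> \<longrightarrow> 0 \<le> \<theta> * w x" using bd by eventually_elim (use \<theta> in simp)
    fix \<phi> assume p: "C2_closure \<Omega> \<phi>" "\<forall>x\<in>frontier \<Omega>. \<phi> x = 0"
    have "(LINT x:\<Omega>|lebesgue. \<theta> * w x * - laplacian \<phi> x) = \<theta> * (LINT x:\<Omega>|lebesgue. w x * - laplacian \<phi> x)"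
      by (subst set_integral_mult_right[symmetric]) (simp add: mult.assoc)
    also have "\<dots> = (LINT x:\<Omega>|lebesgue. \<theta> * (l * \<alpha> x * \<phi> x * f (z x)))" unfolding id1[OF p] by simp
    also have "\<dots> = (LINT x:\<Omega>|lebesgue. \<phi> x * H1 x)"
      unfolding set_lebesgue_integral_def H1_def A.rhs_def by (rule Bochner_Integration.integral_cong) auto
    finally show "(LINT x:\<Omega>|lebesgue. \<theta> * w x * - laplacian \<phi> x) = (LINT x:\<Omega>|lebesgue. \<phi> x * H1 x)" .
  qed
  have Z: "weak_super (\<lambda>x. \<theta> * z x) H2"
    unfolding weak_super_def
  proof (intro conjI allI impI)
    show "set_integrable lebesgue \<Omega> (\<lambda>x. \<theta> * z x)" using int(2) by simp
    show "set_integrable lebesgue \<Omega> H2"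
      using set_integrable_mult_right[OF int(4), of "\<theta> * m"] unfolding H2_def B.rhs_def[abs_def] mult.assoc .
    show "AE x in lebesgue. x \<in> \<Omega> \<longrightarrow> 0 \<le> \<theta> * z x" using bd by eventually_elim (use \<theta> in simp)
    fix \<phi> assume p: "C2_closure \<Omega> \<phi>" "\<forall>x\<in>frontier \<Omega>. \<phi> x = 0"
    have "(LINT x:\<Omega>|lebesgue. \<theta> * z x * - laplacian \<phi> x) = \<theta> * (LINT x:\<Omega>|lebesgue. z x * - laplacian \<phi> x)"
      by (subst set_integral_mult_right[symmetric]) (simp add: mult.assoc)
    also have "\<dots> = (LINT x:\<Omega>|lebesgue. \<theta> * (m * \<beta> x * \<phi> x * g (w x)))" unfolding id2[OF p] by simp
    also have "\<dots> = (LINT x:\<Omega>|lebesgue. \<phi> x * H2 x)"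
      unfolding set_lebesgue_integral_def H2_def B.rhs_def by (rule Bochner_Integration.integral_cong) auto
    finally show "(LINT x:\<Omega>|lebesgue. \<theta> * z x * - laplacian \<phi> x) = (LINT x:\<Omega>|lebesgue. \<phi> x * H2 x)" .
  qed
  have l': "0 < \<theta> * l" "0 < \<theta> * m" using l \<theta> by auto
  then have l0: "0 \<le> \<theta> * l" "0 \<le> \<theta> * m" by auto
  let ?iterate = "iterate (\<theta> * l) (\<theta> * m)"
  have everywhere: "v x \<le> \<theta>"
    if ae: "AE x in lebesgue. x \<in> \<Omega> \<longrightarrow> v x \<le> \<theta>" and v: "sol v k" and x: "x \<in> closure \<Omega>" for v k x
    using cl_cases[OF x]
  proof
    assume "x \<in> \<Omega>"
    have "continuous_on \<Omega> v" using v continuous_on_subset closure_subset unfolding sol_def by blast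
    then have "v x \<in> {..\<theta>}" by (rule AE_open_mem_closed[OF open_dom _ closed_atMost _ \<open>x \<in> \<Omega>\<close>]) (use ae in simp)
    then show ?thesis by simp
  next
    assume "x \<in> frontier \<Omega>" then show ?thesis using v \<theta> by (simp add: sol_def)
  qed
  have "good \<theta> (?iterate n) \<and> (AE x in lebesgue. x \<in> \<Omega> \<longrightarrow> fst (?iterate n) x \<le> \<theta> * w x \<and> snd (?iterate n) x \<le> \<theta> * z x)" for n
  proof (induction n)
    case 0
    have "AE x in lebesgue. x \<in> \<Omega> \<longrightarrow> fst (?iterate 0) x \<le> \<theta> * w x \<and> snd (?iterate 0) x \<le> \<theta> * z x"
      using bd by eventually_elim (use \<theta> in simp)
    then show ?case using good_0 \<theta> by simp
  next
    case (Suc n)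
    then have G: "good \<theta> (?iterate n)" and le: "AE x in lebesgue. x \<in> \<Omega> \<longrightarrow> fst (?iterate n) x \<le> \<theta> * w x \<and> snd (?iterate n) x \<le> \<theta> * z x" by auto
    note gd = goodD[OF G] and s = iterate_step[OF G \<theta>(2) l0]
    have sc: "\<theta> * t \<le> t" "\<theta> * t \<le> \<theta>" if "0 \<le> t" "t < 1" for t
      using that \<theta> by (simp_all add: mult_left_le_one_le mult_left_le)
    have "AE x in lebesgue. x \<in> \<Omega> \<longrightarrow> A.rhs (\<theta> * l) (snd (?iterate n)) x \<le> H1 x"
      using le bd
    proof eventually_elim
      fix x assume 1: "x \<in> \<Omega> \<longrightarrow> fst (?iterate n) x \<le> \<theta> * w x \<and> snd (?iterate n) x \<le> \<theta> * z x"
        and 2: "x \<in> \<Omega> \<longrightarrow> 0 \<le> w x \<and> w x < 1 \<and> 0 \<le> z x \<and> z x < 1"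
      show "x \<in> \<Omega> \<longrightarrow> A.rhs (\<theta> * l) (snd (?iterate n)) x \<le> H1 x"
        unfolding H1_def using 1 2 gd(4)[OF dom_cl, of x] sc(1)[of "z x"] l0 dom_cl
        by (intro impI A.rhs_mono) auto
    qed
    from weak_compare[OF W s(1) _ this]
    have wle: "AE x in lebesgue. x \<in> \<Omega> \<longrightarrow> fst (?iterate (Suc n)) x \<le> \<theta> * w x"
      using A.rhs_src[OF gd(2,4) \<theta>(2)] by (simp add: src_def)
    have "AE x in lebesgue. x \<in> \<Omega> \<longrightarrow> B.rhs (\<theta> * m) (fst (?iterate n)) x \<le> H2 x"
      using le bd
    proof eventually_elim
      fix x assume 1: "x \<in> \<Omega> \<longrightarrow> fst (?iterate n) x \<le> \<theta> * w x \<and> snd (?iterate n) x \<le> \<theta> * z x"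
        and 2: "x \<in> \<Omega> \<longrightarrow> 0 \<le> w x \<and> w x < 1 \<and> 0 \<le> z x \<and> z x < 1"
      show "x \<in> \<Omega> \<longrightarrow> B.rhs (\<theta> * m) (fst (?iterate n)) x \<le> H2 x"
        unfolding H2_def using 1 2 gd(3)[OF dom_cl, of x] sc(1)[of "w x"] l0 dom_cl
        by (intro impI B.rhs_mono) auto
    qed
    from weak_compare[OF Z s(2) _ this]
    have zle: "AE x in lebesgue. x \<in> \<Omega> \<longrightarrow> snd (?iterate (Suc n)) x \<le> \<theta> * z x"
      using B.rhs_src[OF gd(1,3) \<theta>(2)] by (simp add: src_def)
    have w1: "AE x in lebesgue. x \<in> \<Omega> \<longrightarrow> fst (?iterate (Suc n)) x \<le> \<theta>"
      using wle bd by eventually_elim (use sc(2) in \<open>blast intro: order_trans\<close>)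
    have z1: "AE x in lebesgue. x \<in> \<Omega> \<longrightarrow> snd (?iterate (Suc n)) x \<le> \<theta>"
      using zle bd by eventually_elim (use sc(2) in \<open>blast intro: order_trans\<close>)
    have "good \<theta> (?iterate (Suc n))"
      by (rule good_Suc[OF G \<theta>(2) l0]) (fact everywhere[OF w1 s(1)], fact everywhere[OF z1 s(2)])
    moreover have "AE x in lebesgue. x \<in> \<Omega> \<longrightarrow> fst (?iterate (Suc n)) x \<le> \<theta> * w x \<and> snd (?iterate (Suc n)) x \<le> \<theta> * z x"
      using wle zle by eventually_elim blast
    ultimately show ?case by blast
  qed
  then have "\<And>n. good \<theta> (?iterate n)" by blast
  then show ?thesis by (rule minimal_exists) (use \<theta> l' in auto)
qed

end

section \<open>The region of solvability\<close>

context nonlinearity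
begin

text \<open>Increments of a convex function grow with the base point: d and y are complementary
  convex combinations of 0 and y + d, so adding the two convexity inequalities gives f(d) + f(y) <=
  f(0) + f(y + d).\<close>

lemma nonlin_increment:
  assumes "0 \<le> y" "0 \<le> d" "y + d < 1"
  shows "f d - f 0 \<le> f (y + d) - f y"
proof (cases "y + d = 0")
  case True
  then have "y = 0" "d = 0" using assms by linarith+
  then show ?thesis by simp
next
  case False
  then have p: "0 < y + d" using assms by simp
  have c: "f (t * (y + d)) \<le> (1 - t) * f 0 + t * f (y + d)" if t: "0 \<le> t" "t \<le> 1" for t
  proof (cases "t = 0 \<or> t = 1")
    case True
    then show ?thesis by auto
  next
    case False
    have "\<forall>x\<in>{0..<1}. \<forall>y\<in>{0..<1}. \<forall>t\<in>{0<..<1}. x \<noteq> y \<longrightarrow> f ((1 - t) * x + t * y) < (1 - t) * f x + t * f y"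
      using nonlin_convex by (simp add: strictly_convex_on_def)
    from this[rule_format, of 0 "y + d" t] show ?thesis using False t p assms(3) by simp
  qed
  have "f d \<le> (1 - d / (y + d)) * f 0 + d / (y + d) * f (y + d)"
    using c[of "d / (y + d)"] assms p by simp
  moreover have "f y \<le> (1 - y / (y + d)) * f 0 + y / (y + d) * f (y + d)"
    using c[of "y / (y + d)"] assms p by simp
  moreover have "y / (y + d) = 1 - d / (y + d)" using p by (simp add: field_simps)
  ultimately have "f d + f y \<le> ((1 - d / (y + d)) * f 0 + d / (y + d) * f (y + d)) + (d / (y + d) * f 0 + (1 - d / (y + d)) * f (y + d))"
    by simp
  also have "\<dots> = f 0 + f (y + d)" by (simp only: left_diff_distrib)
  finally show ?thesis by simp
qed

text \<open>\<open>mono_on\<close> is monotonicity in the weak sense; strictness comes from strict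
  convexity at the midpoint d/2.\<close>

lemma nonlin_strict:
  assumes "0 < d" "d < 1"
  shows "f 0 < f d"
proof -
  have "\<forall>x\<in>{0..<1}. \<forall>y\<in>{0..<1}. \<forall>t\<in>{0<..<1}. x \<noteq> y \<longrightarrow> f ((1 - t) * x + t * y) < (1 - t) * f x + t * f y"
    using nonlin_convex by (simp add: strictly_convex_on_def)
  from this[rule_format, of 0 d "1/2"] have "f (d / 2) < (f 0 + f d) / 2" using assms by (simp add: field_simps)
  moreover have "f 0 \<le> f (d / 2)" using assms by (intro nonlin_mono) auto
  ultimately show ?thesis by simp
qed

lemma nonlin_near_zero:
  assumes "0 < s"
  shows "\<exists>\<eta>>0. \<eta> < 1 \<and> f \<eta> \<le> (1 + s) * f 0"
proof -
  have f0: "0 < f 0" by (rule nonlin_pos) auto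
  have "\<exists>d>0. \<forall>t\<in>{0..<1}. dist t 0 < d \<longrightarrow> dist (f t) (f 0) < s * f 0"
    by (rule nonlin_continuous[unfolded continuous_on_iff, rule_format]) (use assms f0 in auto)
  then obtain d where d: "0 < d" "\<And>t. t \<in> {0..<1} \<Longrightarrow> dist t 0 < d \<Longrightarrow> dist (f t) (f 0) < s * f 0" by blast
  define \<eta> where "\<eta> = min d 1 / 2"
  have e: "0 < \<eta>" "\<eta> < 1" "\<eta> < d" using d(1) by (auto simp: \<eta>_def)
  then have "dist (f \<eta>) (f 0) < s * f 0" by (intro d(2)) auto
  then have "f \<eta> \<le> (1 + s) * f 0" by (simp add: dist_real_def algebra_simps abs_less_iff)
  then show ?thesis using e by blast
qed

lemma Gr_coeff_pos: "x \<in> \<Omega> \<Longrightarrow> 0 < Gr \<alpha> x"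
proof -
  assume x: "x \<in> \<Omega>"
  obtain p where p: "p \<in> \<Omega>" "\<alpha> p \<noteq> 0" using coeff_nontrivial_inside by blast
  show ?thesis by (rule sol_pos[OF Gr_sol[OF coeff_src] coeff_ge0[OF dom_cl] p x])
qed

text \<open>Bounding f(z) below by f(0) removes the dependence on z. At a fixed interior point this
  bounds the parameter, since u < 1 there; for the second equation it yields a lower bound common to
  all solutions.\<close>

lemma rhs_sol_lower:
  assumes "sol u (rhs l z)" "0 \<le> l" "\<And>x. x \<in> closure \<Omega> \<Longrightarrow> 0 \<le> z x \<and> z x < 1" "x \<in> closure \<Omega>"
  shows "l * f 0 * Gr \<alpha> x \<le> u x"
proof (rule sol_mono[OF sol_scale[OF Gr_sol[OF coeff_src]] assms(1) _ assms(4)])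
  fix y assume y: "y \<in> \<Omega>"
  have "f 0 \<le> f (z y)" using assms(3)[OF dom_cl[OF y]] by (intro nonlin_mono) auto
  then show "l * f 0 * \<alpha> y \<le> rhs l z y"
    using assms(2) coeff_ge0[OF dom_cl[OF y]] unfolding rhs_def by (simp add: mult_left_mono mult.commute mult.left_commute)
qed

lemma rhs_sol_upper:
  assumes "sol u (rhs l z)" "0 \<le> l" "\<And>x. x \<in> closure \<Omega> \<Longrightarrow> 0 \<le> z x \<and> z x \<le> \<theta>" "\<theta> < 1" "x \<in> closure \<Omega>"
  shows "u x \<le> l * f \<theta> * Gr \<alpha> x"
proof (rule sol_mono[OF assms(1) sol_scale[OF Gr_sol[OF coeff_src]] _ assms(5)])
  fix y assume y: "y \<in> \<Omega>"
  have "f (z y) \<le> f \<theta>" using assms(3)[OF dom_cl[OF y]] assms(4) by (intro nonlin_mono) auto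
  then show "rhs l z y \<le> l * f \<theta> * \<alpha> y"
    using assms(2) coeff_ge0[OF dom_cl[OF y]] unfolding rhs_def by (simp add: mult_left_mono mult.commute mult.left_commute)
qed

lemma small_parameter:
  assumes "0 < c"
  shows "\<exists>l>0. \<forall>x\<in>closure \<Omega>. l * \<alpha> x * f (1/2) \<le> c"
proof -
  obtain A where A: "0 \<le> A" "\<And>x. x \<in> closure \<Omega> \<Longrightarrow> \<bar>\<alpha> x\<bar> \<le> A"
    using compact_continuous_bound[OF compact_cl] coeff_src unfolding src_def by metis
  have f: "0 < f (1/2)" by (rule nonlin_pos) auto
  define l where "l = c / ((A + 1) * f (1/2))"
  have l: "0 < l" using assms A(1) f by (simp add: l_def)
  have "l * \<alpha> x * f (1/2) \<le> c" if "x \<in> closure \<Omega>" for x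
  proof -
    have "l * \<alpha> x * f (1/2) \<le> l * (A + 1) * f (1/2)"
      using A(2)[OF that] l f by (intro mult_left_mono mult_right_mono) auto
    also have "\<dots> = c" using A(1) f by (simp add: l_def)
    finally show ?thesis .
  qed
  then show ?thesis using l by blast
qed

end

section \<open>The set of solvable parameters\<close>

context coupled
begin

definition Lam :: "(real \<times> real) set" where
  "Lam = {(l, m). 0 < l \<and> 0 < m \<and> (\<exists>w z. classical_solution \<Omega> \<alpha> \<beta> f g l m w z)}"

lemma classicalD:
  assumes "classical_solution \<Omega> \<alpha> \<beta> f g l m w z"
  shows "sol w (A.rhs l z)" "sol z (B.rhs m w)"
    "x \<in> closure \<Omega> \<Longrightarrow> 0 \<le> w x \<and> w x < 1" "x \<in> closure \<Omega> \<Longrightarrow> 0 \<le> z x \<and> z x < 1"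
  using assms by (auto simp: classical_solution_def sol_def A.rhs_def B.rhs_def)

lemma Lam_pos: "(l, m) \<in> Lam \<Longrightarrow> 0 < l \<and> 0 < m"
  by (simp add: Lam_def)

lemma super_in_Lam:
  assumes l: "0 < l" "0 < m" and W: "sol W h" and Z: "sol Z k"
    and b: "\<And>x. x \<in> closure \<Omega> \<Longrightarrow> 0 \<le> W x \<and> W x < 1 \<and> 0 \<le> Z x \<and> Z x < 1"
    and sup: "\<And>x. x \<in> \<Omega> \<Longrightarrow> A.rhs l Z x \<le> h x" "\<And>x. x \<in> \<Omega> \<Longrightarrow> B.rhs m W x \<le> k x"
  shows "\<exists>w z. minimal_classical_solution \<Omega> \<alpha> \<beta> f g l m w z \<and> (\<forall>x\<in>\<Omega>. 0 < w x \<and> 0 < z x)" "(l, m) \<in> Lam"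
proof -
  show 1: "\<exists>w z. minimal_classical_solution \<Omega> \<alpha> \<beta> f g l m w z \<and> (\<forall>x\<in>\<Omega>. 0 < w x \<and> 0 < z x)"
  proof (rule super_minimal_exists[OF l _ _ _ _ b])
    show "l * \<alpha> x * f (Z x) \<le> - laplacian W x" if "x \<in> \<Omega>" for x
    proof -
      have "- laplacian W x = h x" using W that by (simp add: sol_def)
      then show ?thesis using sup(1)[OF that] by (simp add: A.rhs_def)
    qed
    show "m * \<beta> x * g (W x) \<le> - laplacian Z x" if "x \<in> \<Omega>" for x
    proof -
      have "- laplacian Z x = k x" using Z that by (simp add: sol_def)
      then show ?thesis using sup(2)[OF that] by (simp add: B.rhs_def)
    qed
  qed (use W Z in \<open>simp_all add: sol_def\<close>)
  then show "(l, m) \<in> Lam" using l unfolding Lam_def minimal_classical_solution_def by blast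
qed

lemma Lam_down:
  assumes L: "(l, m) \<in> Lam" and l: "0 < l'" "l' \<le> l" "0 < m'" "m' \<le> m"
  shows "\<exists>w z. minimal_classical_solution \<Omega> \<alpha> \<beta> f g l' m' w z \<and> (\<forall>x\<in>\<Omega>. 0 < w x \<and> 0 < z x)" "(l', m') \<in> Lam"
proof -
  obtain w z where wz: "classical_solution \<Omega> \<alpha> \<beta> f g l m w z" using L by (auto simp: Lam_def)
  note c = classicalD[OF wz]
  have r: "A.rhs l' z x \<le> A.rhs l z x" "B.rhs m' w x \<le> B.rhs m w x" if "x \<in> \<Omega>" for x
    using c(3,4)[OF dom_cl[OF that]] l dom_cl[OF that] by (auto intro!: A.rhs_mono B.rhs_mono)
  show "\<exists>w z. minimal_classical_solution \<Omega> \<alpha> \<beta> f g l' m' w z \<and> (\<forall>x\<in>\<Omega>. 0 < w x \<and> 0 < z x)" "(l', m') \<in> Lam"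
    using super_in_Lam[OF l(1,3) c(1,2) _ r] c(3,4) by blast+
qed

lemma Lam_nonempty: "\<exists>l m. (l, m) \<in> Lam"
proof -
  obtain T where T: "0 \<le> T" "\<And>x. x \<in> closure \<Omega> \<Longrightarrow> \<bar>torsion x\<bar> \<le> T"
    using compact_continuous_bound[OF compact_cl] torsion_sol unfolding sol_def by metis
  \<comment> \<open>Makes c times \<open>torsion\<close> at most 1/2, the argument at which
    \<open>small_parameter\<close> evaluates f and g.\<close>
  define c where "c = 1 / (2 * (T + 1))"
  have c: "0 < c" using T(1) by (simp add: c_def)
  obtain l where l: "0 < l" "\<forall>x\<in>closure \<Omega>. l * \<alpha> x * f (1/2) \<le> c" using A.small_parameter[OF c] by blast
  obtain m where m: "0 < m" "\<forall>x\<in>closure \<Omega>. m * \<beta> x * g (1/2) \<le> c" using B.small_parameter[OF c] by blast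
  have b: "0 \<le> c * torsion x" "c * torsion x \<le> 1/2" if "x \<in> closure \<Omega>" for x
  proof -
    show "0 \<le> c * torsion x" using c torsion_nonneg[OF that] by simp
    have "c * torsion x \<le> c * (T + 1)" using c T(2)[OF that] by (intro mult_left_mono) auto
    also have "\<dots> = 1/2" using T(1) by (simp add: c_def)
    finally show "c * torsion x \<le> 1/2" .
  qed
  have S: "sol (\<lambda>x. c * torsion x) (\<lambda>x. c * 1)" by (rule sol_scale[OF torsion_sol])
  have "(l, m) \<in> Lam"
  proof (rule super_in_Lam(2)[OF l(1) m(1) S S])
    fix x assume x: "x \<in> \<Omega>"
    have "A.rhs l (\<lambda>x. c * torsion x) x \<le> A.rhs l (\<lambda>_. 1/2) x"
      using b[OF dom_cl[OF x]] l(1) dom_cl[OF x] by (intro A.rhs_mono) auto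
    then show "A.rhs l (\<lambda>x. c * torsion x) x \<le> c * 1" using l(2) dom_cl[OF x] by (force simp: A.rhs_def)
    have "B.rhs m (\<lambda>x. c * torsion x) x \<le> B.rhs m (\<lambda>_. 1/2) x"
      using b[OF dom_cl[OF x]] m(1) dom_cl[OF x] by (intro B.rhs_mono) auto
    then show "B.rhs m (\<lambda>x. c * torsion x) x \<le> c * 1" using m(2) dom_cl[OF x] by (force simp: B.rhs_def)
  qed (use b in force)
  then show ?thesis by blast
qed

lemma Lam_bounded: "\<exists>B. \<forall>l m. (l, m) \<in> Lam \<longrightarrow> l \<le> B \<and> m \<le> B"
proof -
  obtain p where p: "p \<in> \<Omega>" using nonempty_dom by blast
  have a: "0 < f 0 * Gr \<alpha> p" "0 < g 0 * Gr \<beta> p"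
    using A.Gr_coeff_pos[OF p] B.Gr_coeff_pos[OF p] A.nonlin_pos[of 0] B.nonlin_pos[of 0] by auto
  have "l \<le> 1 / (f 0 * Gr \<alpha> p) \<and> m \<le> 1 / (g 0 * Gr \<beta> p)" if L: "(l, m) \<in> Lam" for l m
  proof -
    obtain w z where wz: "classical_solution \<Omega> \<alpha> \<beta> f g l m w z" and lm: "0 < l" "0 < m" using L by (auto simp: Lam_def)
    note c = classicalD[OF wz]
    have "l * f 0 * Gr \<alpha> p \<le> w p" by (rule A.rhs_sol_lower[OF c(1) _ c(4) dom_cl[OF p]]) (use lm in auto)
    moreover have "m * g 0 * Gr \<beta> p \<le> z p" by (rule B.rhs_sol_lower[OF c(2) _ c(3) dom_cl[OF p]]) (use lm in auto)
    ultimately have "l * (f 0 * Gr \<alpha> p) \<le> 1" "m * (g 0 * Gr \<beta> p) \<le> 1"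
      using c(3,4)[OF dom_cl[OF p]] by (auto simp: mult.assoc)
    then show ?thesis using a by (simp add: pos_le_divide_eq)
  qed
  then show ?thesis by (intro exI[of _ "max (1 / (f 0 * Gr \<alpha> p)) (1 / (g 0 * Gr \<beta> p))"]) (meson max.coboundedI1 max.coboundedI2)
qed

text \<open>Lowering \<open>m\<close> leaves room to replace \<open>z\<close> by \<open>\<theta> z\<close>. This decreases \<open>f(z)\<close> by at least an amount independent
  of the solution, so that on a compact set \<open>w\<close> survives a small increase of \<open>l\<close>; off that set the new \<open>w\<close> is
  so small that \<open>g\<close> is within a factor \<open>1 + s\<close> of \<open>g 0\<close>.\<close>

lemma Lam_push:
  assumes l0: "0 < l0" and m: "0 < m1" "m1 < m2" and L: "\<And>e. 0 < e \<Longrightarrow> e < l0 \<Longrightarrow> (l0 - e, m2) \<in> Lam"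
  shows "\<exists>d>0. (l0 + d, m1) \<in> Lam"
proof -
  \<comment> \<open>(1 + s) m1 is the midpoint of m1 and m2. The room between m1 and m2 is spent in
    two parts: the factor \<theta> pays for shrinking z, the factor 1 + s for the possible growth of
    g(w).\<close>
  define s where "s = (m2 / m1 - 1) / 2"
  define \<theta> where "\<theta> = (1 + s) * m1 / m2"
  have s: "0 < s" using m by (simp add: s_def)
  have sm: "(1 + s) * m1 = (m1 + m2) / 2" using m by (simp add: s_def field_simps)
  have \<theta>: "0 < \<theta>" "\<theta> < 1" "\<theta> * m2 = (1 + s) * m1" using m unfolding \<theta>_def sm by auto
  \<comment> \<open>A lower bound for z in every classical solution with parameter m2, whatever l
    is.\<close>
  define \<zeta> where "\<zeta> = (\<lambda>x. m2 * g 0 * Gr \<beta> x)"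
  have \<zeta>S: "sol \<zeta> (\<lambda>x. m2 * g 0 * \<beta> x)" unfolding \<zeta>_def by (rule sol_scale[OF Gr_sol[OF B.coeff_src]])
  have \<zeta>pos: "0 < \<zeta> x" if "x \<in> \<Omega>" for x
    using B.Gr_coeff_pos[OF that] B.nonlin_pos[of 0] m by (simp add: \<zeta>_def)
  have \<zeta>nn: "0 \<le> \<zeta> x" if "x \<in> closure \<Omega>" for x
    using cl_cases[OF that] \<zeta>pos \<zeta>S by (auto simp: sol_def less_imp_le)
  have low: "\<zeta> x \<le> z x" if "classical_solution \<Omega> \<alpha> \<beta> f g l m2 w z" "x \<in> closure \<Omega>" for l w z x
    unfolding \<zeta>_def using classicalD[OF that(1)] m that(2) by (intro B.rhs_sol_lower[of z m2 w]) auto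
  have \<zeta>1: "\<zeta> x < 1" if "x \<in> closure \<Omega>" for x
  proof -
    obtain w z where "classical_solution \<Omega> \<alpha> \<beta> f g (l0 - l0 / 2) m2 w z"
      using L[of "l0 / 2"] l0 by (auto simp: Lam_def)
    then show ?thesis using low[OF _ that] classicalD(4)[OF _ that] by (meson order_le_less_trans)
  qed
  \<comment> \<open>A lower bound for the drop z - \<theta> z, again independent of the
    solution.\<close>
  define d0 where "d0 = (\<lambda>x. (1 - \<theta>) * \<zeta> x)"
  have d0S: "src d0" unfolding d0_def by (rule sol_src[OF sol_scale[OF \<zeta>S]])
  have d0b: "0 \<le> d0 x \<and> d0 x \<le> 1 - \<theta>" if "x \<in> closure \<Omega>" for x
    using \<zeta>nn[OF that] \<zeta>1[OF that] \<theta> by (simp add: d0_def mult_left_le)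
  define q where "q = (\<lambda>x. A.rhs 1 d0 x - A.rhs 1 (\<lambda>_. 0) x)"
  have q: "q x = \<alpha> x * (f (d0 x) - f 0)" for x by (simp add: q_def A.rhs_def right_diff_distrib)
  \<comment> \<open>The gain in w per unit of l: P solves the Poisson problem with source \<alpha>
    (f(d0) - f(0)). Strict growth of f and the strong minimum principle make it positive
    inside.\<close>
  define P where "P = (\<lambda>x. Gr (A.rhs 1 d0) x - Gr (A.rhs 1 (\<lambda>_. 0)) x)"
  have 1: "src (A.rhs 1 d0)" by (rule A.rhs_src[OF d0S d0b]) (use \<theta> in auto)
  have 2: "src (A.rhs 1 (\<lambda>_. 0))" by (rule A.rhs_src[OF src_const, of 0 0]) auto
  have PS: "sol P q" unfolding P_def q_def by (rule sol_diff[OF Gr_sol[OF 1] Gr_sol[OF 2]])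
  have fd: "f 0 \<le> f (d0 x)" if "x \<in> closure \<Omega>" for x using d0b[OF that] \<theta> by (intro A.nonlin_mono) auto
  have qnn: "0 \<le> q x" if "x \<in> closure \<Omega>" for x using fd[OF that] A.coeff_ge0[OF that] by (simp add: q)
  obtain p where p: "p \<in> \<Omega>" "\<alpha> p \<noteq> 0" using A.coeff_nontrivial_inside by blast
  have q0: "q p \<noteq> 0"
  proof -
    have "0 < d0 p" using \<zeta>pos[OF p(1)] \<theta> by (simp add: d0_def)
    moreover have "d0 p < 1" using \<theta>(1) d0b[OF dom_cl[OF p(1)]] by linarith
    ultimately show ?thesis using A.nonlin_strict[of "d0 p"] p(2) by (simp add: q)
  qed
  have Ppos: "0 < P x" if "x \<in> \<Omega>" for x by (rule sol_pos[OF PS qnn[OF dom_cl] p(1) q0 that])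
  define F where "F = f \<theta>"
  have F: "0 < F" using A.nonlin_pos[of \<theta>] \<theta> by (simp add: F_def)
  obtain \<eta> where \<eta>: "0 < \<eta>" "\<eta> < 1" "g \<eta> \<le> (1 + s) * g 0" using B.nonlin_near_zero[OF s] by blast
  \<comment> \<open>Off this compact set the new first component is below \<eta>, because f(z') <= F
    and l0 + e <= 2 l0; on it P has a positive minimum c.\<close>
  define K where "K = {x \<in> closure \<Omega>. \<eta> \<le> 2 * l0 * F * Gr \<alpha> x}"
  have Gc: "continuous_on (closure \<Omega>) (Gr \<alpha>)" "\<And>x. x \<in> frontier \<Omega> \<Longrightarrow> Gr \<alpha> x = 0"
    using Gr_sol[OF A.coeff_src] by (auto simp: sol_def)
  have "closed K" using continuous_closed_preimage[OF continuous_on_mult_left[OF Gc(1), of "2 * l0 * F"] closed_closure, of "{\<eta>..}"]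
    by (simp add: K_def vimage_def Int_def)
  then have K: "compact K" using compact_Int_closed[OF compact_cl, of K] by (simp add: K_def Int_absorb1 subset_iff Int_def)
  have Kin: "x \<in> \<Omega>" if "x \<in> K" for x
    using that cl_cases[of x] Gc(2)[of x] \<eta>(1) by (auto simp: K_def)
  have "\<exists>c>0. \<forall>x\<in>K. c \<le> P x"
  proof (cases "K = {}")
    case True
    then show ?thesis by (auto intro: exI[of _ 1])
  next
    case False
    have "continuous_on K P" using PS by (auto simp: sol_def K_def intro: continuous_on_subset)
    then obtain a where "a \<in> K" "\<forall>x\<in>K. P a \<le> P x" using continuous_attains_inf[OF K False] by blast
    then show ?thesis using Ppos[OF Kin] by blast
  qed
  then obtain c where c: "0 < c" "\<And>x. x \<in> K \<Longrightarrow> c \<le> P x" by blast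
  obtain A where A: "0 \<le> A" "\<And>x. x \<in> closure \<Omega> \<Longrightarrow> \<bar>Gr \<alpha> x\<bar> \<le> A"
    using compact_continuous_bound[OF compact_cl Gc(1)] by metis
  \<comment> \<open>The first bound gives l0 - e >= l0 / 2. The second makes the loss 2 e F Gr
    \<alpha>, caused by raising l from l0 - e to l0 + e, at most the gain (l0 / 2) c on K.\<close>
  define e where "e = min (l0 / 2) (l0 * c / (4 * F * (A + 1)))"
  have e: "0 < e" "e \<le> l0 / 2" "e < l0" using l0 c(1) F A(1) by (auto simp: e_def)
  have e2: "2 * e * F * (A + 1) \<le> l0 / 2 * c"
  proof -
    have "e \<le> l0 * c / (4 * F * (A + 1))" by (simp add: e_def)
    then have "e * (4 * F * (A + 1)) \<le> l0 * c" using F A(1) by (simp add: pos_le_divide_eq)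
    then show ?thesis by (simp add: algebra_simps)
  qed
  \<comment> \<open>The solution is chosen only now: e and all constants before it are fixed
    independently of w and z.\<close>
  obtain w z where wz: "classical_solution \<Omega> \<alpha> \<beta> f g (l0 - e) m2 w z" using L[OF e(1,3)] by (auto simp: Lam_def)
  note cs = classicalD[OF wz]
  define z' where "z' = (\<lambda>x. \<theta> * z x)"
  have z'S: "sol z' (\<lambda>x. \<theta> * B.rhs m2 w x)" unfolding z'_def by (rule sol_scale[OF cs(2)])
  have z'b: "0 \<le> z' x \<and> z' x \<le> \<theta>" if "x \<in> closure \<Omega>" for x
    using cs(4)[OF that] \<theta> by (simp add: z'_def mult_left_le)
  have rs: "src (A.rhs (l0 + e) z')" by (rule A.rhs_src[OF sol_src[OF z'S] z'b \<theta>(2)])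
  define w' where "w' = Gr (A.rhs (l0 + e) z')"
  have w'S: "sol w' (A.rhs (l0 + e) z')" unfolding w'_def by (rule Gr_sol[OF rs])
  have w'0: "0 \<le> w' x" if "x \<in> closure \<Omega>" for x
    by (rule sol_nonneg[OF w'S A.rhs_nonneg that]) (use l0 e z'b dom_cl \<theta> in force)+
  have Gnn: "0 \<le> Gr \<alpha> x" if "x \<in> closure \<Omega>" for x by (rule sol_nonneg[OF Gr_sol[OF A.coeff_src] A.coeff_ge0[OF dom_cl] that])
  \<comment> \<open>By convexity the drop from z to z' lowers the source by at least (l0 - e) times
    that of P, while the larger l adds at most 2 e F \<alpha>.\<close>
  have cmp: "w' x \<le> w x - ((l0 - e) * P x - 2 * e * F * Gr \<alpha> x)" if x: "x \<in> closure \<Omega>" for x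
  proof -
    have S: "sol (\<lambda>x. w x - ((l0 - e) * P x - 2 * e * F * Gr \<alpha> x))
       (\<lambda>x. A.rhs (l0 - e) z x - ((l0 - e) * q x - 2 * e * F * \<alpha> x))"
      by (intro sol_diff sol_scale cs(1) PS Gr_sol[OF A.coeff_src])
    show ?thesis
    proof (rule sol_mono[OF w'S S _ x])
      fix y assume y: "y \<in> \<Omega>"
      note y' = dom_cl[OF y]
      have "f (d0 y) - f 0 \<le> f (z y) - f (z' y)"
      proof -
        have sum: "\<theta> * z y + (1 - \<theta>) * z y = z y" by (simp add: algebra_simps)
        have nn: "0 \<le> \<theta> * z y" "0 \<le> (1 - \<theta>) * z y" using cs(4)[OF y'] \<theta> by auto
        have lt: "z y < 1" using cs(4)[OF y'] by simp
        have "d0 y \<le> (1 - \<theta>) * z y" using low[OF wz y'] \<theta> by (simp add: d0_def)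
        then have "f (d0 y) \<le> f ((1 - \<theta>) * z y)"
          using d0b[OF y'] sum nn lt by (intro A.nonlin_mono) linarith+
        moreover have "f ((1 - \<theta>) * z y) - f 0 \<le> f (\<theta> * z y + (1 - \<theta>) * z y) - f (\<theta> * z y)"
          using sum nn lt by (intro A.nonlin_increment) simp_all
        moreover note sum
        ultimately show ?thesis by (simp add: z'_def)
      qed
      then have "(l0 - e) * \<alpha> y * (f (d0 y) - f 0) \<le> (l0 - e) * \<alpha> y * (f (z y) - f (z' y))"
        using e A.coeff_ge0[OF y'] by (intro mult_left_mono) auto
      moreover have "2 * e * \<alpha> y * f (z' y) \<le> 2 * e * \<alpha> y * F"
        using z'b[OF y'] \<theta> e A.coeff_ge0[OF y'] unfolding F_def by (intro mult_left_mono A.nonlin_mono) auto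
      ultimately show "A.rhs (l0 + e) z' y \<le> A.rhs (l0 - e) z y - ((l0 - e) * q y - 2 * e * F * \<alpha> y)"
        unfolding A.rhs_def q by (simp add: algebra_simps)
    qed
  qed
  have onK: "w' x \<le> w x" if x: "x \<in> K" for x
  proof -
    have x': "x \<in> closure \<Omega>" using x by (simp add: K_def)
    have "l0 / 2 * c \<le> (l0 - e) * P x" using e l0 c(1) c(2)[OF x] by (intro mult_mono) auto
    moreover have "2 * e * F * Gr \<alpha> x \<le> 2 * e * F * (A + 1)" using A(2)[OF x'] e F by (intro mult_left_mono) auto
    ultimately show ?thesis using cmp[OF x'] e2 by linarith
  qed
  have offK: "w' x \<le> \<eta>" if x: "x \<in> closure \<Omega>" "x \<notin> K" for x
  proof -
    have "w' x \<le> (l0 + e) * F * Gr \<alpha> x" unfolding F_def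
      by (rule A.rhs_sol_upper[OF w'S _ z'b \<theta>(2) x(1)]) (use l0 e in auto)
    also have "\<dots> \<le> 2 * l0 * F * Gr \<alpha> x" using e F Gnn[OF x(1)] by (intro mult_right_mono) auto
    also have "\<dots> < \<eta>" using x by (simp add: K_def)
    finally show ?thesis by simp
  qed
  have gw: "w' x < 1 \<and> g (w' x) \<le> (1 + s) * g (w x)" if x: "x \<in> closure \<Omega>" for x
  proof (cases "x \<in> K")
    case True
    have "g (w' x) \<le> g (w x)" using onK[OF True] w'0[OF x] cs(3)[OF x] by (intro B.nonlin_mono) auto
    moreover have "0 \<le> s * g (w x)" using s B.nonlin_pos[of "w x"] cs(3)[OF x] by simp
    ultimately show ?thesis using onK[OF True] cs(3)[OF x] by (simp add: distrib_right)
  next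
    case False
    have "g (w' x) \<le> g \<eta>" using offK[OF x False] w'0[OF x] \<eta> by (intro B.nonlin_mono) auto
    also have "\<dots> \<le> (1 + s) * g 0" by (rule \<eta>(3))
    also have "\<dots> \<le> (1 + s) * g (w x)" using s cs(3)[OF x] by (intro mult_left_mono B.nonlin_mono) auto
    finally show ?thesis using offK[OF x False] \<eta> by simp
  qed
  have "(l0 + e, m1) \<in> Lam"
  proof (rule super_in_Lam(2)[OF _ m(1) w'S z'S])
    show "0 \<le> w' x \<and> w' x < 1 \<and> 0 \<le> z' x \<and> z' x < 1" if "x \<in> closure \<Omega>" for x
      using w'0[OF that] gw[OF that] z'b[OF that] \<theta> by simp
    fix x assume x: "x \<in> \<Omega>"
    have "m1 * \<beta> x * g (w' x) \<le> m1 * \<beta> x * ((1 + s) * g (w x))"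
      using gw[OF dom_cl[OF x]] m B.coeff_ge0[OF dom_cl[OF x]] by (intro mult_left_mono) auto
    also have "\<dots> = ((1 + s) * m1) * \<beta> x * g (w x)" by simp
    also have "\<dots> = \<theta> * B.rhs m2 w x" unfolding \<theta>(3)[symmetric] B.rhs_def by simp
    finally show "B.rhs m1 w' x \<le> \<theta> * B.rhs m2 w x" by (simp add: B.rhs_def)
  qed (use l0 e in simp_all)
  then show ?thesis using e(1) by blast
qed

end

section \<open>The critical curve\<close>

text \<open>The curve is built from these properties alone. The last one excludes vertical jumps: if
  all points strictly to the left of l0 at height m2 belong to the region, then at any smaller
  height the region extends beyond l0.\<close>

locale down_region =
  fixes L :: "(real \<times> real) set"
  assumes region_pos: "\<And>l m. (l, m) \<in> L \<Longrightarrow> 0 < l \<and> 0 < m"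
    and region_down: "\<And>l m l' m'. (l, m) \<in> L \<Longrightarrow> 0 < l' \<Longrightarrow> l' \<le> l \<Longrightarrow> 0 < m' \<Longrightarrow> m' \<le> m \<Longrightarrow> (l', m') \<in> L"
    and region_nonempty: "\<exists>l m. (l, m) \<in> L"
    and region_bounded: "\<exists>B. \<forall>l m. (l, m) \<in> L \<longrightarrow> l \<le> B \<and> m \<le> B"
    and region_push: "\<And>l0 m1 m2. 0 < l0 \<Longrightarrow> 0 < m1 \<Longrightarrow> m1 < m2 \<Longrightarrow>
       (\<And>e. 0 < e \<Longrightarrow> e < l0 \<Longrightarrow> (l0 - e, m2) \<in> L) \<Longrightarrow> \<exists>d>0. (l0 + d, m1) \<in> L"
begin

text \<open>Taking the supremum over all \<open>l' > l\<close> instead of at \<open>l\<close> makes the curve right-continuous by construction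
  and defines it at \<open>0\<close>; inserting \<open>0\<close> makes it vanish beyond the region.\<close>

definition curve :: "real \<Rightarrow> real" where
  "curve l = Sup (insert 0 {m. \<exists>l'>l. (l', m) \<in> L})"

text \<open>The intercept of the curve with the first axis, \<open>lams\<close> in the final
  statement.\<close>

definition extent :: real where
  "extent = Sup (fst ` L)"

lemma curve_bdd: "bdd_above (insert 0 {m. \<exists>l'>l. (l', m) \<in> L})"
proof -
  obtain B where "\<forall>l m. (l, m) \<in> L \<longrightarrow> l \<le> B \<and> m \<le> B" using region_bounded by blast
  then show ?thesis by (intro bdd_aboveI[of _ "max 0 B"]) (auto intro: max.coboundedI2)
qed

lemma curve_upper: "(l', m) \<in> L \<Longrightarrow> l < l' \<Longrightarrow> m \<le> curve l"
  unfolding curve_def by (rule cSup_upper[OF _ curve_bdd]) blast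

lemma curve_nonneg: "0 \<le> curve l"
  unfolding curve_def by (rule cSup_upper[OF _ curve_bdd]) blast

lemma curve_less: "c < curve l \<Longrightarrow> 0 \<le> c \<Longrightarrow> \<exists>l' m. l < l' \<and> c < m \<and> (l', m) \<in> L"
  unfolding curve_def using less_cSup_iff[OF _ curve_bdd, of l c] by fastforce

lemma curve_antimono: "x \<le> y \<Longrightarrow> curve y \<le> curve x"
  unfolding curve_def[of y] by (rule cSup_least) (use curve_nonneg curve_upper[of _ _ x] in \<open>auto intro: order_le_less_trans\<close>)

lemma curve_below: "0 < l \<Longrightarrow> 0 < m \<Longrightarrow> m < curve l \<Longrightarrow> (l, m) \<in> L"
  using curve_less[of m l] region_down by (meson less_imp_le)

lemma extent_bdd: "bdd_above (fst ` L)"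
  using region_bounded by (force simp: bdd_above_def)

lemma region_le_extent: "(l, m) \<in> L \<Longrightarrow> l \<le> extent"
  unfolding extent_def by (rule cSup_upper[OF _ extent_bdd]) force

lemma extent_pos: "0 < extent"
  using region_nonempty region_le_extent region_pos by (meson order_less_le_trans)

lemma curve_beyond: "extent \<le> l \<Longrightarrow> curve l = 0"
proof -
  assume l: "extent \<le> l"
  have "{m. \<exists>l'>l. (l', m) \<in> L} = {}" using region_le_extent l by force
  then show ?thesis by (simp only: curve_def) simp
qed

lemma curve_pos: "l < extent \<Longrightarrow> 0 < curve l"
proof -
  assume l: "l < extent"
  have "fst ` L \<noteq> {}" using region_nonempty by auto
  then obtain l' m where "(l', m) \<in> L" "l < l'"
    using l less_cSup_iff[OF _ extent_bdd, of l] unfolding extent_def by force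
  then show ?thesis using curve_upper region_pos by (meson order_less_le_trans)
qed

text \<open>The lower bound is immediate from the supremum over all l' > x. For the upper bound, a
  drop of at least e at x would place points at height curve x + 2e/3 in the region all the way up
  to x; pushing then gives a point of the region to the right of x at height curve x + e/3, above
  the curve.\<close>

lemma curve_continuous: "continuous_on {0..} curve"
  unfolding continuous_on_iff
proof (intro ballI allI impI)
  fix x e :: real assume x: "x \<in> {0..}" and e: "0 < e"
  have right: "\<exists>d>0. \<forall>y. y < x + d \<longrightarrow> curve x - e < curve y"
  proof (cases "curve x - e < 0")
    case True
    have "curve x - e < curve y" for y using True curve_nonneg[of y] by linarith
    then show ?thesis by (intro exI[of _ 1]) simp
  next
    case False
    then obtain l' m where lm: "x < l'" "curve x - e < m" "(l', m) \<in> L" using curve_less[of "curve x - e" x] e by auto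
    then show ?thesis by (intro exI[of _ "l' - x"]) (auto intro: order_less_le_trans curve_upper)
  qed
  have left: "\<exists>d>0. \<forall>y\<in>{0..}. x - d < y \<longrightarrow> curve y < curve x + e"
  proof (rule ccontr)
    assume "\<not> ?thesis"
    then have n: "\<exists>y\<in>{0..}. x - d < y \<and> curve x + e \<le> curve y" if "0 < d" for d using that by force
    have yx: "y < x" if "curve x + e \<le> curve y" for y
      using curve_antimono[of x y] that e by linarith
    obtain y0 where "0 \<le> y0" "y0 < x" using n[of 1] yx by force
    then have x0: "0 < x" by linarith
    \<comment> \<open>Two levels between curve x and curve x + e are needed, since pushing to the
      right loses height: 2e/3 before and e/3 after.\<close>
    have in_L: "(x - d, curve x + 2 * e / 3) \<in> L" if d: "0 < d" "d < x" for d
    proof -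
      obtain y where y: "x - d < y" "curve x + e \<le> curve y" using n[OF d(1)] by blast
      then have "curve x + 2 * e / 3 < curve y" using e by simp
      then obtain l' m where lm: "y < l'" "curve x + 2 * e / 3 < m" "(l', m) \<in> L"
        using curve_less[of "curve x + 2 * e / 3" y] curve_nonneg[of x] e by auto
      show ?thesis by (rule region_down[OF lm(3)]) (use d y lm curve_nonneg[of x] e in auto)
    qed
    have "\<exists>d>0. (x + d, curve x + e / 3) \<in> L"
      by (rule region_push[OF x0 _ _ in_L]) (use curve_nonneg[of x] e in auto)
    then obtain d where "0 < d" "(x + d, curve x + e / 3) \<in> L" by blast
    then have "curve x + e / 3 \<le> curve x" by (intro curve_upper) auto
    then show False using e by simp
  qed
  obtain d1 where d1: "0 < d1" "\<And>y. y < x + d1 \<Longrightarrow> curve x - e < curve y" using right by blast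
  obtain d2 where d2: "0 < d2" "\<And>y. 0 \<le> y \<Longrightarrow> x - d2 < y \<Longrightarrow> curve y < curve x + e" using left by auto
  show "\<exists>d>0. \<forall>y\<in>{0..}. dist y x < d \<longrightarrow> dist (curve y) (curve x) < e"
  proof (intro exI[of _ "min d1 d2"] conjI ballI impI)
    fix y assume y: "y \<in> {0..}" "dist y x < min d1 d2"
    then have "curve x - e < curve y" "curve y < curve x + e" by (auto intro!: d1 d2 simp: dist_real_def)
    then show "dist (curve y) (curve x) < e" by (simp add: dist_real_def abs_less_iff)
  qed (use d1 d2 in simp)
qed

definition below :: "(real \<times> real) set" where "below = {(l, m). 0 < l \<and> 0 < m \<and> m < curve l}"

definition above :: "(real \<times> real) set" where "above = {(l, m). 0 < l \<and> 0 < m \<and> curve l < m}"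

lemma curve_isCont: "0 < l \<Longrightarrow> isCont curve l"
  by (rule continuous_on_interior[OF curve_continuous]) simp

lemma open_below: "open below" and open_above: "open above"
proof -
  have Q: "open ({0<..} \<times> {0<..} :: (real \<times> real) set)" by (simp add: open_Times)
  have c: "continuous_on ({0<..} \<times> {0<..}) (\<lambda>p. curve (fst p) - snd p)"
    by (intro continuous_on_diff continuous_on_compose2[OF curve_continuous] continuous_intros) auto
  have "below = {p \<in> {0<..} \<times> {0<..}. curve (fst p) - snd p \<in> {0<..}}" by (auto simp: below_def)
  then show "open below" using continuous_open_preimage[OF c Q, of "{0<..}"] by (simp add: vimage_def Int_def)
  have "above = {p \<in> {0<..} \<times> {0<..}. curve (fst p) - snd p \<in> {..<0}}" by (auto simp: above_def)
  then show "open above" using continuous_open_preimage[OF c Q, of "{..<0}"] by (simp add: vimage_def Int_def)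
qed

text \<open>The curve is positive exactly up to \<open>extent\<close>, so the region is a rectangle
  scaled vertically by it, hence a continuous image of a connected set.\<close>

lemma connected_below: "connected below"
proof -
  have "below = (\<lambda>p. (fst p, snd p * curve (fst p))) ` ({0<..<extent} \<times> {0<..<1})"
  proof (intro equalityI subsetI)
    fix p assume p: "p \<in> below"
    obtain l m where lm: "p = (l, m)" "0 < l" "0 < m" "m < curve l" using p by (auto simp: below_def)
    then have "l < extent" using curve_beyond[of l] by force
    then show "p \<in> (\<lambda>p. (fst p, snd p * curve (fst p))) ` ({0<..<extent} \<times> {0<..<1})"
      using lm by (intro image_eqI[of _ _ "(l, m / curve l)"]) auto
  next
    fix p assume "p \<in> (\<lambda>p. (fst p, snd p * curve (fst p))) ` ({0<..<extent} \<times> {0<..<1})"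
    then show "p \<in> below" using curve_pos by (auto simp: below_def)
  qed
  moreover have "continuous_on ({0<..<extent} \<times> {0<..<1}) (\<lambda>p::real \<times> real. (fst p, snd p * curve (fst p)))"
    by (intro continuous_on_Pair continuous_on_mult continuous_on_compose2[OF curve_continuous] continuous_intros) auto
  ultimately show ?thesis by (auto intro!: connected_continuous_image connected_Times)
qed

lemma connected_above: "connected above"
proof -
  have "above = (\<lambda>p. (fst p, snd p + curve (fst p))) ` ({0<..} \<times> {0<..})"
  proof (intro equalityI subsetI)
    fix p assume p: "p \<in> above"
    obtain l m where lm: "p = (l, m)" "0 < l" "0 < m" "curve l < m" using p by (auto simp: above_def)
    then show "p \<in> (\<lambda>p. (fst p, snd p + curve (fst p))) ` ({0<..} \<times> {0<..})"
      by (intro image_eqI[of _ _ "(l, m - curve l)"]) auto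
  next
    fix p assume "p \<in> (\<lambda>p. (fst p, snd p + curve (fst p))) ` ({0<..} \<times> {0<..})"
    then show "p \<in> above" using curve_nonneg by (auto simp: above_def add_pos_nonneg)
  qed
  moreover have "continuous_on ({0<..} \<times> {0<..}) (\<lambda>p::real \<times> real. (fst p, snd p + curve (fst p)))"
    by (intro continuous_on_Pair continuous_on_add continuous_on_compose2[OF curve_continuous] continuous_intros) auto
  ultimately show ?thesis by (auto intro!: connected_continuous_image connected_Times)
qed

lemma below_nonempty: "below \<noteq> {}"
proof -
  have "(extent / 2, curve (extent / 2) / 2) \<in> below"
    using extent_pos curve_pos[of "extent / 2"] by (simp add: below_def)
  then show ?thesis by blast
qed

lemma above_nonempty: "above \<noteq> {}"
proof -
  have "(1, curve 1 + 1) \<in> above" using curve_nonneg[of 1] by (simp add: above_def)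
  then show ?thesis by blast
qed

lemma below_above_disjoint: "below \<inter> above = {}"
  by (auto simp: below_def above_def)

text \<open>From \<open>extent\<close> on the graph lies on the axis, outside the open quadrant, so
  removing it over [0, extent] amounts to removing all of it.\<close>

lemma components_off_curve:
  "components (({0<..} \<times> {0<..}) - (\<lambda>l. (l, curve l)) ` {0..extent}) = {below, above}"
proof (rule components_open_unique)
  show "pairwise disjnt {below, above}" using below_above_disjoint by (auto simp: pairwise_def disjnt_def)
  show "\<Union> {below, above} = ({0<..} \<times> {0<..}) - (\<lambda>l. (l, curve l)) ` {0..extent}"
  proof (intro equalityI subsetI)
    fix p assume "p \<in> \<Union> {below, above}"
    then show "p \<in> ({0<..} \<times> {0<..}) - (\<lambda>l. (l, curve l)) ` {0..extent}" by (auto simp: below_def above_def)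
  next
    fix p assume p: "p \<in> ({0<..} \<times> {0<..}) - (\<lambda>l. (l, curve l)) ` {0..extent}"
    obtain l m where lm: "p = (l, m)" "0 < l" "0 < m" using p by auto
    have "m \<noteq> curve l"
    proof (cases "l \<le> extent")
      case True
      then show ?thesis using p lm by force
    next
      case False
      then show ?thesis using curve_beyond[of l] lm by simp
    qed
    then show "p \<in> \<Union> {below, above}" using lm by (auto simp: below_def above_def)
  qed
qed (use open_below open_above connected_below connected_above below_nonempty above_nonempty in auto)

text \<open>Membership bounds the height only by the curve at strictly smaller first coordinates, so
  t^2 l is used against t l: by continuity t m still exceeds curve(t^2 l) for t slightly below 1,
  and membership of (t l, t m) would contradict \<open>curve_upper\<close>.\<close>

lemma above_ray:
  assumes "(l, m) \<in> above"
  shows "\<exists>\<theta>>0. \<theta> < 1 \<and> (\<theta> * l, \<theta> * m) \<notin> L"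
proof -
  have lm: "0 < l" "0 < m" "curve l < m" using assms by (auto simp: above_def)
  have "((\<lambda>t. t * m - curve (t\<^sup>2 * l)) \<longlongrightarrow> 1 * m - curve (1\<^sup>2 * l)) (at_left 1)"
    by (intro tendsto_intros isCont_tendsto_compose[OF curve_isCont]) (use lm in auto)
  then have "\<forall>\<^sub>F t in at_left 1. 0 < t * m - curve (t\<^sup>2 * l)" by (rule order_tendstoD(1)) (use lm in simp)
  moreover have "\<forall>\<^sub>F t in at_left (1::real). t \<in> {0<..<1}" by (rule eventually_at_left_real) simp
  ultimately have "\<forall>\<^sub>F t in at_left 1. 0 < t * m - curve (t\<^sup>2 * l) \<and> t \<in> {0<..<1}" by (rule eventually_conj)
  then obtain t where t: "0 < t * m - curve (t\<^sup>2 * l)" "0 < t" "t < 1"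
    using eventually_happens[of _ "at_left (1::real)"] trivial_limit_at_left_real by auto
  have "t\<^sup>2 * l < t * l" using t lm by (simp add: power2_eq_square)
  then have "(t * l, t * m) \<notin> L" using curve_upper[of "t * l" "t * m" "t\<^sup>2 * l"] t by force
  then show ?thesis using t by blast
qed

end

theorem theoremA:
  fixes \<Omega> :: "'a::euclidean_space set"
    and \<alpha> \<beta> :: "'a \<Rightarrow> real"
    and f g :: "real \<Rightarrow> real"
  assumes "smooth_bounded_domain \<Omega>"
    and "hoelder_on (closure \<Omega>) \<alpha>" and "hoelder_on (closure \<Omega>) \<beta>"
    and "\<forall>x\<in>closure \<Omega>. 0 \<le> \<alpha> x" and "\<forall>x\<in>closure \<Omega>. 0 \<le> \<beta> x"
    and "\<exists>x\<in>closure \<Omega>. \<alpha> x \<noteq> 0" and "\<exists>x\<in>closure \<Omega>. \<beta> x \<noteq> 0"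
    and "C2_Ico01 f" and "C2_Ico01 g"
    and "\<forall>t\<in>{0..<1}. 0 < f t" and "\<forall>t\<in>{0..<1}. 0 < g t"
    and "mono_on {0..<1} f" and "mono_on {0..<1} g"
    and "strictly_convex_on {0..<1} f" and "strictly_convex_on {0..<1} g"
    and "filterlim f at_top (at_left 1)" and "filterlim g at_top (at_left 1)"
  shows "\<exists>(lams::real) (mus::real) (\<Gamma>::real \<Rightarrow> real) O1 O2.
     0 < lams \<and> 0 < mus \<and>
     continuous_on {0..lams} \<Gamma> \<and> antimono_on {0..lams} \<Gamma> \<and>
     \<Gamma> 0 = mus \<and> \<Gamma> lams = 0 \<and> (\<forall>l\<in>{0<..<lams}. 0 < \<Gamma> l) \<and>
     O1 \<noteq> O2 \<and>
     components (({0<..} \<times> {0<..}) - (\<lambda>l. (l, \<Gamma> l)) ` {0..lams}) = {O1, O2} \<and>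
     (\<forall>(lam, mu)\<in>O1. \<exists>w z. minimal_classical_solution \<Omega> \<alpha> \<beta> f g lam mu w z \<and>
        (\<forall>x\<in>\<Omega>. 0 < w x \<and> 0 < z x)) \<and>
     (\<forall>(lam, mu)\<in>O2. \<not> (\<exists>w z. weak_solution \<Omega> \<alpha> \<beta> f g lam mu w z))"
proof -
  interpret coupled \<Omega> \<alpha> \<beta> f g
    by unfold_locales (fact assms)+
  interpret R: down_region Lam
  proof
    show "0 < l \<and> 0 < m" if "(l, m) \<in> Lam" for l m using Lam_pos[OF that] .
    show "(l', m') \<in> Lam" if "(l, m) \<in> Lam" "0 < l'" "l' \<le> l" "0 < m'" "m' \<le> m" for l m l' m'
      using Lam_down(2)[OF that] .
    show "\<exists>l m. (l, m) \<in> Lam" by (rule Lam_nonempty)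
    show "\<exists>B. \<forall>l m. (l, m) \<in> Lam \<longrightarrow> l \<le> B \<and> m \<le> B" by (rule Lam_bounded)
    show "\<exists>d>0. (l0 + d, m1) \<in> Lam" if "0 < l0" "0 < m1" "m1 < m2" "\<And>e. 0 < e \<Longrightarrow> e < l0 \<Longrightarrow> (l0 - e, m2) \<in> Lam" for l0 m1 m2
      by (rule Lam_push[OF that])
  qed
  have min: "\<forall>(lam, mu)\<in>R.below. \<exists>w z. minimal_classical_solution \<Omega> \<alpha> \<beta> f g lam mu w z \<and> (\<forall>x\<in>\<Omega>. 0 < w x \<and> 0 < z x)"
  proof clarify
    fix l m assume "(l, m) \<in> R.below"
    then have "0 < l" "0 < m" "(l, m) \<in> Lam" using R.curve_below by (auto simp: R.below_def)
    then show "\<exists>w z. minimal_classical_solution \<Omega> \<alpha> \<beta> f g l m w z \<and> (\<forall>x\<in>\<Omega>. 0 < w x \<and> 0 < z x)"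
      using Lam_down(1) by blast
  qed
  \<comment> \<open>A weak solution makes all its contractions by \<theta> in (0, 1) solvable,
    whereas above the curve some contraction lies outside \<open>Lam\<close>.\<close>
  have weak: "\<forall>(lam, mu)\<in>R.above. \<not> (\<exists>w z. weak_solution \<Omega> \<alpha> \<beta> f g lam mu w z)"
  proof clarify
    fix l m w z assume lm: "(l, m) \<in> R.above" and w: "weak_solution \<Omega> \<alpha> \<beta> f g l m w z"
    obtain \<theta> where \<theta>: "0 < \<theta>" "\<theta> < 1" "(\<theta> * l, \<theta> * m) \<notin> Lam" using R.above_ray[OF lm] by blast
    have p: "0 < l" "0 < m" using lm by (auto simp: R.above_def)
    show False
      using weak_minimal_exists[OF w p \<theta>(1,2)] \<theta> p unfolding Lam_def minimal_classical_solution_def by auto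
  qed
  have "R.below \<noteq> R.above" using R.below_above_disjoint R.below_nonempty by auto
  moreover have "continuous_on {0..R.extent} R.curve" by (rule continuous_on_subset[OF R.curve_continuous]) auto
  moreover have "antimono_on {0..R.extent} R.curve" by (auto intro!: monotone_onI R.curve_antimono)
  ultimately show ?thesis
    using R.extent_pos R.curve_pos R.curve_beyond R.components_off_curve min weak
    by (intro exI[of _ R.extent] exI[of _ "R.curve 0"] exI[of _ R.curve] exI[of _ R.below] exI[of _ R.above]) simp
qed

end
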